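(* Let $s\ge 1$ and $k\ge 1$ be fixed integers (not depending on $n$). For each $n$, let $K_n,P_n$ be positive integers with $s\le K_n\le P_n$, and let $G_s(n,K_n,P_n)$ be the uniform random $s$-intersection graph. Suppose $P_n=\Omega(n)$, and define the real sequence $\alpha_n$ by $$\frac{1}{s!}\cdot\frac{K_n^{2s}}{P_n^{s}}=\frac{\ln n+(k-1)\ln\ln n+\alpha_n}{n}.$$ Then $$\lim_{n\to\infty}\mathbb{P}[G_s(n,K_n,P_n)\text{ is }k\text{-vertex-connected}]=\lim_{n\to\infty}\mathbb{P}[G_s(n,K_n,P_n)\text{ is }k\text{-edge-connected}]=\lim_{n\to\infty}\mathbb{P}[G_s(n,K_n,P_n)\text{ has minimum vertex degree at least }k],$$ and this common limit equals $e^{-e^{-\alpha^*}/(k-1)!}$ if $\lim_{n\to\infty}\alpha_n=\alpha^*\in(-\infty,\infty)$, equals $0$ if $\lim_{n\to\infty}\alpha_n=-\infty$, and equals $1$ if $\lim_{n\to\infty}\alpha_n=\infty$.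
   Context: The uniform random $s$-intersection graph $G_s(n,K_n,P_n)$ has $n$ vertices; each vertex independently selects a set of $K_n$ distinct items uniformly at random from a common pool of $P_n$ distinct items, and two vertices are joined by an (undirected) edge if and only if their item sets share at least $s$ items. A graph is $k$-vertex-connected (resp. $k$-edge-connected) if it remains connected after deleting any at most $k-1$ vertices (resp. edges). Asymptotic notation is as $n\to\infty$. *)

theory Defs
  imports "HOL-Probability.Probability" "HOL-Library.Landau_Symbols"
begin

text \<open>Vertices are 0..n-1, items are 0..P-1. Each vertex independently picks a uniformly
random K-element subset of the item pool (Pi_pmf = independent product).\<close>

definition ksubsets :: "nat \<Rightarrow> nat \<Rightarrow> nat set set" where
  "ksubsets P K = {S. S \<subseteq> {..<P} \<and> card S = K}"

definition rand_sets :: "nat \<Rightarrow> nat \<Rightarrow> nat \<Rightarrow> (nat \<Rightarrow> nat set) pmf" where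
  "rand_sets n K P = Pi_pmf {..<n} {} (\<lambda>_. pmf_of_set (ksubsets P K))"

text \<open>The s-intersection graph determined by the item sets f.\<close>
definition sadj :: "nat \<Rightarrow> (nat \<Rightarrow> nat set) \<Rightarrow> nat \<Rightarrow> nat \<Rightarrow> bool" where
  "sadj s f i j \<longleftrightarrow> i \<noteq> j \<and> card (f i \<inter> f j) \<ge> s"

text \<open>Graph on vertex set V with symmetric edge relation E.\<close>
definition graph_connected :: "'a set \<Rightarrow> ('a \<Rightarrow> 'a \<Rightarrow> bool) \<Rightarrow> bool" where
  "graph_connected V E \<longleftrightarrow>
     (\<forall>u\<in>V. \<forall>v\<in>V. (u, v) \<in> {(x, y). x \<in> V \<and> y \<in> V \<and> E x y}\<^sup>*)"

definition graph_edges :: "'a set \<Rightarrow> ('a \<Rightarrow> 'a \<Rightarrow> bool) \<Rightarrow> 'a set set" where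
  "graph_edges V E = {{x, y} | x y. x \<in> V \<and> y \<in> V \<and> E x y}"

definition k_vertex_connected :: "nat \<Rightarrow> 'a set \<Rightarrow> ('a \<Rightarrow> 'a \<Rightarrow> bool) \<Rightarrow> bool" where
  "k_vertex_connected k V E \<longleftrightarrow>
     (\<forall>S. S \<subseteq> V \<and> card S \<le> k - 1 \<longrightarrow> graph_connected (V - S) E)"

definition k_edge_connected :: "nat \<Rightarrow> 'a set \<Rightarrow> ('a \<Rightarrow> 'a \<Rightarrow> bool) \<Rightarrow> bool" where
  "k_edge_connected k V E \<longleftrightarrow>
     (\<forall>F. F \<subseteq> graph_edges V E \<and> card F \<le> k - 1 \<longrightarrow>
        graph_connected V (\<lambda>x y. E x y \<and> {x, y} \<notin> F))"

definition min_degree_ge :: "nat \<Rightarrow> 'a set \<Rightarrow> ('a \<Rightarrow> 'a \<Rightarrow> bool) \<Rightarrow> bool" where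
  "min_degree_ge k V E \<longleftrightarrow> (\<forall>v\<in>V. card {u\<in>V. E v u} \<ge> k)"

end

theory Submission
  imports Defs "HOL-Real_Asymp.Real_Asymp"
begin

text \<open>A vertex is adjacent to a fixed vertex with probability \<open>w (1 + o(1 / ln n))\<close>, where
  \<open>w = K ^ (2 * s) / (s! * P ^ s)\<close>. When \<open>a = n * w\<close> is of order \<open>ln n\<close>, the condition \<open>P = \<Omega>(n)\<close> forces
  \<open>K\<close> to tend to infinity, and the item sets of different vertices overlap too little to create relevant
  dependence. Any
  fixed number \<open>j\<close> of vertices therefore all have degree less than \<open>k\<close> with probability asymptotic to
  \<open>(a ^ (k - 1) * exp (- a) / (k - 1)!) ^ j\<close>, and the Bonferroni inequalities (Poisson case) or the
  second moment method give the limit for the minimum degree.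

  A graph with minimum degree at least \<open>k\<close> that is not \<open>k\<close>-vertex-connected has a connected set of
  between \<open>2\<close> and \<open>n / 2\<close> vertices that fewer than \<open>k\<close> vertices separate from the rest. Such sets do
  not exist with high probability: every set of \<open>m \<le> O(n / ln n)\<close> vertices is adjacent to a new
  vertex with probability close to that of \<open>m\<close> independent trials, which a union bound exploits. The
  extreme cases of \<open>\<alpha>\<close> are reduced by coupling in \<open>K\<close> to \<open>a\<close> of order \<open>ln n\<close>.\<close>


section \<open>Products of probability mass functions\<close>

text \<open>Relative errors in \<open>w\<close> matter on the scale \<open>1 / ln n\<close>, because
  \<open>n * w\<close> stands in an exponent. For \<open>s >= 2\<close>,
  \<open>P = \<Omega>(n)\<close> makes \<open>K\<close> at least of order \<open>n ^ (1/4)\<close>,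
  so corrections of relative size \<open>1 / K\<close> are harmless. For \<open>s = 1\<close> only
  \<open>K ^ 2\<close> of order at least \<open>ln n\<close> is available, and
  \<open>ln n / K\<close> may grow. This obstacle shapes two places. In the joint low-degree
  probability the correction arises only if item sets overlap: it costs at most a factor of order
  \<open>n ^ (1 / (4 * s))\<close>, while overlaps have probability at most of order
  \<open>n ^ (- 1 / (2 * s))\<close>. For cuts, the chance of avoiding \<open>m\<close> vertices
  comes from a second moment inequality if \<open>s >= 2\<close>, but from the number of items
  covered by the \<open>m\<close> sets if \<open>s = 1\<close>. Both are relaxed to
  \<open>1 / (1 + (1 - \<epsilon>) * m * w)\<close>, which is close to \<open>exp (- m * w)\<close>
  for small \<open>m * w\<close> and a small constant for large \<open>m * w\<close>. The couplings
  succeed because raising \<open>K\<close> by one multiplies \<open>w\<close> by at most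
  \<open>4 ^ s\<close>, so the scale \<open>ln n\<close> cannot be jumped over.\<close>

lemma Pi_pmf_split_coordinate:
  assumes "finite V" "v \<in> V"
  shows "Pi_pmf V d D = Pi_pmf (V - {v}) d D \<bind> (\<lambda>f. map_pmf (\<lambda>y. f(v := y)) (D v))"
proof -
  have V: "V = insert v (V - {v})" using assms(2) by auto
  have "Pi_pmf V d D = D v \<bind> (\<lambda>y. Pi_pmf (V - {v}) d D \<bind> (\<lambda>f. return_pmf (f(v := y))))"
    by (subst V, subst Pi_pmf_insert') (use assms in auto)
  \<comment> \<open>\<open>Pi_pmf_insert'\<close> draws coordinate \<open>v\<close> first; the
    exchange makes it the last draw, with all other coordinates known.\<close>
  also have "\<dots> = Pi_pmf (V - {v}) d D \<bind> (\<lambda>f. D v \<bind> (\<lambda>y. return_pmf (f(v := y))))"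
    by (rule bind_commute_pmf)
  finally show ?thesis by (simp add: map_pmf_def)
qed

text \<open>Neither \<open>G\<close> nor \<open>H\<close> reads coordinate \<open>v\<close>. With
  the other coordinates fixed, \<open>G\<close> is decided and only the draw of \<open>f v\<close>
  remains random. The nonnegative integral avoids integrability conditions.\<close>

lemma emeasure_Pi_pmf_coordinate:
  assumes "finite V" "v \<in> V"
    and G: "\<And>f y. G (f(v := y)) \<longleftrightarrow> G f" and H: "\<And>f y. H (f(v := y)) = H f"
  shows "emeasure (Pi_pmf V d D) {f. G f \<and> f v \<in> H f} =
           (\<integral>\<^sup>+f. (if G f then emeasure (D v) (H f) else 0) \<partial>Pi_pmf (V - {v}) d D)"
    and "emeasure (Pi_pmf V d D) {f. G f} =
           (\<integral>\<^sup>+f. (if G f then 1 else 0) \<partial>Pi_pmf (V - {v}) d D)"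
proof -
  have vim: "(\<lambda>y. f(v := y)) -` {f. G f \<and> f v \<in> H f} = (if G f then H f else {})"
     "(\<lambda>y. f(v := y)) -` {f. G f} = (if G f then UNIV else {})" for f
    by (auto simp: G H)
  show "emeasure (Pi_pmf V d D) {f. G f \<and> f v \<in> H f} =
           (\<integral>\<^sup>+f. (if G f then emeasure (D v) (H f) else 0) \<partial>Pi_pmf (V - {v}) d D)"
    unfolding Pi_pmf_split_coordinate[OF assms(1,2)] emeasure_bind_pmf emeasure_map_pmf vim
    by (intro nn_integral_cong) auto
  show "emeasure (Pi_pmf V d D) {f. G f} =
           (\<integral>\<^sup>+f. (if G f then 1 else 0) \<partial>Pi_pmf (V - {v}) d D)"
    unfolding Pi_pmf_split_coordinate[OF assms(1,2)] emeasure_bind_pmf emeasure_map_pmf vim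
    by (intro nn_integral_cong) auto
qed

lemma prob_Pi_pmf_coordinate_le:
  assumes "finite V" "v \<in> V"
    and G: "\<And>f y. G (f(v := y)) \<longleftrightarrow> G f" and H: "\<And>f y. H (f(v := y)) = H f"
    and le: "\<And>f. G f \<Longrightarrow> measure_pmf.prob (D v) (H f) \<le> c" and c: "c \<ge> 0"
  shows "measure_pmf.prob (Pi_pmf V d D) {f. G f \<and> f v \<in> H f}
           \<le> measure_pmf.prob (Pi_pmf V d D) {f. G f} * c"
proof -
  have "emeasure (Pi_pmf V d D) {f. G f \<and> f v \<in> H f}
      \<le> (\<integral>\<^sup>+f. ennreal c * (if G f then 1 else 0) \<partial>Pi_pmf (V - {v}) d D)"
    unfolding emeasure_Pi_pmf_coordinate(1)[OF assms(1-2) G H]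
    by (intro nn_integral_mono) (auto simp: measure_pmf.emeasure_eq_measure intro!: ennreal_leI le)
  also have "\<dots> = ennreal c * emeasure (Pi_pmf V d D) {f. G f}"
    unfolding emeasure_Pi_pmf_coordinate(2)[OF assms(1-2) G H]
    by (intro nn_integral_cmult) auto
  finally show ?thesis
    using c by (simp add: measure_pmf.emeasure_eq_measure mult.commute flip: ennreal_mult)
qed

lemma prob_Pi_pmf_coordinate_ge:
  assumes "finite V" "v \<in> V"
    and G: "\<And>f y. G (f(v := y)) \<longleftrightarrow> G f" and H: "\<And>f y. H (f(v := y)) = H f"
    and ge: "\<And>f. G f \<Longrightarrow> c \<le> measure_pmf.prob (D v) (H f)" and c: "c \<ge> 0"
  shows "measure_pmf.prob (Pi_pmf V d D) {f. G f} * c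
           \<le> measure_pmf.prob (Pi_pmf V d D) {f. G f \<and> f v \<in> H f}"
proof -
  have "ennreal c * emeasure (Pi_pmf V d D) {f. G f} =
      (\<integral>\<^sup>+f. ennreal c * (if G f then 1 else 0) \<partial>Pi_pmf (V - {v}) d D)"
    unfolding emeasure_Pi_pmf_coordinate(2)[OF assms(1-2) G H]
    by (intro nn_integral_cmult[symmetric]) auto
  also have "\<dots> \<le> emeasure (Pi_pmf V d D) {f. G f \<and> f v \<in> H f}"
    unfolding emeasure_Pi_pmf_coordinate(1)[OF assms(1-2) G H]
    by (intro nn_integral_mono) (auto simp: measure_pmf.emeasure_eq_measure intro!: ennreal_leI ge)
  finally show ?thesis
    using c by (simp add: measure_pmf.emeasure_eq_measure mult.commute flip: ennreal_mult)
qed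

text \<open>Coordinates in \<open>B\<close> are revealed one at a time. Each \<open>H w\<close>
  reads only coordinates outside \<open>B\<close>, so the constraints already treated can join
  \<open>G\<close> when the next coordinate is revealed. Typically the item sets of a small vertex
  set determine \<open>G\<close> and \<open>H\<close>, and \<open>B\<close> consists of vertices
  outside it.\<close>

lemma prob_Pi_pmf_coordinates_le:
  assumes "finite V" "B \<subseteq> V"
    and "\<And>f v y. v \<in> B \<Longrightarrow> G (f(v := y)) \<longleftrightarrow> G f"
    and "\<And>f v w y. v \<in> B \<Longrightarrow> w \<in> B \<Longrightarrow> H w (f(v := y)) = H w f"
    and "\<And>f w. G f \<Longrightarrow> w \<in> B \<Longrightarrow> measure_pmf.prob (D w) (H w f) \<le> c w"
    and "\<And>w. w \<in> B \<Longrightarrow> c w \<ge> 0"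
  shows "measure_pmf.prob (Pi_pmf V d D) {f. G f \<and> (\<forall>w\<in>B. f w \<in> H w f)}
           \<le> measure_pmf.prob (Pi_pmf V d D) {f. G f} * (\<Prod>w\<in>B. c w)"
proof -
  have "finite B" using assms(1,2) finite_subset by blast
  from this assms(2-) show ?thesis
  proof (induction B)
    case (insert b B)
    have Gb: "G (f(b := y)) \<longleftrightarrow> G f" for f y by (rule insert.prems(2)) simp
    have Hb: "w \<in> insert b B \<Longrightarrow> H w (f(b := y)) = H w f" for f y w by (rule insert.prems(3)) simp_all
    have IH: "measure_pmf.prob (Pi_pmf V d D) {f. G f \<and> (\<forall>w\<in>B. f w \<in> H w f)}
        \<le> measure_pmf.prob (Pi_pmf V d D) {f. G f} * (\<Prod>w\<in>B. c w)"
      by (rule insert.IH)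
        (use insert.prems(1) in blast, (rule insert.prems(2-5); simp)+)
    have "measure_pmf.prob (Pi_pmf V d D) {f. G f \<and> (\<forall>w\<in>insert b B. f w \<in> H w f)}
       = measure_pmf.prob (Pi_pmf V d D) {f. (G f \<and> (\<forall>w\<in>B. f w \<in> H w f)) \<and> f b \<in> H b f}"
      by (rule arg_cong[where f = "measure_pmf.prob _"]) auto
    also have "\<dots> \<le> measure_pmf.prob (Pi_pmf V d D) {f. G f \<and> (\<forall>w\<in>B. f w \<in> H w f)} * c b"
    proof (rule prob_Pi_pmf_coordinate_le[where G = "\<lambda>f. G f \<and> (\<forall>w\<in>B. f w \<in> H w f)" and H = "H b"])
      fix f y
      show "(G (f(b := y)) \<and> (\<forall>w\<in>B. (f(b := y)) w \<in> H w (f(b := y)))) = (G f \<and> (\<forall>w\<in>B. f w \<in> H w f))"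
        using insert.hyps(2) by (auto simp: Gb Hb)
      show "H b (f(b := y)) = H b f" by (simp add: Hb)
    next
      fix f assume "G f \<and> (\<forall>w\<in>B. f w \<in> H w f)"
      thus "measure_pmf.prob (D b) (H b f) \<le> c b" by (intro insert.prems(4)) simp_all
    next
      show "b \<in> V" using insert.prems(1) by blast
      show "c b \<ge> 0" by (rule insert.prems(5)) simp
    qed (rule assms(1))
    also have "\<dots> \<le> measure_pmf.prob (Pi_pmf V d D) {f. G f} * (\<Prod>w\<in>B. c w) * c b"
      by (rule mult_right_mono[OF IH]) (rule insert.prems(5), simp)
    finally show ?case using insert.hyps by (simp add: mult_ac)
  qed auto
qed

lemma prob_Pi_pmf_coordinates_ge:
  assumes "finite V" "B \<subseteq> V"
    and "\<And>f v y. v \<in> B \<Longrightarrow> G (f(v := y)) \<longleftrightarrow> G f"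
    and "\<And>f v w y. v \<in> B \<Longrightarrow> w \<in> B \<Longrightarrow> H w (f(v := y)) = H w f"
    and "\<And>f w. G f \<Longrightarrow> w \<in> B \<Longrightarrow> c w \<le> measure_pmf.prob (D w) (H w f)"
    and "\<And>w. w \<in> B \<Longrightarrow> c w \<ge> 0"
  shows "measure_pmf.prob (Pi_pmf V d D) {f. G f} * (\<Prod>w\<in>B. c w)
           \<le> measure_pmf.prob (Pi_pmf V d D) {f. G f \<and> (\<forall>w\<in>B. f w \<in> H w f)}"
proof -
  have "finite B" using assms(1,2) finite_subset by blast
  from this assms(2-) show ?thesis
  proof (induction B)
    case (insert b B)
    have Gb: "G (f(b := y)) \<longleftrightarrow> G f" for f y by (rule insert.prems(2)) simp
    have Hb: "w \<in> insert b B \<Longrightarrow> H w (f(b := y)) = H w f" for f y w by (rule insert.prems(3)) simp_all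
    have IH: "measure_pmf.prob (Pi_pmf V d D) {f. G f} * (\<Prod>w\<in>B. c w)
        \<le> measure_pmf.prob (Pi_pmf V d D) {f. G f \<and> (\<forall>w\<in>B. f w \<in> H w f)}"
      by (rule insert.IH)
        (use insert.prems(1) in blast, (rule insert.prems(2-5); simp)+)
    have "measure_pmf.prob (Pi_pmf V d D) {f. G f} * (\<Prod>w\<in>insert b B. c w)
        = measure_pmf.prob (Pi_pmf V d D) {f. G f} * (\<Prod>w\<in>B. c w) * c b"
      using insert.hyps by (simp add: mult_ac)
    also have "\<dots> \<le> measure_pmf.prob (Pi_pmf V d D) {f. G f \<and> (\<forall>w\<in>B. f w \<in> H w f)} * c b"
      by (rule mult_right_mono[OF IH]) (rule insert.prems(5), simp)
    also have "\<dots> \<le> measure_pmf.prob (Pi_pmf V d D) {f. (G f \<and> (\<forall>w\<in>B. f w \<in> H w f)) \<and> f b \<in> H b f}"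
    proof (rule prob_Pi_pmf_coordinate_ge[where G = "\<lambda>f. G f \<and> (\<forall>w\<in>B. f w \<in> H w f)" and H = "H b"])
      fix f y
      show "(G (f(b := y)) \<and> (\<forall>w\<in>B. (f(b := y)) w \<in> H w (f(b := y)))) = (G f \<and> (\<forall>w\<in>B. f w \<in> H w f))"
        using insert.hyps(2) by (auto simp: Gb Hb)
      show "H b (f(b := y)) = H b f" by (simp add: Hb)
    next
      fix f assume "G f \<and> (\<forall>w\<in>B. f w \<in> H w f)"
      thus "c b \<le> measure_pmf.prob (D b) (H b f)" by (intro insert.prems(4)) simp_all
    next
      show "b \<in> V" using insert.prems(1) by blast
      show "c b \<ge> 0" by (rule insert.prems(5)) simp
    qed (rule assms(1))
    also have "\<dots> = measure_pmf.prob (Pi_pmf V d D) {f. G f \<and> (\<forall>w\<in>insert b B. f w \<in> H w f)}"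
      by (rule arg_cong[where f = "measure_pmf.prob _"]) auto
    finally show ?case .
  qed auto
qed

section \<open>Moment inequalities\<close>

lemma prob_le_sum_prob:
  assumes "finite I" "E \<subseteq> (\<Union>i\<in>I. F i)"
  shows "measure_pmf.prob p E \<le> (\<Sum>i\<in>I. measure_pmf.prob p (F i))"
proof -
  have "measure_pmf.prob p E \<le> measure_pmf.prob p (\<Union>i\<in>I. F i)"
    by (rule measure_pmf.finite_measure_mono) (use assms in auto)
  also have "\<dots> \<le> (\<Sum>i\<in>I. measure_pmf.prob p (F i))"
    by (rule measure_pmf.finite_measure_subadditive_finite) (use assms in auto)
  finally show ?thesis .
qed

lemma integrable_pmf_bounded:
  fixes X :: "'a \<Rightarrow> real"
  assumes "\<And>x. \<bar>X x\<bar> \<le> c"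
  shows "integrable (measure_pmf p) X"
  by (rule measure_pmf.integrable_const_bound[of _ c]) (use assms in auto)

text \<open>Cauchy--Schwarz for the number of events that occur.\<close>
lemma chung_erdos:
  assumes "finite I"
  shows "(\<Sum>i\<in>I. measure_pmf.prob p (F i))\<^sup>2 \<le>
           measure_pmf.prob p (\<Union>i\<in>I. F i) * (\<Sum>i\<in>I. \<Sum>j\<in>I. measure_pmf.prob p (F i \<inter> F j))"
proof -
  define U where "U = (\<Union>i\<in>I. F i)"
  define X where "X = (\<lambda>x. \<Sum>i\<in>I. indicat_real (F i) x)"
  define E where "E = (\<Sum>i\<in>I. measure_pmf.prob p (F i))"
  define E2 where "E2 = (\<Sum>i\<in>I. \<Sum>j\<in>I. measure_pmf.prob p (F i \<inter> F j))"
  define u where "u = measure_pmf.prob p U"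
  have [simp]: "integrable (measure_pmf p) (indicat_real A)" for A
    by (rule integrable_pmf_bounded[of _ 1]) (auto simp: indicator_def)
  have XU: "indicat_real U x * X x = X x" for x
    unfolding X_def U_def by (auto simp: indicator_def intro!: sum.neutral)
  have X2: "X x ^ 2 = (\<Sum>i\<in>I. \<Sum>j\<in>I. indicat_real (F i \<inter> F j) x)" for x
    unfolding X_def power2_eq_square sum_product by (simp add: indicator_inter_arith)
  have intX: "integrable (measure_pmf p) X" unfolding X_def by auto
  have intX2: "integrable (measure_pmf p) (\<lambda>x. X x ^ 2)" unfolding X2 by auto
  have EX: "measure_pmf.expectation p X = E" unfolding X_def E_def by simp
  have EX2: "measure_pmf.expectation p (\<lambda>x. X x ^ 2) = E2" unfolding X2 E2_def by simp
  \<comment> \<open>\<open>X\<close> vanishes off \<open>U\<close>, so the mean of the square of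
    \<open>t * indicator U - X\<close> is a quadratic polynomial in \<open>t\<close>. Its minimiser
    \<open>t = E / u\<close> gives the claim.\<close>
  have quad: "0 \<le> t\<^sup>2 * u - 2 * t * E + E2" for t
  proof -
    have "0 \<le> measure_pmf.expectation p (\<lambda>x. (t * indicat_real U x - X x)\<^sup>2)"
      by (intro integral_nonneg_AE) auto
    also have "(\<lambda>x. (t * indicat_real U x - X x)\<^sup>2) = (\<lambda>x. t\<^sup>2 * indicat_real U x - 2 * t * X x + X x ^ 2)"
    proof
      fix x
      have "(t * indicat_real U x - X x)\<^sup>2 =
         t\<^sup>2 * (indicat_real U x)\<^sup>2 - 2 * t * (indicat_real U x * X x) + X x ^ 2"
        by (simp add: power2_eq_square algebra_simps)
      also have "(indicat_real U x)\<^sup>2 = indicat_real U x" by (simp add: indicator_def)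
      finally show "(t * indicat_real U x - X x)\<^sup>2 = t\<^sup>2 * indicat_real U x - 2 * t * X x + X x ^ 2"
        by (simp add: XU)
    qed
    also have "measure_pmf.expectation p \<dots> = t\<^sup>2 * u - 2 * t * E + E2"
      using intX intX2 by (simp add: u_def EX EX2)
    finally show ?thesis .
  qed
  have "E\<^sup>2 \<le> u * E2"
  proof (cases "u = 0")
    case True
    have "measure_pmf.prob p (F i) \<le> u" if "i \<in> I" for i
      unfolding u_def U_def by (rule measure_pmf.finite_measure_mono) (use that in auto)
    hence "E = 0" unfolding E_def using True
      by (intro sum.neutral) (auto intro: antisym)
    thus ?thesis using True by simp
  next
    case False
    hence "u > 0" by (simp add: u_def zero_less_measure_iff)
    have "0 \<le> u * ((E/u)\<^sup>2 * u - 2 * (E/u) * E + E2)"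
      using quad[of "E/u"] \<open>u > 0\<close> by simp
    also have "\<dots> = u * E2 - E\<^sup>2" using \<open>u > 0\<close> by (simp add: field_simps power2_eq_square)
    finally show ?thesis by simp
  qed
  thus ?thesis by (simp add: E_def E2_def u_def U_def)
qed

text \<open>Telescopes by Pascal's rule. The count is \<open>Suc y\<close> because for the count
  \<open>0\<close> every partial sum equals 1.\<close>

lemma alternating_binomial_partial_sum:
  "(\<Sum>i\<le>m. (-1) ^ i * real (Suc y choose i)) = (-1) ^ m * real (y choose m)"
  by (induction m) (auto simp: algebra_simps)

lemma bonferroni_count:
  shows "(\<Sum>i\<le>2 * m + 1. (-1) ^ i * real (y choose i)) \<le> (if y = 0 then 1 else 0)"
    and "(if y = 0 then 1 else 0) \<le> (\<Sum>i\<le>2 * m. (-1) ^ i * real (y choose i))"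
proof -
  have zero: "(\<Sum>i\<le>r. (-1) ^ i * real (0 choose i)) = 1" for r
    by (induction r) auto
  show "(\<Sum>i\<le>2 * m + 1. (-1) ^ i * real (y choose i)) \<le> (if y = 0 then 1 else 0)"
  proof (cases y)
    case 0 thus ?thesis by (simp only: zero) simp
  next
    case (Suc z) thus ?thesis
      by (simp only: alternating_binomial_partial_sum) simp
  qed
  show "(if y = 0 then 1 else 0) \<le> (\<Sum>i\<le>2 * m. (-1) ^ i * real (y choose i))"
  proof (cases y)
    case 0 thus ?thesis by (simp only: zero) simp
  next
    case (Suc z) thus ?thesis
      by (simp only: alternating_binomial_partial_sum) simp
  qed
qed

text \<open>Expectation of \<open>bonferroni_count\<close> at the number \<open>Y\<close> of events
  that occur: \<open>Y choose i\<close> counts the \<open>i\<close>-subsets of \<open>V\<close> all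
  of whose events occur, so its mean is \<open>S i\<close>.\<close>

lemma bonferroni:
  fixes p :: "'a pmf" and F :: "'b \<Rightarrow> 'a set"
  assumes "finite V"
  defines "S \<equiv> \<lambda>i. \<Sum>J | J \<subseteq> V \<and> card J = i. measure_pmf.prob p (\<Inter>v\<in>J. F v)"
  shows "(\<Sum>i\<le>2 * m + 1. (-1) ^ i * S i) \<le> measure_pmf.prob p {x. \<forall>v\<in>V. x \<notin> F v}"
    and "measure_pmf.prob p {x. \<forall>v\<in>V. x \<notin> F v} \<le> (\<Sum>i\<le>2 * m. (-1) ^ i * S i)"
proof -
  define Y where "Y = (\<lambda>x. card {v\<in>V. x \<in> F v})"
  have [simp]: "integrable (measure_pmf p) (indicat_real A)" for A
    by (rule integrable_pmf_bounded[of _ 1]) (auto simp: indicator_def)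
  have fin: "finite {J. J \<subseteq> V \<and> card J = i}" for i
    by (rule finite_subset[of _ "Pow V"]) (use assms in auto)
  have choose: "real (Y x choose i) = (\<Sum>J | J \<subseteq> V \<and> card J = i. indicat_real (\<Inter>v\<in>J. F v) x)" for x i
  proof -
    have "(\<Sum>J | J \<subseteq> V \<and> card J = i. indicat_real (\<Inter>v\<in>J. F v) x) =
        (\<Sum>J | J \<subseteq> V \<and> card J = i. if J \<subseteq> {v\<in>V. x \<in> F v} then 1 else 0)"
      by (intro sum.cong) (auto simp: indicator_def)
    also have "\<dots> = real (card ({J. J \<subseteq> V \<and> card J = i} \<inter> {J. J \<subseteq> {v\<in>V. x \<in> F v}}))"
      using fin by (simp add: sum.If_cases)
    also have "{J. J \<subseteq> V \<and> card J = i} \<inter> {J. J \<subseteq> {v\<in>V. x \<in> F v}} = {J. J \<subseteq> {v\<in>V. x \<in> F v} \<and> card J = i}"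
      by auto
    also have "card \<dots> = (Y x choose i)"
      unfolding Y_def by (rule n_subsets) (use assms in auto)
    finally show ?thesis by simp
  qed
  have ind: "(if Y x = 0 then 1 else 0) = indicat_real {x. \<forall>v\<in>V. x \<notin> F v} x" for x
    unfolding Y_def using assms(1) by (auto simp: indicator_def)
  have intY: "integrable (measure_pmf p) (\<lambda>x. \<Sum>i\<le>r. (-1) ^ i * real (Y x choose i))" for r
    unfolding choose by auto
  have EY: "measure_pmf.expectation p (\<lambda>x. \<Sum>i\<le>r. (-1) ^ i * real (Y x choose i)) = (\<Sum>i\<le>r. (-1) ^ i * S i)" for r
    unfolding choose S_def by simp
  have E0: "measure_pmf.expectation p (\<lambda>x. if Y x = 0 then 1 else 0 :: real) = measure_pmf.prob p {x. \<forall>v\<in>V. x \<notin> F v}"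
    unfolding ind by simp
  have int0: "integrable (measure_pmf p) (\<lambda>x. if Y x = 0 then 1 else 0 :: real)"
    unfolding ind by simp
  show "(\<Sum>i\<le>2 * m + 1. (-1) ^ i * S i) \<le> measure_pmf.prob p {x. \<forall>v\<in>V. x \<notin> F v}"
    unfolding E0[symmetric] EY[symmetric] by (intro integral_mono intY int0 bonferroni_count)
  show "measure_pmf.prob p {x. \<forall>v\<in>V. x \<notin> F v} \<le> (\<Sum>i\<le>2 * m. (-1) ^ i * S i)"
    unfolding E0[symmetric] EY[symmetric] by (intro integral_mono intY int0 bonferroni_count)
qed

section \<open>A uniformly random set of \<open>K\<close> items\<close>

abbreviation kset_pmf :: "nat \<Rightarrow> nat \<Rightarrow> nat set pmf" where
  "kset_pmf P K \<equiv> pmf_of_set (ksubsets P K)"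

lemma finite_ksubsets [simp]: "finite (ksubsets P K)"
  unfolding ksubsets_def by (rule finite_subset[of _ "Pow {..<P}"]) auto

lemma card_ksubsets: "card (ksubsets P K) = P choose K"
  unfolding ksubsets_def using n_subsets[of "{..<P}" K] by simp

lemma ksubsets_nonempty: "K \<le> P \<Longrightarrow> ksubsets P K \<noteq> {}"
  using card_ksubsets[of P K] by (metis binomial_eq_0_iff card.empty not_less)

lemma ksubsetsD:
  assumes "T \<in> ksubsets P K"
  shows "T \<subseteq> {..<P}" "card T = K" "finite T"
  using assms finite_subset[of T "{..<P}"] by (auto simp: ksubsets_def)

lemma prob_kset_pmf:
  "K \<le> P \<Longrightarrow> measure_pmf.prob (kset_pmf P K) X = card (ksubsets P K \<inter> X) / (P choose K)"
  by (subst measure_pmf_of_set) (auto simp: card_ksubsets ksubsets_nonempty)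

text \<open>Each step from \<open>y\<close> to \<open>Suc y\<close> multiplies the ratio of the
  binomials by \<open>(K - y) / (P - y)\<close>, which is at most \<open>K / P\<close>. The
  division-free form also covers \<open>y > P\<close>.\<close>

lemma choose_mult_power_le:
  assumes "K \<le> P"
  shows "real (K choose y) * real P ^ y \<le> real (P choose y) * real K ^ y"
proof (induction y)
  case (Suc y)
  show ?case
  proof (cases "Suc y \<le> K")
    case True
    have step: "real (Suc y) * real (N choose Suc y) = real (N choose y) * real (N - y)" for N
      by (metis Suc_times_binomial_eq binomial_absorb_comp mult.commute of_nat_mult binomial_absorption)
    have mono: "real (K - y) * real P \<le> real (P - y) * real K"
    proof -
      have "real (K - y) = real K - real y" "real (P - y) = real P - real y" using True assms by auto
      moreover have "real y * real K \<le> real y * real P" using assms by (intro mult_left_mono) auto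
      ultimately show ?thesis by (simp add: algebra_simps)
    qed
    have "real (Suc y) * (real (K choose Suc y) * real P ^ Suc y) =
        (real (K choose y) * real P ^ y) * (real (K - y) * real P)"
      unfolding mult.assoc[symmetric] step[of K] by (simp add: mult_ac)
    also have "\<dots> \<le> (real (P choose y) * real K ^ y) * (real (P - y) * real K)"
      by (intro mult_mono Suc.IH mono) auto
    also have "\<dots> = real (Suc y) * (real (P choose Suc y) * real K ^ Suc y)"
      unfolding mult.assoc[symmetric] step[of P] by (simp add: mult_ac)
    finally show ?thesis by (simp del: of_nat_Suc)
  next
    case False
    thus ?thesis by (simp add: binomial_eq_0)
  qed
qed auto

lemma choose_ratio_le:
  assumes "K \<le> P" "y \<le> P" "0 < P"
  shows "real (K choose y) / real (P choose y) \<le> (real K / real P) ^ y"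
  using choose_mult_power_le[OF assms(1), of y] assms
  by (simp add: power_divide divide_simps mult.commute)

lemma choose_le_power_div_fact: "real (n choose k) \<le> real n ^ k / fact k"
proof -
  have "(n choose k) * fact k \<le> n ^ k" by (rule binomial_fact_pow)
  hence "real ((n choose k) * fact k) \<le> real (n ^ k)" by (simp only: of_nat_le_iff)
  thus ?thesis by (simp add: field_simps)
qed

lemma choose_le_power: "real (n choose k) \<le> real n ^ k"
proof -
  have "real n ^ k / fact k \<le> real n ^ k / 1"
    by (intro divide_left_mono) (auto simp: fact_ge_1)
  with choose_le_power_div_fact[of n k] show ?thesis by linarith
qed

text \<open>Removing \<open>Y\<close> maps the favourable sets onto the
  \<open>(K - card Y)\<close>-subsets of the other items; the trinomial identity
  \<open>choose_mult\<close> then gives a quotient to which \<open>choose_ratio_le\<close>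
  applies.\<close>

lemma prob_kset_superset:
  assumes "K \<le> P" "Y \<subseteq> {..<P}"
  shows "measure_pmf.prob (kset_pmf P K) {T. Y \<subseteq> T} = real (K choose card Y) / real (P choose card Y)"
proof -
  have finY: "finite Y" using assms(2) finite_subset by blast
  have yP: "card Y \<le> P" using card_mono[OF _ assms(2)] by simp
  show ?thesis
  proof (cases "card Y \<le> K")
    case True
    have "bij_betw (\<lambda>T. T - Y) (ksubsets P K \<inter> {T. Y \<subseteq> T}) {Z. Z \<subseteq> {..<P} - Y \<and> card Z = K - card Y}"
    proof (rule bij_betw_byWitness[where f' = "\<lambda>Z. Z \<union> Y"])
      show "(\<lambda>T. T - Y) ` (ksubsets P K \<inter> {T. Y \<subseteq> T}) \<subseteq> {Z. Z \<subseteq> {..<P} - Y \<and> card Z = K - card Y}"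
        using finY by (auto simp: ksubsets_def card_Diff_subset)
      show "(\<lambda>Z. Z \<union> Y) ` {Z. Z \<subseteq> {..<P} - Y \<and> card Z = K - card Y} \<subseteq> ksubsets P K \<inter> {T. Y \<subseteq> T}"
      proof safe
        fix Z assume Z: "Z \<subseteq> {..<P} - Y" "card Z = K - card Y"
        have "finite Z" using Z(1) finite_subset[of Z "{..<P} - Y"] by simp
        hence "card (Z \<union> Y) = card Z + card Y" using finY Z by (intro card_Un_disjoint) auto
        thus "Z \<union> Y \<in> ksubsets P K" using Z assms True by (auto simp: ksubsets_def)
      qed
    qed auto
    hence "card (ksubsets P K \<inter> {T. Y \<subseteq> T}) = card {Z. Z \<subseteq> {..<P} - Y \<and> card Z = K - card Y}"
      by (rule bij_betw_same_card)
    also have "\<dots> = (P - card Y) choose (K - card Y)"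
      using n_subsets[of "{..<P} - Y" "K - card Y"] assms finY by (simp add: card_Diff_subset)
    finally have card: "card (ksubsets P K \<inter> {T. Y \<subseteq> T}) = (P - card Y) choose (K - card Y)" .
    have "(P choose K) * (K choose card Y) = (P choose card Y) * ((P - card Y) choose (K - card Y))"
      using True assms by (intro choose_mult) auto
    hence "real (P choose K) * real (K choose card Y) =
        real (P choose card Y) * real ((P - card Y) choose (K - card Y))"
      by (metis of_nat_mult)
    moreover have "(P choose K) > 0" "(P choose card Y) > 0" using assms yP by auto
    ultimately show ?thesis using assms by (simp add: prob_kset_pmf card field_simps)
  next
    case False
    have "ksubsets P K \<inter> {T. Y \<subseteq> T} = {}"
      using False ksubsetsD(2,3) card_mono by fastforce
    thus ?thesis using False assms by (simp add: prob_kset_pmf binomial_eq_0)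
  qed
qed

lemma prob_kset_superset_le:
  assumes "K \<le> P" "0 < P" "Y \<subseteq> {..<P}"
  shows "measure_pmf.prob (kset_pmf P K) {T. Y \<subseteq> T} \<le> (real K / real P) ^ card Y"
  using prob_kset_superset[OF assms(1,3)] choose_ratio_le[OF assms(1) _ assms(2), of "card Y"]
    card_mono[OF _ assms(3)] by simp

text \<open>Here \<open>choose_ratio_le\<close> is used with \<open>card W\<close> in the role of
  \<open>K\<close> and \<open>K\<close> in the role of \<open>y\<close>.\<close>

lemma prob_kset_subset_le:
  assumes "K \<le> P" "0 < P" "W \<subseteq> {..<P}"
  shows "measure_pmf.prob (kset_pmf P K) {T. T \<subseteq> W} \<le> (real (card W) / real P) ^ K"
proof -
  have finW: "finite W" using assms(3) finite_subset by blast
  have "ksubsets P K \<inter> {T. T \<subseteq> W} = {T. T \<subseteq> W \<and> card T = K}"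
    using assms by (auto simp: ksubsets_def)
  hence "card (ksubsets P K \<inter> {T. T \<subseteq> W}) = card W choose K"
    using n_subsets[OF finW] by simp
  thus ?thesis using choose_ratio_le[of "card W" P K] assms card_mono[OF _ assms(3)]
    by (simp add: prob_kset_pmf)
qed

text \<open>The number \<open>t\<close> of common items enters through its binomial moments \<open>t choose l\<close>.\<close>
lemma prob_kset_inter_ge_le:
  assumes "K \<le> P" "0 < P" "S \<subseteq> {..<P}"
  shows "measure_pmf.prob (kset_pmf P K) {T. l \<le> card (T \<inter> S)} \<le> real (card S choose l) * (real K / real P) ^ l"
proof -
  have finS: "finite S" using assms(3) finite_subset by blast
  have "measure_pmf.prob (kset_pmf P K) {T. l \<le> card (T \<inter> S)} \<le>
      (\<Sum>X | X \<subseteq> S \<and> card X = l. measure_pmf.prob (kset_pmf P K) {T. X \<subseteq> T})"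
  proof (rule prob_le_sum_prob)
    show "finite {X. X \<subseteq> S \<and> card X = l}" using finS by simp
    show "{T. l \<le> card (T \<inter> S)} \<subseteq> (\<Union>X\<in>{X. X \<subseteq> S \<and> card X = l}. {T. X \<subseteq> T})"
    proof safe
      fix T assume "l \<le> card (T \<inter> S)"
      then obtain X where "X \<subseteq> T \<inter> S" "card X = l"
        by (meson obtain_subset_with_card_n)
      thus "T \<in> (\<Union>X\<in>{X. X \<subseteq> S \<and> card X = l}. {T. X \<subseteq> T})" by auto
    qed
  qed
  also have "\<dots> \<le> (\<Sum>X | X \<subseteq> S \<and> card X = l. (real K / real P) ^ l)"
  proof (rule sum_mono)
    fix X assume X: "X \<in> {X. X \<subseteq> S \<and> card X = l}"
    hence "X \<subseteq> {..<P}" using assms(3) by blast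
    from prob_kset_superset_le[OF assms(1,2) this] X
    show "measure_pmf.prob (kset_pmf P K) {T. X \<subseteq> T} \<le> (real K / real P) ^ l" by simp
  qed
  also have "\<dots> = real (card S choose l) * (real K / real P) ^ l"
    using n_subsets[OF finS, of l] by simp
  finally show ?thesis .
qed

text \<open>Double counting: \<open>card (T \<inter> S) choose l\<close> is the number of
  \<open>l\<close>-subsets of \<open>S\<close> contained in \<open>T\<close>, and each of the
  \<open>K choose l\<close> candidates is contained with the probability of
  \<open>prob_kset_superset\<close>.\<close>

lemma expectation_kset_inter_choose:
  assumes "K \<le> P" "S \<in> ksubsets P K"
  shows "measure_pmf.expectation (kset_pmf P K) (\<lambda>T. real (card (T \<inter> S) choose l)) =
           real (K choose l) ^ 2 / real (P choose l)"
proof -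
  note S = ksubsetsD[OF assms(2)]
  have [simp]: "integrable (measure_pmf (kset_pmf P K)) (indicat_real A)" for A
    by (rule integrable_pmf_bounded[of _ 1]) (auto simp: indicator_def)
  have "real (card (T \<inter> S) choose l) = (\<Sum>X | X \<subseteq> S \<and> card X = l. indicat_real {T. X \<subseteq> T} T)" for T
  proof -
    have "(\<Sum>X | X \<subseteq> S \<and> card X = l. indicat_real {T. X \<subseteq> T} T) =
        real (card ({X. X \<subseteq> S \<and> card X = l} \<inter> {X. X \<subseteq> T}))"
      using S(3) by (simp add: indicator_def sum.If_cases flip: of_bool_def)
    also have "{X. X \<subseteq> S \<and> card X = l} \<inter> {X. X \<subseteq> T} = {X. X \<subseteq> T \<inter> S \<and> card X = l}" by auto
    also have "card \<dots> = card (T \<inter> S) choose l" using S(3) by (intro n_subsets) auto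
    finally show ?thesis by simp
  qed
  hence "measure_pmf.expectation (kset_pmf P K) (\<lambda>T. real (card (T \<inter> S) choose l)) =
      (\<Sum>X | X \<subseteq> S \<and> card X = l. measure_pmf.prob (kset_pmf P K) {T. X \<subseteq> T})"
    by simp
  also have "\<dots> = (\<Sum>X | X \<subseteq> S \<and> card X = l. real (K choose l) / real (P choose l))"
    by (intro sum.cong refl) (use S(1) prob_kset_superset[OF assms(1)] in auto)
  also have "\<dots> = real (K choose l) ^ 2 / real (P choose l)"
    using n_subsets[OF S(3), of l] S(2) by (simp add: power2_eq_square)
  finally show ?thesis .
qed

lemma integrable_kset_pmf:
  fixes X :: "nat set \<Rightarrow> real"
  assumes "K \<le> P"
  shows "integrable (measure_pmf (kset_pmf P K)) X"
  by (rule integrable_measure_pmf_finite) (use assms in \<open>simp add: set_pmf_of_set ksubsets_nonempty\<close>)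

text \<open>Since \<open>(s + 1) * (y choose Suc s) = (y - s) * (y choose s)\<close>, the left side
  is \<open>(y choose s) * (1 - (y - s))\<close>: it is 1 at \<open>y = s\<close> and not positive
  beyond. Thus two binomial moments bound the adjacency probability from below.\<close>

lemma choose_minus_choose_Suc_le:
  "real (y choose s) - (real s + 1) * real (y choose Suc s) \<le> of_bool (s \<le> y)"
proof (cases "s \<le> y")
  case True
  have "Suc s * (y choose Suc s) = (y choose s) * (y - s)"
    by (metis binomial_absorb_comp binomial_absorption mult.commute)
  hence "real (Suc s * (y choose Suc s)) = real ((y choose s) * (y - s))" by (simp only:)
  hence "(real s + 1) * real (y choose Suc s) = real (y choose s) * (real y - real s)"
    using True by (simp add: of_nat_diff algebra_simps)
  hence "real (y choose s) - (real s + 1) * real (y choose Suc s) = real (y choose s) * (1 - (real y - real s))"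
    by (simp add: algebra_simps)
  also have "\<dots> \<le> 1"
  proof (cases "y = s")
    case False
    hence "1 - (real y - real s) \<le> 0" using True by simp
    hence "real (y choose s) * (1 - (real y - real s)) \<le> 0" by (simp add: mult_nonneg_nonpos)
    thus ?thesis by linarith
  qed simp
  finally show ?thesis using True by simp
qed (auto simp: binomial_eq_0)

lemma prob_kset_inter_ge_ge:
  assumes "K \<le> P" "S \<in> ksubsets P K"
  shows "measure_pmf.prob (kset_pmf P K) {T. s \<le> card (T \<inter> S)} \<ge>
          real (K choose s) ^ 2 / real (P choose s) - (real s + 1) * (real (K choose Suc s) ^ 2 / real (P choose Suc s))"
proof -
  have "real (K choose s) ^ 2 / real (P choose s) - (real s + 1) * (real (K choose Suc s) ^ 2 / real (P choose Suc s)) =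
     measure_pmf.expectation (kset_pmf P K)
       (\<lambda>T. real (card (T \<inter> S) choose s) - (real s + 1) * real (card (T \<inter> S) choose Suc s))"
    unfolding expectation_kset_inter_choose[OF assms, symmetric]
    by (subst Bochner_Integration.integral_diff) (use integrable_kset_pmf[OF assms(1)] in auto)
  also have "\<dots> \<le> measure_pmf.expectation (kset_pmf P K) (indicat_real {T. s \<le> card (T \<inter> S)})"
    by (intro integral_mono integrable_kset_pmf assms(1) order_trans[OF choose_minus_choose_Suc_le])
       (auto simp: indicator_def)
  finally show ?thesis by simp
qed

text \<open>Weierstrass product inequality for the factors \<open>1 - i / K\<close>. Bounding each
  \<open>i\<close> by \<open>s - 1\<close> loses a factor 2 in the error term, which does not
  matter.\<close>

lemma choose_ge_power:
  assumes "s \<le> K" "0 < K"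
  shows "real K ^ s / fact s * (1 - real (s * (s - 1)) / real K) \<le> real (K choose s)"
proof -
  have "1 - real (s * (s - 1)) / real K \<le> (\<Prod>i<s. 1 - real i / real K)"
  proof -
    have "1 - (\<Sum>i<s. real i / real K) \<le> (\<Prod>i<s. 1 - real i / real K)"
      using assms by (intro Weierstrass_prod_ineq) auto
    moreover have "(\<Sum>i<s. real i / real K) \<le> (\<Sum>i<s. real (s - 1) / real K)"
      by (intro sum_mono divide_right_mono) auto
    moreover have "(\<Sum>i<s. real (s - 1) / real K) = real (s * (s - 1)) / real K"
      by (simp only: sum_constant card_lessThan of_nat_mult times_divide_eq_right)
    ultimately show ?thesis by linarith
  qed
  also have "\<dots> = (\<Prod>i<s. (real K - real i) / real K)"
    using assms by (intro prod.cong) (auto simp: field_simps)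
  also have "\<dots> = (\<Prod>i<s. real K - real i) / real K ^ s"
    by (simp add: prod_dividef)
  finally have "real K ^ s * (1 - real (s * (s - 1)) / real K) \<le> (\<Prod>i<s. real K - real i)"
    using assms by (simp add: field_simps)
  also have "(\<Prod>i<s. real K - real i) = fact s * real (K choose s)"
    using binomial_gbinomial[of K s, where 'a = real] by (simp add: gbinomial_prod_rev atLeast0LessThan)
  finally show ?thesis by (simp add: field_simps)
qed


section \<open>Adjacency probabilities for one choice of \<open>s\<close>, \<open>K\<close> and
  \<open>P\<close>\<close>

locale intersection_params =
  fixes s K P :: nat
  assumes s_pos: "1 \<le> s" and s_le_K: "s \<le> K" and K_le_P: "K \<le> P"
begin

text \<open>The mean number of items shared by two vertices. Its powers \<open>x ^ l\<close> bound
  the chance of sharing \<open>l\<close> items, and \<open>x ^ s = fact s * w\<close> links it to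
  adjacency.\<close>

definition x :: real where "x = real K ^ 2 / real P"
definition w :: real where "w = 1 / fact s * (real K ^ (2 * s) / real P ^ s)"
text \<open>Lower counterpart of \<open>w\<close> for the adjacency probability. The loss
  \<open>2 * s * (s - 1) / K\<close> comes from replacing \<open>K choose s\<close> by
  \<open>K ^ s / fact s\<close> twice, the loss \<open>x\<close> from pairs that share more than
  \<open>s\<close> items.\<close>

definition w_lower :: real where "w_lower = w * (1 - 2 * real (s * (s - 1)) / real K - x)"

lemma K_pos: "0 < K" and P_pos: "0 < P"
  using s_pos s_le_K K_le_P by auto

lemma x_pos: "0 < x" and w_pos: "0 < w"
  using K_pos P_pos by (auto simp: x_def w_def)

lemma x_power_s: "x ^ s = fact s * w"
  by (simp add: x_def w_def power_divide flip: power_mult)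

lemma w_eq: "w = (real K ^ s)\<^sup>2 / (fact s * real P ^ s)"
  by (simp add: w_def mult.commute flip: power_mult)

lemma prob_overlap_le:
  assumes "S \<in> ksubsets P K"
  shows "measure_pmf.prob (kset_pmf P K) {T. l \<le> card (T \<inter> S)} \<le> x ^ l"
proof -
  have "measure_pmf.prob (kset_pmf P K) {T. l \<le> card (T \<inter> S)} \<le> real (K choose l) * (real K / real P) ^ l"
    using prob_kset_inter_ge_le[OF K_le_P P_pos ksubsetsD(1)[OF assms], of l] ksubsetsD(2)[OF assms] by simp
  also have "\<dots> \<le> real K ^ l * (real K / real P) ^ l"
    by (intro mult_right_mono choose_le_power) auto
  also have "\<dots> = x ^ l" by (simp add: x_def power2_eq_square flip: power_mult_distrib)
  finally show ?thesis .
qed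

lemma choose_mult_ratio_le_w: "real (K choose s) * (real K / real P) ^ s \<le> w"
proof -
  have "real (K choose s) * (real K / real P) ^ s \<le> (real K ^ s / fact s) * (real K / real P) ^ s"
    by (intro mult_right_mono choose_le_power_div_fact) auto
  also have "\<dots> = w" by (simp add: w_def power_divide mult_2 power_add)
  finally show ?thesis .
qed

lemma prob_adj_le:
  assumes "S \<in> ksubsets P K"
  shows "measure_pmf.prob (kset_pmf P K) {T. s \<le> card (T \<inter> S)} \<le> w"
  using prob_kset_inter_ge_le[OF K_le_P P_pos ksubsetsD(1)[OF assms], of s] ksubsetsD(2)[OF assms]
    choose_mult_ratio_le_w by simp

text \<open>The \<open>s\<close>-th binomial moment of the overlap is at least
  \<open>w * (1 - 2 * \<delta>)\<close>, and the subtracted moment of order \<open>Suc s\<close> is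
  at most \<open>w * x\<close>.\<close>

lemma prob_adj_ge:
  assumes "S \<in> ksubsets P K"
  shows "w_lower \<le> measure_pmf.prob (kset_pmf P K) {T. s \<le> card (T \<inter> S)}"
proof -
  define \<delta> where "\<delta> = real (s * (s - 1)) / real K"
  have \<delta>: "\<delta> \<ge> 0" by (simp add: \<delta>_def)
  have Ps: "real (P choose s) > 0" using s_le_K K_le_P by simp
  show ?thesis
  \<comment> \<open>Squaring the bound of \<open>choose_ge_power\<close> needs
    \<open>1 - \<delta>\<close> to be nonnegative; otherwise \<open>w_lower\<close> is not positive
    and the claim is trivial.\<close>
  proof (cases "\<delta> \<le> 1")
    case True
    have "w * (1 - 2 * \<delta>) \<le> w * (1 - \<delta>) ^ 2"
      using w_pos by (intro mult_left_mono) (auto simp: power2_eq_square algebra_simps)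
    also have "\<dots> = (real K ^ s / fact s * (1 - \<delta>)) ^ 2 / (real P ^ s / fact s)"
    proof -
      have "A\<^sup>2 / (F * B) * (1 - \<delta>)\<^sup>2 = (A / F * (1 - \<delta>))\<^sup>2 / (B / F)" if "F > 0" for A B F :: real
        using that by (cases "B = 0") (simp_all add: divide_simps power2_eq_square)
      from this[of "fact s" "real K ^ s" "real P ^ s"] show ?thesis by (simp add: w_eq)
    qed
    also have "\<dots> \<le> real (K choose s) ^ 2 / real (P choose s)"
      using choose_ge_power[OF s_le_K K_pos] choose_le_power_div_fact[of P s] Ps True
      by (intro frac_le power_mono mult_nonneg_nonneg) (auto simp: \<delta>_def)
    finally have 1: "w * (1 - 2 * \<delta>) \<le> real (K choose s) ^ 2 / real (P choose s)" .
    have 2: "real (K choose Suc s) ^ 2 / real (P choose Suc s) \<le> real K ^ Suc s / fact (Suc s) * (real K / real P) ^ Suc s"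
    proof (cases "Suc s \<le> K")
      case True
      have "real (K choose Suc s) ^ 2 / real (P choose Suc s) =
          real (K choose Suc s) * (real (K choose Suc s) / real (P choose Suc s))"
        by (simp add: power2_eq_square)
      also have "\<dots> \<le> real K ^ Suc s / fact (Suc s) * (real K / real P) ^ Suc s"
        using True K_le_P P_pos
        by (intro mult_mono choose_le_power_div_fact choose_ratio_le) auto
      finally show ?thesis .
    qed (simp add: binomial_eq_0)
    have "(real s + 1) * (real (K choose Suc s) ^ 2 / real (P choose Suc s)) \<le>
        (real s + 1) * (real K ^ Suc s / fact (Suc s) * (real K / real P) ^ Suc s)"
      by (intro mult_left_mono 2) auto
    also have "\<dots> = w * x"
    proof -
      have "(real s + 1) * (u / fact (Suc s)) = u / fact s" for u :: real
      proof -
        have "real s + 1 \<noteq> 0" by linarith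
        hence "(real s + 1) * u / ((real s + 1) * fact s) = u / fact s"
          by (rule mult_divide_mult_cancel_left)
        thus ?thesis by (simp only: fact_Suc of_nat_Suc times_divide_eq_right add.commute)
      qed
      hence "(real s + 1) * (real K ^ Suc s / fact (Suc s) * (real K / real P) ^ Suc s) =
        real K ^ Suc s / fact s * (real K / real P) ^ Suc s"
        by (metis mult.assoc)
      also have "\<dots> = w * x"
        by (simp add: w_eq x_def power_divide power2_eq_square mult_ac)
      finally show ?thesis .
    qed
    finally have 3: "(real s + 1) * (real (K choose Suc s) ^ 2 / real (P choose Suc s)) \<le> w * x" .
    have "w_lower = w * (1 - 2 * \<delta>) - w * x"
      by (simp add: w_lower_def \<delta>_def algebra_simps)
    with 1 3 prob_kset_inter_ge_ge[OF K_le_P assms, of s] show ?thesis by linarith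
  next
    case False
    have "1 - 2 * real (s * (s - 1)) / real K - x \<le> 0"
    proof -
      have "2 * real (s * (s - 1)) / real K = 2 * \<delta>" by (simp only: \<delta>_def times_divide_eq_right)
      thus ?thesis using False x_pos by linarith
    qed
    hence "w_lower \<le> 0" using w_pos by (simp add: w_lower_def mult_nonneg_nonpos)
    thus ?thesis using measure_nonneg[of "measure_pmf (kset_pmf P K)"] order_trans by blast
  qed
qed

text \<open>For two vertices with \<open>u\<close> common items, \<open>l\<close> counts the common
  items that serve both adjacencies. Choosing them gives \<open>u choose l\<close>, completing both
  \<open>s\<close>-sets gives at most \<open>K ^ (2 * (s - l))\<close>, and the
  \<open>2 * s - l\<close> items cost \<open>K / P\<close> each; this is
  \<open>x ^ (2 * s - l) / K ^ l\<close>. The part \<open>l = 0\<close> is \<open>w ^ 2\<close>, as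
  under independence.\<close>

definition pair_bound :: "nat \<Rightarrow> real" where
  "pair_bound u = w\<^sup>2 + (\<Sum>l=1..s. real (u choose l) * x ^ (2 * s - l) / real K ^ l)"

text \<open>Union bound over all pairs of an \<open>s\<close>-subset \<open>X\<close> of
  \<open>S\<close> and an \<open>s\<close>-subset \<open>X'\<close> of \<open>S'\<close> that
  \<open>T\<close> might contain, grouped by the size \<open>l\<close> of
  \<open>X \<inter> X'\<close>, so that \<open>X \<union> X'\<close> has \<open>2 * s - l\<close>
  items.\<close>

lemma prob_adj_both_le:
  assumes S: "S \<in> ksubsets P K" "S' \<in> ksubsets P K"
  shows "measure_pmf.prob (kset_pmf P K) {T. s \<le> card (T \<inter> S) \<and> s \<le> card (T \<inter> S')} \<le> pair_bound (card (S \<inter> S'))"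
proof -
  note S1 = ksubsetsD[OF S(1)] and S2 = ksubsetsD[OF S(2)]
  define u where "u = card (S \<inter> S')"
  define r where "r = real K / real P"
  have r: "0 < r" "r \<le> 1" using K_pos P_pos K_le_P by (auto simp: r_def)
  define C where "C = (\<lambda>S l. {X. X \<subseteq> S \<and> card X = (l::nat)} :: nat set set)"
  define I where "I = C S s \<times> C S' s"
  define J where "J = (\<lambda>l. {(X, X') \<in> I. card (X \<inter> X') = l})"
  have finC: "finite (C A l)" if "finite A" for A l using that by (auto simp: C_def)
  have cardC: "card (C A l) = (card A choose l)" if "finite A" for A l
    using n_subsets[OF that] by (simp add: C_def)
  have finI: "finite I" using S1 S2 finC by (auto simp: I_def)
  have cardJ: "card (J l) \<le> (u choose l) * ((K choose (s - l)) * (K choose (s - l)))" for l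
  proof -
    \<comment> \<open>A pair is determined by its intersection and its two differences, which are
      counted separately.\<close>
    have "card (J l) \<le> card (C (S \<inter> S') l \<times> C S (s - l) \<times> C S' (s - l))"
    proof (rule card_inj_on_le)
      show "inj_on (\<lambda>(X, X'). (X \<inter> X', X - X', X' - X)) (J l)"
        by (rule inj_onI, clarsimp) blast
      show "(\<lambda>(X, X'). (X \<inter> X', X - X', X' - X)) ` J l \<subseteq> C (S \<inter> S') l \<times> C S (s - l) \<times> C S' (s - l)"
      proof safe
        fix X X' assume "(X, X') \<in> J l"
        hence X: "X \<subseteq> S" "card X = s" "X' \<subseteq> S'" "card X' = s" "card (X \<inter> X') = l"
          by (auto simp: J_def I_def C_def)
        have "finite X" "finite X'" using X S1 S2 finite_subset by blast+
        hence "card (X - X') = s - l" "card (X' - X) = s - l"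
          using X by (simp_all add: card_Diff_subset_Int Int_commute)
        thus "X \<inter> X' \<in> C (S \<inter> S') l" "X - X' \<in> C S (s - l)" "X' - X \<in> C S' (s - l)"
          using X by (auto simp: C_def)
      qed
      show "finite (C (S \<inter> S') l \<times> C S (s - l) \<times> C S' (s - l))"
        using S1 S2 finC by auto
    qed
    also have "\<dots> = (u choose l) * ((K choose (s - l)) * (K choose (s - l)))"
      using S1 S2 by (simp add: card_cartesian_product cardC u_def)
    finally show ?thesis .
  qed
  have "measure_pmf.prob (kset_pmf P K) {T. s \<le> card (T \<inter> S) \<and> s \<le> card (T \<inter> S')} \<le>
      (\<Sum>(X, X')\<in>I. measure_pmf.prob (kset_pmf P K) {T. X \<union> X' \<subseteq> T})"
    unfolding case_prod_unfold
  proof (rule prob_le_sum_prob[OF finI])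
    show "{T. s \<le> card (T \<inter> S) \<and> s \<le> card (T \<inter> S')} \<subseteq> (\<Union>z\<in>I. {T. fst z \<union> snd z \<subseteq> T})"
    proof
      fix T assume T: "T \<in> {T. s \<le> card (T \<inter> S) \<and> s \<le> card (T \<inter> S')}"
      then obtain X X' where X: "X \<subseteq> T \<inter> S" "card X = s" "X' \<subseteq> T \<inter> S'" "card X' = s"
        by (metis (mono_tags, lifting) mem_Collect_eq obtain_subset_with_card_n)
      hence "(X, X') \<in> I" by (auto simp: I_def C_def)
      thus "T \<in> (\<Union>z\<in>I. {T. fst z \<union> snd z \<subseteq> T})"
        using X by (intro UN_I[of "(X, X')"]) auto
    qed
  qed
  also have "\<dots> \<le> (\<Sum>(X, X')\<in>I. r ^ (2 * s - card (X \<inter> X')))"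
  proof (rule sum_mono, clarify)
    fix X X' assume "(X, X') \<in> I"
    hence X: "X \<subseteq> S" "card X = s" "X' \<subseteq> S'" "card X' = s" by (auto simp: I_def C_def)
    have "finite X" "finite X'" using X S1 S2 finite_subset by blast+
    hence "card (X \<union> X') = 2 * s - card (X \<inter> X')" using card_Un_Int[of X X'] X by simp
    moreover have "X \<union> X' \<subseteq> {..<P}" using X S1 S2 by blast
    ultimately show "measure_pmf.prob (kset_pmf P K) {T. X \<union> X' \<subseteq> T} \<le> r ^ (2 * s - card (X \<inter> X'))"
      using prob_kset_superset_le[OF K_le_P P_pos, of "X \<union> X'"] by (simp add: r_def)
  qed
  also have "\<dots> = (\<Sum>l\<in>{0..s}. \<Sum>(X, X')\<in>J l. r ^ (2 * s - card (X \<inter> X')))"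
  proof -
    have "card (X \<inter> X') \<le> s" if "(X, X') \<in> I" for X X'
    proof -
      have "finite X" "card X = s" using that S1 finite_subset[of X S] s_pos by (auto simp: I_def C_def)
      thus ?thesis using card_mono[of X "X \<inter> X'"] by auto
    qed
    thus ?thesis
      unfolding J_def case_prod_unfold
      by (subst sum.group[OF finI, symmetric, where T = "{0..s}" and g = "\<lambda>z. card (fst z \<inter> snd z)"]) auto
  qed
  also have "\<dots> = (\<Sum>l\<in>{0..s}. real (card (J l)) * r ^ (2 * s - l))"
    by (intro sum.cong refl) (auto simp: J_def case_prod_unfold)
  also have "\<dots> \<le> (\<Sum>l\<in>{0..s}. real ((u choose l) * ((K choose (s - l)) * (K choose (s - l)))) * r ^ (2 * s - l))"
    by (intro sum_mono mult_right_mono of_nat_mono cardJ) (use r in auto)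
  also have "\<dots> = (real (K choose s) * r ^ s) ^ 2 +
      (\<Sum>l=1..s. real (u choose l) * (real (K choose (s - l)))\<^sup>2 * r ^ (2 * s - l))"
  proof -
    have "r ^ (2 * s) = r ^ s * r ^ s" by (simp only: mult_2 power_add)
    thus ?thesis by (simp add: sum.atLeast_Suc_atMost power2_eq_square mult_ac)
  qed
  also have "\<dots> \<le> w\<^sup>2 + (\<Sum>l=1..s. real (u choose l) * x ^ (2 * s - l) / real K ^ l)"
  proof (intro add_mono sum_mono power_mono)
    show "real (K choose s) * r ^ s \<le> w" using choose_mult_ratio_le_w by (simp add: r_def)
    fix l assume l: "l \<in> {1..s}"
    have "(real (K choose (s - l)))\<^sup>2 * r ^ (2 * s - l) \<le> (real K ^ (s - l))\<^sup>2 * r ^ (2 * s - l)"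
      using r by (intro mult_right_mono power_mono choose_le_power) auto
    also have "\<dots> = x ^ (2 * s - l) / real K ^ l"
    proof -
      have "real K ^ (2 * (s - l)) * (real K ^ l * real K ^ (2 * s - l)) = real K ^ (2 * (2 * s - l))"
        unfolding power_add[symmetric] using l by (intro arg_cong[where f = "\<lambda>e. real K ^ e"]) auto
      thus ?thesis using K_pos P_pos
        by (simp add: x_def r_def power_divide field_simps flip: power_mult)
    qed
    finally have "(real (K choose (s - l)))\<^sup>2 * r ^ (2 * s - l) \<le> x ^ (2 * s - l) / real K ^ l" .
    from mult_left_mono[OF this, of "real (u choose l)"]
    show "real (u choose l) * (real (K choose (s - l)))\<^sup>2 * r ^ (2 * s - l) \<le> real (u choose l) * x ^ (2 * s - l) / real K ^ l"
      by (simp add: mult.assoc)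
  qed (use r in auto)
  finally show ?thesis by (simp add: pair_bound_def u_def)
qed

text \<open>Disjoint item sets make the chosen \<open>s\<close>-subsets disjoint. Their union has
  exactly \<open>s * card I\<close> items, so the union bound factorises as if the adjacencies were
  independent.\<close>

lemma prob_adj_all_le:
  assumes I: "finite I" and S: "\<And>i. i \<in> I \<Longrightarrow> S i \<in> ksubsets P K"
    and disj: "\<And>i j. i \<in> I \<Longrightarrow> j \<in> I \<Longrightarrow> i \<noteq> j \<Longrightarrow> S i \<inter> S j = {}"
  shows "measure_pmf.prob (kset_pmf P K) {T. \<forall>i\<in>I. s \<le> card (T \<inter> S i)} \<le> w ^ card I"
proof -
  define C where "C = (\<lambda>i. {X. X \<subseteq> S i \<and> card X = s})"
  have cardC: "card (C i) = (K choose s)" if "i \<in> I" for i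
    using n_subsets[OF ksubsetsD(3)[OF S[OF that]]] ksubsetsD(2)[OF S[OF that]] by (simp add: C_def)
  have finC: "finite (C i)" if "i \<in> I" for i
    using ksubsetsD(3)[OF S[OF that]] by (simp add: C_def)
  have "measure_pmf.prob (kset_pmf P K) {T. \<forall>i\<in>I. s \<le> card (T \<inter> S i)} \<le>
      (\<Sum>X\<in>PiE I C. measure_pmf.prob (kset_pmf P K) {T. (\<Union>i\<in>I. X i) \<subseteq> T})"
  proof (rule prob_le_sum_prob)
    show "finite (PiE I C)" using I finC by (intro finite_PiE) auto
    show "{T. \<forall>i\<in>I. s \<le> card (T \<inter> S i)} \<subseteq> (\<Union>X\<in>PiE I C. {T. (\<Union>i\<in>I. X i) \<subseteq> T})"
    proof
      fix T assume T: "T \<in> {T. \<forall>i\<in>I. s \<le> card (T \<inter> S i)}"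
      hence "\<forall>i\<in>I. \<exists>X. X \<subseteq> T \<inter> S i \<and> card X = s"
        by (metis (mono_tags, lifting) mem_Collect_eq obtain_subset_with_card_n)
      then obtain X where "\<forall>i\<in>I. X i \<subseteq> T \<inter> S i \<and> card (X i) = s" by metis
      hence "restrict X I \<in> PiE I C" "(\<Union>i\<in>I. restrict X I i) \<subseteq> T" by (auto simp: C_def)
      thus "T \<in> (\<Union>X\<in>PiE I C. {T. (\<Union>i\<in>I. X i) \<subseteq> T})" by blast
    qed
  qed
  also have "\<dots> \<le> (\<Sum>X\<in>PiE I C. (real K / real P) ^ (s * card I))"
  proof (rule sum_mono)
    fix X assume "X \<in> PiE I C"
    hence X: "\<And>i. i \<in> I \<Longrightarrow> X i \<subseteq> S i \<and> card (X i) = s" by (auto simp: C_def)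
    have "card (\<Union>i\<in>I. X i) = (\<Sum>i\<in>I. card (X i))"
    proof (rule card_UN_disjoint[OF I])
      show "\<forall>i\<in>I. finite (X i)" using X ksubsetsD(3)[OF S] finite_subset by blast
      show "\<forall>i\<in>I. \<forall>j\<in>I. i \<noteq> j \<longrightarrow> X i \<inter> X j = {}" using X disj by blast
    qed
    hence "card (\<Union>i\<in>I. X i) = s * card I" using X by simp
    moreover have "(\<Union>i\<in>I. X i) \<subseteq> {..<P}" using X ksubsetsD(1)[OF S] by blast
    ultimately show "measure_pmf.prob (kset_pmf P K) {T. (\<Union>i\<in>I. X i) \<subseteq> T} \<le> (real K / real P) ^ (s * card I)"
      using prob_kset_superset_le[OF K_le_P P_pos] by metis
  qed
  also have "\<dots> = (real (K choose s) * (real K / real P) ^ s) ^ card I"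
    using I cardC by (simp add: card_PiE power_mult_distrib power_mult)
  also have "\<dots> \<le> w ^ card I"
    by (intro power_mono choose_mult_ratio_le_w) auto
  finally show ?thesis .
qed

end

section \<open>Vertices of low degree\<close>

text \<open>Sums of this kind arise from the choice of a neighbourhood with fewer than
  \<open>k\<close> vertices, each neighbour carrying the weight \<open>y\<close>.\<close>

lemma sum_power_card_le:
  fixes y :: real
  assumes "finite A" "card A \<le> n" "0 \<le> y"
  shows "(\<Sum>X | X \<subseteq> A \<and> card X < k. y ^ card X) \<le> (\<Sum>d<k. (real n * y) ^ d / fact d)"
proof -
  have fin: "finite {X. X \<subseteq> A \<and> card X < k}" using assms(1) by simp
  have "(\<Sum>X | X \<subseteq> A \<and> card X < k. y ^ card X) =
      (\<Sum>d\<in>{..<k}. \<Sum>X | X \<in> {X. X \<subseteq> A \<and> card X < k} \<and> card X = d. y ^ card X)"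
    by (subst sum.group[OF fin, where T = "{..<k}" and g = card]) auto
  also have "\<dots> = (\<Sum>d<k. real (card A choose d) * y ^ d)"
  proof (intro sum.cong refl)
    fix d assume "d \<in> {..<k}"
    hence "{X. X \<in> {X. X \<subseteq> A \<and> card X < k} \<and> card X = d} = {X. X \<subseteq> A \<and> card X = d}" by auto
    thus "(\<Sum>X | X \<in> {X. X \<subseteq> A \<and> card X < k} \<and> card X = d. y ^ card X) = real (card A choose d) * y ^ d"
      using n_subsets[OF assms(1), of d] by simp
  qed
  also have "\<dots> \<le> (\<Sum>d<k. real n ^ d / fact d * y ^ d)"
  proof (intro sum_mono mult_right_mono)
    fix d
    have "real (card A choose d) \<le> real (n choose d)"
      by (intro of_nat_mono binomial_right_mono assms(2)) 
    also have "\<dots> \<le> real n ^ d / fact d" by (rule choose_le_power_div_fact)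
    finally show "real (card A choose d) \<le> real n ^ d / fact d" .
  qed (use assms in auto)
  also have "\<dots> = (\<Sum>d<k. (real n * y) ^ d / fact d)"
    by (simp add: power_mult_distrib)
  finally show ?thesis .
qed

text \<open>The sets are chosen one after another. Whenever one is chosen, fewer than
  \<open>r * card J\<close> elements of \<open>A\<close> plus its own \<open>r\<close> are excluded
  at most, so a uniform bound for every factor is enough.\<close>

lemma card_disjoint_families_ge:
  assumes "finite J" "finite A"
  shows "((card A - r * card J) choose r) ^ card J \<le>
    card {N \<in> PiE J (\<lambda>_. {X. X \<subseteq> A \<and> card X = r}). \<forall>i\<in>J. \<forall>j\<in>J. i \<noteq> j \<longrightarrow> N i \<inter> N j = {}}"
  using assms(1)
proof (induction J)
  case empty
  have "{N \<in> PiE {} (\<lambda>_. {X. X \<subseteq> A \<and> card X = r}). \<forall>i\<in>{}. \<forall>j\<in>{}. i \<noteq> j \<longrightarrow> N i \<inter> N j = {}} = {\<lambda>_. undefined}"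
    by auto
  thus ?case by simp
next
  case (insert b J)
  let ?F = "\<lambda>J. {N \<in> PiE J (\<lambda>_. {X. X \<subseteq> A \<and> card X = r}). \<forall>i\<in>J. \<forall>j\<in>J. i \<noteq> j \<longrightarrow> N i \<inter> N j = {}}"
  let ?C = "\<lambda>N. {X. X \<subseteq> A - (\<Union>i\<in>J. N i) \<and> card X = r}"
  let ?h = "\<lambda>(N, X). N(b := X)"
  have finF: "finite (?F J)" if "finite J" for J :: "'a set"
    by (rule finite_subset[OF _ finite_PiE[OF that, of "\<lambda>_. {X. X \<subseteq> A \<and> card X = r}"]]) (use assms(2) in auto)
  have cardC: "(card A - r * card (insert b J)) choose r \<le> card (?C N)" if N: "N \<in> ?F J" for N
  proof -
    have "card (\<Union>i\<in>J. N i) \<le> (\<Sum>i\<in>J. card (N i))" by (rule card_UN_le) (use insert.hyps in auto)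
    also have "\<dots> = r * card J" using N by (simp add: PiE_iff)
    finally have "card A - r * card (insert b J) \<le> card A - card (\<Union>i\<in>J. N i)"
      using insert.hyps by simp
    also have "\<dots> \<le> card (A - (\<Union>i\<in>J. N i))"
    proof (rule diff_card_le_card_Diff)
      have "(\<Union>i\<in>J. N i) \<subseteq> A" using N by (auto simp: PiE_iff)
      thus "finite (\<Union>i\<in>J. N i)" using assms(2) by (rule finite_subset)
    qed
    finally have "(card A - r * card (insert b J)) choose r \<le> card (A - (\<Union>i\<in>J. N i)) choose r"
      by (rule binomial_right_mono)
    also have "\<dots> = card (?C N)" using n_subsets[of "A - (\<Union>i\<in>J. N i)" r] assms(2) by simp
    finally show ?thesis .
  qed
  have "((card A - r * card (insert b J)) choose r) ^ card (insert b J) =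
      ((card A - r * card (insert b J)) choose r) ^ card J * ((card A - r * card (insert b J)) choose r)"
    using insert.hyps by simp
  also have "\<dots> \<le> ((card A - r * card J) choose r) ^ card J * ((card A - r * card (insert b J)) choose r)"
    using insert.hyps by (intro mult_right_mono power_mono binomial_right_mono) auto
  also have "\<dots> \<le> card (?F J) * ((card A - r * card (insert b J)) choose r)"
    by (intro mult_right_mono insert.IH) auto
  also have "\<dots> = (\<Sum>N\<in>?F J. (card A - r * card (insert b J)) choose r)" by simp
  also have "\<dots> \<le> (\<Sum>N\<in>?F J. card (?C N))" by (intro sum_mono cardC)
  also have "\<dots> = card (Sigma (?F J) ?C)"
    by (subst card_SigmaI) (use finF insert.hyps assms(2) in auto)
  also have "\<dots> \<le> card (?F (insert b J))"
  proof (rule card_inj_on_le[of ?h])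
    show "inj_on ?h (Sigma (?F J) ?C)"
    proof (rule inj_onI)
      fix z z' assume z: "z \<in> Sigma (?F J) ?C" "z' \<in> Sigma (?F J) ?C" and eq: "?h z = ?h z'"
      obtain N X N' X' where zz: "z = (N, X)" "z' = (N', X')" by (cases z, cases z')
      have N: "N \<in> PiE J (\<lambda>_. {X. X \<subseteq> A \<and> card X = r})" "N' \<in> PiE J (\<lambda>_. {X. X \<subseteq> A \<and> card X = r})"
        using z unfolding zz mem_Sigma_iff by simp_all
      have eq': "N(b := X) = N'(b := X')" using eq unfolding zz by simp
      have "N i = N' i" for i
      proof (cases "i \<in> J")
        case True
        hence "i \<noteq> b" using insert.hyps(2) by blast
        thus ?thesis using fun_cong[OF eq', of i] by simp
      next
        case False
        show ?thesis using PiE_arb[OF N(1) False] PiE_arb[OF N(2) False] by simp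
      qed
      moreover have "X = X'" using fun_cong[OF eq', of b] by simp
      ultimately show "z = z'" unfolding zz by auto
    qed
    show "?h ` Sigma (?F J) ?C \<subseteq> ?F (insert b J)"
    proof (rule image_subsetI)
      fix z assume z: "z \<in> Sigma (?F J) ?C"
      obtain N X where zz: "z = (N, X)" by (cases z)
      have N: "N \<in> PiE J (\<lambda>_. {X. X \<subseteq> A \<and> card X = r})" "\<forall>i\<in>J. \<forall>j\<in>J. i \<noteq> j \<longrightarrow> N i \<inter> N j = {}"
        and X: "X \<subseteq> A - (\<Union>i\<in>J. N i)" "card X = r"
        using z unfolding zz mem_Sigma_iff by simp_all
      have "(N(b := X)) i \<inter> (N(b := X)) j = {}" if "i \<in> insert b J" "j \<in> insert b J" "i \<noteq> j" for i j
        using that N(2) X(1) insert.hyps(2) by (cases "i = b"; cases "j = b") auto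
      moreover have "N(b := X) \<in> PiE (insert b J) (\<lambda>_. {Z. Z \<subseteq> A \<and> card Z = r})"
      proof (rule PiE_I)
        fix i assume "i \<in> insert b J"
        thus "(N(b := X)) i \<in> {Z. Z \<subseteq> A \<and> card Z = r}"
          using PiE_mem[OF N(1), of i] X by auto
      next
        fix i assume "i \<notin> insert b J"
        thus "(N(b := X)) i = undefined" using PiE_arb[OF N(1), of i] by simp
      qed
      ultimately show "?h z \<in> ?F (insert b J)" unfolding zz mem_Collect_eq prod.case by blast
    qed
    show "finite (?F (insert b J))" using finF[of "insert b J"] insert.hyps by simp
  qed
  finally show ?case .
qed

context intersection_params
begin

text \<open>The conditional probability, given the item sets of \<open>A\<close>, that a fresh
  independent vertex is adjacent to no vertex of \<open>A\<close>. It is a function of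
  \<open>f\<close> that reads only coordinates in \<open>A\<close>, hence may serve as a condition
  when other vertices are revealed.\<close>

definition nonadj_prob :: "nat set \<Rightarrow> (nat \<Rightarrow> nat set) \<Rightarrow> real" where
  "nonadj_prob A f = measure_pmf.prob (kset_pmf P K) {T. \<forall>i\<in>A. \<not> s \<le> card (T \<inter> f i)}"

lemma set_pmf_rand_sets: "set_pmf (rand_sets n K P) \<subseteq> {f. \<forall>i<n. f i \<in> ksubsets P K}"
  using set_Pi_pmf_subset'[of "{..<n}" "{}" "\<lambda>_. kset_pmf P K"] ksubsets_nonempty[OF K_le_P]
  by (auto simp: rand_sets_def PiE_dflt_def set_pmf_of_set)

text \<open>Only functions in the support count, so inclusions of events may be checked for genuine
  \<open>K\<close>-sets. Where a conditional bound needs this later, membership in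
  \<open>ksubsets\<close> is put into the event itself.\<close>

lemma prob_rand_sets_mono:
  assumes "\<And>f. (\<And>i. i < n \<Longrightarrow> f i \<in> ksubsets P K) \<Longrightarrow> f \<in> X \<Longrightarrow> f \<in> Y"
  shows "measure_pmf.prob (rand_sets n K P) X \<le> measure_pmf.prob (rand_sets n K P) Y"
proof -
  have "measure_pmf.prob (rand_sets n K P) X = measure_pmf.prob (rand_sets n K P) (X \<inter> set_pmf (rand_sets n K P))"
    by (simp add: measure_Int_set_pmf)
  also have "\<dots> \<le> measure_pmf.prob (rand_sets n K P) Y"
    by (rule measure_pmf.finite_measure_mono) (use set_pmf_rand_sets[of n] assms in auto)
  finally show ?thesis .
qed

lemma pair_bound_0: "pair_bound 0 = w\<^sup>2"
  by (simp add: pair_bound_def binomial_eq_0)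

lemma pair_bound_mono: "u \<le> v \<Longrightarrow> pair_bound u \<le> pair_bound v"
  unfolding pair_bound_def using x_pos K_pos
  by (intro add_left_mono sum_mono divide_right_mono mult_right_mono of_nat_mono binomial_right_mono) auto

lemma pair_bound_nonneg: "0 \<le> pair_bound u"
  unfolding pair_bound_def using x_pos by (intro add_nonneg_nonneg sum_nonneg) auto

lemma prob_overlap_pair_le:
  assumes "i < n" "j < n" "i \<noteq> j"
  shows "measure_pmf.prob (rand_sets n K P) {f. l \<le> card (f i \<inter> f j)} \<le> x ^ l"
proof -
  have "measure_pmf.prob (rand_sets n K P) {f. l \<le> card (f i \<inter> f j)} \<le>
      measure_pmf.prob (rand_sets n K P) {f. f i \<in> ksubsets P K \<and> f j \<in> {T. l \<le> card (T \<inter> f i)}}"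
    by (rule prob_rand_sets_mono) (use assms in \<open>auto simp: Int_commute\<close>)
  also have "\<dots> \<le> measure_pmf.prob (rand_sets n K P) {f. f i \<in> ksubsets P K} * x ^ l"
    unfolding rand_sets_def
    by (rule prob_Pi_pmf_coordinate_le) (use assms prob_overlap_le x_pos in auto)
  also have "\<dots> \<le> x ^ l" using x_pos by (simp add: mult_left_le_one_le)
  finally show ?thesis .
qed

lemma prob_some_overlap_le:
  assumes "J \<subseteq> {..<n}"
  shows "measure_pmf.prob (rand_sets n K P) {f. \<exists>i\<in>J. \<exists>j\<in>J. i \<noteq> j \<and> l \<le> card (f i \<inter> f j)} \<le> (real (card J))\<^sup>2 * x ^ l"
proof -
  have J: "finite J" using assms finite_subset by blast
  define I where "I = {(i, j). i \<in> J \<and> j \<in> J \<and> i \<noteq> j}"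
  have I: "I \<subseteq> J \<times> J" by (auto simp: I_def)
  have finI: "finite I" using I J finite_subset by blast
  have "card I \<le> card (J \<times> J)" using I J by (intro card_mono) auto
  hence cardI: "real (card I) \<le> (real (card J))\<^sup>2"
    by (simp add: card_cartesian_product power2_eq_square flip: of_nat_mult)
  have "measure_pmf.prob (rand_sets n K P) {f. \<exists>i\<in>J. \<exists>j\<in>J. i \<noteq> j \<and> l \<le> card (f i \<inter> f j)} \<le>
      (\<Sum>z\<in>I. measure_pmf.prob (rand_sets n K P) {f. l \<le> card (f (fst z) \<inter> f (snd z))})"
    by (rule prob_le_sum_prob[OF finI]) (auto simp: I_def)
  also have "\<dots> \<le> (\<Sum>z\<in>I. x ^ l)"
    by (intro sum_mono prob_overlap_pair_le) (use assms in \<open>auto simp: I_def\<close>)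
  also have "\<dots> = real (card I) * x ^ l" by simp
  also have "\<dots> \<le> (real (card J))\<^sup>2 * x ^ l" using x_pos by (intro mult_right_mono cardI) auto
  finally show ?thesis .
qed

lemma nonadj_prob_ge:
  assumes "finite J" "\<And>i. i \<in> J \<Longrightarrow> f i \<in> ksubsets P K"
  shows "1 - real (card J) * w \<le> nonadj_prob J f"
proof -
  let ?p = "measure_pmf.prob (kset_pmf P K)"
  have "?p (- {T. \<forall>i\<in>J. \<not> s \<le> card (T \<inter> f i)}) \<le> (\<Sum>i\<in>J. ?p {T. s \<le> card (T \<inter> f i)})"
    by (rule prob_le_sum_prob) (use assms in auto)
  also have "\<dots> \<le> (\<Sum>i\<in>J. w)" by (intro sum_mono prob_adj_le assms)
  finally show ?thesis
    using measure_pmf.prob_compl[of "{T. \<forall>i\<in>J. \<not> s \<le> card (T \<inter> f i)}" "kset_pmf P K"]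
    by (simp add: nonadj_prob_def Compl_eq_Diff_UNIV)
qed

text \<open>Bonferroni with two terms: single adjacencies are bounded below by
  \<open>w_lower\<close>, joint ones above by \<open>pair_bound\<close>, which is monotone in the
  overlap.\<close>

lemma nonadj_prob_le:
  assumes "finite J" "\<And>i. i \<in> J \<Longrightarrow> f i \<in> ksubsets P K"
    and "\<And>i j. i \<in> J \<Longrightarrow> j \<in> J \<Longrightarrow> i \<noteq> j \<Longrightarrow> card (f i \<inter> f j) \<le> u"
  shows "nonadj_prob J f \<le> 1 - real (card J) * w_lower + (real (card J))\<^sup>2 * pair_bound u"
proof -
  let ?F = "\<lambda>i. {T. s \<le> card (T \<inter> f i)}"
  let ?p = "measure_pmf.prob (kset_pmf P K)"
  let ?S = "\<lambda>i. \<Sum>I | I \<subseteq> J \<and> card I = i. ?p (\<Inter>v\<in>I. ?F v)"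
  have S0: "?S 0 = 1"
  proof -
    have "{I. I \<subseteq> J \<and> card I = 0} = {{}}" using finite_subset[OF _ assms(1)] by auto
    thus ?thesis by simp
  qed
  have S1: "?S 1 \<ge> real (card J) * w_lower"
  proof -
    have "{I. I \<subseteq> J \<and> card I = 1} = (\<lambda>i. {i}) ` J" by (auto simp: card_1_singleton_iff)
    hence "?S 1 = (\<Sum>i\<in>J. ?p (?F i))" by (simp add: sum.reindex)
    also have "\<dots> \<ge> (\<Sum>i\<in>J. w_lower)" by (intro sum_mono prob_adj_ge assms)
    finally show ?thesis by simp
  qed
  have S2: "?S 2 \<le> (real (card J))\<^sup>2 * pair_bound u"
  proof -
    have "?S 2 \<le> (\<Sum>I | I \<subseteq> J \<and> card I = 2. pair_bound u)"
    proof (rule sum_mono, clarify)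
      fix I assume I: "I \<subseteq> J" "card I = 2"
      then obtain i j where ij: "I = {i, j}" "i \<noteq> j" by (auto simp: card_2_iff)
      have "?p (\<Inter>v\<in>I. ?F v) = ?p {T. s \<le> card (T \<inter> f i) \<and> s \<le> card (T \<inter> f j)}"
        by (rule arg_cong[where f = ?p]) (auto simp: ij)
      also have "\<dots> \<le> pair_bound (card (f i \<inter> f j))"
        by (rule prob_adj_both_le) (use ij I assms in auto)
      also have "\<dots> \<le> pair_bound u" by (intro pair_bound_mono assms) (use ij I in auto)
      finally show "?p (\<Inter>v\<in>I. ?F v) \<le> pair_bound u" .
    qed
    also have "\<dots> = real (card J choose 2) * pair_bound u" using n_subsets[OF assms(1), of 2] by simp
    also have "\<dots> \<le> (real (card J))\<^sup>2 * pair_bound u"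
      by (intro mult_right_mono choose_le_power pair_bound_nonneg)
    finally show ?thesis .
  qed
  have "nonadj_prob J f = ?p {T. \<forall>i\<in>J. T \<notin> ?F i}" by (simp add: nonadj_prob_def)
  also have "\<dots> \<le> (\<Sum>i\<le>2 * 1. (-1) ^ i * ?S i)" by (rule bonferroni(2)[OF assms(1)])
  also have "\<dots> = ?S 0 - ?S 1 + ?S 2" by (simp add: numeral_2_eq_2)
  finally show ?thesis using S0 S1 S2 by linarith
qed


section \<open>Joint low-degree probability of a fixed set of vertices\<close>

definition low_degree :: "nat \<Rightarrow> nat \<Rightarrow> nat \<Rightarrow> (nat \<Rightarrow> nat set) set" where
  "low_degree n k i = {f. card {u \<in> {..<n}. sadj s f i u} < k}"

text \<open>Union bound over the neighbourhoods \<open>N i\<close> in \<open>Out\<close> of the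
  vertices of \<open>J\<close>, each with fewer than \<open>k\<close> vertices. Given disjoint item
  sets in \<open>J\<close>, the outside vertices are independent, and the sum over all
  \<open>N\<close> factorises over \<open>J\<close>.\<close>

lemma prob_low_degree_disjoint_le:
  assumes J: "J \<subseteq> {..<n}"
    and q: "0 < q" "q \<le> 1" "1 - real (card J) * w_lower + (real (card J))\<^sup>2 * w\<^sup>2 \<le> q"
  shows "measure_pmf.prob (rand_sets n K P)
      {f. (\<forall>i\<in>J. f i \<in> ksubsets P K) \<and> (\<forall>i\<in>J. \<forall>j\<in>J. i \<noteq> j \<longrightarrow> f i \<inter> f j = {}) \<and> (\<forall>i\<in>J. f \<in> low_degree n k i)}
    \<le> q ^ (n - card J) * (\<Sum>d<k. (real n * (w / q)) ^ d / fact d) ^ card J" (is "?lhs \<le> _")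
proof -
  have finJ: "finite J" using J finite_subset by blast
  define R where "R = rand_sets n K P"
  define Out where "Out = {..<n} - J"
  have Out: "finite Out" "card Out = n - card J" "card Out \<le> n"
    using J finJ by (auto simp: Out_def card_Diff_subset)
  define y where "y = w / q"
  have y: "0 < y" using w_pos q by (simp add: y_def)
  define G where "G = (\<lambda>f :: nat \<Rightarrow> nat set. (\<forall>i\<in>J. f i \<in> ksubsets P K) \<and> (\<forall>i\<in>J. \<forall>j\<in>J. i \<noteq> j \<longrightarrow> f i \<inter> f j = {}))"
  define H where "H = (\<lambda>(N :: nat \<Rightarrow> nat set) (v :: nat) (f :: nat \<Rightarrow> nat set). {T :: nat set. \<forall>i\<in>J. s \<le> card (T \<inter> f i) \<longleftrightarrow> v \<in> N i})"
  \<comment> \<open>A vertex adjacent to the nonempty set \<open>I\<close> has probability at most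
    \<open>w ^ card I = q ^ card I * y ^ card I\<close>, and \<open>q <= 1\<close> allows a single
    factor \<open>q\<close> to be kept. With the same prefactor \<open>q\<close> for every vertex,
    the product splits into \<open>q ^ card Out\<close> and one factor per element of
    \<open>J\<close>.\<close>
  define c where "c = (\<lambda>(N :: nat \<Rightarrow> nat set) (v :: nat). q * (\<Prod>i\<in>J. if v \<in> N i then y else 1))"
  define NN where "NN = PiE J (\<lambda>_. {X. X \<subseteq> Out \<and> card X < k})"
  have finNN: "finite NN" unfolding NN_def using finJ Out by (intro finite_PiE) auto
  have cN: "measure_pmf.prob R {f. G f \<and> (\<forall>v\<in>Out. f v \<in> H N v f)} \<le> (\<Prod>v\<in>Out. c N v)" for N
  proof -
    have "measure_pmf.prob R {f. G f \<and> (\<forall>v\<in>Out. f v \<in> H N v f)} \<le> measure_pmf.prob R {f. G f} * (\<Prod>v\<in>Out. c N v)"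
      unfolding R_def rand_sets_def
    proof (rule prob_Pi_pmf_coordinates_le)
      fix f :: "nat \<Rightarrow> nat set" and v u y assume "v \<in> Out"
      hence ne: "i \<in> J \<Longrightarrow> (f(v := y)) i = f i" for i by (auto simp: Out_def)
      show "G (f(v := y)) = G f" unfolding G_def by (simp only: ne cong: ball_cong)
      show "H N u (f(v := y)) = H N u f" unfolding H_def by (simp only: ne cong: ball_cong)
    next
      fix f v assume f: "G f" and "v \<in> Out"
      define I where "I = {i\<in>J. v \<in> N i}"
      have "(\<Prod>i\<in>J. if v \<in> N i then y else 1) = y ^ card I"
        using finJ by (simp add: I_def prod.If_cases Int_def)
      hence c: "c N v = q * y ^ card I" by (simp add: c_def)
      show "measure_pmf.prob (kset_pmf P K) (H N v f) \<le> c N v"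
      proof (cases "I = {}")
        case True
        have "measure_pmf.prob (kset_pmf P K) (H N v f) \<le> nonadj_prob J f"
          unfolding nonadj_prob_def H_def
          by (rule measure_pmf.finite_measure_mono) (use True in \<open>auto simp: I_def\<close>)
        also have "\<dots> \<le> 1 - real (card J) * w_lower + (real (card J))\<^sup>2 * pair_bound 0"
          by (rule nonadj_prob_le) (use finJ f in \<open>auto simp: G_def\<close>)
        also have "\<dots> \<le> q" using q by (simp add: pair_bound_0)
        finally show ?thesis using True by (simp add: c)
      next
        case False
        have "measure_pmf.prob (kset_pmf P K) (H N v f) \<le> measure_pmf.prob (kset_pmf P K) {T. \<forall>i\<in>I. s \<le> card (T \<inter> f i)}"
          by (rule measure_pmf.finite_measure_mono) (auto simp: I_def H_def)
        also have "\<dots> \<le> w ^ card I"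
          by (rule prob_adj_all_le) (use finJ f in \<open>auto simp: I_def G_def\<close>)
        also have "\<dots> = q ^ card I * y ^ card I"
          using q by (simp add: y_def flip: power_mult_distrib)
        also have "\<dots> \<le> q ^ 1 * y ^ card I"
        proof (intro mult_right_mono power_decreasing)
          show "1 \<le> card I" using False finJ by (simp add: I_def card_gt_0_iff Suc_le_eq)
        qed (use q y in auto)
        finally show ?thesis by (simp add: c)
      qed
    next
      fix v show "0 \<le> c N v" unfolding c_def using q y by (intro mult_nonneg_nonneg prod_nonneg) auto
    qed (auto simp: Out_def)
    also have "\<dots> \<le> 1 * (\<Prod>v\<in>Out. c N v)"
      by (intro mult_right_mono prod_nonneg)
         (use q y in \<open>auto simp: c_def intro!: mult_nonneg_nonneg prod_nonneg\<close>)
    finally show ?thesis by simp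
  qed
  have prodc: "(\<Prod>v\<in>Out. c N v) = q ^ card Out * (\<Prod>i\<in>J. y ^ card (N i))" if "N \<in> NN" for N
  proof -
    have "(\<Prod>v\<in>Out. \<Prod>i\<in>J. if v \<in> N i then y else 1) = (\<Prod>i\<in>J. \<Prod>v\<in>Out. if v \<in> N i then y else 1)"
      by (rule prod.swap)
    also have "\<dots> = (\<Prod>i\<in>J. y ^ card (N i))"
    proof (rule prod.cong[OF refl])
      fix i assume "i \<in> J"
      hence "Out \<inter> {v. v \<in> N i} = N i" using that by (auto simp: NN_def)
      thus "(\<Prod>v\<in>Out. if v \<in> N i then y else 1) = y ^ card (N i)"
        using Out by (simp add: prod.If_cases)
    qed
    finally show ?thesis by (simp add: c_def prod.distrib)
  qed
  have "?lhs \<le> (\<Sum>N\<in>NN. measure_pmf.prob R {f. G f \<and> (\<forall>v\<in>Out. f v \<in> H N v f)})"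
    unfolding R_def
  proof (rule prob_le_sum_prob[OF finNN], rule subsetI, rule UN_I)
    fix f assume "f \<in> {f. (\<forall>i\<in>J. f i \<in> ksubsets P K) \<and> (\<forall>i\<in>J. \<forall>j\<in>J. i \<noteq> j \<longrightarrow> f i \<inter> f j = {}) \<and> (\<forall>i\<in>J. f \<in> low_degree n k i)}"
    hence f: "G f" "\<forall>i\<in>J. f \<in> low_degree n k i" by (auto simp: G_def)
    define N where "N = restrict (\<lambda>i. {v\<in>Out. s \<le> card (f v \<inter> f i)}) J"
    have "card {v\<in>Out. s \<le> card (f v \<inter> f i)} < k" if "i \<in> J" for i
    proof -
      have "card {v\<in>Out. s \<le> card (f v \<inter> f i)} \<le> card {u\<in>{..<n}. sadj s f i u}"
        by (rule card_mono) (use that in \<open>auto simp: Out_def sadj_def Int_commute\<close>)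
      thus ?thesis using f(2) that by (auto simp: low_degree_def)
    qed
    thus "N \<in> NN" by (auto simp: NN_def N_def)
    show "f \<in> {f. G f \<and> (\<forall>v\<in>Out. f v \<in> H N v f)}" using f by (auto simp: H_def N_def)
  qed
  also have "\<dots> \<le> (\<Sum>N\<in>NN. \<Prod>v\<in>Out. c N v)" by (intro sum_mono cN)
  also have "\<dots> = (\<Sum>N\<in>NN. q ^ card Out * (\<Prod>i\<in>J. y ^ card (N i)))" by (simp add: prodc)
  also have "\<dots> = q ^ card Out * (\<Sum>N\<in>NN. \<Prod>i\<in>J. y ^ card (N i))" by (simp add: sum_distrib_left)
  also have "(\<Sum>N\<in>NN. \<Prod>i\<in>J. y ^ card (N i)) = (\<Prod>i\<in>J. \<Sum>X | X \<subseteq> Out \<and> card X < k. y ^ card X)"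
    unfolding NN_def by (rule prod_sum_PiE[symmetric]) (use finJ Out in auto)
  also have "q ^ card Out * \<dots> \<le> q ^ card Out * (\<Prod>i\<in>J. \<Sum>d<k. (real n * y) ^ d / fact d)"
    by (intro mult_left_mono prod_mono conjI sum_power_card_le sum_nonneg) (use Out q y in auto)
  finally show ?thesis by (simp add: y_def Out)
qed

text \<open>With overlapping sets the adjacencies to different vertices of \<open>J\<close> are no
  longer nearly independent, so only the union \<open>N\<close> of the neighbourhoods is recorded.
  The bound is coarser than in the disjoint case but carries the factor
  \<open>(card J)^2 * x\<close> for the existence of an overlap.\<close>

lemma prob_low_degree_overlap_le:
  assumes J: "J \<subseteq> {..<n}" "J \<noteq> {}" and k: "1 \<le> k"
    and q: "0 < q" "q \<le> 1" "1 - real (card J) * w_lower + (real (card J))\<^sup>2 * pair_bound t \<le> q"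
  shows "measure_pmf.prob (rand_sets n K P)
      {f. (\<forall>i\<in>J. f i \<in> ksubsets P K) \<and> (\<exists>i\<in>J. \<exists>j\<in>J. i \<noteq> j \<and> 1 \<le> card (f i \<inter> f j)) \<and>
          (\<forall>i\<in>J. \<forall>j\<in>J. i \<noteq> j \<longrightarrow> card (f i \<inter> f j) \<le> t) \<and> (\<forall>i\<in>J. f \<in> low_degree n k i)}
    \<le> (real (card J))\<^sup>2 * x * (q ^ (n - card J) * (\<Sum>d<card J * k. (real n * (real (card J) * w / q)) ^ d / fact d))"
    (is "?lhs \<le> _")
proof -
  have finJ: "finite J" using J finite_subset by blast
  define R where "R = rand_sets n K P"
  define Out where "Out = {..<n} - J"
  have Out: "finite Out" "card Out = n - card J" "card Out \<le> n"
    using J finJ by (auto simp: Out_def card_Diff_subset)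
  define y where "y = real (card J) * w / q"
  have y: "0 \<le> y" using w_pos q by (simp add: y_def)
  define G where "G = (\<lambda>f :: nat \<Rightarrow> nat set. (\<forall>i\<in>J. f i \<in> ksubsets P K) \<and> (\<exists>i\<in>J. \<exists>j\<in>J. i \<noteq> j \<and> 1 \<le> card (f i \<inter> f j)) \<and>
          (\<forall>i\<in>J. \<forall>j\<in>J. i \<noteq> j \<longrightarrow> card (f i \<inter> f j) \<le> t))"
  define H where "H = (\<lambda>(N :: nat set) (v :: nat) (f :: nat \<Rightarrow> nat set). {T :: nat set. (\<exists>i\<in>J. s \<le> card (T \<inter> f i)) \<longleftrightarrow> v \<in> N})"
  define c where "c = (\<lambda>(N :: nat set) (v :: nat). q * (if v \<in> N then y else 1))"
  define NN where "NN = {X. X \<subseteq> Out \<and> card X < card J * k}"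
  have finNN: "finite NN" unfolding NN_def using Out by auto
  have G_le: "measure_pmf.prob R {f. G f} \<le> (real (card J))\<^sup>2 * x"
  proof -
    have "measure_pmf.prob R {f. G f} \<le> measure_pmf.prob R {f. \<exists>i\<in>J. \<exists>j\<in>J. i \<noteq> j \<and> 1 \<le> card (f i \<inter> f j)}"
      by (rule measure_pmf.finite_measure_mono) (auto simp: G_def)
    with prob_some_overlap_le[OF J(1), of 1] show ?thesis by (simp add: R_def)
  qed
  have cN: "measure_pmf.prob R {f. G f \<and> (\<forall>v\<in>Out. f v \<in> H N v f)} \<le> (real (card J))\<^sup>2 * x * (\<Prod>v\<in>Out. c N v)" for N
  proof -
    have "measure_pmf.prob R {f. G f \<and> (\<forall>v\<in>Out. f v \<in> H N v f)} \<le> measure_pmf.prob R {f. G f} * (\<Prod>v\<in>Out. c N v)"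
      unfolding R_def rand_sets_def
    proof (rule prob_Pi_pmf_coordinates_le)
      fix f :: "nat \<Rightarrow> nat set" and v u y assume "v \<in> Out"
      hence ne: "i \<in> J \<Longrightarrow> (f(v := y)) i = f i" for i by (auto simp: Out_def)
      show "G (f(v := y)) = G f" unfolding G_def by (simp only: ne cong: ball_cong bex_cong)
      show "H N u (f(v := y)) = H N u f" unfolding H_def by (simp only: ne cong: ball_cong bex_cong)
    next
      fix f v assume f: "G f" and "v \<in> Out"
      show "measure_pmf.prob (kset_pmf P K) (H N v f) \<le> c N v"
      proof (cases "v \<in> N")
        case False
        have "measure_pmf.prob (kset_pmf P K) (H N v f) \<le> nonadj_prob J f"
          unfolding nonadj_prob_def H_def
          by (rule measure_pmf.finite_measure_mono) (use False in auto)
        also have "\<dots> \<le> 1 - real (card J) * w_lower + (real (card J))\<^sup>2 * pair_bound t"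
          by (rule nonadj_prob_le) (use finJ f in \<open>auto simp: G_def\<close>)
        also have "\<dots> \<le> q" using q by simp
        finally show ?thesis using False by (simp add: c_def)
      next
        case True
        have "measure_pmf.prob (kset_pmf P K) (H N v f) \<le> (\<Sum>i\<in>J. measure_pmf.prob (kset_pmf P K) {T. s \<le> card (T \<inter> f i)})"
          by (rule prob_le_sum_prob) (use finJ True in \<open>auto simp: H_def\<close>)
        also have "\<dots> \<le> (\<Sum>i\<in>J. w)" by (intro sum_mono prob_adj_le) (use f in \<open>auto simp: G_def\<close>)
        finally show ?thesis using True q by (simp add: c_def y_def)
      qed
    next
      fix v show "0 \<le> c N v" unfolding c_def using q y by (intro mult_nonneg_nonneg) auto
    qed (auto simp: Out_def)
    also have "\<dots> \<le> (real (card J))\<^sup>2 * x * (\<Prod>v\<in>Out. c N v)"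
      by (intro mult_right_mono prod_nonneg G_le)
         (use q y in \<open>auto simp: c_def intro!: mult_nonneg_nonneg\<close>)
    finally show ?thesis by simp
  qed
  have prodc: "(\<Prod>v\<in>Out. c N v) = q ^ card Out * y ^ card N" if "N \<in> NN" for N
  proof -
    have "Out \<inter> {v. v \<in> N} = N" using that by (auto simp: NN_def)
    thus ?thesis using Out by (simp add: c_def prod.distrib prod.If_cases)
  qed
  have "?lhs \<le> (\<Sum>N\<in>NN. measure_pmf.prob R {f. G f \<and> (\<forall>v\<in>Out. f v \<in> H N v f)})"
    unfolding R_def
  proof (rule prob_le_sum_prob[OF finNN], rule subsetI, rule UN_I)
    fix f assume "f \<in> {f. (\<forall>i\<in>J. f i \<in> ksubsets P K) \<and> (\<exists>i\<in>J. \<exists>j\<in>J. i \<noteq> j \<and> 1 \<le> card (f i \<inter> f j)) \<and>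
          (\<forall>i\<in>J. \<forall>j\<in>J. i \<noteq> j \<longrightarrow> card (f i \<inter> f j) \<le> t) \<and> (\<forall>i\<in>J. f \<in> low_degree n k i)}"
    hence f: "G f" "\<forall>i\<in>J. f \<in> low_degree n k i" by (auto simp: G_def)
    define N where "N = {v\<in>Out. \<exists>i\<in>J. s \<le> card (f v \<inter> f i)}"
    have "N \<subseteq> (\<Union>i\<in>J. {u\<in>{..<n}. sadj s f i u})"
      by (auto simp: N_def Out_def sadj_def Int_commute)
    hence "card N \<le> card (\<Union>i\<in>J. {u\<in>{..<n}. sadj s f i u})"
      by (rule card_mono[rotated]) (use finJ in auto)
    also have "\<dots> \<le> (\<Sum>i\<in>J. card {u\<in>{..<n}. sadj s f i u})" by (rule card_UN_le[OF finJ])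
    also have "\<dots> \<le> (\<Sum>i\<in>J. k - 1)"
      by (intro sum_mono) (use f in \<open>fastforce simp: low_degree_def\<close>)
    \<comment> \<open>Strict because \<open>J\<close> is nonempty and \<open>k\<close> is
      positive.\<close>
    also have "\<dots> < card J * k" using k J finJ by (simp add: card_gt_0_iff)
    finally show "N \<in> NN" by (auto simp: NN_def N_def)
    show "f \<in> {f. G f \<and> (\<forall>v\<in>Out. f v \<in> H N v f)}" using f by (auto simp: H_def N_def)
  qed
  also have "\<dots> \<le> (\<Sum>N\<in>NN. (real (card J))\<^sup>2 * x * (\<Prod>v\<in>Out. c N v))" by (intro sum_mono cN)
  also have "\<dots> = (\<Sum>N\<in>NN. (real (card J))\<^sup>2 * x * (q ^ card Out * y ^ card N))" by (simp add: prodc)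
  also have "\<dots> = (real (card J))\<^sup>2 * x * (q ^ card Out * (\<Sum>N\<in>NN. y ^ card N))"
    by (simp add: sum_distrib_left)
  also have "\<dots> \<le> (real (card J))\<^sup>2 * x * (q ^ card Out * (\<Sum>d<card J * k. (real n * y) ^ d / fact d))"
    unfolding NN_def by (intro mult_left_mono sum_power_card_le mult_nonneg_nonneg) (use Out q y x_pos in auto)
  finally show ?thesis by (simp add: y_def Out)
qed

text \<open>Three cases for the item sets of \<open>J\<close>: pairwise disjoint, some overlap but
  none above \<open>t\<close>, or an overlap above \<open>t\<close>. A constant \<open>t\<close>
  will make the last case negligible by itself.\<close>

lemma prob_low_degree_le:
  assumes J: "J \<subseteq> {..<n}" "J \<noteq> {}" and k: "1 \<le> k"
    and q: "0 < q" "q \<le> 1" "1 - real (card J) * w_lower + (real (card J))\<^sup>2 * w\<^sup>2 \<le> q"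
    and q': "0 < q'" "q' \<le> 1" "1 - real (card J) * w_lower + (real (card J))\<^sup>2 * pair_bound t \<le> q'"
  shows "measure_pmf.prob (rand_sets n K P) (\<Inter>i\<in>J. low_degree n k i)
    \<le> q ^ (n - card J) * (\<Sum>d<k. (real n * (w / q)) ^ d / fact d) ^ card J
      + (real (card J))\<^sup>2 * x * (q' ^ (n - card J) * (\<Sum>d<card J * k. (real n * (real (card J) * w / q')) ^ d / fact d))
      + (real (card J))\<^sup>2 * x ^ Suc t"
proof -
  let ?p = "measure_pmf.prob (rand_sets n K P)"
  let ?V = "\<lambda>f. \<forall>i\<in>J. f i \<in> ksubsets P K"
  let ?L = "\<lambda>f. \<forall>i\<in>J. f \<in> low_degree n k i"
  let ?A = "{f. ?V f \<and> (\<forall>i\<in>J. \<forall>j\<in>J. i \<noteq> j \<longrightarrow> f i \<inter> f j = {}) \<and> ?L f}"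
  let ?B = "{f. ?V f \<and> (\<exists>i\<in>J. \<exists>j\<in>J. i \<noteq> j \<and> 1 \<le> card (f i \<inter> f j)) \<and>
          (\<forall>i\<in>J. \<forall>j\<in>J. i \<noteq> j \<longrightarrow> card (f i \<inter> f j) \<le> t) \<and> ?L f}"
  let ?C = "{f. \<exists>i\<in>J. \<exists>j\<in>J. i \<noteq> j \<and> Suc t \<le> card (f i \<inter> f j)}"
  have "?p (\<Inter>i\<in>J. low_degree n k i) \<le> ?p (?A \<union> ?B \<union> ?C)"
  proof (rule prob_rand_sets_mono)
    fix f assume f: "\<And>i. i < n \<Longrightarrow> f i \<in> ksubsets P K" "f \<in> (\<Inter>i\<in>J. low_degree n k i)"
    have V: "?V f" using f J by auto
    have fin: "finite (f i \<inter> f j)" if "i \<in> J" for i j using V that ksubsetsD(3) by auto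
    show "f \<in> ?A \<union> ?B \<union> ?C"
    proof (cases "f \<in> ?C")
      case False
      hence le: "\<forall>i\<in>J. \<forall>j\<in>J. i \<noteq> j \<longrightarrow> card (f i \<inter> f j) \<le> t" by (auto simp: not_less_eq_eq)
      show ?thesis
      proof (cases "\<exists>i\<in>J. \<exists>j\<in>J. i \<noteq> j \<and> 1 \<le> card (f i \<inter> f j)")
        case True thus ?thesis using V f le by auto
      next
        case False
        hence "\<forall>i\<in>J. \<forall>j\<in>J. i \<noteq> j \<longrightarrow> card (f i \<inter> f j) = 0" by (auto simp: not_less_eq_eq)
        hence "\<forall>i\<in>J. \<forall>j\<in>J. i \<noteq> j \<longrightarrow> f i \<inter> f j = {}" using fin by simp
        thus ?thesis using V f by auto
      qed
    qed auto
  qed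
  also have "\<dots> \<le> ?p (?A \<union> ?B) + ?p ?C" by (rule measure_Un_le) auto
  also have "?p (?A \<union> ?B) \<le> ?p ?A + ?p ?B" by (rule measure_Un_le) auto
  finally show ?thesis
    using prob_low_degree_disjoint_le[OF J(1) q, of k] prob_low_degree_overlap_le[OF J k q']
      prob_some_overlap_le[OF J(1), of "Suc t"] by linarith
qed

text \<open>Only convenient configurations are counted: the item sets of \<open>J\<close> are
  disjoint, and their neighbourhoods are disjoint sets of exactly \<open>k - 1\<close> outside
  vertices. Different families \<open>N\<close> give disjoint events, so their probabilities add
  up.\<close>

lemma prob_low_degree_ge:
  assumes J: "J \<subseteq> {..<n}" and k: "1 \<le> k"
    and r: "0 \<le> r" "r \<le> w_lower - real (card J) * w\<^sup>2" and q: "0 \<le> 1 - real (card J) * w"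
    and n: "card J * k \<le> n"
  shows "(1 - (real (card J))\<^sup>2 * x) * (real ((n - card J * k) choose (k - 1)) ^ card J *
      (r ^ (card J * (k - 1)) * (1 - real (card J) * w) ^ (n - card J * k)))
     \<le> measure_pmf.prob (rand_sets n K P) (\<Inter>i\<in>J. low_degree n k i)"
proof -
  define j where "j = card J"
  have finJ: "finite J" using J finite_subset by blast
  define R where "R = rand_sets n K P"
  define Out where "Out = {..<n} - J"
  have Out: "finite Out" "card Out = n - j"
    using J finJ by (auto simp: Out_def card_Diff_subset j_def)
  define ql where "ql = 1 - real j * w"
  have ql: "0 \<le> ql" using q by (simp add: ql_def j_def)
  define G where "G = (\<lambda>f :: nat \<Rightarrow> nat set. (\<forall>i\<in>J. f i \<in> ksubsets P K) \<and> (\<forall>i\<in>J. \<forall>j\<in>J. i \<noteq> j \<longrightarrow> f i \<inter> f j = {}))"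
  define H where "H = (\<lambda>(N :: nat \<Rightarrow> nat set) (v :: nat) (f :: nat \<Rightarrow> nat set). {T :: nat set. \<forall>i\<in>J. s \<le> card (T \<inter> f i) \<longleftrightarrow> v \<in> N i})"
  define NN where "NN = {N \<in> PiE J (\<lambda>_. {X. X \<subseteq> Out \<and> card X = k - 1}). \<forall>i\<in>J. \<forall>j\<in>J. i \<noteq> j \<longrightarrow> N i \<inter> N j = {}}"
  have finNN: "finite NN" unfolding NN_def
    by (rule finite_subset[OF _ finite_PiE[OF finJ, of "\<lambda>_. {X. X \<subseteq> Out \<and> card X = k - 1}"]]) (use Out in auto)
  define c where "c = (\<lambda>(N :: nat \<Rightarrow> nat set) (v :: nat). if v \<in> (\<Union>i\<in>J. N i) then r else ql)"
  \<comment> \<open>The vertices of \<open>J\<close> together with \<open>k - 1\<close> neighbours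
    for each account for \<open>j * k\<close> vertices.\<close>
  have jk: "(n - j) - (k - 1) * j = n - j * k"
    using k n by (cases k) (auto simp: j_def algebra_simps)
  have G_ge: "1 - (real j)\<^sup>2 * x \<le> measure_pmf.prob R {f. G f}"
  proof -
    let ?E = "{f. \<exists>i\<in>J. \<exists>j\<in>J. i \<noteq> j \<and> 1 \<le> card (f i \<inter> f j)}"
    have "1 - (real j)\<^sup>2 * x \<le> 1 - measure_pmf.prob R ?E"
      using prob_some_overlap_le[OF J, of 1] by (simp add: R_def j_def)
    also have "\<dots> = measure_pmf.prob R (- ?E)"
      using measure_pmf.prob_compl[of ?E R] by (simp add: Compl_eq_Diff_UNIV)
    also have "\<dots> \<le> measure_pmf.prob R {f. G f}"
      unfolding R_def
    proof (rule prob_rand_sets_mono)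
      fix f assume f: "\<And>i. i < n \<Longrightarrow> f i \<in> ksubsets P K" "f \<in> - ?E"
      have "f i \<inter> f j = {}" if "i \<in> J" "j \<in> J" "i \<noteq> j" for i j
      proof -
        have "card (f i \<inter> f j) = 0" using f(2) that by (auto simp: not_less_eq_eq)
        moreover have "finite (f i)" using f(1)[of i] that J ksubsetsD(3) by auto
        ultimately show ?thesis by simp
      qed
      thus "f \<in> {f. G f}" using f J by (auto simp: G_def)
    qed
    finally show ?thesis .
  qed
  have cN: "measure_pmf.prob R {f. G f} * (\<Prod>v\<in>Out. c N v) \<le> measure_pmf.prob R {f. G f \<and> (\<forall>v\<in>Out. f v \<in> H N v f)}"
    if N: "N \<in> NN" for N
    unfolding R_def rand_sets_def
  proof (rule prob_Pi_pmf_coordinates_ge)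
    fix f :: "nat \<Rightarrow> nat set" and v u y assume "v \<in> Out"
    hence ne: "i \<in> J \<Longrightarrow> (f(v := y)) i = f i" for i by (auto simp: Out_def)
    show "G (f(v := y)) = G f" unfolding G_def by (simp only: ne cong: ball_cong)
    show "H N u (f(v := y)) = H N u f" unfolding H_def by (simp only: ne cong: ball_cong)
  next
    fix f v assume f: "G f" and "v \<in> Out"
    let ?p = "measure_pmf.prob (kset_pmf P K)"
    show "c N v \<le> ?p (H N v f)"
    proof (cases "v \<in> (\<Union>i\<in>J. N i)")
      case False
      have "ql \<le> nonadj_prob J f" unfolding ql_def j_def
        by (rule nonadj_prob_ge) (use finJ f in \<open>auto simp: G_def\<close>)
      also have "\<dots> \<le> ?p (H N v f)" unfolding nonadj_prob_def H_def
        by (rule measure_pmf.finite_measure_mono) (use False in auto)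
      finally show ?thesis using False by (simp add: c_def)
    next
      case True
      then obtain i where i: "i \<in> J" "v \<in> N i" by auto
      have "N l \<inter> N i = {}" if "l \<in> J" "l \<noteq> i" for l using N i(1) that by (simp add: NN_def)
      hence other: "l \<in> J \<Longrightarrow> v \<in> N l \<longleftrightarrow> l = i" for l using i by auto
      have "w_lower \<le> ?p {T. s \<le> card (T \<inter> f i)}" using f i by (intro prob_adj_ge) (auto simp: G_def)
      \<comment> \<open>Adjacency to \<open>i\<close> is either the wanted pattern or comes with
        adjacency to a further vertex of \<open>J\<close>; each of the latter events costs
        \<open>w ^ 2\<close>.\<close>
      also have "\<dots> \<le> ?p (H N v f \<union> (\<Union>l\<in>J-{i}. {T. s \<le> card (T \<inter> f i) \<and> s \<le> card (T \<inter> f l)}))"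
        by (rule measure_pmf.finite_measure_mono) (use other in \<open>auto simp: H_def\<close>)
      also have "\<dots> \<le> ?p (H N v f) + ?p (\<Union>l\<in>J-{i}. {T. s \<le> card (T \<inter> f i) \<and> s \<le> card (T \<inter> f l)})"
        by (rule measure_Un_le) auto
      also have "?p (\<Union>l\<in>J-{i}. {T. s \<le> card (T \<inter> f i) \<and> s \<le> card (T \<inter> f l)}) \<le>
          (\<Sum>l\<in>J-{i}. ?p {T. s \<le> card (T \<inter> f i) \<and> s \<le> card (T \<inter> f l)})"
        by (rule prob_le_sum_prob) (use finJ in auto)
      also have "\<dots> \<le> (\<Sum>l\<in>J-{i}. w\<^sup>2)"
      proof (rule sum_mono)
        fix l assume l: "l \<in> J - {i}"
        have "?p {T. s \<le> card (T \<inter> f i) \<and> s \<le> card (T \<inter> f l)} \<le> pair_bound (card (f i \<inter> f l))"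
          by (rule prob_adj_both_le) (use f i l in \<open>auto simp: G_def\<close>)
        also have "card (f i \<inter> f l) = 0" using f i l by (auto simp: G_def)
        finally show "?p {T. s \<le> card (T \<inter> f i) \<and> s \<le> card (T \<inter> f l)} \<le> w\<^sup>2"
          by (simp add: pair_bound_0)
      qed
      also have "\<dots> \<le> real (card J) * w\<^sup>2"
        using card_mono[OF finJ, of "J - {i}"] by (simp only: sum_constant) (intro mult_right_mono of_nat_mono, auto)
      finally show ?thesis using True r by (simp add: c_def)
    qed
  next
    fix v show "0 \<le> c N v" using r ql by (simp add: c_def)
  qed (auto simp: Out_def)
  have prodc: "(\<Prod>v\<in>Out. c N v) = r ^ (j * (k - 1)) * ql ^ (n - j * k)" if N: "N \<in> NN" for N
  proof -
    have "card (\<Union>i\<in>J. N i) = (\<Sum>i\<in>J. card (N i))"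
    proof (rule card_UN_disjoint[OF finJ])
      show "\<forall>i\<in>J. finite (N i)" using N finite_subset[OF _ Out(1)] by (auto simp: NN_def PiE_iff)
      show "\<forall>i\<in>J. \<forall>j\<in>J. i \<noteq> j \<longrightarrow> N i \<inter> N j = {}" using N by (simp add: NN_def)
    qed
    also have "\<dots> = j * (k - 1)" using N by (simp add: NN_def PiE_iff j_def)
    finally have card: "card (\<Union>i\<in>J. N i) = j * (k - 1)" .
    have sub: "(\<Union>i\<in>J. N i) \<subseteq> Out" using N by (auto simp: NN_def PiE_iff)
    have "card (Out - (\<Union>i\<in>J. N i)) = n - j - j * (k - 1)"
      using card sub Out by (simp add: card_Diff_subset finite_subset[OF sub])
    moreover have "n - j - j * (k - 1) = n - j * k" using jk by (simp add: mult.commute)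
    moreover have "Out \<inter> {v. v \<in> (\<Union>i\<in>J. N i)} = (\<Union>i\<in>J. N i)" "Out \<inter> - {v. v \<in> (\<Union>i\<in>J. N i)} = Out - (\<Union>i\<in>J. N i)"
      using sub by auto
    ultimately show ?thesis
      unfolding c_def by (subst prod.If_cases[OF Out(1)]) (simp only: prod_constant card)
  qed
  have "(1 - (real j)\<^sup>2 * x) * (real ((n - j * k) choose (k - 1)) ^ j * (r ^ (j * (k - 1)) * ql ^ (n - j * k)))
      \<le> measure_pmf.prob R {f. G f} * (real (card NN) * (r ^ (j * (k - 1)) * ql ^ (n - j * k)))"
  proof (intro mult_mono G_ge mult_right_mono)
    have "(((n - j) - (k - 1) * j) choose (k - 1)) ^ j \<le> card NN"
      using card_disjoint_families_ge[OF finJ Out(1), of "k - 1"] unfolding Out NN_def j_def .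
    hence "((n - j * k) choose (k - 1)) ^ j \<le> card NN" unfolding jk .
    hence "real (((n - j * k) choose (k - 1)) ^ j) \<le> real (card NN)" by (rule of_nat_mono)
    thus "real ((n - j * k) choose (k - 1)) ^ j \<le> real (card NN)" by simp
  qed (use r ql in auto)
  also have "\<dots> = (\<Sum>N\<in>NN. measure_pmf.prob R {f. G f} * (\<Prod>v\<in>Out. c N v))"
    by (simp add: prodc)
  also have "\<dots> \<le> (\<Sum>N\<in>NN. measure_pmf.prob R {f. G f \<and> (\<forall>v\<in>Out. f v \<in> H N v f)})"
    by (intro sum_mono cN)
  also have "\<dots> = measure_pmf.prob R (\<Union>N\<in>NN. {f. G f \<and> (\<forall>v\<in>Out. f v \<in> H N v f)})"
  proof (rule measure_pmf.finite_measure_finite_Union[symmetric, OF finNN])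
    show "disjoint_family_on (\<lambda>N. {f. G f \<and> (\<forall>v\<in>Out. f v \<in> H N v f)}) NN"
    proof (unfold disjoint_family_on_def, intro ballI impI)
      fix N N' assume N: "N \<in> NN" "N' \<in> NN" "N \<noteq> N'"
      \<comment> \<open>The family is recovered from \<open>f\<close> as the neighbourhoods within
        \<open>Out\<close>; outside \<open>J\<close> both families are \<open>undefined\<close> by
        \<open>PiE\<close>.\<close>
      have False if f: "\<forall>v\<in>Out. f v \<in> H N v f" "\<forall>v\<in>Out. f v \<in> H N' v f" for f
      proof -
        have "N i = N' i" for i
        proof (cases "i \<in> J")
          case True
          have "N i \<subseteq> Out" "N' i \<subseteq> Out" using N True by (auto simp: NN_def PiE_iff)
          moreover have "v \<in> N i \<longleftrightarrow> v \<in> N' i" if "v \<in> Out" for v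
            using f that True unfolding H_def by auto
          ultimately show ?thesis by blast
        next
          case False thus ?thesis using N by (auto simp: NN_def PiE_iff extensional_def)
        qed
        thus False using N(3) by auto
      qed
      thus "{f. G f \<and> (\<forall>v\<in>Out. f v \<in> H N v f)} \<inter> {f. G f \<and> (\<forall>v\<in>Out. f v \<in> H N' v f)} = {}" by auto
    qed
  qed auto
  also have "\<dots> \<le> measure_pmf.prob R (\<Inter>i\<in>J. low_degree n k i)"
  proof (rule measure_pmf.finite_measure_mono, safe)
    fix N f i assume N: "N \<in> NN" and f: "G f" "\<forall>v\<in>Out. f v \<in> H N v f" and i: "i \<in> J"
    have "{u \<in> {..<n}. sadj s f i u} \<subseteq> N i"
    proof safe
      fix u assume u: "u < n" "sadj s f i u"
      show "u \<in> N i"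
      proof (cases "u \<in> J")
        case True
        hence "f i \<inter> f u = {}" using f(1) i u(2) by (auto simp: G_def sadj_def)
        thus ?thesis using u(2) s_pos by (simp add: sadj_def)
      next
        case False
        hence "u \<in> Out" using u(1) by (simp add: Out_def)
        hence "s \<le> card (f u \<inter> f i) \<longleftrightarrow> u \<in> N i" using f(2) i by (simp add: H_def)
        thus ?thesis using u(2) by (simp add: sadj_def Int_commute)
      qed
    qed
    moreover have "card (N i) = k - 1" "finite (N i)"
      using N i finite_subset[OF _ Out(1)] by (auto simp: NN_def PiE_iff)
    ultimately have "card {u \<in> {..<n}. sadj s f i u} \<le> k - 1" using card_mono by metis
    thus "f \<in> low_degree n k i" using k by (auto simp: low_degree_def)
  qed auto
  finally show ?thesis by (simp add: R_def j_def ql_def)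
qed

end

section \<open>Monotonicity in the number of items per vertex\<close>

text \<open>A uniform \<open>K\<close>-subset of a uniform \<open>K'\<close>-set is uniform: a fixed
  \<open>S\<close> lies in the larger set with probability
  \<open>(K' choose K) / (P choose K)\<close> and is then picked with probability
  \<open>1 / (K' choose K)\<close>.\<close>

lemma kset_pmf_eq_bind:
  assumes "K \<le> K'" "K' \<le> P"
  shows "kset_pmf P K = kset_pmf P K' \<bind> (\<lambda>T. pmf_of_set {S. S \<subseteq> T \<and> card S = K})"
proof (rule pmf_eqI)
  fix S
  let ?q = "\<lambda>T. pmf_of_set {S. S \<subseteq> T \<and> card S = K}"
  have ne: "ksubsets P K' \<noteq> {}" using assms by (simp add: ksubsets_nonempty)
  have q: "pmf (?q T) S = (if S \<subseteq> T \<and> card S = K then 1 else 0) / (K' choose K)" if T: "T \<in> ksubsets P K'" for T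
  proof -
    have c: "card {S. S \<subseteq> T \<and> card S = K} = (K' choose K)"
      using n_subsets[OF ksubsetsD(3)[OF T]] ksubsetsD(2)[OF T] by simp
    moreover have "(K' choose K) > 0" using assms by simp
    ultimately have "{S. S \<subseteq> T \<and> card S = K} \<noteq> {}" by (metis card.empty less_numeral_extra(3))
    thus ?thesis using ksubsetsD(3)[OF T] c by (simp add: indicator_def)
  qed
  have "pmf (kset_pmf P K' \<bind> ?q) S = (\<Sum>T\<in>ksubsets P K'. pmf (?q T) S) / card (ksubsets P K')"
    unfolding pmf_bind using ne by (subst integral_pmf_of_set) auto
  also have "(\<Sum>T\<in>ksubsets P K'. pmf (?q T) S) =
      (\<Sum>T\<in>ksubsets P K'. (if S \<subseteq> T \<and> card S = K then 1 else 0) / (K' choose K))"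
    by (intro sum.cong refl q)
  also have "\<dots> = (\<Sum>T\<in>ksubsets P K'. (if S \<subseteq> T \<and> card S = K then 1 else 0)) / (K' choose K)"
    by (simp only: sum_divide_distrib)
  also have "(\<Sum>T\<in>ksubsets P K'. (if S \<subseteq> T \<and> card S = K then 1 else 0)) =
      (if S \<in> ksubsets P K then real (card (ksubsets P K' \<inter> {T. S \<subseteq> T})) else 0)"
  proof (cases "S \<in> ksubsets P K")
    case True
    thus ?thesis using ksubsetsD(2)[OF True] by (simp add: sum.If_cases)
  next
    case False
    have "\<not> (S \<subseteq> T \<and> card S = K)" if "T \<in> ksubsets P K'" for T
      using that False ksubsetsD(1)[OF that] by (auto simp: ksubsets_def)
    hence "(\<Sum>T\<in>ksubsets P K'. (if S \<subseteq> T \<and> card S = K then 1 else 0 :: real)) = 0"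
      by (intro sum.neutral) auto
    thus ?thesis using False by simp
  qed
  also have "\<dots> / (K' choose K) / card (ksubsets P K') = (if S \<in> ksubsets P K then 1 / (P choose K) else 0)"
  proof (cases "S \<in> ksubsets P K")
    case True
    have "real (card (ksubsets P K' \<inter> {T. S \<subseteq> T})) / (P choose K') = real (K' choose K) / real (P choose K)"
      using prob_kset_superset[OF assms(2) ksubsetsD(1)[OF True]] ksubsetsD(2)[OF True]
      by (simp add: prob_kset_pmf[OF assms(2)])
    hence "real (card (ksubsets P K' \<inter> {T. S \<subseteq> T})) / (K' choose K) / (P choose K') =
        real (K' choose K) / real (P choose K) / (K' choose K)"
      by (metis divide_divide_eq_left' mult.commute divide_divide_eq_left)
    thus ?thesis using True assms by (simp add: card_ksubsets)
  qed simp
  also have "\<dots> = pmf (kset_pmf P K) S"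
    using assms by (subst pmf_of_set) (auto simp: ksubsets_nonempty card_ksubsets indicator_def)
  finally show "pmf (kset_pmf P K) S = pmf (kset_pmf P K' \<bind> ?q) S" by simp
qed

text \<open>The smaller sets are coupled to the larger ones as uniformly random subsets of them.\<close>
lemma prob_rand_sets_mono_K:
  assumes "K \<le> K'" "K' \<le> P"
    and mono: "\<And>f g. (\<And>i. i < n \<Longrightarrow> f i \<subseteq> g i \<and> finite (g i)) \<Longrightarrow> \<Phi> f \<Longrightarrow> \<Phi> g"
  shows "measure_pmf.prob (rand_sets n K P) {f. \<Phi> f} \<le> measure_pmf.prob (rand_sets n K' P) {f. \<Phi> f}"
proof -
  let ?q = "\<lambda>T. pmf_of_set {S. S \<subseteq> T \<and> card S = K}"
  let ?R = "\<lambda>f. Pi_pmf {..<n} {} (\<lambda>i. ?q (f i)) :: (nat \<Rightarrow> nat set) pmf"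
  have eq: "rand_sets n K P = rand_sets n K' P \<bind> ?R"
    unfolding rand_sets_def kset_pmf_eq_bind[OF assms(1,2)]
    by (rule Pi_pmf_bind) simp
  have supp: "f i \<in> ksubsets P K'" if "f \<in> set_pmf (rand_sets n K' P)" "i < n" for f i
    using that set_Pi_pmf_subset'[of "{..<n}" "{}" "\<lambda>_. kset_pmf P K'"] ksubsets_nonempty[OF assms(2)]
    by (auto simp: rand_sets_def PiE_dflt_def set_pmf_of_set)
  \<comment> \<open>If \<open>\<Phi>\<close> fails for the larger sets, monotonicity makes it fail
    for every family of subsets in the support of the second draw.\<close>
  have le: "emeasure (?R f) {f. \<Phi> f} \<le> indicator {f. \<Phi> f} f" if f: "f \<in> set_pmf (rand_sets n K' P)" for f
  proof (cases "\<Phi> f")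
    case False
    have "g \<notin> set_pmf (?R f)" if "\<Phi> g" for g
    proof
      assume g: "g \<in> set_pmf (?R f)"
      have "g i \<subseteq> f i \<and> finite (f i)" if i: "i < n" for i
      proof -
        note fi = ksubsetsD[OF supp[OF f i]]
        have "card {S. S \<subseteq> f i \<and> card S = K} > 0"
          using n_subsets[OF fi(3), of K] fi(2) assms by simp
        hence ne: "{S. S \<subseteq> f i \<and> card S = K} \<noteq> {}" "finite {S. S \<subseteq> f i \<and> card S = K}"
          by (auto simp: card_gt_0_iff)
        have "g i \<in> set_pmf (?q (f i))"
          using g set_Pi_pmf_subset'[of "{..<n}" "{}" "\<lambda>i. ?q (f i)"] i
          by (auto simp: PiE_dflt_def)
        thus ?thesis using set_pmf_of_set[OF ne] fi(3) by auto
      qed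
      from mono[OF this \<open>\<Phi> g\<close>] False show False by blast
    qed
    hence "set_pmf (?R f) \<inter> {f. \<Phi> f} = {}" by auto
    hence "emeasure (?R f) {f. \<Phi> f} = 0"
      by (subst measure_pmf.emeasure_eq_measure, subst measure_pmf_zero_iff[THEN iffD2]) auto
    thus ?thesis by simp
  qed (simp add: measure_pmf.emeasure_eq_measure)
  have "emeasure (rand_sets n K P) {f. \<Phi> f} \<le> (\<integral>\<^sup>+f. indicator {f. \<Phi> f} f \<partial>rand_sets n K' P)"
    unfolding eq emeasure_bind_pmf by (rule nn_integral_mono_AE) (simp add: AE_measure_pmf_iff le)
  also have "\<dots> = emeasure (rand_sets n K' P) {f. \<Phi> f}" by simp
  finally show ?thesis by (simp add: measure_pmf.emeasure_eq_measure)
qed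

section \<open>Connectivity of graphs\<close>

text \<open>All cut arguments below obtain their crossing edge from this fact.\<close>

lemma rtrancl_leaves:
  assumes "(a, b) \<in> r\<^sup>*" "a \<in> A" "b \<notin> A"
  shows "\<exists>x y. (x, y) \<in> r \<and> x \<in> A \<and> y \<notin> A"
  using assms by (induction rule: rtrancl_induct) auto

lemma graph_connected_mono:
  assumes "graph_connected V E" "\<And>x y. x \<in> V \<Longrightarrow> y \<in> V \<Longrightarrow> E x y \<Longrightarrow> E' x y"
  shows "graph_connected V E'"
proof -
  have "{(x, y). x \<in> V \<and> y \<in> V \<and> E x y}\<^sup>* \<subseteq> {(x, y). x \<in> V \<and> y \<in> V \<and> E' x y}\<^sup>*"
    by (rule rtrancl_mono) (use assms(2) in auto)
  thus ?thesis using assms(1) unfolding graph_connected_def by blast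
qed

lemma k_vertex_connected_mono:
  assumes "k_vertex_connected k V E" "\<And>x y. x \<in> V \<Longrightarrow> y \<in> V \<Longrightarrow> E x y \<Longrightarrow> E' x y"
  shows "k_vertex_connected k V E'"
  unfolding k_vertex_connected_def
proof (intro allI impI)
  fix S assume "S \<subseteq> V \<and> card S \<le> k - 1"
  hence "graph_connected (V - S) E" using assms(1) by (auto simp: k_vertex_connected_def)
  thus "graph_connected (V - S) E'" by (rule graph_connected_mono) (use assms(2) in auto)
qed

lemma min_degree_ge_mono:
  assumes "min_degree_ge k V E" "finite V" "\<And>x y. x \<in> V \<Longrightarrow> y \<in> V \<Longrightarrow> E x y \<Longrightarrow> E' x y"
  shows "min_degree_ge k V E'"
  unfolding min_degree_ge_def
proof
  fix v assume v: "v \<in> V"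
  have "card {u\<in>V. E v u} \<le> card {u\<in>V. E' v u}"
    by (rule card_mono) (use assms v in auto)
  thus "k \<le> card {u\<in>V. E' v u}" using assms(1) v by (force simp: min_degree_ge_def)
qed

text \<open>Deleting all edges at a vertex of degree below \<open>k\<close> isolates it from some
  second vertex.\<close>

lemma k_edge_connected_imp_min_degree_ge:
  assumes conn: "k_edge_connected k V E" and "finite V" "2 \<le> card V"
  shows "min_degree_ge k V E"
  unfolding min_degree_ge_def
proof
  fix v assume v: "v \<in> V"
  show "k \<le> card {u\<in>V. E v u}"
  proof (rule ccontr)
    assume less: "\<not> k \<le> card {u\<in>V. E v u}"
    define F where "F = (\<lambda>u. {v, u}) ` {u\<in>V. E v u}"
    have "card F \<le> k - 1"
      using less card_image_le[of "{u\<in>V. E v u}" "\<lambda>u. {v, u}"] assms(2) by (simp add: F_def)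
    moreover have "F \<subseteq> graph_edges V E" using v by (auto simp: F_def graph_edges_def)
    ultimately have conn': "graph_connected V (\<lambda>x y. E x y \<and> {x, y} \<notin> F)"
      using conn by (auto simp: k_edge_connected_def)
    obtain u where u: "u \<in> V" "u \<noteq> v"
    proof -
      have "V \<noteq> {v}" using assms(3) by auto
      thus ?thesis using v that by blast
    qed
    have "(v, u) \<in> {(x, y). x \<in> V \<and> y \<in> V \<and> E x y \<and> {x, y} \<notin> F}\<^sup>*"
      using conn' v u by (auto simp: graph_connected_def)
    from rtrancl_leaves[OF this, of "{v}"] u show False by (auto simp: F_def)
  qed
qed

text \<open>If deleting \<open>F\<close> separates \<open>A\<close> from its complement, one side
  \<open>B\<close> has at least \<open>k\<close> vertices. Deleting the ends in \<open>B\<close> of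
  the crossing edges of \<open>F\<close> leaves a vertex on each side, so a surviving edge crosses,
  which contradicts the separation. Some size hypothesis is needed: under the definitions used, a
  single edge on two vertices is 2-vertex-connected but not 2-edge-connected.\<close>

lemma k_vertex_connected_imp_k_edge_connected:
  assumes conn: "k_vertex_connected k V E" and V: "finite V" "2 * k \<le> card V" and k: "1 \<le> k"
    and sym: "\<And>x y. E x y \<Longrightarrow> E y x"
  shows "k_edge_connected k V E"
  unfolding k_edge_connected_def
proof (intro allI impI)
  fix F assume F: "F \<subseteq> graph_edges V E \<and> card F \<le> k - 1"
  define E' where "E' = (\<lambda>x y. E x y \<and> {x, y} \<notin> F)"
  have "graph_edges V E \<subseteq> Pow V" by (auto simp: graph_edges_def)
  hence finF: "finite F" using F V(1) by (meson finite_Pow_iff finite_subset)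
  have "graph_connected V E'"
  proof (rule ccontr)
    assume "\<not> graph_connected V E'"
    then obtain u v where uv: "u \<in> V" "v \<in> V" "(u, v) \<notin> {(x, y). x \<in> V \<and> y \<in> V \<and> E' x y}\<^sup>*"
      by (auto simp: graph_connected_def)
    define A where "A = {x\<in>V. (u, x) \<in> {(x, y). x \<in> V \<and> y \<in> V \<and> E' x y}\<^sup>*}"
    have uA: "u \<in> A" using uv by (simp add: A_def)
    have vA: "v \<in> V - A" using uv by (simp add: A_def)
    have AV: "A \<subseteq> V" by (auto simp: A_def)
    have closed: "False" if "x \<in> A" "y \<in> V - A" "E' x y" for x y
      using that rtrancl_into_rtrancl[of u x "{(x, y). x \<in> V \<and> y \<in> V \<and> E' x y}" y] by (auto simp: A_def)
    have crossing: "False" if B: "B = A \<or> B = V - A" and cB: "k \<le> card B" for B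
    proof -
      \<comment> \<open>Each vertex of \<open>S\<close> selects an edge of \<open>F\<close> whose
        other end lies outside \<open>B\<close>. These edges are distinct, so \<open>S\<close> is no
        larger than \<open>F\<close>.\<close>
      define S where "S = {x\<in>B. \<exists>y\<in>V - B. {x, y} \<in> F}"
      have BV: "B \<subseteq> V" using B AV by auto
      have finB: "finite B" using BV V(1) finite_subset by blast
      have "card S \<le> card F"
      proof -
        have "\<forall>x\<in>S. \<exists>y. y \<in> V - B \<and> {x, y} \<in> F" by (auto simp: S_def)
        then obtain h where h: "\<And>x. x \<in> S \<Longrightarrow> h x \<in> V - B \<and> {x, h x} \<in> F" by metis
        have "inj_on (\<lambda>x. {x, h x}) S"
        proof (rule inj_onI)
          fix x x' assume x: "x \<in> S" "x' \<in> S" "{x, h x} = {x', h x'}"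
          have "x \<in> B" "x' \<in> B" using x by (auto simp: S_def)
          thus "x = x'" using x(3) h[OF x(1)] h[OF x(2)] by (auto simp: doubleton_eq_iff)
        qed
        thus ?thesis using h by (intro card_inj_on_le[OF _ _ finF]) auto
      qed
      hence cS: "card S \<le> k - 1" using F by linarith
      have SB: "S \<subseteq> B" by (auto simp: S_def)
      have "\<not> B \<subseteq> S"
      proof
        assume "B \<subseteq> S"
        hence "B = S" using SB by auto
        thus False using cS cB k by simp
      qed
      then obtain z where z: "z \<in> B" "z \<notin> S" by auto
      have "S \<subseteq> V" using SB BV by auto
      hence g: "graph_connected (V - S) E" using conn cS by (auto simp: k_vertex_connected_def)
      obtain t where t: "t \<in> V - B" using B uA vA AV by (cases "B = A") auto
      have "t \<in> V - S" "z \<in> V - S" using t z BV SB by auto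
      hence "(z, t) \<in> {(x, y). x \<in> V - S \<and> y \<in> V - S \<and> E x y}\<^sup>*"
        using g by (auto simp: graph_connected_def)
      from rtrancl_leaves[OF this, of B] z t obtain x y where
        xy: "x \<in> V - S" "y \<in> V - S" "E x y" "x \<in> B" "y \<notin> B" by auto
      have "{x, y} \<notin> F" using xy by (auto simp: S_def)
      hence E': "E' x y" "E' y x" using xy(3) sym by (auto simp: E'_def insert_commute)
      show False
      proof (cases "B = A")
        case True thus ?thesis using closed[of x y] xy E' by auto
      next
        case False
        hence "B = V - A" using B by auto
        thus ?thesis using closed[of y x] xy E' by auto
      qed
    qed
    have "card A + card (V - A) = card V" using AV V(1) by (simp add: card_Diff_subset finite_subset card_mono)
    hence "k \<le> card A \<or> k \<le> card (V - A)" using V(2) by linarith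
    thus False using crossing by blast
  qed
  thus "graph_connected V (\<lambda>x y. E x y \<and> {x, y} \<notin> F)" by (simp add: E'_def)
qed

text \<open>An order in which a connected set can be explored: each vertex after the first has an
  earlier neighbour. Lists instead of spanning trees let the vertices be revealed one by one, each
  at a cost proportional to the number of earlier ones.\<close>

definition search_list :: "('a \<Rightarrow> 'a \<Rightarrow> bool) \<Rightarrow> 'a list \<Rightarrow> bool" where
  "search_list E vs \<longleftrightarrow> distinct vs \<and> (\<forall>j<length vs. 0 < j \<longrightarrow> (\<exists>i<j. E (vs ! j) (vs ! i)))"

lemma search_list_snoc:
  "search_list E (vs @ [v]) \<longleftrightarrow> search_list E vs \<and> v \<notin> set vs \<and> (vs = [] \<or> (\<exists>u\<in>set vs. E v u))"
proof -
  have nth: "(vs @ [v]) ! i = vs ! i" if "i < length vs" for i using that by (simp add: nth_append)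
  have "(\<exists>i<j. E (vs ! j) ((vs @ [v]) ! i)) \<longleftrightarrow> (\<exists>i<j. E (vs ! j) (vs ! i))" if "j < length vs" for j
    using that nth by (metis order.strict_trans)
  moreover have "(\<exists>i<length vs. E v ((vs @ [v]) ! i)) \<longleftrightarrow> (\<exists>i<length vs. E v (vs ! i))"
    using nth by metis
  ultimately have "(\<forall>j<length (vs @ [v]). 0 < j \<longrightarrow> (\<exists>i<j. E ((vs @ [v]) ! j) ((vs @ [v]) ! i))) \<longleftrightarrow>
      (\<forall>j<length vs. 0 < j \<longrightarrow> (\<exists>i<j. E (vs ! j) (vs ! i))) \<and> (0 < length vs \<longrightarrow> (\<exists>i<length vs. E v (vs ! i)))"
    by (simp add: All_less_Suc nth) blast
  moreover have "(\<exists>i<length vs. E v (vs ! i)) \<longleftrightarrow> (\<exists>u\<in>set vs. E v u)"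
    by (metis in_set_conv_nth)
  ultimately show ?thesis by (auto simp: search_list_def)
qed

text \<open>While the list misses a vertex of the component, a path to that vertex leaves the list
  along an edge, and the end of this edge is appended.\<close>

lemma search_list_component:
  assumes "finite C" "C = {x. (u, x) \<in> r\<^sup>*}" and sym: "\<And>x y. (x, y) \<in> r \<Longrightarrow> E y x"
  shows "\<exists>vs. search_list E vs \<and> set vs = C"
proof -
  have "\<exists>vs. search_list E vs \<and> set vs \<subseteq> C \<and> u \<in> set vs \<and> length vs = Suc m" if "Suc m \<le> card C" for m
    using that
  proof (induction m)
    case 0
    have "search_list E [u]" by (simp add: search_list_def)
    moreover have "set [u] \<subseteq> C" using assms(2) by simp
    ultimately show ?case by (intro exI[of _ "[u]"]) simp
  next
    case (Suc m)
    then obtain vs where vs: "search_list E vs" "set vs \<subseteq> C" "u \<in> set vs" "length vs = Suc m" by auto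
    have "card (set vs) = Suc m" using vs by (simp add: search_list_def distinct_card)
    hence "set vs \<noteq> C" using Suc.prems by auto
    then obtain z where z: "z \<in> C" "z \<notin> set vs" using vs(2) by auto
    have "(u, z) \<in> r\<^sup>*" using z assms(2) by auto
    from rtrancl_leaves[OF this vs(3) z(2)] obtain x y where xy: "(x, y) \<in> r" "x \<in> set vs" "y \<notin> set vs" by auto
    have "(u, x) \<in> r\<^sup>*" using xy vs(2) assms(2) by auto
    hence "y \<in> C" using xy(1) assms(2) by (auto intro: rtrancl_into_rtrancl)
    moreover have "search_list E (vs @ [y])"
      unfolding search_list_snoc using vs(1) xy sym[OF xy(1)] by auto
    ultimately show ?case using vs by (intro exI[of _ "vs @ [y]"]) auto
  qed
  moreover have "C \<noteq> {}" using assms(2) by auto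
  then obtain m where m: "card C = Suc m" using assms(1) by (metis card_eq_0_iff not0_implies_Suc)
  ultimately obtain vs where vs: "search_list E vs" "set vs \<subseteq> C" "length vs = Suc m" by auto
  have "card (set vs) = Suc m" using vs by (simp add: search_list_def distinct_card)
  hence "set vs = C" using vs(2) assms(1) m by (intro card_subset_eq) auto
  thus ?thesis using vs(1) by blast
qed

text \<open>After the deletion of a separating set two different components exist, and one of them
  has at most half of all vertices. Its vertices, explored in order, form \<open>vs\<close>.\<close>

lemma small_cut_if_not_k_vertex_connected:
  assumes V: "finite V" and sym: "\<And>x y. E x y \<Longrightarrow> E y x" and irrefl: "\<And>x. \<not> E x x"
    and k: "1 \<le> k"
    and not_conn: "\<not> k_vertex_connected k V E" and deg: "min_degree_ge k V E"
  obtains vs S where "search_list E vs" "set vs \<subseteq> V" "2 \<le> length vs" "2 * length vs \<le> card V"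
    "S \<subseteq> V - set vs" "card S < k" "\<forall>v\<in>S. \<exists>a\<in>set vs. E v a"
    "\<forall>v\<in>V - set vs - S. \<forall>a\<in>set vs. \<not> E v a"
proof -
  obtain S where S: "S \<subseteq> V" "card S \<le> k - 1" "\<not> graph_connected (V - S) E"
    using not_conn by (auto simp: k_vertex_connected_def)
  define r where "r = {(x, y). x \<in> V - S \<and> y \<in> V - S \<and> E x y}"
  have symr: "(x, y) \<in> r \<Longrightarrow> (y, x) \<in> r" for x y using sym[of x y] by (simp add: r_def)
  have symr': "(y, x) \<in> r\<^sup>*" if "(x, y) \<in> r\<^sup>*" for x y
    using that by (induction rule: rtrancl_induct) (auto intro: converse_rtrancl_into_rtrancl symr)
  define C where "C = (\<lambda>u. {x. (u, x) \<in> r\<^sup>*})"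
  have CV: "C u \<subseteq> V - S" if "u \<in> V - S" for u
  proof
    fix z assume "z \<in> C u"
    hence "(u, z) \<in> r\<^sup>*" by (simp add: C_def)
    thus "z \<in> V - S" using that by (induction rule: rtrancl_induct) (auto simp: r_def)
  qed
  obtain u1 u2 where u: "u1 \<in> V - S" "u2 \<in> V - S" "(u1, u2) \<notin> r\<^sup>*"
    using S(3) unfolding graph_connected_def r_def by blast
  have "C u1 \<inter> C u2 = {}"
  proof -
    have False if z: "(u1, z) \<in> r\<^sup>*" "(u2, z) \<in> r\<^sup>*" for z
      using rtrancl_trans[OF z(1) symr'[OF z(2)]] u(3) by blast
    thus ?thesis by (auto simp: C_def)
  qed
  note disj = this
  have "card (C u1) + card (C u2) = card (C u1 \<union> C u2)"
  proof (rule card_Un_disjoint[OF _ _ disj, symmetric])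
    show "finite (C u1)" by (rule finite_subset[OF _ V]) (use CV[OF u(1)] in blast)
    show "finite (C u2)" by (rule finite_subset[OF _ V]) (use CV[OF u(2)] in blast)
  qed
  also have "\<dots> \<le> card V" using CV[OF u(1)] CV[OF u(2)] V by (intro card_mono) auto
  finally have "2 * card (C u1) \<le> card V \<or> 2 * card (C u2) \<le> card V" by linarith
  hence "\<exists>u\<in>V - S. 2 * card (C u) \<le> card V" using u(1,2) by blast
  then obtain u where u: "u \<in> V - S" "2 * card (C u) \<le> card V" by auto
  have finC: "finite (C u)" using CV[OF u(1)] V finite_subset by blast
  have rE: "E y x" if "(x, y) \<in> r" for x y using that sym[of x y] by (simp add: r_def)
  have "\<exists>vs. search_list E vs \<and> set vs = C u"
    by (rule search_list_component[OF finC, of u r E]) (simp_all add: C_def rE)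
  then obtain vs where vs: "search_list E vs" "set vs = C u" by blast
  \<comment> \<open>The separating set is pruned to the vertices with a neighbour in the component,
    so that in the union bound every vertex of the cut pays for an adjacency.\<close>
  define S' where "S' = {v\<in>S. \<exists>a\<in>set vs. E v a}"
  have len: "length vs = card (C u)" using vs distinct_card[of vs] by (simp add: search_list_def)
  have noedge: "\<not> E v a" if v: "v \<in> V - set vs - S'" and a: "a \<in> set vs" for v a
  proof
    assume "E v a"
    hence vS: "v \<notin> S" using v a by (auto simp: S'_def)
    have "a \<in> V - S" using a vs CV[OF u(1)] by auto
    hence "(a, v) \<in> r" using sym[OF \<open>E v a\<close>] v vS by (auto simp: r_def)
    hence "v \<in> C u" using a vs by (auto simp: C_def intro: rtrancl_into_rtrancl)
    thus False using v vs by auto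
  qed
  have S'V: "S' \<subseteq> V - set vs" using S(1) vs CV[OF u(1)] by (auto simp: S'_def)
  have finS: "finite S" using S(1) V finite_subset by blast
  have cS': "card S' \<le> card S" by (rule card_mono[OF finS]) (auto simp: S'_def)
  \<comment> \<open>This is where the minimum degree enters: the neighbours of a one-vertex
    component all lie in \<open>S'\<close>, which has fewer than \<open>k\<close> elements.\<close>
  have len2: "2 \<le> length vs"
  proof (rule ccontr)
    assume "\<not> 2 \<le> length vs"
    moreover have uC: "u \<in> C u" by (simp add: C_def)
    ultimately have "card (C u) \<noteq> 0" "card (C u) \<le> 1" using len finC by auto
    hence "card (C u) = 1" by linarith
    hence Cu: "C u = {u}" using uC by (auto simp: card_1_singleton_iff)
    have "{v\<in>V. E u v} \<subseteq> S'"
    proof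
      fix v assume v: "v \<in> {v\<in>V. E u v}"
      show "v \<in> S'"
      proof (rule ccontr)
        assume "v \<notin> S'"
        moreover have "v \<noteq> u" using v irrefl by auto
        ultimately show False using noedge[of v u] v vs Cu sym[of u v] by auto
      qed
    qed
    hence "card {v\<in>V. E u v} \<le> card S'" by (rule card_mono[rotated]) (use finS in \<open>auto simp: S'_def\<close>)
    moreover have "k \<le> card {v\<in>V. E u v}" using deg u(1) by (auto simp: min_degree_ge_def)
    ultimately show False using cS' S(2) k by linarith
  qed
  show ?thesis
  proof (rule that[of vs S'])
    show "2 * length vs \<le> card V" using u(2) len by simp
    show "set vs \<subseteq> V" using vs CV[OF u(1)] by auto
    show "card S' < k" using cS' S(2) k by linarith
    show "\<forall>v\<in>S'. \<exists>a\<in>set vs. E v a" by (simp add: S'_def)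
    show "\<forall>v\<in>V - set vs - S'. \<forall>a\<in>set vs. \<not> E v a" using noedge by blast
  qed (fact vs(1) len2 S'V)+
qed

section \<open>Union bound over small cuts\<close>

lemma search_list_cong:
  assumes "\<And>x y. x \<in> set vs \<Longrightarrow> y \<in> set vs \<Longrightarrow> E x y \<longleftrightarrow> E' x y"
  shows "search_list E vs \<longleftrightarrow> search_list E' vs"
proof -
  have "E (vs ! j) (vs ! i) \<longleftrightarrow> E' (vs ! j) (vs ! i)" if "j < length vs" "i < j" for i j
    using that by (intro assms nth_mem) auto
  thus ?thesis unfolding search_list_def by blast
qed

lemma sadj_sym: "sadj s f i j \<Longrightarrow> sadj s f j i"
  by (auto simp: sadj_def Int_commute)

lemma sadj_irrefl: "\<not> sadj s f i i"
  by (simp add: sadj_def)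

context intersection_params
begin

lemma prob_adj_some_le:
  assumes "finite A" "\<And>i. i \<in> A \<Longrightarrow> f i \<in> ksubsets P K"
  shows "measure_pmf.prob (kset_pmf P K) {T. \<exists>i\<in>A. s \<le> card (T \<inter> f i)} \<le> real (card A) * w"
proof -
  have "measure_pmf.prob (kset_pmf P K) {T. \<exists>i\<in>A. s \<le> card (T \<inter> f i)} \<le>
      (\<Sum>i\<in>A. measure_pmf.prob (kset_pmf P K) {T. s \<le> card (T \<inter> f i)})"
    by (rule prob_le_sum_prob) (use assms(1) in auto)
  also have "\<dots> \<le> (\<Sum>i\<in>A. w)" by (intro sum_mono prob_adj_le assms)
  finally show ?thesis by simp
qed

text \<open>In the order of the list, the vertex at position \<open>i\<close> must be adjacent to
  one of \<open>i\<close> earlier vertices, which costs at most \<open>i * w\<close>. The product of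
  these costs is the bound.\<close>

lemma prob_search_list_le:
  assumes "vs \<noteq> []" "set vs \<subseteq> {..<n}"
  shows "measure_pmf.prob (rand_sets n K P) {f. (\<forall>i\<in>set vs. f i \<in> ksubsets P K) \<and> search_list (sadj s f) vs}
           \<le> fact (length vs - 1) * w ^ (length vs - 1)"
  using assms
proof (induction vs rule: rev_nonempty_induct)
  case (snoc v vs)
  let ?p = "measure_pmf.prob (rand_sets n K P)"
  let ?G = "\<lambda>vs f. (\<forall>i\<in>set vs. f i \<in> ksubsets P K) \<and> search_list (sadj s f) vs"
  obtain m where m: "length vs = Suc m" using snoc.hyps by (cases vs) auto
  show ?case
  proof (cases "v \<in> set vs")
    case True
    hence "{f. ?G (vs @ [v]) f} = {}" by (simp add: search_list_snoc)
    hence "?p {f. ?G (vs @ [v]) f} = 0" by (simp only: measure_empty)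
    thus ?thesis using w_pos by (simp only:) simp
  next
    case False
    have "?p {f. ?G (vs @ [v]) f} \<le> ?p {f. ?G vs f \<and> f v \<in> {T. \<exists>i\<in>set vs. s \<le> card (T \<inter> f i)}}"
      by (rule measure_pmf.finite_measure_mono) (use snoc.hyps in \<open>auto simp: search_list_snoc sadj_def\<close>)
    also have "\<dots> \<le> ?p {f. ?G vs f} * (real (length vs) * w)"
      unfolding rand_sets_def
    proof (rule prob_Pi_pmf_coordinate_le)
      fix f :: "nat \<Rightarrow> nat set" and y
      have ne: "i \<in> set vs \<Longrightarrow> (f(v := y)) i = f i" for i using False by auto
      have "search_list (sadj s (f(v := y))) vs = search_list (sadj s f) vs"
        by (rule search_list_cong) (simp only: sadj_def ne)
      thus "?G vs (f(v := y)) = ?G vs f" by (simp only: ne cong: ball_cong)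
      show "{T. \<exists>i\<in>set vs. s \<le> card (T \<inter> (f(v := y)) i)} = {T. \<exists>i\<in>set vs. s \<le> card (T \<inter> f i)}"
        by (simp only: ne cong: bex_cong)
    next
      fix f assume G: "?G vs f"
      hence "measure_pmf.prob (kset_pmf P K) {T. \<exists>i\<in>set vs. s \<le> card (T \<inter> f i)} \<le> real (card (set vs)) * w"
        by (intro prob_adj_some_le) auto
      thus "measure_pmf.prob (kset_pmf P K) {T. \<exists>i\<in>set vs. s \<le> card (T \<inter> f i)} \<le> real (length vs) * w"
        using G by (simp add: search_list_def distinct_card)
    qed (use snoc.prems w_pos in auto)
    also have "\<dots> \<le> (fact (length vs - 1) * w ^ (length vs - 1)) * (real (length vs) * w)"
      using snoc.IH snoc.prems w_pos by (intro mult_right_mono) auto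
    also have "\<dots> = fact (length (vs @ [v]) - 1) * w ^ (length (vs @ [v]) - 1)"
      by (simp add: m algebra_simps)
    finally show ?thesis .
  qed
qed auto

lemma nonadj_prob_cong:
  assumes "\<And>i. i \<in> A \<Longrightarrow> f i = g i"
  shows "nonadj_prob A f = nonadj_prob A g"
  unfolding nonadj_prob_def using assms by (simp cong: ball_cong)

text \<open>\<open>G\<close> and \<open>nonadj_prob A f\<close> read only the item sets of
  \<open>A\<close>. Given these, the vertices outside \<open>A\<close> are independent: one in
  \<open>S\<close> costs at most \<open>card A * w\<close>, one in \<open>B\<close> at most
  \<open>\<beta>\<close>.\<close>

lemma prob_cut_le:
  assumes A: "A \<subseteq> {..<n}" and S: "S \<subseteq> {..<n} - A" and B: "B \<subseteq> {..<n} - A - S" and \<beta>: "0 \<le> \<beta>"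
    and G: "\<And>f v y. v \<notin> A \<Longrightarrow> G (f(v := y)) \<longleftrightarrow> G f"
    and G_valid: "\<And>f i. G f \<Longrightarrow> i \<in> A \<Longrightarrow> f i \<in> ksubsets P K"
  shows "measure_pmf.prob (rand_sets n K P)
      {f. G f \<and> nonadj_prob A f \<le> \<beta> \<and> (\<forall>v\<in>S. \<exists>a\<in>A. sadj s f v a) \<and> (\<forall>v\<in>B. \<forall>a\<in>A. \<not> sadj s f v a)}
    \<le> measure_pmf.prob (rand_sets n K P) {f. G f} * ((real (card A) * w) ^ card S * \<beta> ^ card B)"
proof -
  let ?p = "measure_pmf.prob (rand_sets n K P)"
  have fin: "finite A" "finite S" "finite B"
    using A S B by (auto intro: finite_subset[OF _ finite_lessThan[of n]])
  define G' where "G' = (\<lambda>f. G f \<and> nonadj_prob A f \<le> \<beta>)"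
  define H where "H = (\<lambda>v (f :: nat \<Rightarrow> nat set). if v \<in> S then {T. \<exists>a\<in>A. s \<le> card (T \<inter> f a)} else {T. \<forall>a\<in>A. \<not> s \<le> card (T \<inter> f a)})"
  define c where "c = (\<lambda>v. if v \<in> S then real (card A) * w else \<beta>)"
  have disj: "S \<inter> B = {}" using B by auto
  have "?p {f. G f \<and> nonadj_prob A f \<le> \<beta> \<and> (\<forall>v\<in>S. \<exists>a\<in>A. sadj s f v a) \<and> (\<forall>v\<in>B. \<forall>a\<in>A. \<not> sadj s f v a)}
    \<le> ?p {f. G' f \<and> (\<forall>v\<in>S \<union> B. f v \<in> H v f)}"
  proof (rule measure_pmf.finite_measure_mono, safe)
    fix f assume f: "G f" "nonadj_prob A f \<le> \<beta>" "\<forall>v\<in>S. \<exists>a\<in>A. sadj s f v a" "\<forall>v\<in>B. \<forall>a\<in>A. \<not> sadj s f v a"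
    show "G' f" using f by (simp add: G'_def)
    fix v
    show "f v \<in> H v f" if "v \<in> S" using f(3) that unfolding H_def sadj_def by auto
    show "f v \<in> H v f" if v: "v \<in> B"
    proof -
      have "v \<notin> S" "v \<notin> A" using v B by auto
      thus ?thesis using f(4) v unfolding H_def sadj_def by auto
    qed
  qed auto
  also have "\<dots> \<le> ?p {f. G' f} * (\<Prod>v\<in>S \<union> B. c v)"
    unfolding rand_sets_def
  proof (rule prob_Pi_pmf_coordinates_le)
    fix f :: "nat \<Rightarrow> nat set" and v u y assume "v \<in> S \<union> B"
    hence vA: "v \<notin> A" using S B by auto
    hence ne: "i \<in> A \<Longrightarrow> (f(v := y)) i = f i" for i by auto
    have "nonadj_prob A (f(v := y)) = nonadj_prob A f" by (rule nonadj_prob_cong) (rule ne)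
    thus "G' (f(v := y)) = G' f" unfolding G'_def G[OF vA] by simp
    show "H u (f(v := y)) = H u f" unfolding H_def by (simp only: ne cong: ball_cong bex_cong)
  next
    fix f v assume f: "G' f" and v: "v \<in> S \<union> B"
    show "measure_pmf.prob (kset_pmf P K) (H v f) \<le> c v"
    proof (cases "v \<in> S")
      case True
      thus ?thesis using prob_adj_some_le[OF fin(1), of f] f G_valid by (simp add: H_def c_def G'_def)
    next
      case False
      thus ?thesis using f by (simp add: H_def c_def G'_def nonadj_prob_def)
    qed
  qed (use S B \<beta> w_pos in \<open>auto simp: c_def\<close>)
  also have "(\<Prod>v\<in>S \<union> B. c v) = (real (card A) * w) ^ card S * \<beta> ^ card B"
  proof -
    have "(\<Prod>v\<in>B. c v) = (\<Prod>v\<in>B. \<beta>)" by (rule prod.cong) (use disj in \<open>auto simp: c_def\<close>)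
    moreover have "(\<Prod>v\<in>S. c v) = (\<Prod>v\<in>S. real (card A) * w)" by (rule prod.cong) (auto simp: c_def)
    ultimately show ?thesis using fin disj by (simp add: prod.union_disjoint)
  qed
  also have "?p {f. G' f} * ((real (card A) * w) ^ card S * \<beta> ^ card B) \<le> ?p {f. G f} * ((real (card A) * w) ^ card S * \<beta> ^ card B)"
    using \<beta> w_pos by (intro mult_right_mono measure_pmf.finite_measure_mono) (auto simp: G'_def)
  finally show ?thesis .
qed

text \<open>A property of the item sets alone. Asking for it simultaneously for all small
  \<open>A\<close> lets its failure be paid for once, instead of in every term of the union bound
  over cuts.\<close>

definition expanding :: "nat \<Rightarrow> nat \<Rightarrow> (nat \<Rightarrow> real) \<Rightarrow> (nat \<Rightarrow> nat set) set" where
  "expanding n M \<beta> = {f. \<forall>A\<subseteq>{..<n}. 1 \<le> card A \<longrightarrow> card A \<le> M \<longrightarrow> nonadj_prob A f \<le> \<beta> (card A)}"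

text \<open>Besides the failure of \<open>expanding\<close> there is one term per range of the size
  \<open>m\<close> of the component. Up to \<open>M1\<close> it is listed as a search list, and the
  cost of its edges compensates the \<open>n ^ m\<close> lists. Up to \<open>M\<close> only the sets
  are counted and the edges are ignored. Beyond \<open>M\<close> only \<open>M\<close> of its
  vertices and a set of common non-neighbours are recorded.\<close>

lemma prob_not_k_connected_le:
  assumes k: "1 \<le> k" and M: "M1 \<le> M" "1 \<le> M" and \<beta>: "\<And>m. 0 \<le> \<beta> m" "\<And>m. \<beta> m \<le> 1"
  shows "measure_pmf.prob (rand_sets n K P)
      {f. min_degree_ge k {..<n} (sadj s f) \<and> \<not> k_vertex_connected k {..<n} (sadj s f)}
    \<le> measure_pmf.prob (rand_sets n K P) (- expanding n M \<beta>)
      + (\<Sum>m=2..M1. \<Sum>d<k. real n ^ m * real n ^ d * (fact (m - 1) * w ^ (m - 1) * ((real m * w) ^ d * \<beta> m ^ (n - m - d))))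
      + (\<Sum>m=Suc M1..M. \<Sum>d<k. real (n choose m) * real n ^ d * \<beta> m ^ (n - m - d))
      + 4 ^ n * \<beta> M ^ (n - n div 2 - k)"
proof -
  let ?p = "measure_pmf.prob (rand_sets n K P)"
  let ?V = "{..<n}"
  let ?valid = "\<lambda>A f. \<forall>i\<in>A. f i \<in> ksubsets P K"
  define SS where "SS = (\<lambda>d. {S. S \<subseteq> ?V \<and> card S = d})"
  define LL where "LL = (\<lambda>m. {vs. set vs \<subseteq> ?V \<and> length vs = m})"
  define CUT where "CUT = (\<lambda>A S b f. nonadj_prob A f \<le> b \<and> (\<forall>v\<in>S. \<exists>a\<in>A. sadj s f v a) \<and> (\<forall>v\<in>?V - A - S. \<forall>a\<in>A. \<not> sadj s f v a))"
  define X1 where "X1 = (\<lambda>(vs, S). {f. ?valid (set vs) f \<and> search_list (sadj s f) vs \<and> S \<subseteq> ?V - set vs \<and> CUT (set vs) S (\<beta> (length vs)) f})"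
  define X2 where "X2 = (\<lambda>(A, S). {f. ?valid A f \<and> S \<subseteq> ?V - A \<and> CUT A S (\<beta> (card A)) f})"
  \<comment> \<open>At most half of the vertices are in the component and fewer than
    \<open>k\<close> in the cut, so at least \<open>n - n div 2 - k\<close> vertices are adjacent to
    nothing in the component.\<close>
  define I3 where "I3 = {(A, B). A \<subseteq> ?V \<and> B \<subseteq> ?V - A \<and> card A = M \<and> n - n div 2 - k \<le> card B}"
  define X3 where "X3 = (\<lambda>(A, B). {f. ?valid A f \<and> nonadj_prob A f \<le> \<beta> M \<and> (\<forall>v\<in>B. \<forall>a\<in>A. \<not> sadj s f v a)})"
  define Y1 where "Y1 = (\<Union>m\<in>{2..M1}. \<Union>d\<in>{..<k}. \<Union>(X1 ` (LL m \<times> SS d)))"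
  define Y2 where "Y2 = (\<Union>m\<in>{Suc M1..M}. \<Union>d\<in>{..<k}. \<Union>(X2 ` (SS m \<times> SS d)))"
  define Y3 where "Y3 = \<Union>(X3 ` I3)"
  have finSS: "finite (SS d)" for d unfolding SS_def by (rule finite_subset[of _ "Pow ?V"]) auto
  have cardSS: "card (SS d) = n choose d" for d unfolding SS_def using n_subsets[of ?V d] by simp
  have finLL: "finite (LL m)" and cardLL: "card (LL m) = n ^ m" for m
    unfolding LL_def using finite_lists_length_eq[of ?V m] card_lists_length_eq[of ?V m] by auto
  have cover: "?p {f. min_degree_ge k ?V (sadj s f) \<and> \<not> k_vertex_connected k ?V (sadj s f)}
      \<le> ?p (- expanding n M \<beta> \<union> Y1 \<union> Y2 \<union> Y3)"
  proof (rule prob_rand_sets_mono)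
    fix f assume valid: "\<And>i. i < n \<Longrightarrow> f i \<in> ksubsets P K"
      and "f \<in> {f. min_degree_ge k ?V (sadj s f) \<and> \<not> k_vertex_connected k ?V (sadj s f)}"
    hence f: "\<not> k_vertex_connected k ?V (sadj s f)" "min_degree_ge k ?V (sadj s f)" by auto
    show "f \<in> - expanding n M \<beta> \<union> Y1 \<union> Y2 \<union> Y3"
    proof (cases "f \<in> expanding n M \<beta>")
      case True
      obtain vs S where vs: "search_list (sadj s f) vs" "set vs \<subseteq> ?V" "2 \<le> length vs" "2 * length vs \<le> card ?V"
        and S: "S \<subseteq> ?V - set vs" "card S < k" "\<forall>v\<in>S. \<exists>a\<in>set vs. sadj s f v a"
        and no: "\<forall>v\<in>?V - set vs - S. \<forall>a\<in>set vs. \<not> sadj s f v a"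
        by (rule small_cut_if_not_k_vertex_connected[OF finite_lessThan sadj_sym sadj_irrefl k f])
      define m where "m = length vs"
      have cm: "card (set vs) = m" using vs(1) by (simp add: m_def search_list_def distinct_card)
      have va: "?valid (set vs) f" using vs(2) valid by auto
      have nb: "nonadj_prob A f \<le> \<beta> (card A)" if "A \<subseteq> ?V" "1 \<le> card A" "card A \<le> M" for A
        using True that by (auto simp: expanding_def)
      have CUT: "CUT (set vs) S (\<beta> m) f" if "m \<le> M"
        unfolding CUT_def using nb[OF vs(2)] cm vs(3) that S(3) no by (auto simp: m_def)
      have SSS: "S \<in> SS (card S)" using S by (auto simp: SS_def)
      consider "m \<le> M1" | "M1 < m" "m \<le> M" | "M < m" by linarith
      thus ?thesis
      proof cases
        case 1
        hence "f \<in> X1 (vs, S)" using CUT va vs S M by (simp add: X1_def m_def)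
        moreover have "(vs, S) \<in> LL m \<times> SS (card S)" using SSS vs(2) by (simp add: LL_def m_def)
        ultimately have "f \<in> Y1" unfolding Y1_def using 1 vs(3) S(2)
          by (intro UN_I[of m] UN_I[of "card S"] UnionI[of "X1 (vs, S)"] imageI) (auto simp: m_def)
        thus ?thesis by blast
      next
        case 2
        hence "f \<in> X2 (set vs, S)" using CUT va S by (simp add: X2_def cm)
        moreover have "(set vs, S) \<in> SS m \<times> SS (card S)" using SSS vs(2) cm by (simp add: SS_def)
        ultimately have "f \<in> Y2" unfolding Y2_def using 2 S(2)
          by (intro UN_I[of m] UN_I[of "card S"] UnionI[of "X2 (set vs, S)"] imageI) auto
        thus ?thesis by blast
      next
        case 3
        \<comment> \<open>A part of exactly \<open>M\<close> vertices suffices: what is adjacent to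
          nothing in the component is adjacent to nothing in the part, and \<open>expanding\<close>
          applies at size \<open>M\<close>.\<close>
        hence "M \<le> card (set vs)" using cm by simp
        then obtain A where A: "A \<subseteq> set vs" "card A = M" by (meson obtain_subset_with_card_n)
        define B where "B = ?V - set vs - S"
        have finS: "finite S" using S(1) finite_subset by blast
        have "card B = n - m - card S"
          unfolding B_def using S(1) finS vs(2) cm by (simp add: card_Diff_subset)
        hence cB: "n - n div 2 - k \<le> card B" using vs(4) S(2) by (simp add: m_def)
        have "(A, B) \<in> I3" using A cB vs(2) by (auto simp: I3_def B_def)
        moreover have "nonadj_prob A f \<le> \<beta> M" using nb[of A] A vs(2) M by auto
        hence "f \<in> X3 (A, B)" using A va no by (auto simp: X3_def B_def)
        ultimately have "f \<in> Y3" unfolding Y3_def by blast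
        thus ?thesis by blast
      qed
    qed auto
  qed
  have Y1: "?p Y1 \<le> (\<Sum>m=2..M1. \<Sum>d<k. real n ^ m * real n ^ d * (fact (m - 1) * w ^ (m - 1) * ((real m * w) ^ d * \<beta> m ^ (n - m - d))))"
  proof -
    have "?p (\<Union>(X1 ` (LL m \<times> SS d))) \<le> real n ^ m * real n ^ d * (fact (m - 1) * w ^ (m - 1) * ((real m * w) ^ d * \<beta> m ^ (n - m - d)))"
      if m: "2 \<le> m" for m d
    proof -
      let ?c = "fact (m - 1) * w ^ (m - 1) * ((real m * w) ^ d * \<beta> m ^ (n - m - d))"
      have c0: "0 \<le> ?c" using w_pos \<beta> by simp
      have X1: "?p (X1 (vs, S)) \<le> ?c" if vs: "vs \<in> LL m" and S: "S \<in> SS d" for vs S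
      proof (cases "distinct vs \<and> S \<subseteq> ?V - set vs")
        case True
        have card: "card (set vs) = m" "length vs = m" "card S = d" "finite S" "set vs \<subseteq> ?V"
          using True vs S by (auto simp: LL_def SS_def distinct_card intro: finite_subset[OF _ finite_lessThan[of n]])
        have cB: "card (?V - set vs - S) = n - m - d"
          using card True by (simp add: card_Diff_subset)
        let ?G = "\<lambda>f. ?valid (set vs) f \<and> search_list (sadj s f) vs"
        have "?p (X1 (vs, S)) = ?p {f. ?G f \<and> CUT (set vs) S (\<beta> m) f}"
          using True card by (intro arg_cong[where f = ?p]) (auto simp: X1_def)
        also have "\<dots> \<le> ?p {f. ?G f} * ((real (card (set vs)) * w) ^ card S * \<beta> m ^ card (?V - set vs - S))"
          unfolding CUT_def
        proof (rule prob_cut_le)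
          fix f :: "nat \<Rightarrow> nat set" and v y assume "v \<notin> set vs"
          hence ne: "i \<in> set vs \<Longrightarrow> (f(v := y)) i = f i" for i by auto
          have "search_list (sadj s (f(v := y))) vs = search_list (sadj s f) vs"
            by (rule search_list_cong) (simp only: sadj_def ne)
          thus "?G (f(v := y)) = ?G f" by (simp only: ne cong: ball_cong)
        qed (use True card \<beta> in auto)
        also have "\<dots> \<le> (fact (m - 1) * w ^ (m - 1)) * ((real (card (set vs)) * w) ^ card S * \<beta> m ^ card (?V - set vs - S))"
        proof (rule mult_right_mono)
          have "vs \<noteq> []" using m card by auto
          from prob_search_list_le[OF this card(5)] card(2)
          show "?p {f. ?G f} \<le> fact (m - 1) * w ^ (m - 1)" by simp
        qed (use w_pos \<beta> in auto)
        finally show ?thesis by (simp only: card cB)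
      next
        case False
        hence "X1 (vs, S) = {}" by (auto simp: X1_def search_list_def)
        thus ?thesis using c0 by simp
      qed
      have "?p (\<Union>(X1 ` (LL m \<times> SS d))) \<le> (\<Sum>z\<in>LL m \<times> SS d. ?p (X1 z))"
        by (rule prob_le_sum_prob) (use finLL finSS in auto)
      also have "\<dots> \<le> (\<Sum>z\<in>LL m \<times> SS d. ?c)" by (rule sum_mono) (use X1 in auto)
      also have "\<dots> = real n ^ m * real (n choose d) * ?c" by (simp add: card_cartesian_product cardLL cardSS)
      also have "\<dots> \<le> real n ^ m * real n ^ d * ?c"
        by (intro mult_right_mono mult_left_mono choose_le_power c0) auto
      finally show ?thesis .
    qed
    note step = this
    have "?p Y1 \<le> (\<Sum>m=2..M1. ?p (\<Union>d\<in>{..<k}. \<Union>(X1 ` (LL m \<times> SS d))))"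
      by (rule prob_le_sum_prob) (auto simp: Y1_def)
    also have "\<dots> \<le> (\<Sum>m=2..M1. \<Sum>d<k. ?p (\<Union>(X1 ` (LL m \<times> SS d))))"
      by (intro sum_mono prob_le_sum_prob) auto
    also have "\<dots> \<le> (\<Sum>m=2..M1. \<Sum>d<k. real n ^ m * real n ^ d * (fact (m - 1) * w ^ (m - 1) * ((real m * w) ^ d * \<beta> m ^ (n - m - d))))"
      by (intro sum_mono step) auto
    finally show ?thesis .
  qed
  have Y2: "?p Y2 \<le> (\<Sum>m=Suc M1..M. \<Sum>d<k. real (n choose m) * real n ^ d * \<beta> m ^ (n - m - d))"
  proof -
    have "?p (\<Union>(X2 ` (SS m \<times> SS d))) \<le> real (n choose m) * real n ^ d * \<beta> m ^ (n - m - d)" for m d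
    proof -
      have X2: "?p (X2 (A, S)) \<le> \<beta> m ^ (n - m - d)" if A: "A \<in> SS m" and S: "S \<in> SS d" for A S
      proof (cases "S \<subseteq> ?V - A")
        case True
        have card: "card A = m" "card S = d" "finite S" "finite A" "A \<subseteq> ?V"
          using True A S by (auto simp: SS_def intro: finite_subset[OF _ finite_lessThan[of n]])
        have cB: "card (?V - A - S) = n - m - d"
          using card True by (simp add: card_Diff_subset)
        \<comment> \<open>The adjacencies of the cut are dropped by applying
          \<open>prob_cut_le\<close> with an empty set in place of \<open>S\<close>.\<close>
        have "?p (X2 (A, S)) \<le> ?p {f. ?valid A f \<and> nonadj_prob A f \<le> \<beta> m \<and> (\<forall>v\<in>{}. \<exists>a\<in>A. sadj s f v a) \<and> (\<forall>v\<in>?V - A - S. \<forall>a\<in>A. \<not> sadj s f v a)}"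
          using card by (intro measure_pmf.finite_measure_mono) (auto simp: X2_def CUT_def)
        also have "\<dots> \<le> ?p {f. ?valid A f} * ((real (card A) * w) ^ card ({} :: nat set) * \<beta> m ^ card (?V - A - S))"
        proof (rule prob_cut_le)
          fix f :: "nat \<Rightarrow> nat set" and v y assume "v \<notin> A"
          hence ne: "i \<in> A \<Longrightarrow> (f(v := y)) i = f i" for i by auto
          show "?valid A (f(v := y)) = ?valid A f" by (simp only: ne cong: ball_cong)
        qed (use card \<beta> in auto)
        also have "\<dots> \<le> 1 * ((real (card A) * w) ^ card ({} :: nat set) * \<beta> m ^ card (?V - A - S))"
          by (intro mult_right_mono) (use w_pos \<beta> in auto)
        finally show ?thesis by (simp add: cB)
      next
        case False
        hence "X2 (A, S) = {}" by (auto simp: X2_def)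
        thus ?thesis using \<beta> by simp
      qed
      have "?p (\<Union>(X2 ` (SS m \<times> SS d))) \<le> (\<Sum>z\<in>SS m \<times> SS d. ?p (X2 z))"
        by (rule prob_le_sum_prob) (use finSS in auto)
      also have "\<dots> \<le> (\<Sum>z\<in>SS m \<times> SS d. \<beta> m ^ (n - m - d))" by (rule sum_mono) (use X2 in auto)
      also have "\<dots> = real (n choose m) * real (n choose d) * \<beta> m ^ (n - m - d)" by (simp add: card_cartesian_product cardSS)
      also have "\<dots> \<le> real (n choose m) * real n ^ d * \<beta> m ^ (n - m - d)"
        by (intro mult_right_mono mult_left_mono choose_le_power) (use \<beta> in auto)
      finally show ?thesis .
    qed
    note step = this
    have "?p Y2 \<le> (\<Sum>m=Suc M1..M. ?p (\<Union>d\<in>{..<k}. \<Union>(X2 ` (SS m \<times> SS d))))"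
      by (rule prob_le_sum_prob) (auto simp: Y2_def)
    also have "\<dots> \<le> (\<Sum>m=Suc M1..M. \<Sum>d<k. ?p (\<Union>(X2 ` (SS m \<times> SS d))))"
      by (intro sum_mono prob_le_sum_prob) auto
    also have "\<dots> \<le> (\<Sum>m=Suc M1..M. \<Sum>d<k. real (n choose m) * real n ^ d * \<beta> m ^ (n - m - d))"
      by (intro sum_mono step)
    finally show ?thesis .
  qed
  have Y3: "?p Y3 \<le> 4 ^ n * \<beta> M ^ (n - n div 2 - k)"
  proof -
    have I3: "I3 \<subseteq> Pow ?V \<times> Pow ?V" by (auto simp: I3_def)
    hence finI3: "finite I3" by (rule finite_subset) simp
    \<comment> \<open>Both members of a pair are arbitrary vertex sets, hence
      \<open>2 ^ n * 2 ^ n\<close>.\<close>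
    have "card I3 \<le> card (Pow ?V \<times> Pow ?V)" using I3 by (intro card_mono) auto
    also have "\<dots> = 4 ^ n" by (simp add: card_cartesian_product card_Pow flip: power_mult_distrib)
    finally have cI3: "real (card I3) \<le> 4 ^ n" by (metis of_nat_le_iff of_nat_numeral of_nat_power)
    have X3: "?p (X3 z) \<le> \<beta> M ^ (n - n div 2 - k)" if z: "z \<in> I3" for z
    proof -
      obtain A B where AB: "z = (A, B)" "A \<subseteq> ?V" "B \<subseteq> ?V - A" "card A = M" "n - n div 2 - k \<le> card B"
        using z by (auto simp: I3_def)
      have "?p (X3 z) = ?p {f. ?valid A f \<and> nonadj_prob A f \<le> \<beta> M \<and> (\<forall>v\<in>{}. \<exists>a\<in>A. sadj s f v a) \<and> (\<forall>v\<in>B. \<forall>a\<in>A. \<not> sadj s f v a)}"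
        by (simp add: AB(1) X3_def)
      also have "\<dots> \<le> ?p {f. ?valid A f} * ((real (card A) * w) ^ card ({} :: nat set) * \<beta> M ^ card B)"
      proof (rule prob_cut_le)
        fix f :: "nat \<Rightarrow> nat set" and v y assume "v \<notin> A"
        hence ne: "i \<in> A \<Longrightarrow> (f(v := y)) i = f i" for i by auto
        show "?valid A (f(v := y)) = ?valid A f" by (simp only: ne cong: ball_cong)
      qed (use AB \<beta> in auto)
      also have "\<dots> \<le> 1 * ((real (card A) * w) ^ card ({} :: nat set) * \<beta> M ^ card B)"
        by (intro mult_right_mono) (use w_pos \<beta> in auto)
      also have "\<dots> \<le> \<beta> M ^ (n - n div 2 - k)" using AB(5) \<beta> by (simp add: power_decreasing)
      finally show ?thesis .
    qed
    have "?p Y3 \<le> (\<Sum>z\<in>I3. ?p (X3 z))" by (rule prob_le_sum_prob[OF finI3]) (simp add: Y3_def)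
    also have "\<dots> \<le> (\<Sum>z\<in>I3. \<beta> M ^ (n - n div 2 - k))" by (intro sum_mono X3)
    also have "\<dots> = real (card I3) * \<beta> M ^ (n - n div 2 - k)" by simp
    also have "\<dots> \<le> 4 ^ n * \<beta> M ^ (n - n div 2 - k)" by (intro mult_right_mono cI3) (use \<beta> in auto)
    finally show ?thesis .
  qed
  have "?p (- expanding n M \<beta> \<union> Y1 \<union> Y2 \<union> Y3) \<le> ?p (- expanding n M \<beta>) + ?p Y1 + ?p Y2 + ?p Y3"
    using measure_Un_le[of "- expanding n M \<beta>" "rand_sets n K P" Y1]
      measure_Un_le[of "- expanding n M \<beta> \<union> Y1" "rand_sets n K P" Y2]
      measure_Un_le[of "- expanding n M \<beta> \<union> Y1 \<union> Y2" "rand_sets n K P" Y3] by simp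
  with cover Y1 Y2 Y3 show ?thesis by linarith
qed

end

section \<open>Most vertices are adjacent to a given set of vertices\<close>

lemma power_div_fact_le_exp: "real d ^ d / fact d \<le> exp (real d)"
proof -
  have "real d ^ d / fact d \<le> (\<Sum>i. real d ^ i / fact i)"
    using sum_le_suminf[of "\<lambda>i. real d ^ i / fact i" "{d}"] summable_exp[of "real d"]
    by (simp add: field_simps)
  thus ?thesis by (simp add: exp_def field_simps)
qed

lemma choose_mult_power_le_exp: "real (N choose d) * real d ^ d \<le> real N ^ d * exp (real d)"
proof -
  have "real (N choose d) * real d ^ d \<le> (real N ^ d / fact d) * real d ^ d"
    by (intro mult_right_mono choose_le_power_div_fact) auto
  also have "\<dots> = real N ^ d * (real d ^ d / fact d)" by simp
  also have "\<dots> \<le> real N ^ d * exp (real d)"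
    by (intro mult_left_mono power_div_fact_le_exp) auto
  finally show ?thesis .
qed

lemma choose_le_exp:
  assumes "1 \<le> m" "0 < n"
  shows "real (n choose m) \<le> exp (real m * (1 + ln (real n / real m)))"
proof -
  have "real (n choose m) \<le> real n ^ m * exp (real m) / real m ^ m"
    using choose_mult_power_le_exp[of n m] assms by (simp add: field_simps)
  also have "\<dots> = (real n / real m) ^ m * exp (real m)" by (simp add: power_divide)
  also have "(real n / real m) ^ m = exp (real m * ln (real n / real m))"
    using assms by (simp add: exp_of_nat_mult)
  finally show ?thesis by (simp add: algebra_simps flip: exp_add)
qed

context intersection_params
begin

lemma expanding_mono:
  "(\<And>m. 1 \<le> m \<Longrightarrow> m \<le> M \<Longrightarrow> \<beta> m \<le> \<beta>' m) \<Longrightarrow> expanding n M \<beta> \<subseteq> expanding n M \<beta>'"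
  unfolding expanding_def by (auto intro: order_trans)

text \<open>For \<open>s = 1\<close> only the number of items covered by the vertices in \<open>A\<close> matters.\<close>
lemma nonadj_prob_le_exp:
  assumes "s = 1" "\<And>i. i \<in> A \<Longrightarrow> f i \<in> ksubsets P K"
    and U: "c * real K \<le> real (card (\<Union>i\<in>A. f i))"
  shows "nonadj_prob A f \<le> exp (- (c * w))"
proof -
  define U where "U = (\<Union>i\<in>A. f i)"
  have UP: "U \<subseteq> {..<P}" using assms(2) ksubsetsD(1) by (force simp: U_def)
  have finU: "finite U" using UP finite_subset by blast
  have cU: "card U \<le> P" using card_mono[OF _ UP] by simp
  have "nonadj_prob A f \<le> measure_pmf.prob (kset_pmf P K) {T. T \<subseteq> {..<P} - U}"
  proof -
    have "nonadj_prob A f = measure_pmf.prob (kset_pmf P K) ({T. \<forall>i\<in>A. \<not> s \<le> card (T \<inter> f i)} \<inter> set_pmf (kset_pmf P K))"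
      by (simp add: nonadj_prob_def measure_Int_set_pmf)
    also have "\<dots> \<le> measure_pmf.prob (kset_pmf P K) {T. T \<subseteq> {..<P} - U}"
    proof (rule measure_pmf.finite_measure_mono, safe)
      fix T j assume T: "\<forall>i\<in>A. \<not> s \<le> card (T \<inter> f i)" "T \<in> set_pmf (kset_pmf P K)" "j \<in> T"
      have TK: "T \<in> ksubsets P K" using T(2) ksubsets_nonempty[OF K_le_P] by simp
      show "j < P" using ksubsetsD(1)[OF TK] T(3) by auto
      assume "j \<in> U"
      then obtain i where i: "i \<in> A" "j \<in> f i" by (auto simp: U_def)
      have "T \<inter> f i = {}" using T(1) i assms(1) ksubsetsD(3)[OF TK] by (auto simp: Suc_le_eq card_gt_0_iff)
      thus False using T(3) i by auto
    qed auto
    finally show ?thesis .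
  qed
  also have "\<dots> \<le> (real (card ({..<P} - U)) / real P) ^ K"
    by (rule prob_kset_subset_le[OF K_le_P P_pos]) auto
  also have "real (card ({..<P} - U)) = real P - real (card U)"
    using UP finU cU by (simp add: card_Diff_subset of_nat_diff)
  also have "((real P - real (card U)) / real P) ^ K \<le> exp (- (real (card U) / real P)) ^ K"
  proof (rule power_mono)
    have "(real P - real (card U)) / real P = 1 + - (real (card U) / real P)"
      using P_pos by (simp add: field_simps)
    also have "\<dots> \<le> exp (- (real (card U) / real P))" by (rule exp_ge_add_one_self)
    finally show "(real P - real (card U)) / real P \<le> exp (- (real (card U) / real P))" .
    show "0 \<le> (real P - real (card U)) / real P" using cU by simp
  qed
  also have "\<dots> = exp (- (real K * real (card U) / real P))" by (simp flip: exp_of_nat_mult)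
  also have "\<dots> \<le> exp (- (c * w))"
  proof -
    have "c * w = real K * (c * real K) / real P"
    proof -
      have "w = real K * real K / real P" by (subst w_def) (simp add: assms(1) power2_eq_square)
      thus ?thesis by simp
    qed
    also have "\<dots> \<le> real K * real (card U) / real P"
      using U by (intro divide_right_mono mult_left_mono) (auto simp: U_def)
    finally show ?thesis by simp
  qed
  finally show ?thesis .
qed

lemma prob_all_subset_le:
  assumes A: "A \<subseteq> {..<n}" and W: "W \<subseteq> {..<P}"
  shows "measure_pmf.prob (rand_sets n K P) {f. \<forall>i\<in>A. f i \<subseteq> W} \<le> (real (card W) / real P) ^ (K * card A)"
proof -
  have "measure_pmf.prob (rand_sets n K P) {f. True \<and> (\<forall>i\<in>A. f i \<in> {T. T \<subseteq> W})}
      \<le> measure_pmf.prob (rand_sets n K P) {f. True} * (\<Prod>i\<in>A. (real (card W) / real P) ^ K)"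
    unfolding rand_sets_def
    by (rule prob_Pi_pmf_coordinates_le) (use A prob_kset_subset_le[OF K_le_P P_pos W] in auto)
  thus ?thesis by (simp add: power_mult)
qed

text \<open>A small union lies in some set \<open>W\<close> of \<open>d\<close> items. The union
  bound over \<open>W\<close> costs \<open>P choose d\<close>, which \<open>d\<close> of the
  \<open>card A * K\<close> factors \<open>d / P\<close> reduce to at most \<open>exp d\<close>; at
  least \<open>\<epsilon> * card A * K\<close> factors remain, each at most
  \<open>card A * K / P\<close>.\<close>

lemma prob_small_union_le:
  assumes \<epsilon>: "0 < \<epsilon>" "\<epsilon> < 1" and A: "A \<subseteq> {..<n}" "A \<noteq> {}" and m: "card A * K \<le> P"
  shows "measure_pmf.prob (rand_sets n K P) {f. real (card (\<Union>i\<in>A. f i)) < (1 - \<epsilon>) * (real (card A) * real K)}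
     \<le> exp (real (card A) * (real K + \<epsilon> * real K * ln (real (card A) * real K / real P)))"
proof -
  define m where "m = card A"
  have finA: "finite A" using A finite_subset by blast
  have m0: "0 < m" using A finA by (simp add: m_def card_gt_0_iff)
  \<comment> \<open>The largest size permitted by the event. Smaller unions are padded to exactly
    \<open>d\<close> items, so only one size has to be counted.\<close>
  define d where "d = nat \<lfloor>(1 - \<epsilon>) * (real m * real K)\<rfloor>"
  have d_le: "real d \<le> (1 - \<epsilon>) * (real m * real K)" using \<epsilon> by (simp add: d_def)
  also have "\<dots> \<le> 1 * (real m * real K)" using \<epsilon> by (intro mult_right_mono) auto
  finally have "real d \<le> real (m * K)" by simp
  hence dmK: "d \<le> m * K" by (simp only: of_nat_le_iff)
  hence dP: "d \<le> P" using m by (simp add: m_def)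
  define y where "y = real m * real K / real P"
  have "real (m * K) \<le> real P" using m unfolding m_def by (simp only: of_nat_le_iff)
  hence y: "0 < y" "y \<le> 1" using m0 K_pos P_pos by (auto simp: y_def)
  define WW where "WW = {W. W \<subseteq> {..<P} \<and> card W = d}"
  have "measure_pmf.prob (rand_sets n K P) {f. real (card (\<Union>i\<in>A. f i)) < (1 - \<epsilon>) * (real m * real K)}
     \<le> measure_pmf.prob (rand_sets n K P) (\<Union>W\<in>WW. {f. \<forall>i\<in>A. f i \<subseteq> W})"
  proof (rule prob_rand_sets_mono)
    fix f assume f: "\<And>i. i < n \<Longrightarrow> f i \<in> ksubsets P K"
      "f \<in> {f. real (card (\<Union>i\<in>A. f i)) < (1 - \<epsilon>) * (real m * real K)}"
    define U where "U = (\<Union>i\<in>A. f i)"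
    have UP: "U \<subseteq> {..<P}" using f(1) ksubsetsD(1) A(1) by (force simp: U_def)
    have finU: "finite U" using UP finite_subset by blast
    have "real (card U) < (1 - \<epsilon>) * (real m * real K)" using f(2) by (simp add: U_def)
    hence cU: "card U \<le> d" unfolding d_def by linarith
    have "d - card U \<le> card ({..<P} - U)" using dP UP finU by (simp add: card_Diff_subset)
    then obtain Z where Z: "Z \<subseteq> {..<P} - U" "card Z = d - card U" by (meson obtain_subset_with_card_n)
    have "finite Z" using Z finite_subset[of Z "{..<P} - U"] by simp
    hence "card (U \<union> Z) = card U + card Z" using finU Z by (intro card_Un_disjoint) auto
    hence "U \<union> Z \<in> WW" using Z UP cU by (auto simp: WW_def)
    moreover have "\<forall>i\<in>A. f i \<subseteq> U \<union> Z" by (auto simp: U_def)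
    ultimately show "f \<in> (\<Union>W\<in>WW. {f. \<forall>i\<in>A. f i \<subseteq> W})" by blast
  qed
  also have "\<dots> \<le> (\<Sum>W\<in>WW. measure_pmf.prob (rand_sets n K P) {f. \<forall>i\<in>A. f i \<subseteq> W})"
    by (rule prob_le_sum_prob) (auto simp: WW_def)
  also have "\<dots> \<le> (\<Sum>W\<in>WW. (real d / real P) ^ (K * m))"
  proof (rule sum_mono)
    fix W assume "W \<in> WW"
    thus "measure_pmf.prob (rand_sets n K P) {f. \<forall>i\<in>A. f i \<subseteq> W} \<le> (real d / real P) ^ (K * m)"
      using prob_all_subset_le[OF A(1), of W] by (auto simp: WW_def m_def)
  qed
  also have "\<dots> = real (P choose d) * (real d / real P) ^ (K * m)"
    using n_subsets[of "{..<P}" d] by (simp add: WW_def)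
  also have "\<dots> = real (P choose d) * (real d / real P) ^ d * (real d / real P) ^ (K * m - d)"
  proof -
    have e: "K * m = d + (K * m - d)" using dmK by (simp add: mult.commute)
    show ?thesis by (subst e, subst power_add) (simp only: mult.assoc)
  qed
  also have "\<dots> \<le> exp (real d) * y ^ (K * m - d)"
  proof (intro mult_mono power_mono)
    show "real (P choose d) * (real d / real P) ^ d \<le> exp (real d)"
      using choose_mult_power_le_exp[of P d] P_pos by (simp add: power_divide divide_le_eq mult.commute)
    have "real d \<le> real (m * K)" using dmK by (simp only: of_nat_le_iff)
    thus "real d / real P \<le> y" unfolding y_def by (simp add: divide_right_mono)
  qed (use y in auto)
  also have "\<dots> \<le> exp (real m * real K) * exp (\<epsilon> * (real m * real K) * ln y)"
  proof (intro mult_mono)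
    have "real d \<le> real (m * K)" using dmK by (simp only: of_nat_le_iff)
    thus "exp (real d) \<le> exp (real m * real K)" by simp
    have "y ^ (K * m - d) = exp (real (K * m - d) * ln y)" using y by (simp add: exp_of_nat_mult)
    also have "\<dots> \<le> exp (\<epsilon> * (real m * real K) * ln y)"
    proof -
      have "\<epsilon> * (real m * real K) \<le> real m * real K - real d" using d_le by (simp add: algebra_simps)
      also have "\<dots> = real (K * m - d)" using dmK by (simp add: of_nat_diff mult.commute)
      finally have "\<epsilon> * (real m * real K) \<le> real (K * m - d)" .
      moreover have "ln y \<le> 0" using y by simp
      ultimately have "real (K * m - d) * ln y \<le> \<epsilon> * (real m * real K) * ln y" by (rule mult_right_mono_neg)
      thus ?thesis by simp
    qed
    finally show "y ^ (K * m - d) \<le> exp (\<epsilon> * (real m * real K) * ln y)" .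
  qed (use y in auto)
  also have "\<dots> = exp (real m * (real K + \<epsilon> * real K * ln y))"
    by (simp add: algebra_simps flip: exp_add)
  finally show ?thesis by (simp add: m_def y_def)
qed

lemma prob_not_expanding_s1_le:
  assumes "s = 1" and \<epsilon>: "0 < \<epsilon>" "\<epsilon> < 1" and M: "M * K \<le> P" and n: "0 < n"
  shows "measure_pmf.prob (rand_sets n K P) (- expanding n M (\<lambda>m. exp (- ((1 - \<epsilon>) * real m * w))))
     \<le> (\<Sum>m=1..M. exp (real m * (1 + ln (real n / real m) + real K + \<epsilon> * real K * ln (real m * real K / real P))))"
proof -
  let ?p = "measure_pmf.prob (rand_sets n K P)"
  let ?X = "\<lambda>A. {f. real (card (\<Union>i\<in>A. f i)) < (1 - \<epsilon>) * (real (card A) * real K)}"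
  define AA where "AA = (\<lambda>m. {A. A \<subseteq> {..<n} \<and> card A = m})"
  have fin: "finite (AA m)" for m unfolding AA_def by (rule finite_subset[of _ "Pow {..<n}"]) auto
  have "?p (- expanding n M (\<lambda>m. exp (- ((1 - \<epsilon>) * real m * w)))) \<le> ?p (\<Union>m\<in>{1..M}. \<Union>A\<in>AA m. ?X A)"
  proof (rule prob_rand_sets_mono)
    fix f assume f: "\<And>i. i < n \<Longrightarrow> f i \<in> ksubsets P K" "f \<in> - expanding n M (\<lambda>m. exp (- ((1 - \<epsilon>) * real m * w)))"
    obtain A where A: "A \<subseteq> {..<n}" "1 \<le> card A" "card A \<le> M" "\<not> nonadj_prob A f \<le> exp (- ((1 - \<epsilon>) * real (card A) * w))"
      using f(2) by (auto simp: expanding_def)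
    have "f \<in> ?X A"
    proof (rule ccontr)
      assume "f \<notin> ?X A"
      hence "(1 - \<epsilon>) * real (card A) * real K \<le> real (card (\<Union>i\<in>A. f i))" by (simp add: mult.assoc)
      from nonadj_prob_le_exp[OF assms(1) _ this] f(1) A show False by auto
    qed
    thus "f \<in> (\<Union>m\<in>{1..M}. \<Union>A\<in>AA m. ?X A)"
      using A by (intro UN_I[of "card A"] UN_I[of A]) (auto simp: AA_def)
  qed
  also have "\<dots> \<le> (\<Sum>m=1..M. ?p (\<Union>A\<in>AA m. ?X A))"
    by (rule prob_le_sum_prob[OF _ order_refl]) simp
  also have "\<dots> \<le> (\<Sum>m=1..M. \<Sum>A\<in>AA m. ?p (?X A))"
    by (rule sum_mono, rule prob_le_sum_prob[OF fin order_refl])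
  also have "\<dots> \<le> (\<Sum>m=1..M. exp (real m * (1 + ln (real n / real m) + real K + \<epsilon> * real K * ln (real m * real K / real P))))"
  proof (rule sum_mono)
    fix m assume m: "m \<in> {1..M}"
    let ?e = "exp (real m * (real K + \<epsilon> * real K * ln (real m * real K / real P)))"
    have "(\<Sum>A\<in>AA m. ?p (?X A)) \<le> (\<Sum>A\<in>AA m. ?e)"
    proof (rule sum_mono)
      fix A assume A: "A \<in> AA m"
      have "card A * K \<le> M * K" using A m by (intro mult_right_mono) (auto simp: AA_def)
      hence "card A * K \<le> P" using M by linarith
      moreover have "A \<noteq> {}" using A m by (auto simp: AA_def)
      ultimately show "?p (?X A) \<le> ?e" using prob_small_union_le[OF \<epsilon>, of A n] A by (auto simp: AA_def)
    qed
    also have "\<dots> = real (n choose m) * ?e" using n_subsets[of "{..<n}" m] by (simp add: AA_def)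
    also have "\<dots> \<le> exp (real m * (1 + ln (real n / real m))) * ?e"
      by (intro mult_right_mono choose_le_exp) (use m n in auto)
    also have "\<dots> = exp (real m * (1 + ln (real n / real m) + real K + \<epsilon> * real K * ln (real m * real K / real P)))"
      by (simp add: algebra_simps flip: exp_add)
    finally show "(\<Sum>A\<in>AA m. ?p (?X A)) \<le> exp (real m * (1 + ln (real n / real m) + real K + \<epsilon> * real K * ln (real m * real K / real P)))" .
  qed
  finally show ?thesis .
qed

section \<open>Expansion by the second moment inequality and sparse overlaps\<close>

definition overlap_degree :: "nat \<Rightarrow> nat \<Rightarrow> nat \<Rightarrow> (nat \<Rightarrow> nat set) \<Rightarrow> nat" where
  "overlap_degree n l i f = card {j\<in>{..<n}. j \<noteq> i \<and> l \<le> card (f i \<inter> f j)}"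

text \<open>Given \<open>f i\<close>, a set of \<open>d\<close> vertices overlaps it with
  probability at most \<open>x ^ (l * d)\<close>, and the number of such sets is at most
  \<open>(n * exp 1 / d) ^ d\<close>. One factor \<open>exp 1\<close> of the hypothesis pays for
  this count, the other gives the decay \<open>exp (- d)\<close>.\<close>

lemma prob_overlap_degree_le:
  assumes i: "i < n" and d: "exp 2 * (real n * x ^ l) \<le> real d" and n: "0 < n"
  shows "measure_pmf.prob (rand_sets n K P) {f. d \<le> overlap_degree n l i f} \<le> exp (- real d)"
proof -
  let ?p = "measure_pmf.prob (rand_sets n K P)"
  have "0 < exp 2 * (real n * x ^ l)" using x_pos n by simp
  with d have d0: "0 < real d" by linarith
  define JJ where "JJ = {J. J \<subseteq> {..<n} - {i} \<and> card J = d}"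
  have finJJ: "finite JJ" unfolding JJ_def by (rule finite_subset[of _ "Pow {..<n}"]) auto
  have "?p {f. d \<le> overlap_degree n l i f} \<le> ?p (\<Union>J\<in>JJ. {f. f i \<in> ksubsets P K \<and> (\<forall>j\<in>J. f j \<in> {T. l \<le> card (T \<inter> f i)})})"
  proof (rule prob_rand_sets_mono)
    fix f assume f: "\<And>i. i < n \<Longrightarrow> f i \<in> ksubsets P K" "f \<in> {f. d \<le> overlap_degree n l i f}"
    hence "d \<le> card {j\<in>{..<n}. j \<noteq> i \<and> l \<le> card (f i \<inter> f j)}" by (simp add: overlap_degree_def)
    then obtain J where J: "J \<subseteq> {j\<in>{..<n}. j \<noteq> i \<and> l \<le> card (f i \<inter> f j)}" "card J = d"
      by (rule obtain_subset_with_card_n)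
    have "J \<in> JJ" using J by (auto simp: JJ_def)
    moreover have "\<forall>j\<in>J. f j \<in> {T. l \<le> card (T \<inter> f i)}" using J by (auto simp: Int_commute)
    ultimately show "f \<in> (\<Union>J\<in>JJ. {f. f i \<in> ksubsets P K \<and> (\<forall>j\<in>J. f j \<in> {T. l \<le> card (T \<inter> f i)})})"
      using f(1)[OF i] by blast
  qed
  also have "\<dots> \<le> (\<Sum>J\<in>JJ. ?p {f. f i \<in> ksubsets P K \<and> (\<forall>j\<in>J. f j \<in> {T. l \<le> card (T \<inter> f i)})})"
    by (rule prob_le_sum_prob[OF finJJ]) auto
  also have "\<dots> \<le> (\<Sum>J\<in>JJ. (x ^ l) ^ d)"
  proof (rule sum_mono)
    fix J assume J: "J \<in> JJ"
    have "?p {f. f i \<in> ksubsets P K \<and> (\<forall>j\<in>J. f j \<in> {T. l \<le> card (T \<inter> f i)})}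
        \<le> ?p {f. f i \<in> ksubsets P K} * (\<Prod>j\<in>J. x ^ l)"
      unfolding rand_sets_def
    proof (rule prob_Pi_pmf_coordinates_le)
      fix f :: "nat \<Rightarrow> nat set" and v y assume "v \<in> J"
      hence ne: "(f(v := y)) i = f i" using J by (auto simp: JJ_def)
      show "((f(v := y)) i \<in> ksubsets P K) = (f i \<in> ksubsets P K)" by (simp only: ne)
      show "{T. l \<le> card (T \<inter> (f(v := y)) i)} = {T. l \<le> card (T \<inter> f i)}" by (simp only: ne)
    qed (use J x_pos prob_overlap_le in \<open>auto simp: JJ_def\<close>)
    also have "\<dots> \<le> 1 * (\<Prod>j\<in>J. x ^ l)"
      using x_pos by (intro mult_right_mono) (auto intro!: prod_nonneg)
    finally show "?p {f. f i \<in> ksubsets P K \<and> (\<forall>j\<in>J. f j \<in> {T. l \<le> card (T \<inter> f i)})} \<le> (x ^ l) ^ d"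
      using J by (simp add: JJ_def)
  qed
  also have "\<dots> = real ((n - 1) choose d) * (x ^ l) ^ d"
    using n_subsets[of "{..<n} - {i}" d] i by (simp add: JJ_def)
  also have "\<dots> \<le> real (n choose d) * (x ^ l) ^ d"
    using x_pos by (intro mult_right_mono of_nat_mono binomial_right_mono) auto
  also have "\<dots> = (real (n choose d) * real d ^ d) * (x ^ l) ^ d / real d ^ d"
    using d0 by simp
  also have "\<dots> \<le> (real n ^ d * exp (real d)) * (x ^ l) ^ d / real d ^ d"
    using x_pos by (intro divide_right_mono mult_right_mono choose_mult_power_le_exp) auto
  also have "\<dots> = exp (real d) * (real n * x ^ l / real d) ^ d"
    by (simp add: power_mult_distrib power_divide)
  also have "\<dots> \<le> exp (real d) * (exp (- 2)) ^ d"
  proof (intro mult_left_mono power_mono)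
    show "real n * x ^ l / real d \<le> exp (- 2)"
    proof -
      have "real n * x ^ l = exp (- 2) * (exp 2 * (real n * x ^ l))"
        by (simp add: exp_minus)
      also have "\<dots> \<le> exp (- 2) * real d" using d by (intro mult_left_mono) auto
      finally show ?thesis using d0 by (simp add: divide_le_eq)
    qed
  qed (use x_pos in auto)
  also have "\<dots> = exp (real d + real d * (- 2))" by (simp only: exp_add exp_of_nat_mult)
  also have "\<dots> = exp (- real d)" by simp
  finally show ?thesis .
qed

text \<open>The value \<open>3 * s\<close> is chosen so that \<open>n ^ 2 * x ^ (3 * s)\<close>
  vanishes when \<open>x ^ s\<close> is of order \<open>ln n / n\<close>. It bounds every overlap by
  a constant, so that the binomials in \<open>pair_bound\<close> are at most
  \<open>8 ^ s\<close>.\<close>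

definition sparse_overlaps :: "nat \<Rightarrow> (nat \<Rightarrow> nat) \<Rightarrow> (nat \<Rightarrow> nat set) set" where
  "sparse_overlaps n d = {f. (\<forall>i<n. \<forall>j<n. i \<noteq> j \<longrightarrow> card (f i \<inter> f j) < 3 * s) \<and>
     (\<forall>i<n. \<forall>l\<in>{1..s}. overlap_degree n l i f < d l)}"

lemma prob_not_sparse_overlaps_le:
  assumes d: "\<And>l. l \<in> {1..s} \<Longrightarrow> exp 2 * (real n * x ^ l) \<le> real (d l)" and n: "0 < n"
  shows "measure_pmf.prob (rand_sets n K P) (- sparse_overlaps n d)
     \<le> real n ^ 2 * x ^ (3 * s) + real n * (\<Sum>l=1..s. exp (- real (d l)))"
proof -
  let ?p = "measure_pmf.prob (rand_sets n K P)"
  let ?E = "{f. \<exists>i\<in>{..<n}. \<exists>j\<in>{..<n}. i \<noteq> j \<and> 3 * s \<le> card (f i \<inter> f j)}"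
  let ?F = "\<Union>(i, l)\<in>{..<n} \<times> {1..s}. {f. d l \<le> overlap_degree n l i f}"
  have "- sparse_overlaps n d \<subseteq> ?E \<union> ?F"
    unfolding sparse_overlaps_def by (auto simp: not_less; meson lessThan_iff not_less)
  hence "?p (- sparse_overlaps n d) \<le> ?p (?E \<union> ?F)"
    by (intro measure_pmf.finite_measure_mono) auto
  also have "\<dots> \<le> ?p ?E + ?p ?F" by (rule measure_Un_le) auto
  also have "?p ?E \<le> real n ^ 2 * x ^ (3 * s)" using prob_some_overlap_le[of "{..<n}" n "3 * s"] by simp
  also have "?p ?F \<le> (\<Sum>(i, l)\<in>{..<n} \<times> {1..s}. ?p {f. d l \<le> overlap_degree n l i f})"
    unfolding case_prod_unfold by (rule prob_le_sum_prob) auto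
  also have "\<dots> \<le> (\<Sum>(i, l)\<in>{..<n} \<times> {1..s}. exp (- real (d l)))"
    by (intro sum_mono) (auto intro!: prob_overlap_degree_le d n)
  also have "\<dots> = real n * (\<Sum>l=1..s. exp (- real (d l)))"
    by (simp add: sum.cartesian_product[symmetric])
  finally show ?thesis by simp
qed

text \<open>Bound for the total by which the joint adjacency probabilities of one vertex with all
  others exceed \<open>w ^ 2\<close>: fewer than \<open>d l\<close> vertices share \<open>l\<close>
  or more items with it, and \<open>8 ^ s\<close> bounds the binomial coefficient.\<close>

definition overlap_excess :: "(nat \<Rightarrow> nat) \<Rightarrow> real" where
  "overlap_excess d = (\<Sum>l=1..s. real (d l) * (8 ^ s * x ^ (2 * s - l) / real K ^ l))"

text \<open>\<open>chung_erdos\<close> for the events that a fresh set is adjacent to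
  \<open>i\<close>, over \<open>i\<close> in \<open>A\<close>. A row of the pair sum has the
  diagonal term \<open>w\<close>, at most \<open>card A\<close> independent terms
  \<open>w ^ 2\<close>, and the overlap excess.\<close>

lemma sparse_overlaps_subset_expanding:
  assumes f: "f \<in> sparse_overlaps n d" "\<And>i. i < n \<Longrightarrow> f i \<in> ksubsets P K"
    and A: "A \<subseteq> {..<n}" "A \<noteq> {}" and wl: "0 \<le> w_lower"
  shows "nonadj_prob A f \<le> 1 - real (card A) * w_lower\<^sup>2 / (w + real (card A) * w\<^sup>2 + overlap_excess d)"
proof -
  define m where "m = card A"
  have finA: "finite A" using A finite_subset by blast
  have m0: "0 < m" using A finA by (simp add: m_def card_gt_0_iff)
  let ?p = "measure_pmf.prob (kset_pmf P K)"
  let ?F = "\<lambda>i. {T. s \<le> card (T \<inter> f i)}"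
  define g where "g = (\<lambda>l. 8 ^ s * x ^ (2 * s - l) / real K ^ l)"
  have g: "0 \<le> g l" for l using x_pos by (simp add: g_def)
  have ex0: "0 \<le> overlap_excess d" unfolding overlap_excess_def
    using x_pos by (intro sum_nonneg mult_nonneg_nonneg) auto
  have row: "(\<Sum>j\<in>A. ?p (?F i \<inter> ?F j)) \<le> w + real m * w\<^sup>2 + overlap_excess d" if i: "i \<in> A" for i
  proof -
    have iK: "f i \<in> ksubsets P K" using i A f by auto
    have "?p (?F i \<inter> ?F j) \<le> w\<^sup>2 + (\<Sum>l=1..s. of_bool (l \<le> card (f i \<inter> f j)) * g l)" if j: "j \<in> A - {i}" for j
    proof -
      have jK: "f j \<in> ksubsets P K" using j A f by auto
      let ?u = "card (f i \<inter> f j)"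
      have "i < n" "j < n" "i \<noteq> j" using i j A(1) by auto
      hence u: "?u < 3 * s" using f(1) unfolding sparse_overlaps_def by blast
      have "?p (?F i \<inter> ?F j) = ?p {T. s \<le> card (T \<inter> f i) \<and> s \<le> card (T \<inter> f j)}"
        by (rule arg_cong[where f = ?p]) auto
      also have "\<dots> \<le> pair_bound ?u" by (rule prob_adj_both_le[OF iK jK])
      also have "\<dots> \<le> w\<^sup>2 + (\<Sum>l=1..s. of_bool (l \<le> ?u) * g l)"
        unfolding pair_bound_def
      proof (intro add_left_mono sum_mono)
        fix l
        \<comment> \<open>Overlaps are below \<open>3 * s\<close>, and
          \<open>2 ^ (3 * s) = 8 ^ s\<close>.\<close>
        have "real (?u choose l) \<le> of_bool (l \<le> ?u) * 8 ^ s"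
        proof (cases "l \<le> ?u")
          case True
          have "?u choose l \<le> 2 ^ ?u" by (rule binomial_le_pow2)
          also have "\<dots> \<le> 2 ^ (3 * s)" using u by (intro power_increasing) auto
          also have "\<dots> = (8 :: nat) ^ s" by (simp add: power_mult)
          finally have "real (?u choose l) \<le> real (8 ^ s)" by (rule of_nat_mono)
          thus ?thesis using True by simp
        qed (simp add: binomial_eq_0)
        hence "real (?u choose l) * (x ^ (2 * s - l) / real K ^ l) \<le> of_bool (l \<le> ?u) * 8 ^ s * (x ^ (2 * s - l) / real K ^ l)"
          using x_pos by (intro mult_right_mono) auto
        thus "real (?u choose l) * x ^ (2 * s - l) / real K ^ l \<le> of_bool (l \<le> ?u) * g l"
          by (simp add: g_def mult.assoc)
      qed
      finally show ?thesis .
    qed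
    hence "(\<Sum>j\<in>A - {i}. ?p (?F i \<inter> ?F j)) \<le> (\<Sum>j\<in>A - {i}. w\<^sup>2 + (\<Sum>l=1..s. of_bool (l \<le> card (f i \<inter> f j)) * g l))"
      by (rule sum_mono)
    also have "\<dots> = real (card (A - {i})) * w\<^sup>2 + (\<Sum>l=1..s. (\<Sum>j\<in>A - {i}. of_bool (l \<le> card (f i \<inter> f j))) * g l)"
      by (simp add: sum.distrib sum_distrib_right sum.swap[of _ "A - {i}"])
    also have "\<dots> \<le> real m * w\<^sup>2 + (\<Sum>l=1..s. real (d l) * g l)"
    proof (intro add_mono mult_right_mono sum_mono)
      show "real (card (A - {i})) \<le> real m" unfolding m_def by (intro of_nat_mono card_mono finA) auto
      fix l assume l: "l \<in> {1..s}"
      have "(\<Sum>j\<in>A - {i}. of_bool (l \<le> card (f i \<inter> f j))) = real (card ((A - {i}) \<inter> {j. l \<le> card (f i \<inter> f j)}))"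
        using finA by (simp add: of_bool_def sum.If_cases)
      also have "\<dots> \<le> real (overlap_degree n l i f)"
        unfolding overlap_degree_def using A(1) by (intro of_nat_mono card_mono) auto
      also have "\<dots> \<le> real (d l)" using f(1) l i A(1) by (intro of_nat_mono) (auto simp: sparse_overlaps_def less_imp_le)
      finally show "(\<Sum>j\<in>A - {i}. of_bool (l \<le> card (f i \<inter> f j))) \<le> real (d l)" .
    qed (use g in auto)
    finally have "(\<Sum>j\<in>A - {i}. ?p (?F i \<inter> ?F j)) \<le> real m * w\<^sup>2 + overlap_excess d"
      by (simp add: overlap_excess_def g_def)
    moreover have "?p (?F i \<inter> ?F i) \<le> w" using prob_adj_le[OF iK] by simp
    ultimately show ?thesis using finA i by (simp add: sum.remove[of A i])
  qed
  define D where "D = w + real m * w\<^sup>2 + overlap_excess d"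
  have D0: "0 < D" unfolding D_def using w_pos ex0 by (intro add_pos_nonneg add_pos_nonneg) auto
  have "(real m * w_lower)\<^sup>2 \<le> (\<Sum>i\<in>A. ?p (?F i))\<^sup>2"
  proof (rule power_mono)
    have "(\<Sum>i\<in>A. w_lower) \<le> (\<Sum>i\<in>A. ?p (?F i))" by (intro sum_mono prob_adj_ge) (use A f in auto)
    thus "real m * w_lower \<le> (\<Sum>i\<in>A. ?p (?F i))" by (simp add: m_def)
  qed (use wl in auto)
  also have "\<dots> \<le> ?p (\<Union>i\<in>A. ?F i) * (\<Sum>i\<in>A. \<Sum>j\<in>A. ?p (?F i \<inter> ?F j))" by (rule chung_erdos[OF finA])
  also have "\<dots> \<le> ?p (\<Union>i\<in>A. ?F i) * (\<Sum>i\<in>A. D)"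
    unfolding D_def by (intro mult_left_mono sum_mono row) auto
  also have "\<dots> = ?p (\<Union>i\<in>A. ?F i) * D * real m" by (simp add: m_def)
  finally have "real m * (real m * w_lower\<^sup>2) \<le> real m * (?p (\<Union>i\<in>A. ?F i) * D)"
    by (simp add: power2_eq_square algebra_simps)
  hence "real m * w_lower\<^sup>2 \<le> ?p (\<Union>i\<in>A. ?F i) * D" using m0 by simp
  hence "real m * w_lower\<^sup>2 / D \<le> ?p (\<Union>i\<in>A. ?F i)" using D0 by (simp add: field_simps)
  moreover have "nonadj_prob A f = 1 - ?p (\<Union>i\<in>A. ?F i)"
  proof -
    have "{T. \<forall>i\<in>A. \<not> s \<le> card (T \<inter> f i)} = space (measure_pmf (kset_pmf P K)) - (\<Union>i\<in>A. ?F i)" by auto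
    thus ?thesis unfolding nonadj_prob_def by (simp only:) (rule measure_pmf.prob_compl, simp)
  qed
  ultimately show ?thesis by (simp add: D_def m_def)
qed

lemma prob_not_expanding_le:
  assumes d: "\<And>l. l \<in> {1..s} \<Longrightarrow> exp 2 * (real n * x ^ l) \<le> real (d l)" and n: "0 < n" and wl: "0 \<le> w_lower"
  shows "measure_pmf.prob (rand_sets n K P)
       (- expanding n M (\<lambda>m. 1 - real m * w_lower\<^sup>2 / (w + real m * w\<^sup>2 + overlap_excess d)))
     \<le> real n ^ 2 * x ^ (3 * s) + real n * (\<Sum>l=1..s. exp (- real (d l)))"
proof (rule order_trans[OF prob_rand_sets_mono prob_not_sparse_overlaps_le[OF d n]])
  fix f assume f: "\<And>i. i < n \<Longrightarrow> f i \<in> ksubsets P K"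
    "f \<in> - expanding n M (\<lambda>m. 1 - real m * w_lower\<^sup>2 / (w + real m * w\<^sup>2 + overlap_excess d))"
  then obtain A where "A \<subseteq> {..<n}" "1 \<le> card A"
    "\<not> nonadj_prob A f \<le> 1 - real (card A) * w_lower\<^sup>2 / (w + real (card A) * w\<^sup>2 + overlap_excess d)"
    unfolding expanding_def by blast
  moreover from this have "A \<noteq> {}" by auto
  ultimately show "f \<in> - sparse_overlaps n d"
    using sparse_overlaps_subset_expanding[of f n d A] f(1) wl by auto
qed

end

section \<open>The asymptotic regime\<close>

text \<open>The quantity \<open>a n\<close> below is asymptotic to the expected degree of a vertex.\<close>
locale regime =
  fixes s :: nat and K P :: "nat \<Rightarrow> nat" and c c0 C0 :: real
  assumes params: "\<And>n. intersection_params s (K n) (P n)"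
    and c_pos: "0 < c" and P_ge: "eventually (\<lambda>n. c * real n \<le> real (P n)) sequentially"
    and c0_pos: "0 < c0"
    and a_ge': "eventually (\<lambda>n. c0 * ln (real n) \<le> real n * intersection_params.w s (K n) (P n)) sequentially"
    and a_le': "eventually (\<lambda>n. real n * intersection_params.w s (K n) (P n) \<le> C0 * ln (real n)) sequentially"
begin

abbreviation "W n \<equiv> intersection_params.w s (K n) (P n)"
abbreviation "X n \<equiv> intersection_params.x (K n) (P n)"
abbreviation "Wl n \<equiv> intersection_params.w_lower s (K n) (P n)"
abbreviation "R n \<equiv> rand_sets n (K n) (P n)"

definition a :: "nat \<Rightarrow> real" where "a n = real n * W n"
definition \<delta> :: "nat \<Rightarrow> real" where "\<delta> n = 2 * real (s * (s - 1)) / real (K n) + X n"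

lemma a_ge: "eventually (\<lambda>n. c0 * ln (real n) \<le> a n) sequentially"
  and a_le: "eventually (\<lambda>n. a n \<le> C0 * ln (real n)) sequentially"
  using a_ge' a_le' by (auto simp: a_def)

lemma s_pos: "1 \<le> s"
  using intersection_params.s_pos[OF params] .

lemma W_pos: "0 < W n" and X_pos: "0 < X n" and K_pos: "0 < K n" and P_pos: "0 < P n"
  using intersection_params.w_pos[OF params] intersection_params.x_pos[OF params]
    intersection_params.K_pos[OF params] intersection_params.P_pos[OF params] by auto

lemma X_power_s: "X n ^ s = fact s * W n"
  by (rule intersection_params.x_power_s[OF params])

lemma Wl_eq: "Wl n = W n * (1 - \<delta> n)"
  by (simp add: intersection_params.w_lower_def[OF params] \<delta>_def algebra_simps)

lemma \<delta>_nonneg: "0 \<le> \<delta> n"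
  using X_pos[of n] by (simp add: \<delta>_def)

lemma a_at_top: "filterlim a at_top sequentially"
proof (rule filterlim_at_top_mono[OF _ a_ge])
  show "filterlim (\<lambda>n. c0 * ln (real n)) at_top sequentially"
    by (rule filterlim_tendsto_pos_mult_at_top[OF tendsto_const c0_pos]) real_asymp
qed

lemma C0_pos: "0 < C0"
proof -
  have "eventually (\<lambda>n. 0 < C0 * ln (real n)) sequentially"
    using filterlim_at_top_dense[THEN iffD1, OF a_at_top, rule_format, of 0] a_le
    by eventually_elim linarith
  moreover have "eventually (\<lambda>n. 0 < ln (real n)) sequentially" by real_asymp
  ultimately have "eventually (\<lambda>n::nat. 0 < C0) sequentially"
    by eventually_elim (simp add: zero_less_mult_iff)
  thus ?thesis by (simp add: eventually_const)
qed

lemma ln_over_powr_tendsto_0: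
  assumes "0 < e"
  shows "(\<lambda>n. D * ln (real n) ^ i * real n powr (- e)) \<longlonglongrightarrow> 0"
proof -
  have "(\<lambda>n. ln (real n) ^ i * real n powr (- e)) \<longlonglongrightarrow> 0" using assms by real_asymp
  hence "(\<lambda>n. D * (ln (real n) ^ i * real n powr (- e))) \<longlonglongrightarrow> D * 0" by (intro tendsto_mult tendsto_const)
  thus ?thesis by (simp add: mult.assoc)
qed

lemma W_le: "eventually (\<lambda>n. W n \<le> C0 * ln (real n) * real n powr (-1)) sequentially"
  using a_le eventually_gt_at_top[of 0]
proof eventually_elim
  case (elim n)
  hence "W n \<le> C0 * ln (real n) / real n" by (simp add: a_def field_simps)
  thus ?case using elim by (simp add: powr_minus divide_inverse)
qed

text \<open>\<open>X ^ s = fact s * W\<close> is \<open>1 / n\<close> up to a logarithm. Half of the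
  exponent is given away to absorb the logarithm and the constants.\<close>

lemma X_le: "eventually (\<lambda>n. X n \<le> real n powr (- (1 / (2 * real s)))) sequentially"
proof -
  have "(\<lambda>n. (fact s * C0) * ln (real n) ^ 1 * real n powr (- (1/2))) \<longlonglongrightarrow> 0"
    by (rule ln_over_powr_tendsto_0) simp
  hence "eventually (\<lambda>n. (fact s * C0) * ln (real n) ^ 1 * real n powr (- (1/2)) < 1) sequentially"
    by (rule order_tendstoD) simp
  with W_le eventually_gt_at_top[of 0] show ?thesis
  proof eventually_elim
    case (elim n)
    have "X n ^ s \<le> fact s * (C0 * ln (real n) * real n powr (-1))"
      unfolding X_power_s using elim by (intro mult_left_mono) auto
    also have "real n powr (-1) = real n powr (-(1/2)) * real n powr (-(1/2))"
      using powr_add[of "real n" "-(1/2)" "-(1/2)"] by simp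
    also have "fact s * (C0 * ln (real n) * (real n powr (-(1/2)) * real n powr (-(1/2)))) =
       ((fact s * C0) * ln (real n) ^ 1 * real n powr (- (1/2))) * real n powr (-(1/2))"
      by (simp only: power_one_right mult_ac)
    also have "\<dots> \<le> 1 * real n powr (-(1/2))" using elim by (intro mult_right_mono) auto
    also have "\<dots> = (real n powr (- (1 / (2 * real s)))) ^ s"
    proof -
      have "- (1 / (2 * real s)) * real s = - (1 / 2)" using s_pos by (simp add: field_simps)
      moreover have "(real n powr (- (1 / (2 * real s)))) ^ s = real n powr (- (1 / (2 * real s)) * real s)"
        using elim by (subst powr_power) auto
      ultimately show ?thesis by (simp only:)
    qed
    finally have "X n ^ Suc (s - 1) \<le> (real n powr (- (1 / (2 * real s)))) ^ Suc (s - 1)"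
      using s_pos by simp
    thus ?case by (rule power_le_imp_le_base) simp
  qed
qed

lemma powr_tendsto_0: "0 < e \<Longrightarrow> (\<lambda>n. real n powr (- e)) \<longlonglongrightarrow> 0"
  by real_asymp

lemma X_mult_ln_tendsto_0: "(\<lambda>n. D * ln (real n) ^ i * X n) \<longlonglongrightarrow> 0"
proof (rule tendsto_rabs_zero_cancel, rule tendsto_sandwich[OF _ _ tendsto_const])
  show "eventually (\<lambda>n. 0 \<le> \<bar>D * ln (real n) ^ i * X n\<bar>) sequentially" by simp
  show "eventually (\<lambda>n. \<bar>D * ln (real n) ^ i * X n\<bar> \<le> \<bar>D\<bar> * ln (real n) ^ i * real n powr (- (1 / (2 * real s)))) sequentially"
    using X_le eventually_gt_at_top[of 1]
  proof eventually_elim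
    case (elim n)
    have "\<bar>D * ln (real n) ^ i * X n\<bar> = \<bar>D\<bar> * ln (real n) ^ i * X n"
      using X_pos[of n] elim by (simp add: abs_mult)
    also have "\<dots> \<le> \<bar>D\<bar> * ln (real n) ^ i * real n powr (- (1 / (2 * real s)))"
      using elim by (intro mult_left_mono) auto
    finally show ?case .
  qed
  show "(\<lambda>n. \<bar>D\<bar> * ln (real n) ^ i * real n powr (- (1 / (2 * real s)))) \<longlonglongrightarrow> 0"
    by (rule ln_over_powr_tendsto_0) (use s_pos in auto)
qed

lemma X_tendsto_0: "X \<longlonglongrightarrow> 0"
  using X_mult_ln_tendsto_0[of 1 0] by simp

lemma W_mult_ln_tendsto_0: "(\<lambda>n. D * ln (real n) ^ i * W n) \<longlonglongrightarrow> 0"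
proof (rule tendsto_rabs_zero_cancel, rule tendsto_sandwich[OF _ _ tendsto_const])
  show "eventually (\<lambda>n. 0 \<le> \<bar>D * ln (real n) ^ i * W n\<bar>) sequentially" by simp
  show "eventually (\<lambda>n. \<bar>D * ln (real n) ^ i * W n\<bar> \<le> \<bar>D\<bar> * C0 * ln (real n) ^ (Suc i) * real n powr (-1)) sequentially"
    using W_le eventually_gt_at_top[of 1]
  proof eventually_elim
    case (elim n)
    have "\<bar>D * ln (real n) ^ i * W n\<bar> = \<bar>D\<bar> * ln (real n) ^ i * W n"
      using W_pos[of n] elim by (simp add: abs_mult)
    also have "\<dots> \<le> \<bar>D\<bar> * ln (real n) ^ i * (C0 * ln (real n) * real n powr (-1))"
      using elim by (intro mult_left_mono) auto
    finally show ?case by (simp add: mult_ac)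
  qed
  show "(\<lambda>n. \<bar>D\<bar> * C0 * ln (real n) ^ (Suc i) * real n powr (-1)) \<longlonglongrightarrow> 0"
    by (rule ln_over_powr_tendsto_0) auto
qed

lemma W_tendsto_0: "W \<longlonglongrightarrow> 0"
  using W_mult_ln_tendsto_0[of 1 0] by simp

lemma a_mult_tendsto_0:
  assumes "(\<lambda>n. C0 * ln (real n) * g n) \<longlonglongrightarrow> 0" "eventually (\<lambda>n. 0 \<le> g n) sequentially"
  shows "(\<lambda>n. a n * g n) \<longlonglongrightarrow> 0"
proof (rule tendsto_sandwich[OF _ _ tendsto_const assms(1)])
  show "eventually (\<lambda>n. 0 \<le> a n * g n) sequentially"
    using assms(2) by eventually_elim (use W_pos in \<open>auto simp: a_def less_imp_le\<close>)
  show "eventually (\<lambda>n. a n * g n \<le> C0 * ln (real n) * g n) sequentially"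
    using assms(2) a_le by eventually_elim (intro mult_right_mono)
qed

lemma aW_tendsto_0: "(\<lambda>n. a n * W n) \<longlonglongrightarrow> 0"
  by (rule a_mult_tendsto_0) (use W_mult_ln_tendsto_0[of C0 1] W_pos in \<open>auto simp: less_imp_le\<close>)

lemma K_square: "real (K n) ^ 2 = X n * real (P n)"
  using P_pos[of n] by (simp add: intersection_params.x_def[OF params])

text \<open>For \<open>s = 1\<close>, \<open>X = W\<close>, hence \<open>K ^ 2 = X * P\<close> is at
  least \<open>c * n * W = c * a\<close>. No better growth of \<open>K\<close> is available in this
  case.\<close>

lemma K_square_ge_ln: "eventually (\<lambda>n. c * c0 * ln (real n) \<le> real (K n) ^ 2) sequentially" if "s = 1"
  using P_ge a_ge
proof eventually_elim
  case (elim n)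
  have "X n = W n" using X_power_s[of n] by (simp add: that)
  hence "c * (c0 * ln (real n)) \<le> c * (real n * X n)"
    using elim c_pos unfolding a_def by (intro mult_left_mono) simp_all
  also have "\<dots> = X n * (c * real n)" by simp
  also have "\<dots> \<le> X n * real (P n)" using elim X_pos[of n] by (intro mult_left_mono) auto
  finally show ?case by (simp add: K_square)
qed

text \<open>\<open>X\<close> is at least \<open>n powr (- 1 / s)\<close>, hence at least
  \<open>n powr (- 1 / 2)\<close> for \<open>s >= 2\<close>; multiplication by
  \<open>P >= c * n\<close> gives the bound.\<close>

lemma K_square_ge_powr: "eventually (\<lambda>n. c * real n powr (1/2) \<le> real (K n) ^ 2) sequentially" if "2 \<le> s"
proof -
  have "eventually (\<lambda>n. 1 / c0 \<le> ln (real n)) sequentially" using c0_pos by real_asymp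
  with P_ge a_ge eventually_gt_at_top[of 0] show ?thesis
  proof eventually_elim
    case (elim n)
    have "(real n powr (- 1 / real s)) ^ s = real n powr (- 1 / real s * real s)"
      using elim by (subst powr_power) auto
    also have "- 1 / real s * real s = - 1" using that by simp
    also have "real n powr (- 1) = 1 / real n" using elim by (simp add: powr_minus_divide)
    also have "\<dots> \<le> W n"
    proof -
      have "1 = c0 * (1 / c0)" using c0_pos by simp
      also have "\<dots> \<le> c0 * ln (real n)" using elim c0_pos by (intro mult_left_mono) auto
      also have "\<dots> \<le> W n * real n" using elim by (simp add: a_def mult.commute)
      finally show ?thesis using elim by (simp add: divide_le_eq)
    qed
    also have "\<dots> \<le> fact s * W n" using W_pos[of n] by (simp add: fact_ge_1)
    finally have "(real n powr (- 1 / real s)) ^ s \<le> X n ^ s" by (simp add: X_power_s)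
    hence "(real n powr (- 1 / real s)) ^ Suc (s - 1) \<le> X n ^ Suc (s - 1)" using that by simp
    hence "real n powr (- 1 / real s) \<le> X n"
      by (rule power_le_imp_le_base) (use X_pos[of n] in simp)
    moreover have "real n powr (- 1 / 2) \<le> real n powr (- 1 / real s)"
      using that elim by (intro powr_mono) (auto simp: field_simps)
    ultimately have X: "real n powr (- 1 / 2) \<le> X n" by linarith
    have "c * real n powr (1/2) = real n powr (- 1 / 2) * (c * real n)"
      using elim powr_add[of "real n" "-1/2" 1] by (simp add: mult_ac)
    also have "\<dots> \<le> X n * real (P n)" using X elim c_pos X_pos[of n] by (intro mult_mono) auto
    finally show ?case by (simp add: K_square)
  qed
qed

lemma K_ge_powr: "eventually (\<lambda>n. sqrt c * real n powr (1/4) \<le> real (K n)) sequentially" if "2 \<le> s"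
  using K_square_ge_powr[OF that]
proof eventually_elim
  case (elim n)
  have "(sqrt c * real n powr (1/4)) ^ 2 = c * real n powr (1/2)"
  proof -
    have "(real n powr (1/4)) ^ 2 = real n powr (1/2)"
      using powr_add[of "real n" "1/4" "1/4"] by (simp add: power2_eq_square)
    thus ?thesis using c_pos by (simp add: power_mult_distrib)
  qed
  also note elim
  finally show ?case by (rule power2_le_imp_le) simp
qed

lemma K_at_top: "filterlim (\<lambda>n. real (K n)) at_top sequentially"
proof (cases "s = 1")
  case True
  have "filterlim (\<lambda>n. c * c0 * ln (real n)) at_top sequentially"
    by (rule filterlim_tendsto_pos_mult_at_top[OF tendsto_const]) (use c_pos c0_pos in \<open>simp, real_asymp\<close>)
  hence "filterlim (\<lambda>n. real (K n) ^ 2) at_top sequentially"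
    by (rule filterlim_at_top_mono) (rule K_square_ge_ln[OF True])
  hence "filterlim (\<lambda>n. sqrt (real (K n) ^ 2)) at_top sequentially"
    by (rule filterlim_compose[OF sqrt_at_top])
  thus ?thesis by simp
next
  case False
  hence s: "2 \<le> s" using s_pos by simp
  have "filterlim (\<lambda>n. sqrt c * real n powr (1/4)) at_top sequentially"
    by (rule filterlim_tendsto_pos_mult_at_top[OF tendsto_const]) (use c_pos in \<open>simp, real_asymp\<close>)
  thus ?thesis by (rule filterlim_at_top_mono) (rule K_ge_powr[OF s])
qed

lemma ln_over_K_tendsto_0: "(\<lambda>n. D * ln (real n) / real (K n)) \<longlonglongrightarrow> 0" if "2 \<le> s"
proof (rule tendsto_rabs_zero_cancel, rule tendsto_sandwich[OF _ _ tendsto_const])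
  show "eventually (\<lambda>n. 0 \<le> \<bar>D * ln (real n) / real (K n)\<bar>) sequentially" by simp
  show "eventually (\<lambda>n. \<bar>D * ln (real n) / real (K n)\<bar> \<le> \<bar>D\<bar> / sqrt c * ln (real n) ^ 1 * real n powr (- (1/4))) sequentially"
    using K_ge_powr[OF that] eventually_gt_at_top[of 1]
  proof eventually_elim
    case (elim n)
    have "\<bar>D * ln (real n) / real (K n)\<bar> = \<bar>D\<bar> * ln (real n) / real (K n)"
      using elim by (simp add: abs_mult)
    also have "\<dots> \<le> \<bar>D\<bar> * ln (real n) / (sqrt c * real n powr (1/4))"
      using elim K_pos[of n] c_pos by (intro divide_left_mono) auto
    also have "\<dots> = \<bar>D\<bar> / sqrt c * ln (real n) ^ 1 * real n powr (- (1/4))"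
      by (simp add: powr_minus field_simps)
    finally show ?case .
  qed
  show "(\<lambda>n. \<bar>D\<bar> / sqrt c * ln (real n) ^ 1 * real n powr (- (1/4))) \<longlonglongrightarrow> 0"
    by (rule ln_over_powr_tendsto_0) auto
qed

text \<open>For \<open>s = 1\<close> the term with \<open>1 / K\<close> is absent because
  \<open>s * (s - 1) = 0\<close>. This is essential, since \<open>ln n / K\<close> need not vanish
  there.\<close>

lemma ln_\<delta>_tendsto_0: "(\<lambda>n. D * ln (real n) * \<delta> n) \<longlonglongrightarrow> 0"
proof -
  have "(\<lambda>n. (D * (2 * real (s * (s - 1)))) * ln (real n) / real (K n)) \<longlonglongrightarrow> 0"
  proof (cases "s = 1")
    case False
    thus ?thesis using s_pos by (intro ln_over_K_tendsto_0) auto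
  qed simp
  hence "(\<lambda>n. (D * (2 * real (s * (s - 1)))) * ln (real n) / real (K n) + D * ln (real n) ^ 1 * X n) \<longlonglongrightarrow> 0 + 0"
    by (rule tendsto_add) (rule X_mult_ln_tendsto_0)
  thus ?thesis by (simp add: \<delta>_def algebra_simps)
qed

lemma a\<delta>_tendsto_0: "(\<lambda>n. a n * \<delta> n) \<longlonglongrightarrow> 0"
  by (rule a_mult_tendsto_0) (use ln_\<delta>_tendsto_0 \<delta>_nonneg in auto)

lemma \<delta>_tendsto_0: "\<delta> \<longlonglongrightarrow> 0"
proof -
  have "(\<lambda>n. 2 * real (s * (s - 1)) / real (K n)) \<longlonglongrightarrow> 0"
    by (rule tendsto_divide_0[OF tendsto_const filterlim_at_top_imp_at_infinity[OF K_at_top]])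
  from tendsto_add[OF this X_tendsto_0] show ?thesis by (simp add: \<delta>_def[abs_def])
qed

end

section \<open>Asymptotics of the low degree vertices\<close>

text \<open>The last summand dominates as \<open>a\<close> grows: degree below \<open>k\<close>
  means asymptotically degree exactly \<open>k - 1\<close>.\<close>

lemma exp_partial_sum_ratio_tendsto:
  fixes a q :: "nat \<Rightarrow> real"
  assumes a: "filterlim a at_top sequentially" and q: "q \<longlonglongrightarrow> 1"
  shows "(\<lambda>n. (\<Sum>d<Suc m. (a n / q n) ^ d / fact d) / (a n ^ m / fact m)) \<longlonglongrightarrow> 1"
proof -
  have inv: "(\<lambda>n. inverse (a n)) \<longlonglongrightarrow> 0" by (rule tendsto_inverse_0_at_top[OF a])
  have "(\<lambda>n. \<Sum>d<Suc m. fact m / fact d * (1 / q n) ^ d * inverse (a n) ^ (m - d))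
      \<longlonglongrightarrow> (\<Sum>d<Suc m. fact m / fact d * (1 / 1) ^ d * 0 ^ (m - d))"
    by (intro tendsto_sum tendsto_mult tendsto_power tendsto_divide inv q tendsto_const) auto
  also have "(\<Sum>d<Suc m. fact m / fact d * (1 / 1) ^ d * 0 ^ (m - d)) = (1 :: real)"
    by (simp add: power_0_left)
  finally show ?thesis
  proof (rule Lim_transform_eventually)
    have "eventually (\<lambda>n. 0 < a n) sequentially" using a by (auto simp: filterlim_at_top_dense)
    thus "eventually (\<lambda>n. (\<Sum>d<Suc m. fact m / fact d * (1 / q n) ^ d * inverse (a n) ^ (m - d)) =
        (\<Sum>d<Suc m. (a n / q n) ^ d / fact d) / (a n ^ m / fact m)) sequentially"
    proof eventually_elim
      case (elim n)
      have "fact m / fact d * (1 / q n) ^ d * inverse (a n) ^ (m - d) = (a n / q n) ^ d / fact d / (a n ^ m / fact m)"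
        if "d < Suc m" for d
      proof -
        have "a n ^ m = a n ^ d * a n ^ (m - d)" using that by (simp flip: power_add)
        thus ?thesis using elim by (simp add: power_divide power_inverse divide_simps)
      qed
      thus ?case by (simp only: sum_divide_distrib) (intro sum.cong refl, simp)
    qed
  qed
qed

lemma power_le_exp_neg:
  fixes y :: real
  assumes "0 \<le> 1 - y"
  shows "(1 - y) ^ N \<le> exp (- (real N * y))"
proof -
  have "(1 - y) ^ N \<le> exp (- y) ^ N" using assms exp_ge_add_one_self[of "- y"] by (intro power_mono) auto
  thus ?thesis by (simp add: exp_of_nat_mult[symmetric])
qed

text \<open>For \<open>x <= 1\<close> every correction is at most that with
  \<open>x ^ s = fact s * w\<close> and a single factor \<open>1 / K\<close>, so overlaps of bounded
  size change the pair probability by \<open>O(w / K)\<close>.\<close>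

lemma (in intersection_params) pair_bound_le:
  assumes "x \<le> 1"
  shows "pair_bound t \<le> w\<^sup>2 + real s * 2 ^ t * fact s * (w / real K)"
proof -
  have "(\<Sum>l=1..s. real (t choose l) * x ^ (2 * s - l) / real K ^ l) \<le> (\<Sum>l=1..s. 2 ^ t * x ^ s / real K)"
  proof (rule sum_mono)
    fix l assume l: "l \<in> {1..s}"
    have "real (t choose l) \<le> real (2 ^ t)" by (intro of_nat_mono binomial_le_pow2)
    moreover have "x ^ (2 * s - l) \<le> x ^ s" using l assms x_pos by (intro power_decreasing) auto
    moreover have "real K ^ 1 \<le> real K ^ l" using l K_pos by (intro power_increasing) auto
    ultimately show "real (t choose l) * x ^ (2 * s - l) / real K ^ l \<le> 2 ^ t * x ^ s / real K"
      using x_pos K_pos by (intro frac_le mult_mono) auto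
  qed
  thus ?thesis by (simp add: pair_bound_def x_power_s mult_ac)
qed

context regime
begin

text \<open>The Poisson weight at \<open>k - 1\<close> with mean \<open>a\<close>, the asymptotic
  probability that a vertex has degree below \<open>k\<close>.\<close>

definition b :: "nat \<Rightarrow> nat \<Rightarrow> real" where
  "b k n = a n ^ (k - 1) / fact (k - 1) * exp (- a n)"

abbreviation "low k n i \<equiv> intersection_params.low_degree s n k i"

lemma a_ge_1: "eventually (\<lambda>n. 1 \<le> a n) sequentially"
  using a_at_top by (auto simp: filterlim_at_top)

lemma a_nonneg: "0 \<le> a n"
  using W_pos[of n] by (simp add: a_def)

lemma b_nonneg: "0 \<le> b k n"
  using a_nonneg by (simp add: b_def)

text \<open>Upper bound for the probability of adjacency to none of \<open>j\<close> vertices, in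
  the form delivered by \<open>nonadj_prob_le\<close>. The parameter \<open>A\<close> is the
  coefficient of \<open>W / K\<close> in the pair bound; \<open>A = 0\<close> is the case of
  disjoint item sets.\<close>

definition Q :: "nat \<Rightarrow> real \<Rightarrow> nat \<Rightarrow> real" where
  "Q j A n = 1 - real j * W n * (1 - (\<delta> n + real j * W n + real j * A / real (K n)))"

lemma Q_eq: "Q j A n = 1 - real j * Wl n + (real j)\<^sup>2 * ((W n)\<^sup>2 + A * (W n / real (K n)))"
  by (simp add: Q_def Wl_eq power2_eq_square algebra_simps)

lemma eta_tendsto_0: "(\<lambda>n. \<delta> n + real j * W n + real j * A / real (K n)) \<longlonglongrightarrow> 0"
proof -
  have "(\<lambda>n. real j * A / real (K n)) \<longlonglongrightarrow> 0"
    by (rule tendsto_divide_0[OF tendsto_const filterlim_at_top_imp_at_infinity[OF K_at_top]])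
  moreover have "(\<lambda>n. real j * W n) \<longlonglongrightarrow> real j * 0" by (intro tendsto_mult tendsto_const W_tendsto_0)
  ultimately have "(\<lambda>n. \<delta> n + real j * W n + real j * A / real (K n)) \<longlonglongrightarrow> 0 + real j * 0 + 0"
    by (intro tendsto_add \<delta>_tendsto_0)
  thus ?thesis by simp
qed

lemma Q_tendsto_1: "Q j A \<longlonglongrightarrow> 1"
proof -
  have "(\<lambda>n. 1 - real j * W n * (1 - (\<delta> n + real j * W n + real j * A / real (K n)))) \<longlonglongrightarrow> 1 - real j * 0 * (1 - 0)"
    by (intro tendsto_diff tendsto_mult tendsto_const W_tendsto_0 eta_tendsto_0)
  thus ?thesis by (simp add: Q_def[abs_def])
qed

lemma Q_bounds: "eventually (\<lambda>n. 1 / 2 < Q j A n \<and> Q j A n \<le> 1) sequentially"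
proof -
  have "eventually (\<lambda>n. \<delta> n + real j * W n + real j * A / real (K n) < 1) sequentially"
    by (rule order_tendstoD[OF eta_tendsto_0]) simp
  moreover have "eventually (\<lambda>n. 1 / 2 < Q j A n) sequentially"
    by (rule order_tendstoD[OF Q_tendsto_1]) simp
  ultimately show ?thesis
  proof eventually_elim
    case (elim n)
    have "0 \<le> real j * W n * (1 - (\<delta> n + real j * W n + real j * A / real (K n)))"
      using elim W_pos[of n] by (intro mult_nonneg_nonneg) auto
    thus ?case using elim by (simp add: Q_def)
  qed
qed

text \<open>Besides the main factor \<open>exp (- a) ^ j\<close>, the exponent collects
  \<open>a\<close> times the relative errors. The last term, \<open>j ^ 2 * W\<close>, pays for the
  exponent \<open>n - j\<close> in place of \<open>n\<close>.\<close>

lemma Q_power_le: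
  assumes "0 \<le> A"
  shows "eventually (\<lambda>n. Q j A n ^ (n - j) \<le> exp (- a n) ^ j *
     exp (real j * (a n * \<delta> n + real j * (a n * W n) + real j * A * (a n / real (K n))) + (real j)\<^sup>2 * W n)) sequentially"
  using Q_bounds[of j A] eventually_ge_at_top[of j]
proof eventually_elim
  case (elim n)
  let ?\<eta> = "\<delta> n + real j * W n + real j * A / real (K n)"
  have \<eta>: "0 \<le> ?\<eta>" using \<delta>_nonneg[of n] W_pos[of n] assms by (simp add: less_imp_le)
  have "Q j A n ^ (n - j) \<le> exp (- (real (n - j) * (real j * W n * (1 - ?\<eta>))))"
    using power_le_exp_neg[of "real j * W n * (1 - ?\<eta>)" "n - j"] elim(1) unfolding Q_def[symmetric]
    by simp
  also have "- (real (n - j) * (real j * W n * (1 - ?\<eta>))) \<le>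
      - (real j * a n) + (real j * (a n * ?\<eta>) + (real j)\<^sup>2 * W n)"
  proof -
    have "real (n - j) = real n - real j" using elim by simp
    moreover have "0 \<le> (real j)\<^sup>2 * W n * ?\<eta>" using \<eta> W_pos[of n] by (intro mult_nonneg_nonneg) auto
    moreover have "- ((N - J) * (J * v * (1 - h))) \<le> - (J * (N * v)) + (J * ((N * v) * h) + J\<^sup>2 * v)"
      if "0 \<le> J\<^sup>2 * v * h" for N J v h :: real
      using that by (simp add: power2_eq_square algebra_simps)
    ultimately show ?thesis unfolding a_def by presburger
  qed
  finally have "Q j A n ^ (n - j) \<le> exp (- (real j * a n) + (real j * (a n * ?\<eta>) + (real j)\<^sup>2 * W n))" by simp
  also have "\<dots> = exp (- a n) ^ j * exp (real j * (a n * ?\<eta>) + (real j)\<^sup>2 * W n)"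
    by (simp only: exp_add) (simp flip: exp_of_nat_mult)
  also have "a n * ?\<eta> = a n * \<delta> n + real j * (a n * W n) + real j * A * (a n / real (K n))"
    by (simp add: algebra_simps)
  finally show ?case .
qed

text \<open>The part of the exponent of \<open>Q_power_le\<close> that always vanishes. The term
  with \<open>a / K\<close> is left out, because it may grow for \<open>s = 1\<close>.\<close>

definition err :: "nat \<Rightarrow> nat \<Rightarrow> real" where
  "err j n = real j * (a n * \<delta> n + real j * (a n * W n)) + (real j)\<^sup>2 * W n"

lemma err_tendsto_0: "err j \<longlonglongrightarrow> 0"
proof -
  have "(\<lambda>n. real j * (a n * \<delta> n + real j * (a n * W n)) + (real j)\<^sup>2 * W n)
      \<longlonglongrightarrow> real j * (0 + real j * 0) + (real j)\<^sup>2 * 0"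
    by (intro tendsto_add tendsto_mult tendsto_const a\<delta>_tendsto_0 aW_tendsto_0 W_tendsto_0)
  thus ?thesis by (simp add: err_def[abs_def])
qed

text \<open>The bound is uniform over all sets \<open>J\<close> of size \<open>j\<close>, so that it
  can be summed over them.\<close>

lemma low_degree_prob_le:
  assumes k: "1 \<le> k" and j: "1 \<le> j"
  shows "\<exists>u. u \<longlonglongrightarrow> 1 \<and> eventually (\<lambda>n. \<forall>J\<subseteq>{..<n}. card J = j \<longrightarrow>
     measure_pmf.prob (R n) (\<Inter>i\<in>J. low k n i) \<le> u n * b k n ^ j) sequentially"
proof -
  \<comment> \<open>This makes \<open>X ^ Suc t\<close> at most
    \<open>n powr (- 1 - j * C0)\<close>, which is at most \<open>exp (- a) ^ j / n\<close>:
    overlaps above \<open>t\<close> are negligible against the main term.\<close>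
  obtain t :: nat where t: "2 * real s * (real j * C0 + 1) \<le> real t" using real_arch_simple by blast
  define A where "A = real s * 2 ^ t * fact s"
  have A: "0 \<le> A" by (simp add: A_def)
  obtain m where m: "k = Suc m" using k by (cases k) auto
  define den where "den = (\<lambda>n. a n ^ m / fact m)"
  have b_eq: "b k n = den n * exp (- a n)" for n by (simp add: b_def den_def m)
  have den: "eventually (\<lambda>n. 1 / fact m \<le> den n) sequentially"
    using a_ge_1 by eventually_elim (simp add: den_def divide_right_mono)
  define S1 where "S1 = (\<lambda>n. \<Sum>d<k. (a n / Q j 0 n) ^ d / fact d)"
  define S2 where "S2 = (\<lambda>n. \<Sum>d<j * k. (real j * a n / Q j A n) ^ d / fact d)"
  define T1 where "T1 = (\<lambda>n. exp (err j n) * (S1 n / den n) ^ j)"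
  define D where "D = (real j)\<^sup>2 * (exp 1 * (real (j * k) * (2 * real j * C0) ^ (j * k)) * fact m ^ j)"
  \<comment> \<open>An overlap has probability of order \<open>n powr (- 1 / (2 * s))\<close>; the
    weaker estimate of \<open>Q\<close> loses \<open>n powr (1 / (4 * s))\<close>, and the coarse
    count of neighbourhoods loses powers of \<open>ln n\<close>.\<close>
  define T2 where "T2 = (\<lambda>n. D * ln (real n) ^ (j * k) * real n powr (- (1 / (4 * real s))))"
  define T3 where "T3 = (\<lambda>n. (real j)\<^sup>2 * fact m ^ j * real n powr (- 1))"
  have "T1 \<longlonglongrightarrow> exp 0 * 1 ^ j"
    unfolding T1_def
  proof (intro tendsto_mult tendsto_power tendsto_exp err_tendsto_0)
    show "(\<lambda>n. S1 n / den n) \<longlonglongrightarrow> 1"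
      unfolding S1_def den_def m by (rule exp_partial_sum_ratio_tendsto[OF a_at_top Q_tendsto_1])
  qed
  moreover have "T2 \<longlonglongrightarrow> 0" unfolding T2_def by (rule ln_over_powr_tendsto_0) (use s_pos in auto)
  moreover have "T3 \<longlonglongrightarrow> (real j)\<^sup>2 * fact m ^ j * 0"
    unfolding T3_def by (intro tendsto_mult tendsto_const powr_tendsto_0) auto
  ultimately have "(\<lambda>n. T1 n + T2 n + T3 n) \<longlonglongrightarrow> exp 0 * 1 ^ j + 0 + (real j)\<^sup>2 * fact m ^ j * 0"
    by (intro tendsto_add)
  hence lim: "(\<lambda>n. T1 n + T2 n + T3 n) \<longlonglongrightarrow> 1" by simp
  have first: "eventually (\<lambda>n. Q j 0 n ^ (n - j) * S1 n ^ j \<le> T1 n * b k n ^ j) sequentially"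
    using Q_power_le[of 0 j, OF order_refl] Q_bounds[of j 0] den
  proof eventually_elim
    case (elim n)
    have den0: "0 < den n" using elim by (meson divide_pos_pos fact_gt_zero less_le_trans zero_less_one)
    have "0 \<le> S1 n" unfolding S1_def using elim a_nonneg[of n]
      by (intro sum_nonneg divide_nonneg_nonneg zero_le_power) auto
    hence "Q j 0 n ^ (n - j) * S1 n ^ j \<le> (exp (- a n) ^ j * exp (err j n)) * S1 n ^ j"
      using elim(1) by (intro mult_right_mono) (simp_all add: err_def)
    also have "\<dots> = T1 n * b k n ^ j"
      using den0 by (simp add: T1_def b_eq power_mult_distrib power_divide)
    finally show ?case .
  qed
  have second: "eventually (\<lambda>n. (real j)\<^sup>2 * X n * (Q j A n ^ (n - j) * S2 n) \<le> T2 n * b k n ^ j) sequentially"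
  proof -
    have "(\<lambda>n. (real j)\<^sup>2 * A * C0 / real (K n)) \<longlonglongrightarrow> 0"
      by (rule tendsto_divide_0[OF tendsto_const filterlim_at_top_imp_at_infinity[OF K_at_top]])
    \<comment> \<open>Only \<open>K\<close> tending to infinity is used: the term with
      \<open>a / K\<close> becomes a small multiple of \<open>ln n\<close>, even if it does not
      vanish.\<close>
    hence K1: "eventually (\<lambda>n. (real j)\<^sup>2 * A * C0 / real (K n) < 1 / (4 * real s)) sequentially"
      by (rule order_tendstoD) (use s_pos in auto)
    have e1: "eventually (\<lambda>n. err j n < 1) sequentially" by (rule order_tendstoD[OF err_tendsto_0]) simp
    show ?thesis
      using Q_power_le[OF A, of j] Q_bounds[of j A] den K1 e1 a_le a_ge_1 X_le eventually_gt_at_top[of 1]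
    proof eventually_elim
      case (elim n)
      have ln0: "0 < ln (real n)" using elim by simp
      have y: "1 \<le> real j * a n / Q j A n" "real j * a n / Q j A n \<le> 2 * real j * C0 * ln (real n)"
      proof -
        have "1 * 1 \<le> real j * a n" using j elim by (intro mult_mono) auto
        also have "real j * a n / 1 \<le> real j * a n / Q j A n"
          using elim a_nonneg[of n] by (intro divide_left_mono) auto
        finally show "1 \<le> real j * a n / Q j A n" by simp
        have "real j * a n / Q j A n \<le> real j * a n / (1 / 2)"
          using elim a_nonneg[of n] by (intro divide_left_mono) auto
        also have "\<dots> = 2 * real j * a n" by simp
        also have "\<dots> \<le> 2 * real j * (C0 * ln (real n))" using elim by (intro mult_left_mono) auto
        finally show "real j * a n / Q j A n \<le> 2 * real j * C0 * ln (real n)" by (simp add: mult.assoc)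
      qed
      have "S2 n \<le> (\<Sum>d<j * k. (2 * real j * C0 * ln (real n)) ^ (j * k))"
        unfolding S2_def
      proof (rule sum_mono)
        fix d assume d: "d \<in> {..<j * k}"
        have "(real j * a n / Q j A n) ^ d / fact d \<le> (real j * a n / Q j A n) ^ d / 1"
          using y by (intro divide_left_mono) (auto simp: fact_ge_1)
        also have "\<dots> \<le> (real j * a n / Q j A n) ^ (j * k)"
          using y d by (simp add: power_increasing)
        also have "\<dots> \<le> (2 * real j * C0 * ln (real n)) ^ (j * k)"
          by (rule power_mono[OF y(2)]) (use y(1) in linarith)
        finally show "(real j * a n / Q j A n) ^ d / fact d \<le> (2 * real j * C0 * ln (real n)) ^ (j * k)" .
      qed
      also have "\<dots> = real (j * k) * (2 * real j * C0) ^ (j * k) * ln (real n) ^ (j * k)"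
        by (simp add: power_mult_distrib)
      finally have S2: "S2 n \<le> real (j * k) * (2 * real j * C0) ^ (j * k) * ln (real n) ^ (j * k)" .
      have S20: "0 \<le> S2 n" unfolding S2_def using y(1) by (intro sum_nonneg) auto
      have "real j * (real j * A * (a n / real (K n))) = (real j)\<^sup>2 * A / real (K n) * a n"
        by (simp add: power2_eq_square)
      also have "\<dots> \<le> (real j)\<^sup>2 * A / real (K n) * (C0 * ln (real n))"
        using elim A by (intro mult_left_mono) auto
      also have "\<dots> = (real j)\<^sup>2 * A * C0 / real (K n) * ln (real n)" by simp
      also have "\<dots> \<le> 1 / (4 * real s) * ln (real n)" using elim ln0 by (intro mult_right_mono) auto
      finally have ex: "real j * (real j * A * (a n / real (K n))) \<le> 1 / (4 * real s) * ln (real n)" .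
      have "Q j A n ^ (n - j) \<le> exp (- a n) ^ j * exp (real j * (a n * \<delta> n + real j * (a n * W n) + real j * A * (a n / real (K n))) + (real j)\<^sup>2 * W n)"
        by (rule elim(1))
      also have "real j * (a n * \<delta> n + real j * (a n * W n) + real j * A * (a n / real (K n))) + (real j)\<^sup>2 * W n
          = err j n + real j * (real j * A * (a n / real (K n)))"
        by (simp add: err_def algebra_simps)
      also have "exp (- a n) ^ j * exp (err j n + real j * (real j * A * (a n / real (K n)))) \<le>
          exp (- a n) ^ j * exp (1 + 1 / (4 * real s) * ln (real n))"
        using ex elim(5) by (intro mult_left_mono) auto
      also have "exp (1 + 1 / (4 * real s) * ln (real n)) = exp 1 * real n powr (1 / (4 * real s))"
        using elim by (simp add: exp_add powr_def)
      finally have Qp: "Q j A n ^ (n - j) \<le> exp (- a n) ^ j * (exp 1 * real n powr (1 / (4 * real s)))" .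
      \<comment> \<open>Since \<open>a >= 1\<close>, \<open>exp (- a) ^ j\<close> is at most a
        constant times \<open>b k n ^ j\<close>; so errors relative to \<open>exp (- a) ^ j\<close>
        may be stated relative to \<open>b k n ^ j\<close>.\<close>
      have fm: "1 \<le> fact m ^ j * den n ^ j"
      proof -
        have "fact m * (1 / fact m) \<le> fact m * den n" using elim by (intro mult_left_mono) auto
        hence "1 ^ j \<le> (fact m * den n) ^ j" by (intro power_mono) auto
        thus ?thesis by (simp add: power_mult_distrib)
      qed
      have "(real j)\<^sup>2 * X n * (Q j A n ^ (n - j) * S2 n) \<le> (real j)\<^sup>2 * real n powr (- (1 / (2 * real s))) *
          ((exp (- a n) ^ j * (exp 1 * real n powr (1 / (4 * real s)))) *
           (real (j * k) * (2 * real j * C0) ^ (j * k) * ln (real n) ^ (j * k)))"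
        using elim(2,8) X_pos[of n] S20 by (intro mult_mono mult_left_mono Qp S2 mult_nonneg_nonneg) (auto intro: less_imp_le)
      also have "\<dots> = (real j)\<^sup>2 * (exp 1 * (real (j * k) * (2 * real j * C0) ^ (j * k))) * ln (real n) ^ (j * k) *
          (real n powr (- (1 / (2 * real s))) * real n powr (1 / (4 * real s))) * exp (- a n) ^ j" (is "_ = ?Z")
        by (simp only: mult_ac)
      also have "?Z \<le> ?Z * (fact m ^ j * den n ^ j)"
      proof -
        have "0 \<le> ?Z" using ln0 C0_pos by (intro mult_nonneg_nonneg zero_le_power) auto
        from mult_left_mono[OF fm this] show ?thesis by simp
      qed
      also have "real n powr (- (1 / (2 * real s))) * real n powr (1 / (4 * real s)) = real n powr (- (1 / (4 * real s)))"
      proof -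
        have "- (1 / (2 * real s)) + 1 / (4 * real s) = - (1 / (4 * real s))" using s_pos by (simp add: field_simps)
        thus ?thesis by (metis powr_add)
      qed
      also have "(real j)\<^sup>2 * (exp 1 * (real (j * k) * (2 * real j * C0) ^ (j * k))) * ln (real n) ^ (j * k) *
          real n powr (- (1 / (4 * real s))) * exp (- a n) ^ j * (fact m ^ j * den n ^ j) = T2 n * b k n ^ j"
        unfolding T2_def D_def b_eq power_mult_distrib[of "den n"] by (simp only: mult_ac)
      finally show ?case .
    qed
  qed
  have third: "eventually (\<lambda>n. (real j)\<^sup>2 * X n ^ Suc t \<le> T3 n * b k n ^ j) sequentially"
    using X_le den a_le eventually_gt_at_top[of 1]
  proof eventually_elim
    case (elim n)
    have "X n ^ Suc t \<le> (real n powr (- (1 / (2 * real s)))) ^ Suc t"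
      using elim X_pos[of n] by (intro power_mono) auto
    also have "\<dots> = real n powr (- (1 / (2 * real s)) * real (Suc t))"
      using elim by (subst powr_power) auto
    also have "\<dots> \<le> real n powr (- 1 - real j * C0)"
    proof (rule powr_mono)
      have "real j * C0 + 1 \<le> real (Suc t) / (2 * real s)" using t s_pos by (simp add: field_simps)
      thus "- (1 / (2 * real s)) * real (Suc t) \<le> - 1 - real j * C0" by simp
    qed (use elim in auto)
    also have "\<dots> = real n powr (- 1) * exp (- (C0 * ln (real n))) ^ j"
      using elim by (simp add: powr_def exp_of_nat_mult[symmetric] algebra_simps flip: exp_add)
    also have "\<dots> \<le> real n powr (- 1) * exp (- a n) ^ j"
      using elim by (intro mult_left_mono power_mono) auto
    also have "\<dots> \<le> real n powr (- 1) * exp (- a n) ^ j * (fact m ^ j * den n ^ j)"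
    proof -
      have "fact m * (1 / fact m) \<le> fact m * den n" using elim by (intro mult_left_mono) auto
      hence "1 ^ j \<le> (fact m * den n) ^ j" by (intro power_mono) auto
      hence "1 \<le> fact m ^ j * den n ^ j" by (simp add: power_mult_distrib)
      from mult_left_mono[OF this, of "real n powr (- 1) * exp (- a n) ^ j"] show ?thesis by simp
    qed
    finally have "(real j)\<^sup>2 * X n ^ Suc t \<le> (real j)\<^sup>2 * (real n powr (- 1) * exp (- a n) ^ j * (fact m ^ j * den n ^ j))"
      by (intro mult_left_mono) auto
    also have "\<dots> = T3 n * b k n ^ j"
      unfolding T3_def b_eq power_mult_distrib[of "den n"] by (simp only: mult_ac)
    finally show ?case .
  qed
  have X1: "eventually (\<lambda>n. X n < 1) sequentially" by (rule order_tendstoD[OF X_tendsto_0]) simp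
  have "eventually (\<lambda>n. \<forall>J\<subseteq>{..<n}. card J = j \<longrightarrow>
     measure_pmf.prob (R n) (\<Inter>i\<in>J. low k n i) \<le> (T1 n + T2 n + T3 n) * b k n ^ j) sequentially"
    using first second third X1 Q_bounds[of j 0] Q_bounds[of j A]
  proof eventually_elim
    case (elim n)
    show ?case
    proof (intro allI impI)
      fix J assume J: "J \<subseteq> {..<n}" "card J = j"
      interpret I: intersection_params s "K n" "P n" by (rule params)
      have "J \<noteq> {}" using J j by auto
      have "measure_pmf.prob (R n) (\<Inter>i\<in>J. low k n i) \<le>
          Q j 0 n ^ (n - j) * (\<Sum>d<k. (real n * (W n / Q j 0 n)) ^ d / fact d) ^ j
          + (real j)\<^sup>2 * X n * (Q j A n ^ (n - j) * (\<Sum>d<j * k. (real n * (real j * W n / Q j A n)) ^ d / fact d))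
          + (real j)\<^sup>2 * X n ^ Suc t"
      proof (rule I.prob_low_degree_le[OF J(1) \<open>J \<noteq> {}\<close> k, unfolded J(2)])
        show "0 < Q j 0 n" "Q j 0 n \<le> 1" "0 < Q j A n" "Q j A n \<le> 1" using elim by auto
        show "1 - real j * Wl n + (real j)\<^sup>2 * (W n)\<^sup>2 \<le> Q j 0 n" by (simp add: Q_eq)
        have "I.pair_bound t \<le> (W n)\<^sup>2 + A * (W n / real (K n))"
          using I.pair_bound_le[of t] elim(4) by (simp add: A_def)
        thus "1 - real j * Wl n + (real j)\<^sup>2 * I.pair_bound t \<le> Q j A n"
          unfolding Q_eq by (intro add_left_mono mult_left_mono) auto
      qed
      also have "(\<Sum>d<k. (real n * (W n / Q j 0 n)) ^ d / fact d) = S1 n" by (simp add: S1_def a_def)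
      also have "(\<Sum>d<j * k. (real n * (real j * W n / Q j A n)) ^ d / fact d) = S2 n"
        by (simp add: S2_def a_def mult_ac)
      also have "Q j 0 n ^ (n - j) * S1 n ^ j + (real j)\<^sup>2 * X n * (Q j A n ^ (n - j) * S2 n) + (real j)\<^sup>2 * X n ^ Suc t
          \<le> (T1 n + T2 n + T3 n) * b k n ^ j"
        using elim(1-3) by (simp add: algebra_simps)
      finally show "measure_pmf.prob (R n) (\<Inter>i\<in>J. low k n i) \<le> (T1 n + T2 n + T3 n) * b k n ^ j" .
    qed
  qed
  with lim show ?thesis by (intro exI[of _ "\<lambda>n. T1 n + T2 n + T3 n"] conjI)
qed

end

lemma choose_over_power_tendsto: "(\<lambda>n. real (n choose i) / real n ^ i) \<longlonglongrightarrow> 1 / fact i"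
proof (rule tendsto_sandwich)
  show "eventually (\<lambda>n. real (n choose i) / real n ^ i \<le> 1 / fact i) sequentially"
    using eventually_gt_at_top[of 0]
    by eventually_elim (use choose_le_power_div_fact in \<open>simp add: divide_simps\<close>)
  show "eventually (\<lambda>n. 1 / fact i * (1 - real (i * (i - 1)) / real n) \<le> real (n choose i) / real n ^ i) sequentially"
    using eventually_gt_at_top[of 0] eventually_ge_at_top[of i]
  proof eventually_elim
    case (elim n)
    have "1 / fact i * (1 - real (i * (i - 1)) / real n) = real n ^ i / fact i * (1 - real (i * (i - 1)) / real n) / real n ^ i"
      using elim by simp
    also have "\<dots> \<le> real (n choose i) / real n ^ i"
      by (intro divide_right_mono choose_ge_power) (use elim in auto)
    finally show ?case .
  qed
  have "(\<lambda>n. real (i * (i - 1)) / real n) \<longlonglongrightarrow> 0"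
    by (rule tendsto_divide_0[OF tendsto_const]) (rule filterlim_at_top_imp_at_infinity[OF filterlim_real_sequentially])
  hence "(\<lambda>n. 1 / fact i * (1 - real (i * (i - 1)) / real n)) \<longlonglongrightarrow> 1 / fact i * (1 - 0)"
    by (intro tendsto_mult tendsto_diff tendsto_const)
  thus "(\<lambda>n. 1 / fact i * (1 - real (i * (i - 1)) / real n)) \<longlonglongrightarrow> 1 / fact i" by simp
qed (rule tendsto_const)

context regime
begin

text \<open>Each factor of \<open>prob_low_degree_ge\<close> equals its heuristic value up to a
  factor tending to 1: no overlap, choice of the neighbours, their adjacencies, and the
  non-adjacencies.\<close>

lemma low_degree_prob_ge:
  assumes k: "1 \<le> k"
  shows "\<exists>l. l \<longlonglongrightarrow> 1 \<and> eventually (\<lambda>n. \<forall>J\<subseteq>{..<n}. card J = j \<longrightarrow>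
     l n * b k n ^ j \<le> measure_pmf.prob (R n) (\<Inter>i\<in>J. low k n i)) sequentially"
proof -
  obtain m where m: "k = Suc m" using k by (cases k) auto
  define N where "N = (\<lambda>n. n - j * k)"
  define \<rho> where "\<rho> = (\<lambda>n. 1 - (\<delta> n + real j * W n))"
  define L1 where "L1 = (\<lambda>n. 1 - (real j)\<^sup>2 * X n)"
  define L2 where "L2 = (\<lambda>n. (real (N n) / real n) ^ m * (1 - real (m * (m - 1)) / real (N n)))"
  define L3 where "L3 = (\<lambda>n. exp (- (2 * (real j)\<^sup>2 * (a n * W n))))"
  define L where "L = (\<lambda>n. L1 n * (L2 n ^ j * (\<rho> n ^ (j * m) * L3 n)))"
  have \<rho>: "\<rho> \<longlonglongrightarrow> 1"
  proof -
    have "(\<lambda>n. 1 - (\<delta> n + real j * W n)) \<longlonglongrightarrow> 1 - (0 + real j * 0)"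
      by (intro tendsto_diff tendsto_add tendsto_mult tendsto_const \<delta>_tendsto_0 W_tendsto_0)
    thus ?thesis by (simp add: \<rho>_def)
  qed
  have "L1 \<longlonglongrightarrow> 1 - (real j)\<^sup>2 * 0"
    unfolding L1_def by (intro tendsto_diff tendsto_mult tendsto_const X_tendsto_0)
  moreover have "L2 \<longlonglongrightarrow> 1 ^ m * (1 - 0)"
    unfolding L2_def
  proof (intro tendsto_mult tendsto_power tendsto_diff tendsto_const)
    have "(\<lambda>n. 1 - real (j * k) / real n) \<longlonglongrightarrow> 1 - 0"
      by (intro tendsto_diff tendsto_const tendsto_divide_0[OF tendsto_const]
          filterlim_at_top_imp_at_infinity[OF filterlim_real_sequentially])
    moreover have "eventually (\<lambda>n. 1 - real (j * k) / real n = real (N n) / real n) sequentially"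
      using eventually_gt_at_top[of "j * k"]
      by eventually_elim (simp add: N_def of_nat_diff field_simps)
    ultimately show "(\<lambda>n. real (N n) / real n) \<longlonglongrightarrow> 1" by (simp add: tendsto_cong)
    have "filterlim N at_top sequentially" unfolding N_def by (rule filterlim_minus_const_nat_at_top)
    hence "filterlim (\<lambda>n. real (N n)) at_top sequentially"
      by (rule filterlim_compose[OF filterlim_real_sequentially])
    thus "(\<lambda>n. real (m * (m - 1)) / real (N n)) \<longlonglongrightarrow> 0"
      by (intro tendsto_divide_0[OF tendsto_const] filterlim_at_top_imp_at_infinity)
  qed
  moreover have "L3 \<longlonglongrightarrow> exp (- (2 * (real j)\<^sup>2 * 0))"
    unfolding L3_def by (intro tendsto_exp tendsto_minus tendsto_mult tendsto_const aW_tendsto_0)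
  ultimately have "L \<longlonglongrightarrow> (1 - (real j)\<^sup>2 * 0) * ((1 ^ m * (1 - 0)) ^ j * (1 ^ (j * m) * exp (- (2 * (real j)\<^sup>2 * 0))))"
    unfolding L_def by (intro tendsto_mult tendsto_power \<rho>)
  hence lim: "L \<longlonglongrightarrow> 1" by simp
  have ev1: "eventually (\<lambda>n. 0 < \<rho> n) sequentially" by (rule order_tendstoD[OF \<rho>]) simp
  have "(\<lambda>n. real j * W n) \<longlonglongrightarrow> real j * 0" by (intro tendsto_mult tendsto_const W_tendsto_0)
  hence ev2: "eventually (\<lambda>n. real j * W n < 1 / 2) sequentially" by (rule order_tendstoD) simp
  have "L1 \<longlonglongrightarrow> 1 - (real j)\<^sup>2 * 0"
    unfolding L1_def by (intro tendsto_diff tendsto_mult tendsto_const X_tendsto_0)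
  hence ev3: "eventually (\<lambda>n. 0 < L1 n) sequentially" by (rule order_tendstoD) simp
  have ev4: "eventually (\<lambda>n. m * (m - 1) + m + 1 + j * k \<le> n) sequentially" by (rule eventually_ge_at_top)
  have "eventually (\<lambda>n. \<forall>J\<subseteq>{..<n}. card J = j \<longrightarrow>
     L n * b k n ^ j \<le> measure_pmf.prob (R n) (\<Inter>i\<in>J. low k n i)) sequentially"
    using ev1 ev2 ev3 ev4
  proof eventually_elim
    case (elim n)
    have N: "m * (m - 1) \<le> N n" "m \<le> N n" "0 < N n" and n: "0 < n" "j * k \<le> n"
      using elim(4) by (auto simp: N_def)
    show ?case
    proof (intro allI impI)
      fix J assume J: "J \<subseteq> {..<n}" "card J = j"
      interpret I: intersection_params s "K n" "P n" by (rule params)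
      let ?r = "W n * \<rho> n"
      have choose: "real n ^ m / fact m * L2 n \<le> real (N n choose (k - 1))"
      proof -
        have "real n ^ m / fact m * L2 n = real (N n) ^ m / fact m * (1 - real (m * (m - 1)) / real (N n))"
          using n by (simp add: L2_def power_divide)
        also have "\<dots> \<le> real (N n choose m)" by (rule choose_ge_power) (use N in auto)
        finally show ?thesis by (simp add: m)
      qed
      have L20: "0 \<le> L2 n"
      proof -
        have "real (m * (m - 1)) \<le> real (N n)" using N(1) by (rule of_nat_mono)
        hence "real (m * (m - 1)) / real (N n) \<le> 1" using N by (simp add: divide_le_eq del: of_nat_mult)
        thus ?thesis unfolding L2_def by (intro mult_nonneg_nonneg) auto
      qed
      \<comment> \<open>Uses \<open>ln (1 - y) >= - y - 2 * y ^ 2\<close> for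
        \<open>0 <= y <= 1/2\<close>; the quadratic part is of order \<open>a * W\<close> and
        vanishes.\<close>
      have tail: "exp (- a n) ^ j * L3 n \<le> (1 - real j * W n) ^ (n - j * k)"
      proof -
        let ?y = "real j * W n"
        have y: "0 \<le> ?y" "?y \<le> 1 / 2" using elim(2) W_pos[of n] by auto
        have "exp (- a n) ^ j * L3 n = exp (real n * (- ?y - 2 * ?y\<^sup>2))"
          by (simp add: L3_def a_def power2_eq_square algebra_simps flip: exp_of_nat_mult exp_add)
        also have "\<dots> \<le> exp (real n * ln (1 - ?y))"
          using ln_one_minus_pos_lower_bound[OF y] by (simp add: mult_left_mono)
        also have "\<dots> = (1 - ?y) ^ n" using y by (simp add: exp_of_nat_mult)
        also have "\<dots> \<le> (1 - ?y) ^ (n - j * k)" using y by (intro power_decreasing) auto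
        finally show ?thesis .
      qed
      have "L n * b k n ^ j = L1 n * ((real n ^ m / fact m * L2 n) ^ j * (?r ^ (j * m) * (exp (- a n) ^ j * L3 n)))"
        by (simp add: L_def b_def m a_def power_mult_distrib power_divide flip: power_mult)
           (simp add: mult_ac)
      also have "\<dots> \<le> L1 n * (real (N n choose (k - 1)) ^ j * (?r ^ (j * m) * (1 - real j * W n) ^ (n - j * k)))"
        using elim(1,3) L20 W_pos[of n] L3_def
        by (intro mult_left_mono mult_mono power_mono choose tail mult_nonneg_nonneg zero_le_power)
           (auto simp: L3_def)
      also have "\<dots> = (1 - (real (card J))\<^sup>2 * X n) * (real ((n - card J * k) choose (k - 1)) ^ card J *
          (?r ^ (card J * (k - 1)) * (1 - real (card J) * W n) ^ (n - card J * k)))"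
        by (simp add: L1_def N_def J(2) m)
      also have "\<dots> \<le> measure_pmf.prob (R n) (\<Inter>i\<in>J. low k n i)"
      proof (rule I.prob_low_degree_ge[OF J(1) k])
        show "0 \<le> ?r" using elim(1) W_pos[of n] by simp
        show "?r \<le> Wl n - real (card J) * (W n)\<^sup>2"
          by (simp add: Wl_eq \<rho>_def J(2) power2_eq_square algebra_simps)
        show "0 \<le> 1 - real (card J) * W n" using elim(2) by (simp add: J(2))
        show "card J * k \<le> n" using n by (simp add: J(2))
      qed
      finally show "L n * b k n ^ j \<le> measure_pmf.prob (R n) (\<Inter>i\<in>J. low k n i)" .
    qed
  qed
  with lim show ?thesis by blast
qed

text \<open>The \<open>i\<close>-th binomial moment of the number of vertices of degree below
  \<open>k\<close>.\<close>

definition S :: "nat \<Rightarrow> nat \<Rightarrow> nat \<Rightarrow> real" where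
  "S k n i = (\<Sum>J | J \<subseteq> {..<n} \<and> card J = i. measure_pmf.prob (R n) (\<Inter>v\<in>J. low k n v))"

lemma S_tendsto:
  assumes k: "1 \<le> k" and lim: "(\<lambda>n. real n * b k n) \<longlonglongrightarrow> \<mu>"
  shows "(\<lambda>n. S k n i) \<longlonglongrightarrow> \<mu> ^ i / fact i"
proof (cases "i = 0")
  case True
  have "{J. J \<subseteq> {..<n} \<and> card J = 0} = {{}}" for n :: nat
    using finite_subset[OF _ finite_lessThan[of n]] by auto
  thus ?thesis using True by (simp add: S_def)
next
  case False
  hence i: "1 \<le> i" by simp
  obtain u where u: "u \<longlonglongrightarrow> 1" "eventually (\<lambda>n. \<forall>J\<subseteq>{..<n}. card J = i \<longrightarrow>
     measure_pmf.prob (R n) (\<Inter>i\<in>J. low k n i) \<le> u n * b k n ^ i) sequentially"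
    using low_degree_prob_le[OF k i] by blast
  obtain l where l: "l \<longlonglongrightarrow> 1" "eventually (\<lambda>n. \<forall>J\<subseteq>{..<n}. card J = i \<longrightarrow>
     l n * b k n ^ i \<le> measure_pmf.prob (R n) (\<Inter>i\<in>J. low k n i)) sequentially"
    using low_degree_prob_ge[OF k] by blast
  have card: "real (card {J. J \<subseteq> {..<n} \<and> card J = i}) = real (n choose i)" for n
    using n_subsets[of "{..<n}" i] by simp
  have base: "(\<lambda>n. real (n choose i) / real n ^ i * (real n * b k n) ^ i) \<longlonglongrightarrow> 1 / fact i * \<mu> ^ i"
    by (intro tendsto_mult tendsto_power lim choose_over_power_tendsto)
  have eq: "eventually (\<lambda>n. real (n choose i) / real n ^ i * (real n * b k n) ^ i = real (n choose i) * b k n ^ i) sequentially"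
    using eventually_gt_at_top[of 0] by eventually_elim (simp add: power_mult_distrib)
  have base': "(\<lambda>n. real (n choose i) * b k n ^ i) \<longlonglongrightarrow> 1 / fact i * \<mu> ^ i"
    using base by (simp only: tendsto_cong[OF eq])
  have "(\<lambda>n. S k n i) \<longlonglongrightarrow> 1 * (1 / fact i * \<mu> ^ i)"
  proof (rule tendsto_sandwich)
    show "(\<lambda>n. l n * (real (n choose i) * b k n ^ i)) \<longlonglongrightarrow> 1 * (1 / fact i * \<mu> ^ i)"
      by (intro tendsto_mult l base')
    show "(\<lambda>n. u n * (real (n choose i) * b k n ^ i)) \<longlonglongrightarrow> 1 * (1 / fact i * \<mu> ^ i)"
      by (intro tendsto_mult u base')
    show "eventually (\<lambda>n. l n * (real (n choose i) * b k n ^ i) \<le> S k n i) sequentially"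
      using l(2)
    proof eventually_elim
      case (elim n)
      have "(\<Sum>J | J \<subseteq> {..<n} \<and> card J = i. l n * b k n ^ i) \<le> S k n i"
        unfolding S_def by (rule sum_mono) (use elim in auto)
      thus ?case by (simp add: card mult_ac)
    qed
    show "eventually (\<lambda>n. S k n i \<le> u n * (real (n choose i) * b k n ^ i)) sequentially"
      using u(2)
    proof eventually_elim
      case (elim n)
      have "S k n i \<le> (\<Sum>J | J \<subseteq> {..<n} \<and> card J = i. u n * b k n ^ i)"
        unfolding S_def by (rule sum_mono) (use elim in auto)
      thus ?case by (simp add: card mult_ac)
    qed
  qed
  thus ?thesis by simp
qed

definition pD :: "nat \<Rightarrow> nat \<Rightarrow> real" where
  "pD k n = measure_pmf.prob (R n) {f. min_degree_ge k {..<n} (sadj s f)}"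

lemma pD_eq: "pD k n = measure_pmf.prob (R n) {f. \<forall>v\<in>{..<n}. f \<notin> low k n v}"
  unfolding pD_def min_degree_ge_def intersection_params.low_degree_def[OF params]
  by (rule arg_cong[where f = "measure_pmf.prob _"]) (auto simp: not_less)

text \<open>The binomial moments converge to those of a Poisson variable with mean
  \<open>\<mu>\<close>. For a given tolerance the truncation order of the Bonferroni sums is fixed
  first, and only then does \<open>n\<close> grow. The case \<open>\<mu> = 0\<close> is included and
  serves for \<open>\<alpha>\<close> tending to infinity.\<close>

lemma pD_tendsto:
  assumes k: "1 \<le> k" and lim: "(\<lambda>n. real n * b k n) \<longlonglongrightarrow> \<mu>"
  shows "pD k \<longlonglongrightarrow> exp (- \<mu>)"
proof -
  define A where "A = (\<lambda>r. \<Sum>i\<le>r. (-1) ^ i * (\<mu> ^ i / fact i))"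
  have A: "A \<longlonglongrightarrow> exp (- \<mu>)"
  proof -
    have "(\<lambda>i. (- \<mu>) ^ i / fact i) sums exp (- \<mu>)"
      using exp_converges[of "- \<mu>"] by (simp add: field_simps)
    hence "(\<lambda>r. \<Sum>i\<le>r. (- \<mu>) ^ i / fact i) \<longlonglongrightarrow> exp (- \<mu>)" by (simp add: sums_def_le)
    moreover have "(- \<mu>) ^ i / fact i = (-1) ^ i * (\<mu> ^ i / fact i)" for i
      using power_minus[of \<mu> i] by simp
    ultimately show ?thesis by (simp add: A_def)
  qed
  have SA: "(\<lambda>n. \<Sum>i\<le>r. (-1) ^ i * S k n i) \<longlonglongrightarrow> A r" for r
    unfolding A_def by (intro tendsto_sum tendsto_mult tendsto_const S_tendsto k lim)
  have low: "(\<Sum>i\<le>2 * m + 1. (-1) ^ i * S k n i) \<le> pD k n" for m n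
    unfolding pD_eq S_def by (rule bonferroni(1)) simp
  have upp: "pD k n \<le> (\<Sum>i\<le>2 * m. (-1) ^ i * S k n i)" for m n
    unfolding pD_eq S_def by (rule bonferroni(2)) simp
  show ?thesis
  proof (rule order_tendstoI)
    fix y assume y: "y < exp (- \<mu>)"
    have "(\<lambda>m. A (2 * m + 1)) \<longlonglongrightarrow> exp (- \<mu>)"
      by (rule LIMSEQ_subseq_LIMSEQ[OF A, unfolded o_def]) (simp add: strict_mono_def)
    from order_tendstoD(1)[OF this y] obtain m where "y < A (2 * m + 1)"
      by (auto simp: eventually_sequentially)
    from order_tendstoD(1)[OF SA this] show "eventually (\<lambda>n. y < pD k n) sequentially"
      by eventually_elim (use low[of _ m] in \<open>fastforce intro: less_le_trans\<close>)
  next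
    fix y assume y: "exp (- \<mu>) < y"
    have "(\<lambda>m. A (2 * m)) \<longlonglongrightarrow> exp (- \<mu>)"
      by (rule LIMSEQ_subseq_LIMSEQ[OF A, unfolded o_def]) (simp add: strict_mono_def)
    from order_tendstoD(2)[OF this y] obtain m where "A (2 * m) < y"
      by (auto simp: eventually_sequentially)
    from order_tendstoD(2)[OF SA this] show "eventually (\<lambda>n. pD k n < y) sequentially"
      by eventually_elim (use upp[of _ m] in \<open>fastforce intro: le_less_trans\<close>)
  qed
qed

text \<open>Second moment method: with \<open>B = n * b\<close> growing, the diagonal of the pair
  sum is \<open>O(B)\<close>, while the rest is at most \<open>B ^ 2\<close> up to a factor tending
  to 1, so some vertex of low degree exists with high probability.\<close>

lemma pD_tendsto_0:
  assumes k: "1 \<le> k" and lim: "filterlim (\<lambda>n. real n * b k n) at_top sequentially"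
  shows "pD k \<longlonglongrightarrow> 0"
proof -
  obtain u where u: "u \<longlonglongrightarrow> 1" "eventually (\<lambda>n. \<forall>J\<subseteq>{..<n}. card J = 2 \<longrightarrow>
     measure_pmf.prob (R n) (\<Inter>i\<in>J. low k n i) \<le> u n * b k n ^ 2) sequentially"
    using low_degree_prob_le[OF k, of 2] by auto
  obtain v where v: "v \<longlonglongrightarrow> 1" "eventually (\<lambda>n. \<forall>J\<subseteq>{..<n}. card J = 1 \<longrightarrow>
     measure_pmf.prob (R n) (\<Inter>i\<in>J. low k n i) \<le> v n * b k n ^ 1) sequentially"
    using low_degree_prob_le[OF k, of 1] by auto
  obtain l where l: "l \<longlonglongrightarrow> 1" "eventually (\<lambda>n. \<forall>J\<subseteq>{..<n}. card J = 1 \<longrightarrow>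
     l n * b k n ^ 1 \<le> measure_pmf.prob (R n) (\<Inter>i\<in>J. low k n i)) sequentially"
    using low_degree_prob_ge[OF k] by blast
  define B where "B = (\<lambda>n. real n * b k n)"
  have B: "filterlim B at_top sequentially" using lim by (simp add: B_def)
  have Binv: "(\<lambda>n. inverse (B n)) \<longlonglongrightarrow> 0" by (rule tendsto_inverse_0_at_top[OF B])
  define g where "g = (\<lambda>n. 1 - (l n)\<^sup>2 / (v n * inverse (B n) + u n))"
  have "g \<longlonglongrightarrow> 1 - 1\<^sup>2 / (1 * 0 + 1)"
    unfolding g_def by (intro tendsto_diff tendsto_divide tendsto_power tendsto_add tendsto_mult tendsto_const l u v Binv) auto
  hence g: "g \<longlonglongrightarrow> 0" by simp
  have "eventually (\<lambda>n. 0 < B n) sequentially" using B by (auto simp: filterlim_at_top_dense)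
  moreover have "eventually (\<lambda>n. 0 < l n) sequentially" by (rule order_tendstoD[OF l(1)]) simp
  moreover have "eventually (\<lambda>n. 0 < u n) sequentially" by (rule order_tendstoD[OF u(1)]) simp
  moreover have "eventually (\<lambda>n. 0 < v n) sequentially" by (rule order_tendstoD[OF v(1)]) simp
  ultimately have "eventually (\<lambda>n. pD k n \<le> g n) sequentially"
    using u(2) v(2) l(2)
  proof eventually_elim
    case (elim n)
    let ?p = "measure_pmf.prob (R n)"
    have one: "?p (low k n i) \<le> v n * b k n" "l n * b k n \<le> ?p (low k n i)" if "i < n" for i
      using elim(6)[rule_format, of "{i}"] elim(7)[rule_format, of "{i}"] that by auto
    have pair: "?p (low k n i \<inter> low k n j) \<le> (if i = j then v n * b k n else u n * (b k n)\<^sup>2)" if "i < n" "j < n" for i j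
      using elim(5)[rule_format, of "{i, j}"] one[of i] that by auto
    have row: "(\<Sum>j<n. ?p (low k n i \<inter> low k n j)) \<le> v n * b k n + real n * (u n * (b k n)\<^sup>2)" if i: "i < n" for i
    proof -
      have "(\<Sum>j<n. ?p (low k n i \<inter> low k n j)) \<le> (\<Sum>j<n. (if i = j then v n * b k n else 0) + u n * (b k n)\<^sup>2)"
        by (rule sum_mono, rule order_trans[OF pair]) (use i elim(3) in auto)
      also have "\<dots> = v n * b k n + real n * (u n * (b k n)\<^sup>2)" using i by (simp add: sum.distrib)
      finally show ?thesis .
    qed
    have E2: "(\<Sum>i<n. \<Sum>j<n. ?p (low k n i \<inter> low k n j)) \<le> v n * B n + u n * (B n)\<^sup>2"
    proof -
      have "(\<Sum>i<n. \<Sum>j<n. ?p (low k n i \<inter> low k n j)) \<le> (\<Sum>i<n. v n * b k n + real n * (u n * (b k n)\<^sup>2))"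
        by (intro sum_mono row) auto
      thus ?thesis by (simp add: B_def power2_eq_square algebra_simps)
    qed
    have "l n * B n \<le> (\<Sum>i<n. ?p (low k n i))"
    proof -
      have "(\<Sum>i<n. l n * b k n) \<le> (\<Sum>i<n. ?p (low k n i))" by (intro sum_mono one) auto
      thus ?thesis by (simp add: B_def mult_ac)
    qed
    hence "(l n * B n)\<^sup>2 \<le> (\<Sum>i<n. ?p (low k n i))\<^sup>2" using elim(1,2) by (intro power_mono) auto
    also have "\<dots> \<le> ?p (\<Union>i<n. low k n i) * (\<Sum>i<n. \<Sum>j<n. ?p (low k n i \<inter> low k n j))"
      by (rule chung_erdos) simp
    also have "\<dots> \<le> ?p (\<Union>i<n. low k n i) * (v n * B n + u n * (B n)\<^sup>2)"
      by (intro mult_left_mono E2) auto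
    finally have "(l n * B n)\<^sup>2 \<le> ?p (\<Union>i<n. low k n i) * (v n * B n + u n * (B n)\<^sup>2)" .
    moreover have "v n * B n + u n * (B n)\<^sup>2 = (B n)\<^sup>2 * (v n * inverse (B n) + u n)"
      using elim(1) by (simp add: power2_eq_square field_simps)
    ultimately have "(B n)\<^sup>2 * (l n)\<^sup>2 \<le> (B n)\<^sup>2 * (?p (\<Union>i<n. low k n i) * (v n * inverse (B n) + u n))"
      by (simp add: power_mult_distrib mult_ac)
    hence "(l n)\<^sup>2 \<le> ?p (\<Union>i<n. low k n i) * (v n * inverse (B n) + u n)" using elim(1) by simp
    moreover have "0 < v n * inverse (B n) + u n" using elim by (intro add_pos_pos mult_pos_pos) auto
    ultimately have "(l n)\<^sup>2 / (v n * inverse (B n) + u n) \<le> ?p (\<Union>i<n. low k n i)"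
      by (simp add: divide_le_eq)
    moreover have "pD k n = 1 - ?p (\<Union>i<n. low k n i)"
    proof -
      have "{f. \<forall>v\<in>{..<n}. f \<notin> low k n v} = space (measure_pmf (R n)) - (\<Union>i<n. low k n i)" by auto
      thus ?thesis unfolding pD_eq by (simp only:) (rule measure_pmf.prob_compl, simp)
    qed
    ultimately show ?case by (simp add: g_def)
  qed
  thus ?thesis using g
    by (intro tendsto_sandwich[OF _ _ tendsto_const g]) (auto simp: pD_def)
qed

end

section \<open>Asymptotics of small cuts\<close>

lemma sum_exp_neg_le:
  assumes "0 < B"
  shows "(\<Sum>m=1..M. exp (- (real m * B))) \<le> exp (- B) / (1 - exp (- B))"
proof -
  have r: "exp (- B) < 1" using assms by simp
  have "(\<Sum>m=1..M. exp (- (real m * B))) = (\<Sum>m=1..M. exp (- B) ^ m)"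
    by (simp flip: exp_of_nat_mult)
  also have "\<dots> = exp (- B) * (\<Sum>m<M. exp (- B) ^ m)"
    by (simp add: sum_distrib_left sum.atLeast1_atMost_eq)
  also have "\<dots> \<le> exp (- B) * (1 / (1 - exp (- B)))"
  proof (intro mult_left_mono)
    have "(\<Sum>m<M. exp (- B) ^ m) \<le> (\<Sum>m. exp (- B) ^ m)"
      by (rule sum_le_suminf) (use r in \<open>auto intro: summable_geometric\<close>)
    thus "(\<Sum>m<M. exp (- B) ^ m) \<le> 1 / (1 - exp (- B))" using r by (simp add: suminf_geometric)
  qed auto
  finally show ?thesis by simp
qed

section \<open>Expansion holds with high probability\<close>

context regime
begin

text \<open>Common form of both expansion estimates: with \<open>\<mu> = m * W\<close>, the second
  moment inequality gives about \<open>1 - \<mu> / (1 + \<mu>) = 1 / (1 + \<mu>)\<close>, and the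
  exponential bound for \<open>s = 1\<close> is smaller still.\<close>

definition \<beta> :: "real \<Rightarrow> nat \<Rightarrow> nat \<Rightarrow> real" where
  "\<beta> \<epsilon> n m = 1 / (1 + (1 - \<epsilon>) * (real m * W n))"

text \<open>At this size \<open>m * W\<close> is of constant order, bounded by
  \<open>C * C0 + 1\<close> and as large as wanted through \<open>C\<close>.\<close>

definition M :: "real \<Rightarrow> nat \<Rightarrow> nat" where
  "M C n = nat \<lceil>C * real n / ln (real n)\<rceil>"

abbreviation "expanding n m g \<equiv> intersection_params.expanding s (K n) (P n) n m g"

lemma M_bounds:
  assumes "0 < C"
  shows "eventually (\<lambda>n. C * real n / ln (real n) \<le> real (M C n) \<and> real (M C n) \<le> C * real n / ln (real n) + 1) sequentially"
  using eventually_gt_at_top[of 1]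
proof eventually_elim
  case (elim n)
  hence "0 \<le> C * real n / ln (real n)" using assms by simp
  thus ?case unfolding M_def by linarith
qed

lemma MW_le:
  assumes "0 < C"
  shows "eventually (\<lambda>n. real (M C n) * W n \<le> C * C0 + 1) sequentially"
proof -
  have "eventually (\<lambda>n. W n < 1) sequentially" by (rule order_tendstoD[OF W_tendsto_0]) simp
  with M_bounds[OF assms] a_le eventually_gt_at_top[of 1] show ?thesis
  proof eventually_elim
    case (elim n)
    have ln: "0 < ln (real n)" using elim by simp
    have "real (M C n) * W n \<le> (C * real n / ln (real n) + 1) * W n"
      using elim W_pos[of n] by (intro mult_right_mono) auto
    also have "\<dots> = C * (a n / ln (real n)) + W n" by (simp add: a_def field_simps)
    also have "\<dots> \<le> C * C0 + 1"
      using elim assms ln by (intro add_mono mult_left_mono) (auto simp: divide_le_eq)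
    finally show ?case .
  qed
qed

text \<open>Per vertex, a set that covers too few items costs about
  \<open>\<epsilon> * K * ln K\<close> in the exponent, against the gains \<open>K\<close> and
  \<open>ln (n / m)\<close>; the cost wins because \<open>K\<close> tends to infinity.\<close>

lemma prob_not_expanding_s1_tendsto_0:
  assumes s1: "s = 1" and \<epsilon>: "0 < \<epsilon>" "\<epsilon> < 1" and C: "0 < C"
  shows "(\<lambda>n. measure_pmf.prob (R n) (- expanding n (M C n) (\<beta> \<epsilon> n))) \<longlonglongrightarrow> 0"
proof -
  define Y where "Y = C * C0 + 1"
  have Y: "1 \<le> Y" using C C0_pos by (simp add: Y_def)
  define D where "D = ln (C0 / (c * c0))"
  \<comment> \<open>\<open>- \<phi> K\<close> bounds the exponent per vertex after the substitutions
    \<open>n / m = a / (m * W)\<close> and \<open>m * K / P = m * W / K\<close>, using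
    \<open>m * W <= Y\<close> and \<open>ln a <= D + 2 * ln K\<close>. The latter follows from
    \<open>K_square_ge_ln\<close>.\<close>
  define \<phi> where "\<phi> = (\<lambda>t :: real. \<epsilon> * t * ln t - t * (1 + \<epsilon> * ln Y) - 1 - D - 2 * ln t)"
  have "filterlim \<phi> at_top at_top" unfolding \<phi>_def using \<epsilon> by real_asymp
  hence \<phi>: "filterlim (\<lambda>n. \<phi> (real (K n))) at_top sequentially" by (rule filterlim_compose) (rule K_at_top)
  have neg: "(\<lambda>n. exp (- \<phi> (real (K n)))) \<longlonglongrightarrow> 0"
    by (rule filterlim_compose[OF exp_at_bot]) (use \<phi> in \<open>simp add: filterlim_uminus_at_top\<close>)
  have "(\<lambda>n. exp (- \<phi> (real (K n))) / (1 - exp (- \<phi> (real (K n))))) \<longlonglongrightarrow> 0 / (1 - 0)"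
    by (intro tendsto_divide tendsto_diff tendsto_const neg) auto
  hence lim: "(\<lambda>n. exp (- \<phi> (real (K n))) / (1 - exp (- \<phi> (real (K n))))) \<longlonglongrightarrow> 0" by simp
  have "eventually (\<lambda>n. 0 < \<phi> (real (K n))) sequentially" using \<phi> by (auto simp: filterlim_at_top_dense)
  \<comment> \<open>\<open>K >= Y\<close> yields \<open>M * K <= P\<close>;
    \<open>K >= 1 / \<epsilon>\<close> makes the coefficient \<open>\<epsilon> * K - 1\<close> of
    \<open>ln (m * W)\<close> nonnegative, so \<open>m * W\<close> may be replaced by its upper
    bound \<open>Y\<close>.\<close>
  moreover have "eventually (\<lambda>n. max Y (1 / \<epsilon>) \<le> real (K n)) sequentially"
    using K_at_top unfolding filterlim_at_top by blast
  ultimately have "eventually (\<lambda>n. measure_pmf.prob (R n) (- expanding n (M C n) (\<beta> \<epsilon> n))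
      \<le> exp (- \<phi> (real (K n))) / (1 - exp (- \<phi> (real (K n))))) sequentially"
    using MW_le[OF C] K_square_ge_ln[OF s1] a_le a_ge_1 eventually_gt_at_top[of 1]
  proof eventually_elim
    case (elim n)
    interpret I: intersection_params s "K n" "P n" by (rule params)
    have Kp: "0 < real (K n)" using K_pos[of n] by simp
    have WK: "W n = real (K n) * real (K n) / real (P n)"
      using I.w_eq s1 by (simp add: power2_eq_square)
    have MW: "real (M C n) * W n \<le> Y" using elim by (simp add: Y_def)
    have "real (M C n * K n) = (real (M C n) * W n) / real (K n) * real (P n)"
      using Kp P_pos[of n] by (simp add: WK)
    also have "\<dots> \<le> 1 * real (P n)" using MW elim Kp by (intro mult_right_mono) (auto simp: divide_le_eq)
    finally have MK: "M C n * K n \<le> P n" by (simp only: mult_1 of_nat_le_iff)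
    have br: "1 + ln (real n / real m) + real (K n) + \<epsilon> * real (K n) * ln (real m * real (K n) / real (P n)) \<le> - \<phi> (real (K n))"
      if m: "1 \<le> m" "m \<le> M C n" for m
    proof -
      have mW: "0 < real m * W n" using m W_pos[of n] by simp
      have "real m * W n \<le> real (M C n) * W n" using m W_pos[of n] by (intro mult_right_mono) auto
      hence L: "ln (real m * W n) \<le> ln Y" using mW MW by (subst ln_le_cancel_iff) auto
      have an: "0 < a n" using elim by linarith
      have "real n / real m = a n / (real m * W n)" using W_pos[of n] by (simp add: a_def)
      also have "ln \<dots> = ln (a n) - ln (real m * W n)" using mW an m by (subst ln_div) auto
      finally have e1: "ln (real n / real m) = ln (a n) - ln (real m * W n)" .
      have "real m * real (K n) / real (P n) = (real m * W n) / real (K n)" using Kp by (simp add: WK)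
      also have "ln \<dots> = ln (real m * W n) - ln (real (K n))" using mW Kp m by (subst ln_div) auto
      finally have e2: "ln (real m * real (K n) / real (P n)) = ln (real m * W n) - ln (real (K n))" .
      have "ln (real n) \<le> real (K n) ^ 2 / (c * c0)"
        using elim(4) c_pos c0_pos by (simp add: field_simps)
      hence "C0 * ln (real n) \<le> C0 * (real (K n) ^ 2 / (c * c0))" using C0_pos by (intro mult_left_mono) auto
      hence "a n \<le> (C0 / (c * c0)) * real (K n) ^ 2" using elim(5) by simp
      hence "ln (a n) \<le> ln ((C0 / (c * c0)) * real (K n) ^ 2)" using an by (intro ln_mono) auto
      also have "\<dots> = D + 2 * ln (real (K n))"
      proof -
        have "0 < C0 / (c * c0)" "0 < real (K n) ^ 2" using Kp C0_pos c_pos c0_pos by auto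
        thus ?thesis using ln_mult_pos[of "C0 / (c * c0)" "real (K n) ^ 2"] ln_realpow[of "real (K n)" 2]
          by (simp add: D_def del: times_divide_eq_left)
      qed
      finally have la: "ln (a n) \<le> D + 2 * ln (real (K n))" .
      have "1 \<le> \<epsilon> * real (K n)" using elim(2) \<epsilon> by (simp add: field_simps)
      hence "(\<epsilon> * real (K n) - 1) * ln (real m * W n) \<le> (\<epsilon> * real (K n) - 1) * ln Y"
        using L by (intro mult_left_mono) auto
      moreover have "0 \<le> ln Y" using Y by simp
      ultimately have "(\<epsilon> * real (K n) - 1) * ln (real m * W n) \<le> \<epsilon> * real (K n) * ln Y"
        by (simp add: algebra_simps)
      hence "\<epsilon> * real (K n) * ln (real m * W n) - ln (real m * W n) \<le> \<epsilon> * real (K n) * ln Y"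
        by (simp add: algebra_simps)
      with la show ?thesis unfolding e1 e2 \<phi>_def by (simp add: algebra_simps)
    qed
    have "measure_pmf.prob (R n) (- expanding n (M C n) (\<beta> \<epsilon> n)) \<le>
        measure_pmf.prob (R n) (- expanding n (M C n) (\<lambda>m. exp (- ((1 - \<epsilon>) * real m * W n))))"
    proof (intro measure_pmf.finite_measure_mono, rule Compl_anti_mono, rule I.expanding_mono)
      fix m
      have z: "0 \<le> (1 - \<epsilon>) * (real m * W n)" using \<epsilon> W_pos[of n] by simp
      have "exp (- ((1 - \<epsilon>) * (real m * W n))) = 1 / exp ((1 - \<epsilon>) * (real m * W n))"
        by (simp add: exp_minus divide_inverse)
      also have "\<dots> \<le> \<beta> \<epsilon> n m" unfolding \<beta>_def
        using z exp_ge_add_one_self[of "(1 - \<epsilon>) * (real m * W n)"] by (intro divide_left_mono) auto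
      finally show "exp (- ((1 - \<epsilon>) * real m * W n)) \<le> \<beta> \<epsilon> n m" by (simp add: mult.assoc)
    qed auto
    also have "\<dots> \<le> (\<Sum>m=1..M C n. exp (real m * (1 + ln (real n / real m) + real (K n) + \<epsilon> * real (K n) * ln (real m * real (K n) / real (P n)))))"
      by (rule I.prob_not_expanding_s1_le[OF s1 \<epsilon> MK]) (use elim in auto)
    also have "\<dots> \<le> (\<Sum>m=1..M C n. exp (- (real m * \<phi> (real (K n)))))"
    proof (rule sum_mono)
      fix m assume "m \<in> {1..M C n}"
      hence "real m * (1 + ln (real n / real m) + real (K n) + \<epsilon> * real (K n) * ln (real m * real (K n) / real (P n))) \<le> real m * (- \<phi> (real (K n)))"
        by (intro mult_left_mono br) auto
      thus "exp (real m * (1 + ln (real n / real m) + real (K n) + \<epsilon> * real (K n) * ln (real m * real (K n) / real (P n)))) \<le> exp (- (real m * \<phi> (real (K n))))"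
        by simp
    qed
    also have "\<dots> \<le> exp (- \<phi> (real (K n))) / (1 - exp (- \<phi> (real (K n))))"
      by (rule sum_exp_neg_le[OF elim(1)])
    finally show ?case .
  qed
  thus ?thesis by (intro tendsto_sandwich[OF _ _ tendsto_const lim]) auto
qed

text \<open>With \<open>d l\<close> of order \<open>n * X ^ l\<close>, each term of the overlap
  excess contains \<open>X ^ l * X ^ (2 * s - l) = (fact s * W) ^ 2\<close>. Relative to
  \<open>W\<close> the excess is therefore of order \<open>a / K\<close>, which vanishes for
  \<open>s >= 2\<close>.\<close>

lemma prob_not_expanding_s2_tendsto_0:
  assumes s2: "2 \<le> s" and \<epsilon>: "0 < \<epsilon>" "\<epsilon> < 1" and C: "0 < C"
  shows "(\<lambda>n. measure_pmf.prob (R n) (- expanding n (M C n) (\<beta> \<epsilon> n))) \<longlonglongrightarrow> 0"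
proof -
  define Y where "Y = C * C0 + 1"
  have Y: "1 \<le> Y" using C C0_pos by (simp add: Y_def)
  \<comment> \<open>\<open>exp 2\<close> meets the hypothesis of
    \<open>prob_overlap_degree_le\<close>; \<open>2 / c0\<close> gives
    \<open>d l >= 2 * ln n\<close>, so a union bound over \<open>n\<close> vertices still
    vanishes.\<close>
  define D where "D = exp 2 + 2 / c0"
  have D: "exp 2 \<le> D" "2 / c0 \<le> D" "0 < D" using c0_pos by (auto simp: D_def add_pos_pos)
  define d where "d = (\<lambda>n l. nat \<lceil>D * (real n * X n ^ l)\<rceil>)"
  define E where "E = real s * (2 * D * 8 ^ s * (fact s)\<^sup>2)"
  define \<eta> where "\<eta> = (\<lambda>n. E * (a n / real (K n)))"
  have aK: "(\<lambda>n. a n / real (K n)) \<longlonglongrightarrow> 0"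
    using a_mult_tendsto_0[of "\<lambda>n. 1 / real (K n)"] ln_over_K_tendsto_0[OF s2, of C0] by simp
  have \<eta>: "\<eta> \<longlonglongrightarrow> 0" using tendsto_mult[OF tendsto_const aK, of E] by (simp add: \<eta>_def[abs_def])
  have "(\<lambda>n. 2 * \<delta> n * (1 + Y) + \<eta> n) \<longlonglongrightarrow> 2 * 0 * (1 + Y) + 0"
    by (intro tendsto_add tendsto_mult tendsto_const \<delta>_tendsto_0 \<eta>)
  hence ev1: "eventually (\<lambda>n. 2 * \<delta> n * (1 + Y) + \<eta> n < \<epsilon>) sequentially"
    by (rule order_tendstoD) (use \<epsilon> in simp)
  have ev2: "eventually (\<lambda>n. \<delta> n < 1) sequentially" by (rule order_tendstoD[OF \<delta>_tendsto_0]) simp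
  have ev3: "eventually (\<lambda>n. X n < 1) sequentially" by (rule order_tendstoD[OF X_tendsto_0]) simp
  have ev4: "eventually (\<lambda>n. 1 / D \<le> a n) sequentially" using a_at_top by (auto simp: filterlim_at_top)
  define bnd where "bnd = (\<lambda>n. (fact s)^3 * (C0\<^sup>2 * ln (real n) ^ 2 * W n) + real s * real n powr (-1))"
  have "bnd \<longlonglongrightarrow> (fact s)^3 * 0 + real s * 0"
    unfolding bnd_def by (intro tendsto_add tendsto_mult tendsto_const W_mult_ln_tendsto_0 powr_tendsto_0) auto
  hence lim: "bnd \<longlonglongrightarrow> 0" by simp
  have "eventually (\<lambda>n. measure_pmf.prob (R n) (- expanding n (M C n) (\<beta> \<epsilon> n)) \<le> bnd n) sequentially"
    using MW_le[OF C] ev1 ev2 ev3 ev4 a_le a_ge eventually_gt_at_top[of 1]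
  proof eventually_elim
    case (elim n)
    interpret I: intersection_params s "K n" "P n" by (rule params)
    have Kp: "1 \<le> real (K n)" using K_pos[of n] by simp
    have ln0: "0 < ln (real n)" using elim by simp
    have nX: "a n \<le> real n * X n ^ l" if "l \<in> {1..s}" for l
    proof -
      have "1 * W n \<le> fact s * W n" using W_pos[of n] by (intro mult_right_mono) auto
      hence "a n \<le> real n * (fact s * W n)" unfolding a_def by (intro mult_left_mono) auto
      also have "\<dots> = real n * X n ^ s" by (simp add: X_power_s)
      also have "\<dots> \<le> real n * X n ^ l"
        using that elim(4) X_pos[of n] by (intro mult_left_mono power_decreasing) auto
      finally show ?thesis .
    qed
    have d_ge: "D * (real n * X n ^ l) \<le> real (d n l)" for l
      unfolding d_def by linarith
    have d_le: "real (d n l) \<le> 2 * D * (real n * X n ^ l)" if "l \<in> {1..s}" for l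
    proof -
      have "1 = D * (1 / D)" using D by simp
      also have "\<dots> \<le> D * (real n * X n ^ l)" using elim(5) nX[OF that] D by (intro mult_left_mono) auto
      finally show ?thesis unfolding d_def by linarith
    qed
    have exc: "I.overlap_excess (d n) \<le> W n * \<eta> n"
    proof -
      have "I.overlap_excess (d n) \<le> (\<Sum>l=1..s. 2 * D * 8 ^ s * (fact s)\<^sup>2 * (W n * (a n / real (K n))))"
        unfolding I.overlap_excess_def
      proof (rule sum_mono)
        fix l assume l: "l \<in> {1..s}"
        have "real (d n l) * (8 ^ s * X n ^ (2 * s - l) / real (K n) ^ l) \<le>
            2 * D * (real n * X n ^ l) * (8 ^ s * X n ^ (2 * s - l) / real (K n) ^ 1)"
        proof (intro mult_mono d_le l frac_le)
          show "real (K n) ^ 1 \<le> real (K n) ^ l" using Kp l by (intro power_increasing) auto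
        qed (use D X_pos[of n] Kp in auto)
        also have "\<dots> = 2 * D * 8 ^ s * (real n * (X n ^ l * X n ^ (2 * s - l))) / real (K n)" by simp
        also have "X n ^ l * X n ^ (2 * s - l) = X n ^ (s + s)" using l by (simp add: mult_2 flip: power_add)
        also have "X n ^ (s + s) = (fact s * W n) * (fact s * W n)" by (simp only: power_add X_power_s)
        also have "2 * D * 8 ^ s * (real n * ((fact s * W n) * (fact s * W n))) / real (K n) =
            2 * D * 8 ^ s * (fact s)\<^sup>2 * (W n * (a n / real (K n)))"
          by (simp add: a_def power2_eq_square)
        finally show "real (d n l) * (8 ^ s * X n ^ (2 * s - l) / real (K n) ^ l) \<le> 2 * D * 8 ^ s * (fact s)\<^sup>2 * (W n * (a n / real (K n)))" .
      qed
      thus ?thesis by (simp add: E_def \<eta>_def mult_ac)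
    qed
    have exc0: "0 \<le> I.overlap_excess (d n)"
      unfolding I.overlap_excess_def using X_pos[of n] by (intro sum_nonneg mult_nonneg_nonneg) auto
    have wl: "0 \<le> Wl n" using elim(3) W_pos[of n] by (simp add: Wl_eq)
    have \<eta>0: "0 \<le> \<eta> n" using D a_nonneg[of n] by (simp add: \<eta>_def E_def)
    have "measure_pmf.prob (R n) (- expanding n (M C n) (\<beta> \<epsilon> n)) \<le>
        measure_pmf.prob (R n) (- expanding n (M C n) (\<lambda>m. 1 - real m * (Wl n)\<^sup>2 / (W n + real m * (W n)\<^sup>2 + I.overlap_excess (d n))))"
    proof (intro measure_pmf.finite_measure_mono, rule Compl_anti_mono, rule I.expanding_mono)
      fix m assume m: "1 \<le> m" "m \<le> M C n"
      define \<mu> where "\<mu> = real m * W n"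
      have \<mu>0: "0 \<le> \<mu>" using W_pos[of n] by (simp add: \<mu>_def)
      have "\<mu> \<le> real (M C n) * W n" unfolding \<mu>_def using m W_pos[of n] by (intro mult_right_mono) auto
      hence \<mu>Y: "\<mu> \<le> Y" using elim(1) by (simp add: Y_def)
      have sq: "1 - 2 * \<delta> n \<le> (1 - \<delta> n)\<^sup>2" by (simp add: power2_eq_square algebra_simps)
      \<comment> \<open>Divided by \<open>W\<close>, the estimate to be compared with
        \<open>\<beta>\<close> is \<open>(1 - \<delta>) ^ 2 * \<mu> / (1 + \<mu> + \<eta>)\<close>.
        Since \<open>\<mu> <= Y\<close>, the slack \<open>\<epsilon>\<close> absorbs both errors
        once \<open>2 * \<delta> * (1 + Y) + \<eta> < \<epsilon>\<close>.\<close>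
      have "(1 - \<epsilon>) * (1 + \<mu> + \<eta> n) \<le> 1 + (1 - \<epsilon>) * \<mu> - 2 * \<delta> n * (1 + Y)"
      proof -
        have "0 \<le> \<epsilon> * \<eta> n" using \<eta>0 \<epsilon> by simp
        thus ?thesis using elim(2) by (simp add: algebra_simps)
      qed
      also have "\<dots> \<le> 1 + (1 - \<epsilon>) * \<mu> - 2 * \<delta> n * (1 + (1 - \<epsilon>) * \<mu>)"
      proof -
        have "(1 - \<epsilon>) * \<mu> \<le> 1 * Y" using \<epsilon> \<mu>0 \<mu>Y by (intro mult_mono) auto
        hence "2 * \<delta> n * (1 + (1 - \<epsilon>) * \<mu>) \<le> 2 * \<delta> n * (1 + Y)" using \<delta>_nonneg[of n] by (intro mult_left_mono) auto
        thus ?thesis by simp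
      qed
      also have "\<dots> = (1 - 2 * \<delta> n) * (1 + (1 - \<epsilon>) * \<mu>)" by (simp add: algebra_simps)
      also have "\<dots> \<le> (1 - \<delta> n)\<^sup>2 * (1 + (1 - \<epsilon>) * \<mu>)" using \<epsilon> \<mu>0 sq by (intro mult_right_mono) auto
      finally have "(1 - \<epsilon>) * (1 + \<mu> + \<eta> n) * \<mu> \<le> (1 - \<delta> n)\<^sup>2 * (1 + (1 - \<epsilon>) * \<mu>) * \<mu>"
        using \<mu>0 by (intro mult_right_mono)
      hence key: "(1 - \<epsilon>) * \<mu> / (1 + (1 - \<epsilon>) * \<mu>) \<le> (1 - \<delta> n)\<^sup>2 * \<mu> / (1 + \<mu> + \<eta> n)"
      proof -
        assume h: "(1 - \<epsilon>) * (1 + \<mu> + \<eta> n) * \<mu> \<le> (1 - \<delta> n)\<^sup>2 * (1 + (1 - \<epsilon>) * \<mu>) * \<mu>"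
        have pos: "0 < 1 + (1 - \<epsilon>) * \<mu>" "0 < 1 + \<mu> + \<eta> n" using \<epsilon> \<mu>0 \<eta>0 by (auto intro: add_pos_nonneg)
        have "((1 - \<epsilon>) * \<mu>) * (1 + \<mu> + \<eta> n) \<le> ((1 - \<delta> n)\<^sup>2 * \<mu>) * (1 + (1 - \<epsilon>) * \<mu>)"
          using h by (simp add: mult_ac)
        thus ?thesis
          by (simp only: pos_divide_le_eq[OF pos(1)] times_divide_eq_left pos_le_divide_eq[OF pos(2)])
      qed
      have "1 - real m * (Wl n)\<^sup>2 / (W n + real m * (W n)\<^sup>2 + I.overlap_excess (d n)) \<le>
          1 - real m * (Wl n)\<^sup>2 / (W n + real m * (W n)\<^sup>2 + W n * \<eta> n)"
        using exc exc0 W_pos[of n] by (intro diff_left_mono divide_left_mono add_left_mono mult_pos_pos add_pos_nonneg) auto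
      also have "real m * (Wl n)\<^sup>2 / (W n + real m * (W n)\<^sup>2 + W n * \<eta> n) = (W n * ((1 - \<delta> n)\<^sup>2 * \<mu>)) / (W n * (1 + \<mu> + \<eta> n))"
        by (simp add: Wl_eq \<mu>_def power2_eq_square algebra_simps)
      also have "\<dots> = (1 - \<delta> n)\<^sup>2 * \<mu> / (1 + \<mu> + \<eta> n)" using W_pos[of n] by simp
      also have "1 - (1 - \<delta> n)\<^sup>2 * \<mu> / (1 + \<mu> + \<eta> n) \<le> 1 - (1 - \<epsilon>) * \<mu> / (1 + (1 - \<epsilon>) * \<mu>)"
        using key by simp
      also have "\<dots> = \<beta> \<epsilon> n m"
      proof -
        have "1 + (1 - \<epsilon>) * \<mu> \<noteq> 0" using \<epsilon> \<mu>0 by (smt (verit) mult_nonneg_nonneg)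
        thus ?thesis by (simp add: \<beta>_def \<mu>_def field_simps)
      qed
      finally show "1 - real m * (Wl n)\<^sup>2 / (W n + real m * (W n)\<^sup>2 + I.overlap_excess (d n)) \<le> \<beta> \<epsilon> n m" .
    qed auto
    also have "\<dots> \<le> (real n)\<^sup>2 * X n ^ (3 * s) + real n * (\<Sum>l=1..s. exp (- real (d n l)))"
    proof (rule I.prob_not_expanding_le)
      fix l assume "l \<in> {1..s}"
      have "exp 2 * (real n * X n ^ l) \<le> D * (real n * X n ^ l)"
        using D X_pos[of n] by (intro mult_right_mono) auto
      thus "exp 2 * (real n * X n ^ l) \<le> real (d n l)" using d_ge[of l] by linarith
    qed (use elim wl in auto)
    also have "\<dots> \<le> bnd n"
      unfolding bnd_def
    proof (intro add_mono)
      have "X n ^ (3 * s) = (fact s * W n) ^ 3"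
        by (simp add: mult.commute[of 3] power_mult X_power_s)
      hence "(real n)\<^sup>2 * X n ^ (3 * s) = (fact s)^3 * (a n ^ 2 * W n)"
        by (simp add: a_def power2_eq_square power3_eq_cube)
      also have "\<dots> \<le> (fact s)^3 * ((C0 * ln (real n)) ^ 2 * W n)"
        using elim(6) a_nonneg[of n] W_pos[of n] by (intro mult_left_mono mult_right_mono power_mono) auto
      finally show "(real n)\<^sup>2 * X n ^ (3 * s) \<le> (fact s)^3 * (C0\<^sup>2 * ln (real n) ^ 2 * W n)"
        by (simp add: power_mult_distrib)
      have "(\<Sum>l=1..s. exp (- real (d n l))) \<le> (\<Sum>l=1..s. exp (- (2 * ln (real n))))"
      proof (rule sum_mono)
        fix l assume l: "l \<in> {1..s}"
        have "2 * ln (real n) = 2 / c0 * (c0 * ln (real n))" using c0_pos by simp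
        also have "\<dots> \<le> D * (real n * X n ^ l)"
          by (rule mult_mono) (use D elim(7) nX[OF l] ln0 c0_pos in auto)
        also have "\<dots> \<le> real (d n l)" by (rule d_ge)
        finally show "exp (- real (d n l)) \<le> exp (- (2 * ln (real n)))" by simp
      qed
      hence "real n * (\<Sum>l=1..s. exp (- real (d n l))) \<le> real n * (real s * exp (- (2 * ln (real n))))"
        by (intro mult_left_mono) auto
      also have "\<dots> = real s * (exp (ln (real n)) * exp (- (2 * ln (real n))))"
        using elim by simp
      also have "exp (ln (real n)) * exp (- (2 * ln (real n))) = real n powr (-1)"
        unfolding exp_add[symmetric] using elim by (simp add: powr_def)
      finally show "real n * (\<Sum>l=1..s. exp (- real (d n l))) \<le> real s * real n powr (-1)" .
    qed
    finally show ?case .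
  qed
  thus ?thesis by (intro tendsto_sandwich[OF _ _ tendsto_const lim]) auto
qed

lemma prob_not_expanding_tendsto_0:
  assumes "0 < \<epsilon>" "\<epsilon> < 1" "0 < C"
  shows "(\<lambda>n. measure_pmf.prob (R n) (- expanding n (M C n) (\<beta> \<epsilon> n))) \<longlonglongrightarrow> 0"
proof (cases "s = 1")
  case False
  hence "2 \<le> s" using s_pos by simp
  thus ?thesis using prob_not_expanding_s2_tendsto_0 assms by blast
qed (use prob_not_expanding_s1_tendsto_0 assms in blast)

end

lemma tendsto_0_if_eventually_le:
  fixes f g :: "nat \<Rightarrow> real"
  assumes "eventually (\<lambda>n. f n \<le> g n) sequentially" "g \<longlonglongrightarrow> 0" "\<And>n. 0 \<le> f n"
  shows "f \<longlonglongrightarrow> 0"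
  by (rule tendsto_sandwich[OF _ assms(1) tendsto_const assms(2)]) (simp add: assms(3))

lemma powr_mult_exp_tendsto_0:
  assumes "0 < e" "0 < \<kappa>"
  shows "(\<lambda>n. real n powr q * exp (- (\<kappa> * real n powr e))) \<longlonglongrightarrow> 0"
  using assms by real_asymp

text \<open>A lower bound of order \<open>ln n\<close> with an arbitrary constant would not suffice
  for cuts: \<open>a_ge_ln\<close> makes every vertex of the small side contribute a factor close to
  \<open>1 / n\<close>.\<close>

locale connectivity_regime = regime +
  fixes k :: nat
  assumes k_pos: "1 \<le> k"
    and a_ge_ln: "\<And>\<eta>. 0 < \<eta> \<Longrightarrow> eventually (\<lambda>n. (1 - \<eta>) * ln (real n) \<le> a n) sequentially"
begin

text \<open>Cuts with at most \<open>n powr e1\<close> vertices on the small side need the connectedness of that side;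
  larger ones do not.\<close>
definition e1 :: real where "e1 = 1 / (16 * (real k + 2))"
text \<open>The relative slack spent four times in \<open>\<beta>_power_small\<close>. Since
  \<open>4 * e2 = e1 / 2\<close>, half of the gain \<open>e1\<close> available for sets larger than
  \<open>n powr e1\<close> survives.\<close>

definition e2 :: real where "e2 = e1 / 8"
text \<open>Large enough that \<open>a >= ln n / 2\<close> gives \<open>M * W >= 2048\<close>, and
  then \<open>\<beta>\<close> at size \<open>M\<close> is at most
  \<open>(1 / 4) ^ 5\<close>.\<close>

definition C :: real where "C = 4096"
definition M1 :: "nat \<Rightarrow> nat" where "M1 n = nat \<lfloor>real n powr e1\<rfloor>"

lemma C_pos: "0 < C" by (simp add: C_def)

abbreviation "\<beta>' \<equiv> \<beta> e2"
abbreviation "M' \<equiv> M C"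

lemma e_bounds: "0 < e1" "e1 \<le> 1 / 48" "0 < e2" "e2 < 1 / 2" "4 * e2 = e1 / 2" "2 * e1 * real k \<le> 1 / 8"
proof -
  show "0 < e1" "0 < e2" by (auto simp: e1_def e2_def)
  show "4 * e2 = e1 / 2" by (simp add: e2_def)
  show "e1 \<le> 1 / 48" using k_pos by (simp add: e1_def divide_simps)
  thus "e2 < 1 / 2" by (simp add: e2_def)
  show "2 * e1 * real k \<le> 1 / 8" by (simp add: e1_def divide_simps)
qed

lemma \<beta>_bounds: "0 < \<beta>' n m" "\<beta>' n m \<le> 1"
proof -
  have "0 \<le> (1 - e2) * (real m * W n)" using e_bounds W_pos[of n] by (intro mult_nonneg_nonneg) auto
  thus "0 < \<beta>' n m" "\<beta>' n m \<le> 1" by (auto simp: \<beta>_def)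
qed

lemma \<beta>_power_le_exp:
  assumes "0 \<le> t" "t \<le> (1 - e2) * (real m * W n)"
  shows "\<beta>' n m ^ N \<le> exp (- (real N * (t / (1 + t))))"
proof -
  have "\<beta>' n m \<le> 1 / (1 + t)" unfolding \<beta>_def using assms by (intro divide_left_mono) auto
  also have "\<dots> = 1 - t / (1 + t)" using assms by (simp add: field_simps)
  finally have "\<beta>' n m ^ N \<le> (1 - t / (1 + t)) ^ N" using \<beta>_bounds(1)[of n m] by (intro power_mono) auto
  also have "\<dots> \<le> exp (- (real N * (t / (1 + t))))" by (rule power_le_exp_neg) (use assms in simp)
  finally show ?thesis .
qed

text \<open>Four factors \<open>1 - e2\<close> are lost: in the definition of
  \<open>\<beta>\<close>, in \<open>t / (1 + t) >= (1 - e2) * t\<close>, in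
  \<open>n - m - d >= (1 - e2) * n\<close>, and in the lower bound on \<open>a\<close>. Bernoulli's
  inequality combines them to \<open>1 - 4 * e2\<close>.\<close>

lemma \<beta>_power_small:
  assumes m: "1 \<le> m" "real m * W n \<le> e2" "real (m + k) \<le> e2 * real n" and d: "d \<le> k"
    and a: "(1 - e2) * ln (real n) \<le> a n" and n: "1 < n"
  shows "\<beta>' n m ^ (n - m - d) \<le> exp (- ((1 - 4 * e2) * (real m * ln (real n))))"
proof -
  define t where "t = (1 - e2) * (real m * W n)"
  have e: "0 < e2" "e2 < 1 / 2" using e_bounds by auto
  have t: "0 \<le> t" using e W_pos[of n] by (simp add: t_def)
  have "t \<le> 1 * (real m * W n)" unfolding t_def using e W_pos[of n] by (intro mult_right_mono) auto
  hence te: "t \<le> e2" using m by simp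
  have "(1 - e2) * (1 + t) \<le> (1 - e2) * (1 + e2)" using te e by (intro mult_left_mono) auto
  also have "\<dots> = 1 - e2 * e2" by (simp add: algebra_simps)
  also have "\<dots> \<le> 1" by simp
  finally have "(1 - e2) * t * (1 + t) \<le> t" using t mult_right_mono[of "(1 - e2) * (1 + t)" 1 t] by (simp add: mult_ac)
  hence frac: "(1 - e2) * t \<le> t / (1 + t)" using t by (subst pos_le_divide_eq) auto
  have "real (n - m - d) \<ge> real n - real (m + k)" using d by linarith
  hence N: "(1 - e2) * real n \<le> real (n - m - d)" using m by (simp add: algebra_simps)
  have p: "1 - 4 * e2 \<le> (1 - e2) ^ 4"
  proof -
    have "1 + real 4 * (- e2) \<le> (1 + (- e2)) ^ 4" by (rule Bernoulli_inequality) (use e in simp)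
    thus ?thesis by simp
  qed
  have "(1 - 4 * e2) * (real m * ln (real n)) \<le> (1 - e2) ^ 4 * (real m * ln (real n))"
    using p n by (intro mult_right_mono) auto
  also have "\<dots> = (1 - e2) ^ 3 * real m * ((1 - e2) * ln (real n))" by (simp add: power4_eq_xxxx power3_eq_cube)
  also have "\<dots> \<le> (1 - e2) ^ 3 * real m * a n" using a e by (intro mult_left_mono) auto
  also have "\<dots> = ((1 - e2) * real n) * ((1 - e2) * t)" by (simp add: t_def a_def power3_eq_cube)
  also have "\<dots> \<le> real (n - m - d) * (t / (1 + t))" using N frac e t by (intro mult_mono) auto
  finally have "(1 - 4 * e2) * (real m * ln (real n)) \<le> real (n - m - d) * (t / (1 + t))" .
  moreover have "\<beta>' n m ^ (n - m - d) \<le> exp (- (real (n - m - d) * (t / (1 + t))))"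
    by (rule \<beta>_power_le_exp[OF t]) (simp add: t_def)
  ultimately show ?thesis by (meson exp_le_cancel_iff neg_le_iff_le order_trans)
qed

lemma M1_bounds: "eventually (\<lambda>n. real (M1 n) \<le> real n powr e1 \<and> real n powr e1 < real (M1 n) + 1) sequentially"
proof (rule always_eventually, rule allI)
  fix n
  have "0 \<le> real n powr e1" by simp
  thus "real (M1 n) \<le> real n powr e1 \<and> real n powr e1 < real (M1 n) + 1" unfolding M1_def by linarith
qed

lemma M_le: "eventually (\<lambda>n. real (M' n + k) \<le> e2 * real n) sequentially"
proof -
  have "eventually (\<lambda>n. C * real n / ln (real n) + 1 + real k \<le> e2 * real n) sequentially"
    using e_bounds(3) unfolding C_def by real_asymp
  with M_bounds[OF C_pos] show ?thesis by eventually_elim auto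
qed

lemma M1_le_M: "eventually (\<lambda>n. M1 n \<le> M' n) sequentially"
proof -
  have "eventually (\<lambda>n. real n powr (1/48) \<le> C * real n / ln (real n)) sequentially"
    unfolding C_def by real_asymp
  with M1_bounds M_bounds[OF C_pos] eventually_gt_at_top[of 1] show ?thesis
  proof eventually_elim
    case (elim n)
    have "real n powr e1 \<le> real n powr (1/48)" using e_bounds elim by (intro powr_mono) auto
    hence "real (M1 n) \<le> real (M' n)" using elim by linarith
    thus ?case by simp
  qed
qed

text \<open>The \<open>n ^ m\<close> lists and the cost of their edges combine to at most
  \<open>n * (m * a) ^ (m - 1)\<close>: one free vertex, then a factor of at most
  \<open>n powr (2 * e1)\<close> for each further vertex and each cut vertex. The missing edges
  contribute \<open>n powr (- (1 - 4 * e2) * m)\<close>.\<close>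

lemma sum_small_tendsto_0:
  "(\<lambda>n. \<Sum>m=2..M1 n. \<Sum>d<k. real n ^ m * real n ^ d *
      (fact (m - 1) * W n ^ (m - 1) * ((real m * W n) ^ d * \<beta>' n m ^ (n - m - d)))) \<longlonglongrightarrow> 0"
proof -
  have "(\<lambda>n. real k * real n powr (- (1/4))) \<longlonglongrightarrow> real k * 0"
    by (intro tendsto_mult tendsto_const powr_tendsto_0) auto
  hence lim: "(\<lambda>n. real k * real n powr (- (1/4))) \<longlonglongrightarrow> 0" by simp
  have eva: "eventually (\<lambda>n. C0 * ln (real n) \<le> real n powr e1) sequentially" using e_bounds(1) by real_asymp
  have evW: "eventually (\<lambda>n. real n powr e1 * (C0 * ln (real n) * real n powr (-1)) \<le> e2) sequentially"
  proof -
    have "eventually (\<lambda>n. real n powr (1/48) * (C0 * ln (real n) * real n powr (-1)) < e2) sequentially"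
    proof (rule order_tendstoD)
      have "(\<lambda>n. C0 * ln (real n) ^ 1 * real n powr (- (47/48))) \<longlonglongrightarrow> 0" by (rule ln_over_powr_tendsto_0) simp
      moreover have "C0 * ln (real n) ^ 1 * real n powr (- (47/48)) = real n powr (1/48) * (C0 * ln (real n) * real n powr (-1))" for n
      proof -
        have "- (47/48) = 1/48 + (- 1 :: real)" by simp
        hence "real n powr (- (47/48)) = real n powr (1/48) * real n powr (- 1)" by (simp only: powr_add)
        thus ?thesis by (simp only: power_one_right mult_ac)
      qed
      ultimately show "(\<lambda>n. real n powr (1/48) * (C0 * ln (real n) * real n powr (-1))) \<longlonglongrightarrow> 0" by simp
    qed (use e_bounds in simp)
    thus ?thesis using eventually_gt_at_top[of 1]
    proof eventually_elim
      case (elim n)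
      have "real n powr e1 * (C0 * ln (real n) * real n powr (-1)) \<le> real n powr (1/48) * (C0 * ln (real n) * real n powr (-1))"
        using e_bounds elim C0_pos by (intro mult_right_mono powr_mono) auto
      thus ?case using elim by linarith
    qed
  qed
  have "eventually (\<lambda>n. (\<Sum>m=2..M1 n. \<Sum>d<k. real n ^ m * real n ^ d *
      (fact (m - 1) * W n ^ (m - 1) * ((real m * W n) ^ d * \<beta>' n m ^ (n - m - d)))) \<le> real k * real n powr (- (1/4))) sequentially"
    using eva evW M1_bounds M_le M1_le_M W_le a_le a_ge_1 a_ge_ln[OF e_bounds(3)] eventually_gt_at_top[of 1]
  proof eventually_elim
    case (elim n)
    have n: "1 < n" by (rule elim)
    have summand: "real n ^ m * real n ^ d * (fact (m - 1) * W n ^ (m - 1) * ((real m * W n) ^ d * \<beta>' n m ^ (n - m - d)))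
        \<le> real n powr (- (1 / 2))" if m: "2 \<le> m" "m \<le> M1 n" and d: "d < k" for m d
    proof -
      have mr: "1 \<le> real m" using m by simp
      have mn: "real m \<le> real n powr e1" using m elim(3) by (meson of_nat_mono order_trans)
      have "real m * W n \<le> real n powr e1 * (C0 * ln (real n) * real n powr (-1))"
        using mn elim(6) W_pos[of n] by (intro mult_mono) auto
      hence mW: "real m * W n \<le> e2" using elim(2) by linarith
      have "real (m + k) \<le> real (M' n + k)" using m elim(5) by (intro of_nat_mono) auto
      hence mk: "real (m + k) \<le> e2 * real n" using elim(4) by linarith
      have ma1: "1 \<le> real m * a n" using mr elim(8) mult_mono[of 1 "real m" 1 "a n"] by simp
      have "real m * a n \<le> real n powr e1 * real n powr e1" using mn elim(1,7) a_nonneg[of n] by (intro mult_mono) auto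
      hence ma: "real m * a n \<le> real n powr (2 * e1)" by (simp flip: powr_add)
      obtain i where i: "m = Suc i" using m by (cases m) auto
      have "real n ^ m * real n ^ d * (fact (m - 1) * W n ^ (m - 1) * ((real m * W n) ^ d * \<beta>' n m ^ (n - m - d)))
         = real n * (fact i * a n ^ i) * (real m * a n) ^ d * \<beta>' n m ^ (n - m - d)"
        by (simp add: i a_def power_mult_distrib mult_ac)
      also have "\<dots> \<le> real n * (real m * a n) ^ i * (real m * a n) ^ d * exp (- ((1 - 4 * e2) * (real m * ln (real n))))"
      proof (intro mult_mono mult_left_mono)
        show "\<beta>' n m ^ (n - m - d) \<le> exp (- ((1 - 4 * e2) * (real m * ln (real n))))"
          by (rule \<beta>_power_small) (use m mW mk d elim(9) n in auto)
        have "fact i \<le> real i ^ i" using fact_le_power[of i, where 'a = real] by simp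
        also have "\<dots> \<le> real m ^ i" using i by (intro power_mono) auto
        finally show "fact i * a n ^ i \<le> (real m * a n) ^ i"
          using a_nonneg[of n] by (simp add: power_mult_distrib mult_right_mono)
      qed (use a_nonneg[of n] \<beta>_bounds[of n m] in \<open>auto intro!: mult_nonneg_nonneg simp: less_imp_le\<close>)
      also have "\<dots> = real n * (real m * a n) ^ (i + d) * exp (- ((1 - 4 * e2) * (real m * ln (real n))))"
        by (simp add: power_add mult_ac)
      also have "\<dots> \<le> real n * (real n powr (2 * e1)) ^ (m + k) * exp (- ((1 - 4 * e2) * (real m * ln (real n))))"
      proof (intro mult_right_mono mult_left_mono)
        have "(real m * a n) ^ (i + d) \<le> (real m * a n) ^ (m + k)" using ma1 i d by (intro power_increasing) auto
        also have "\<dots> \<le> (real n powr (2 * e1)) ^ (m + k)" using ma ma1 by (intro power_mono) auto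
        finally show "(real m * a n) ^ (i + d) \<le> (real n powr (2 * e1)) ^ (m + k)" .
      qed auto
      also have "\<dots> = exp (ln (real n) * (1 + 2 * e1 * (real m + real k) - (1 - 4 * e2) * real m))"
      proof -
        have "real n = exp (ln (real n))" using n by simp
        moreover have "(real n powr (2 * e1)) ^ (m + k) = exp (ln (real n) * (2 * e1 * (real m + real k)))"
          using n by (simp add: powr_def algebra_simps flip: exp_of_nat_mult)
        ultimately have "real n * (real n powr (2 * e1)) ^ (m + k) * exp (- ((1 - 4 * e2) * (real m * ln (real n)))) =
           exp (ln (real n)) * exp (ln (real n) * (2 * e1 * (real m + real k))) * exp (- ((1 - 4 * e2) * (real m * ln (real n))))"
          by simp
        also have "\<dots> = exp (ln (real n) + ln (real n) * (2 * e1 * (real m + real k)) + (- ((1 - 4 * e2) * (real m * ln (real n)))))"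
          by (simp only: exp_add)
        finally show ?thesis by (simp add: algebra_simps)
      qed
      also have "\<dots> \<le> exp (ln (real n) * (- (1 / 2)))"
      proof -
        \<comment> \<open>Here \<open>m >= 2\<close> is decisive: the exponent is at most
          \<open>1 + 1/8 - 15/8 = - 3/4\<close>, where \<open>1/8\<close> pays for the cut. For
          \<open>m = 1\<close> it could not be negative, and low-degree vertices are indeed not
          excluded.\<close>
        have "2 * e1 + 4 * e2 \<le> 1 / 16" using e_bounds by linarith
        hence "(2 * e1 + 4 * e2 - 1) * real m \<le> (1 / 16 - 1) * real m" by (intro mult_right_mono) auto
        moreover have "(1 / 16 - 1) * real m \<le> (1 / 16 - 1) * 2" using m by (intro mult_left_mono_neg) auto
        ultimately have "(2 * e1 + 4 * e2 - 1) * real m \<le> (1 / 16 - 1) * 2" by linarith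
        hence "1 + 2 * e1 * (real m + real k) - (1 - 4 * e2) * real m \<le> - (1 / 2)"
          using e_bounds(6) by (simp add: algebra_simps)
        from mult_left_mono[OF this, of "ln (real n)"] show ?thesis using n by simp
      qed
      also have "\<dots> = real n powr (- (1 / 2))" using n by (simp add: powr_def)
      finally show ?thesis .
    qed
    have "(\<Sum>m=2..M1 n. \<Sum>d<k. real n ^ m * real n ^ d *
      (fact (m - 1) * W n ^ (m - 1) * ((real m * W n) ^ d * \<beta>' n m ^ (n - m - d)))) \<le> (\<Sum>m=2..M1 n. \<Sum>d<k. real n powr (- (1 / 2)))"
      by (intro sum_mono summand) auto
    also have "\<dots> = real (M1 n - 1) * (real k * real n powr (- (1 / 2)))" by simp
    also have "\<dots> \<le> real n powr (1/4) * (real k * real n powr (- (1 / 2)))"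
    proof (intro mult_right_mono)
      have "real (M1 n - 1) \<le> real (M1 n)" by simp
      also have "\<dots> \<le> real n powr e1" using elim(3) by simp
      also have "\<dots> \<le> real n powr (1/4)" using e_bounds n by (intro powr_mono) auto
      finally show "real (M1 n - 1) \<le> real n powr (1/4)" .
    qed auto
    also have "\<dots> = real k * real n powr (- (1/4))"
    proof -
      have "- (1/4) = 1/4 + (- (1/2) :: real)" by simp
      hence "real n powr (- (1/4)) = real n powr (1/4) * real n powr (- (1/2))" by (simp only: powr_add)
      thus ?thesis by (simp only: mult_ac)
    qed
    finally show ?case .
  qed
  thus ?thesis
    by (rule tendsto_0_if_eventually_le[OF _ lim], intro sum_nonneg mult_nonneg_nonneg zero_le_power)
       (use \<beta>_bounds W_pos in \<open>auto simp: less_imp_le\<close>)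
qed

text \<open>For \<open>m\<close> above \<open>n powr e1\<close> the entropy of choosing the set is
  at most \<open>(1 - e1) * ln n + 1\<close> per vertex, so the edges inside the set can be
  ignored.\<close>

lemma sum_medium_tendsto_0:
  "(\<lambda>n. \<Sum>m=Suc (M1 n)..M' n. \<Sum>d<k. real (n choose m) * real n ^ d * \<beta>' n m ^ (n - m - d)) \<longlonglongrightarrow> 0"
proof -
  \<comment> \<open>The decay rate \<open>t / (1 + t)\<close> of \<open>\<beta>_power_le_exp\<close>
    at \<open>t = e2 / 2\<close>, available as soon as \<open>m * W > e2\<close>.\<close>
  define \<kappa> where "\<kappa> = (e2 / 2) / (1 + e2 / 2)"
  have \<kappa>: "0 < \<kappa>" using e_bounds by (simp add: \<kappa>_def)
  define g where "g = (\<lambda>n. real n * (real k * real n ^ k * (exp (- (real n powr e1)) + exp (- (\<kappa> / 4 * real n)))))"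
  have lim: "g \<longlonglongrightarrow> 0"
  proof -
    have "(\<lambda>n. real k * (real n powr (real k + 1) * exp (- (1 * real n powr e1)) + real n powr (real k + 1) * exp (- (\<kappa> / 4 * real n powr 1))))
        \<longlonglongrightarrow> real k * (0 + 0)"
      using \<kappa> e_bounds(1) by (intro tendsto_mult tendsto_add tendsto_const powr_mult_exp_tendsto_0) auto
    moreover have "eventually (\<lambda>n. real k * (real n powr (real k + 1) * exp (- (1 * real n powr e1)) + real n powr (real k + 1) * exp (- (\<kappa> / 4 * real n powr 1))) = g n) sequentially"
      using eventually_gt_at_top[of 0]
      by eventually_elim (simp add: g_def powr_add powr_realpow algebra_simps)
    ultimately show ?thesis by (simp add: tendsto_cong)
  qed
  have ev1: "eventually (\<lambda>n. 1 + 1 \<le> e1 / 2 * ln (real n)) sequentially" using e_bounds(1) by real_asymp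
  have ev2: "eventually (\<lambda>n. (C * real n / ln (real n) + 1) * (1 + ln (C0 * ln (real n) / e2)) \<le> \<kappa> / 4 * real n) sequentially"
    unfolding C_def using \<kappa> C0_pos e_bounds(3) by real_asymp
  have ev3: "eventually (\<lambda>n. 1 \<le> C0 * ln (real n) / e2) sequentially" using C0_pos e_bounds(3) by real_asymp
  have evM: "eventually (\<lambda>n. real (M' n) \<le> C * real n / ln (real n) + 1) sequentially"
    using M_bounds[OF C_pos] by eventually_elim simp
  have "eventually (\<lambda>n. (\<Sum>m=Suc (M1 n)..M' n. \<Sum>d<k. real (n choose m) * real n ^ d * \<beta>' n m ^ (n - m - d)) \<le> g n) sequentially"
    using ev1 ev2 ev3 M1_bounds M_le evM a_le a_ge_1 a_ge_ln[OF e_bounds(3)] eventually_gt_at_top[of 1]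
  proof eventually_elim
    case (elim n)
    have n: "1 < n" by (rule elim)
    have main: "real (n choose m) * \<beta>' n m ^ (n - m - d) \<le> exp (- (real n powr e1)) + exp (- (\<kappa> / 4 * real n))"
      if m: "Suc (M1 n) \<le> m" "m \<le> M' n" and d: "d < k" for m d
    proof -
      have m1: "1 \<le> m" using m by simp
      have "real (M1 n) + 1 \<le> real m" using m(1) by linarith
      hence me: "real n powr e1 \<le> real m" using elim(4) by linarith
      have "real (m + k) \<le> real (M' n + k)" using m by (intro of_nat_mono) auto
      hence mk: "real (m + k) \<le> e2 * real n" using elim(5) by linarith
      have "real (n choose m) \<le> exp (real m * (1 + ln (real n / real m)))" by (rule choose_le_exp) (use m1 n in auto)
      hence "real (n choose m) * \<beta>' n m ^ (n - m - d) \<le> exp (real m * (1 + ln (real n / real m))) * \<beta>' n m ^ (n - m - d)"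
        using \<beta>_bounds[of n m] by (intro mult_right_mono) auto
      also have "\<dots> \<le> exp (- (real n powr e1)) + exp (- (\<kappa> / 4 * real n))"
      proof (cases "real m * W n \<le> e2")
        \<comment> \<open>Per vertex, the gain \<open>(1 - e1) * ln n + 1\<close> meets the cost
          \<open>(1 - 4 * e2) * ln n\<close>; the difference \<open>e1 / 2 * ln n - 1\<close> is
          eventually at least 1.\<close>
        case True
        have "ln (real n / real m) \<le> ln (real n / real n powr e1)"
          using m1 me n by (intro ln_mono divide_left_mono) auto
        also have "\<dots> = (1 - e1) * ln (real n)" using n by (simp add: ln_div ln_powr algebra_simps)
        finally have l: "ln (real n / real m) \<le> (1 - e1) * ln (real n)" .
        have "exp (real m * (1 + ln (real n / real m))) * \<beta>' n m ^ (n - m - d) \<le>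
            exp (real m * (1 + (1 - e1) * ln (real n))) * exp (- ((1 - 4 * e2) * (real m * ln (real n))))"
        proof (intro mult_mono)
          show "\<beta>' n m ^ (n - m - d) \<le> exp (- ((1 - 4 * e2) * (real m * ln (real n))))"
            by (rule \<beta>_power_small) (use m1 True mk d elim(9) n in auto)
          show "exp (real m * (1 + ln (real n / real m))) \<le> exp (real m * (1 + (1 - e1) * ln (real n)))"
            using l by (simp add: mult_left_mono)
        qed (use \<beta>_bounds[of n m] in \<open>auto simp: less_imp_le\<close>)
        also have "\<dots> = exp (real m * (1 - (e1 - 4 * e2) * ln (real n)))"
          by (simp add: algebra_simps flip: exp_add)
        also have "\<dots> \<le> exp (real m * (- 1))"
        proof -
          have "e1 - 4 * e2 = e1 / 2" using e_bounds(5) by linarith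
          hence "1 - (e1 - 4 * e2) * ln (real n) \<le> - 1" using elim(1) by simp
          hence "real m * (1 - (e1 - 4 * e2) * ln (real n)) \<le> real m * (- 1)" by (rule mult_left_mono) simp
          thus ?thesis by (simp only: exp_le_cancel_iff)
        qed
        also have "\<dots> \<le> exp (- (real n powr e1))" using me by simp
        also have "\<dots> \<le> exp (- (real n powr e1)) + exp (- (\<kappa> / 4 * real n))" by simp
        finally show ?thesis .
      next
        \<comment> \<open>Now \<open>m\<close> is at least of order \<open>n / ln n\<close>, so
          \<open>n choose m\<close> is only \<open>exp (o(n))\<close>, while \<open>\<beta>\<close>
          is bounded away from 1 and has an exponent of at least \<open>n / 2\<close>.\<close>
        case False
        have "e2 * real n < real m * a n" using False n by (simp add: a_def mult_ac)
        also have "\<dots> \<le> real m * (C0 * ln (real n))" using elim(7) by (intro mult_left_mono) auto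
        finally have "real n / real m \<le> C0 * ln (real n) / e2"
          using m1 e_bounds(3) by (simp add: field_simps)
        hence "ln (real n / real m) \<le> ln (C0 * ln (real n) / e2)" using m1 n by (intro ln_mono) auto
        moreover have "0 \<le> ln (C0 * ln (real n) / e2)" using elim(3) by simp
        moreover have "real m \<le> C * real n / ln (real n) + 1"
        proof -
          have "real m \<le> real (M' n)" using m by simp
          thus ?thesis using elim(6) by linarith
        qed
        ultimately have "real m * (1 + ln (real n / real m)) \<le> (C * real n / ln (real n) + 1) * (1 + ln (C0 * ln (real n) / e2))"
          by (meson add_left_mono add_nonneg_nonneg mult_left_mono mult_right_mono of_nat_0_le_iff order_trans zero_le_one)
        hence A: "real m * (1 + ln (real n / real m)) \<le> \<kappa> / 4 * real n" using elim(2) by linarith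
        have "e2 / 2 \<le> (1 - e2) * (real m * W n)"
        proof -
          have "1 / 2 * e2 \<le> (1 - e2) * (real m * W n)" using False e_bounds by (intro mult_mono) auto
          thus ?thesis by simp
        qed
        hence "\<beta>' n m ^ (n - m - d) \<le> exp (- (real (n - m - d) * ((e2 / 2) / (1 + e2 / 2))))"
          by (intro \<beta>_power_le_exp) (use e_bounds in auto)
        also have "\<dots> \<le> exp (- (\<kappa> / 2 * real n))"
        proof -
          have "real (n - m - d) \<ge> real n - real (m + k)" using d by linarith
          moreover have "e2 * real n \<le> 1 / 2 * real n" using e_bounds by (intro mult_right_mono) auto
          ultimately have "1 / 2 * real n \<le> real (n - m - d)" using mk by linarith
          hence "1 / 2 * real n * \<kappa> \<le> real (n - m - d) * \<kappa>" using \<kappa> by (intro mult_right_mono) auto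
          hence "\<kappa> / 2 * real n \<le> real (n - m - d) * \<kappa>" by (simp only: mult_ac times_divide_eq_left times_divide_eq_right mult_1)
          thus ?thesis unfolding \<kappa>_def by (simp only: exp_le_cancel_iff neg_le_iff_le)
        qed
        finally have B: "\<beta>' n m ^ (n - m - d) \<le> exp (- (\<kappa> / 2 * real n))" .
        have "exp (real m * (1 + ln (real n / real m))) * \<beta>' n m ^ (n - m - d) \<le> exp (\<kappa> / 4 * real n) * exp (- (\<kappa> / 2 * real n))"
          using A B \<beta>_bounds[of n m] by (intro mult_mono) (auto simp: less_imp_le)
        also have "\<dots> = exp (- (\<kappa> / 4 * real n))" by (simp add: algebra_simps flip: exp_add)
        also have "\<dots> \<le> exp (- (real n powr e1)) + exp (- (\<kappa> / 4 * real n))" by simp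
        finally show ?thesis .
      qed
      finally show ?thesis .
    qed
    have summand: "real (n choose m) * real n ^ d * \<beta>' n m ^ (n - m - d) \<le> real n ^ k * (exp (- (real n powr e1)) + exp (- (\<kappa> / 4 * real n)))"
      if m: "Suc (M1 n) \<le> m" "m \<le> M' n" and d: "d < k" for m d
    proof -
      have "real (n choose m) * real n ^ d * \<beta>' n m ^ (n - m - d) = real n ^ d * (real (n choose m) * \<beta>' n m ^ (n - m - d))" by simp
      also have "\<dots> \<le> real n ^ k * (exp (- (real n powr e1)) + exp (- (\<kappa> / 4 * real n)))"
        using d n \<beta>_bounds[of n m] by (intro mult_mono main m power_increasing) (auto simp: less_imp_le)
      finally show ?thesis .
    qed
    have "(\<Sum>m=Suc (M1 n)..M' n. \<Sum>d<k. real (n choose m) * real n ^ d * \<beta>' n m ^ (n - m - d)) \<le>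
        (\<Sum>m=Suc (M1 n)..M' n. \<Sum>d<k. real n ^ k * (exp (- (real n powr e1)) + exp (- (\<kappa> / 4 * real n))))"
      by (intro sum_mono summand) auto
    also have "\<dots> = real (Suc (M' n) - Suc (M1 n)) * (real k * real n ^ k * (exp (- (real n powr e1)) + exp (- (\<kappa> / 4 * real n))))"
      by simp
    also have "\<dots> \<le> g n" unfolding g_def
    proof (intro mult_right_mono mult_nonneg_nonneg add_nonneg_nonneg)
      have "e2 * real n \<le> 1 * real n" using e_bounds by (intro mult_right_mono) auto
      thus "real (Suc (M' n) - Suc (M1 n)) \<le> real n" using elim(5) by simp
    qed auto
    finally show ?case .
  qed
  thus ?thesis
    by (rule tendsto_0_if_eventually_le[OF _ lim], intro sum_nonneg mult_nonneg_nonneg zero_le_power)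
       (use \<beta>_bounds in \<open>auto simp: less_imp_le\<close>)
qed

text \<open>\<open>\<beta>\<close> is at most \<open>(1 / 4) ^ 5\<close>, and
  \<open>5 * (n - n div 2 - k) >= 2 * n\<close> for \<open>n >= 10 * k\<close>; this beats the
  \<open>4 ^ n\<close> pairs of sets by another factor \<open>4 ^ n\<close>.\<close>

lemma large_tendsto_0: "(\<lambda>n. 4 ^ n * \<beta>' n (M' n) ^ (n - n div 2 - k)) \<longlonglongrightarrow> 0"
proof -
  have lim: "(\<lambda>n. (1 / 4 :: real) ^ n) \<longlonglongrightarrow> 0" by (rule LIMSEQ_power_zero) simp
  have evM: "eventually (\<lambda>n. C * real n / ln (real n) \<le> real (M' n)) sequentially"
    using M_bounds[OF C_pos] by eventually_elim simp
  have "eventually (\<lambda>n. 4 ^ n * \<beta>' n (M' n) ^ (n - n div 2 - k) \<le> (1 / 4 :: real) ^ n) sequentially"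
    using evM a_ge_ln[of "1/2", OF half_gt_zero[OF zero_less_one]] eventually_ge_at_top[of "10 * k"] eventually_gt_at_top[of 1]
  proof eventually_elim
    case (elim n)
    have ln0: "0 < ln (real n)" using elim by simp
    have "1 / 2 \<le> a n / ln (real n)" using elim(2) ln0 by (simp add: field_simps)
    hence "C * (1 / 2) \<le> C * (a n / ln (real n))" using C_pos by (intro mult_left_mono) auto
    also have "\<dots> = C * real n / ln (real n) * W n" by (simp add: a_def)
    also have "\<dots> \<le> real (M' n) * W n" using elim W_pos[of n] by (intro mult_right_mono) auto
    finally have MW: "C * (1 / 2) \<le> real (M' n) * W n" .
    have "31 / 32 * (C * (1 / 2)) \<le> (1 - e2) * (real (M' n) * W n)"
      by (rule mult_mono) (use MW e_bounds in \<open>auto simp: C_def e2_def\<close>)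
    hence "\<beta>' n (M' n) \<le> (1 / 4) ^ 5" unfolding \<beta>_def by (simp add: C_def divide_le_eq power_divide)
    hence "\<beta>' n (M' n) ^ (n - n div 2 - k) \<le> ((1 / 4) ^ 5) ^ (n - n div 2 - k)"
      using \<beta>_bounds[of n "M' n"] by (intro power_mono) auto
    also have "\<dots> = (1 / 4) ^ (5 * (n - n div 2 - k))" by (simp only: power_mult)
    also have "\<dots> \<le> (1 / 4) ^ (n + n)" using elim(3) by (intro power_decreasing) auto
    finally have "4 ^ n * \<beta>' n (M' n) ^ (n - n div 2 - k) \<le> 4 ^ n * (1 / 4 :: real) ^ (n + n)"
      by (intro mult_left_mono) auto
    also have "\<dots> = (1 / 4) ^ n" by (simp add: power_add power_divide)
    finally show ?case by (simp add: power_divide)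
  qed
  thus ?thesis
    by (rule tendsto_0_if_eventually_le[OF _ lim], intro mult_nonneg_nonneg zero_le_power)
       (use \<beta>_bounds in \<open>auto simp: less_imp_le\<close>)
qed

end

context connectivity_regime
begin

lemma prob_not_k_connected_tendsto_0:
  "(\<lambda>n. measure_pmf.prob (R n) {f. min_degree_ge k {..<n} (sadj s f) \<and> \<not> k_vertex_connected k {..<n} (sadj s f)}) \<longlonglongrightarrow> 0"
proof (rule tendsto_0_if_eventually_le)
  let ?T0 = "\<lambda>n. measure_pmf.prob (R n) (- expanding n (M' n) (\<beta>' n))"
  let ?T1 = "\<lambda>n. \<Sum>m=2..M1 n. \<Sum>d<k. real n ^ m * real n ^ d * (fact (m - 1) * W n ^ (m - 1) * ((real m * W n) ^ d * \<beta>' n m ^ (n - m - d)))"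
  let ?T2 = "\<lambda>n. \<Sum>m=Suc (M1 n)..M' n. \<Sum>d<k. real (n choose m) * real n ^ d * \<beta>' n m ^ (n - m - d)"
  let ?T3 = "\<lambda>n. 4 ^ n * \<beta>' n (M' n) ^ (n - n div 2 - k)"
  have "?T0 \<longlonglongrightarrow> 0" by (rule prob_not_expanding_tendsto_0) (use e_bounds C_pos in auto)
  from tendsto_add[OF tendsto_add[OF tendsto_add[OF this sum_small_tendsto_0] sum_medium_tendsto_0] large_tendsto_0]
  show "(\<lambda>n. ?T0 n + ?T1 n + ?T2 n + ?T3 n) \<longlonglongrightarrow> 0" by simp
  have "eventually (\<lambda>n. 1 \<le> C * real n / ln (real n)) sequentially" unfolding C_def by real_asymp
  with M_bounds[OF C_pos] M1_le_M
  show "eventually (\<lambda>n. measure_pmf.prob (R n) {f. min_degree_ge k {..<n} (sadj s f) \<and> \<not> k_vertex_connected k {..<n} (sadj s f)}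
      \<le> ?T0 n + ?T1 n + ?T2 n + ?T3 n) sequentially"
  proof eventually_elim
    case (elim n)
    interpret I: intersection_params s "K n" "P n" by (rule params)
    have "1 \<le> real (M' n)" using elim by linarith
    hence "1 \<le> M' n" by simp
    thus ?case using elim(2) \<beta>_bounds
      by (intro I.prob_not_k_connected_le k_pos) (auto simp: less_imp_le)
  qed
qed simp

definition pV :: "nat \<Rightarrow> real" where
  "pV n = measure_pmf.prob (R n) {f. k_vertex_connected k {..<n} (sadj s f)}"

text \<open>For large \<open>n\<close>, \<open>k\<close>-vertex-connectivity implies minimum degree
  at least \<open>k\<close>, and the difference of the two events has vanishing probability.\<close>

lemma pV_tendsto:
  assumes "pD k \<longlonglongrightarrow> L"
  shows "pV \<longlonglongrightarrow> L"
proof -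
  let ?N = "\<lambda>n. measure_pmf.prob (R n) {f. min_degree_ge k {..<n} (sadj s f) \<and> \<not> k_vertex_connected k {..<n} (sadj s f)}"
  have "eventually (\<lambda>n. pD k n = pV n + ?N n) sequentially"
    using eventually_ge_at_top[of "2 * k + 2"]
  proof eventually_elim
    case (elim n)
    have "k_vertex_connected k {..<n} (sadj s f) \<Longrightarrow> min_degree_ge k {..<n} (sadj s f)" for f
      using elim k_pos by (intro k_edge_connected_imp_min_degree_ge k_vertex_connected_imp_k_edge_connected)
        (auto simp: sadj_def Int_commute)
    hence "{f. min_degree_ge k {..<n} (sadj s f)} = {f. k_vertex_connected k {..<n} (sadj s f)} \<union>
        {f. min_degree_ge k {..<n} (sadj s f) \<and> \<not> k_vertex_connected k {..<n} (sadj s f)}" by auto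
    thus ?case unfolding pD_def pV_def
      by (simp only:) (rule measure_pmf.finite_measure_Union, auto)
  qed
  hence "eventually (\<lambda>n. pD k n - ?N n = pV n) sequentially" by eventually_elim simp
  moreover have "(\<lambda>n. pD k n - ?N n) \<longlonglongrightarrow> L - 0"
    by (intro tendsto_diff assms prob_not_k_connected_tendsto_0)
  ultimately show ?thesis by (simp add: tendsto_cong)
qed

end

section \<open>Reduction to the regime\<close>

text \<open>The formula of \<open>w\<close> outside the locale, so that the number of items per
  vertex can be varied for fixed \<open>P\<close>.\<close>

definition weight :: "nat \<Rightarrow> nat \<Rightarrow> nat \<Rightarrow> real" where
  "weight s \<kappa> p = 1 / fact s * (real \<kappa> ^ (2 * s) / real p ^ s)"

lemma weight_nonneg: "0 \<le> weight s \<kappa> p"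
  by (simp add: weight_def)

text \<open>Applied with \<open>\<kappa>' = \<kappa> - 1\<close>: a minimal \<open>\<kappa>\<close>
  above a threshold exceeds the threshold by at most the factor \<open>4 ^ s\<close>.\<close>

lemma weight_double: "\<kappa> \<le> 2 * \<kappa>' \<Longrightarrow> weight s \<kappa> p \<le> 4 ^ s * weight s \<kappa>' p"
proof -
  assume "\<kappa> \<le> 2 * \<kappa>'"
  hence "real \<kappa> \<le> 2 * real \<kappa>'" by linarith
  hence "real \<kappa> ^ (2 * s) \<le> (2 * real \<kappa>') ^ (2 * s)" by (intro power_mono) auto
  also have "\<dots> = 4 ^ s * real \<kappa>' ^ (2 * s)" by (simp add: power_mult_distrib power_mult)
  finally have "1 / fact s * (real \<kappa> ^ (2 * s) / real p ^ s) \<le> 1 / fact s * (4 ^ s * real \<kappa>' ^ (2 * s) / real p ^ s)"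
    by (intro mult_left_mono divide_right_mono) auto
  thus ?thesis by (simp add: weight_def mult_ac)
qed

lemma sadj_mono:
  assumes "\<And>i. i < n \<Longrightarrow> f i \<subseteq> g i \<and> finite (g i)" "i < n" "j < n" "sadj s f i j"
  shows "sadj s g i j"
proof -
  have "card (f i \<inter> f j) \<le> card (g i \<inter> g j)"
    using assms(1)[OF assms(2)] assms(1)[OF assms(3)] by (intro card_mono) auto
  thus ?thesis using assms(4) by (simp add: sadj_def)
qed

text \<open>Expresses the expected number of low-degree vertices through the deviation
  \<open>a - ln n - (k - 1) * ln (ln n)\<close>, which is \<open>\<alpha>\<close>; the remaining
  factor tends to a constant when \<open>a / ln n\<close> converges.\<close>

lemma (in regime) n_mult_b_eq:
  assumes "1 < n" "1 \<le> k"
  shows "real n * b k n = (a n / ln (real n)) ^ (k - 1) / fact (k - 1) *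
     exp (- (a n - ln (real n) - (real k - 1) * ln (ln (real n))))"
proof -
  have ln0: "0 < ln (real n)" using assms by simp
  have k: "real k - 1 = real (k - 1)" using assms by simp
  have sub: "- (u - v - z) = v + z + (- u)" for u v z :: real by simp
  have "exp (- (a n - ln (real n) - (real k - 1) * ln (ln (real n)))) =
      exp (ln (real n) + real (k - 1) * ln (ln (real n)) + (- a n))"
    by (simp only: k sub)
  also have "\<dots> = exp (ln (real n)) * exp (ln (ln (real n))) ^ (k - 1) * exp (- a n)"
    by (simp only: exp_add exp_of_nat_mult)
  also have "\<dots> = real n * ln (real n) ^ (k - 1) * exp (- a n)" using assms ln0 by simp
  finally show ?thesis using ln0 by (simp add: b_def power_divide)
qed

theorem theorem1:
  fixes s k :: nat and K P :: "nat \<Rightarrow> nat" and \<alpha> :: "nat \<Rightarrow> real"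
  assumes s_pos: "s \<ge> 1" and k_pos: "k \<ge> 1"
    and KP: "\<And>n. K n > 0 \<and> P n > 0 \<and> s \<le> K n \<and> K n \<le> P n"
    and P_Omega: "(\<lambda>n. real (P n)) \<in> \<Omega>(\<lambda>n. real n)"
    and alpha_def: "\<And>n. n \<ge> 1 \<Longrightarrow> (1 / fact s) * (real (K n) ^ (2 * s) / real (P n) ^ s)
                        = (ln (real n) + (real k - 1) * ln (ln (real n)) + \<alpha> n) / real n"
  defines "pV \<equiv> \<lambda>n. measure_pmf.prob (rand_sets n (K n) (P n))
                      {f. k_vertex_connected k {..<n} (sadj s f)}"
    and "pE \<equiv> \<lambda>n. measure_pmf.prob (rand_sets n (K n) (P n))
                      {f. k_edge_connected k {..<n} (sadj s f)}"
    and "pD \<equiv> \<lambda>n. measure_pmf.prob (rand_sets n (K n) (P n))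
                      {f. min_degree_ge k {..<n} (sadj s f)}"
  shows "(\<forall>a::real. \<alpha> \<longlonglongrightarrow> a \<longrightarrow>
            (pV \<longlonglongrightarrow> exp (- exp (- a) / fact (k - 1))) \<and>
            (pE \<longlonglongrightarrow> exp (- exp (- a) / fact (k - 1))) \<and>
            (pD \<longlonglongrightarrow> exp (- exp (- a) / fact (k - 1))))
       \<and> (filterlim \<alpha> at_bot sequentially \<longrightarrow>
            pV \<longlonglongrightarrow> 0 \<and> pE \<longlonglongrightarrow> 0 \<and> pD \<longlonglongrightarrow> 0)
       \<and> (filterlim \<alpha> at_top sequentially \<longrightarrow>
            pV \<longlonglongrightarrow> 1 \<and> pE \<longlonglongrightarrow> 1 \<and> pD \<longlonglongrightarrow> 1)"
proof -
  obtain c where c: "0 < c" "eventually (\<lambda>n. norm (real (P n)) \<ge> c * norm (real n)) sequentially"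
    using landau_omega.bigE[OF P_Omega] by blast
  have P_ge: "eventually (\<lambda>n. c * real n \<le> real (P n)) sequentially" using c(2) by simp
  have params: "intersection_params s \<kappa> (P n)" if "s \<le> \<kappa>" "\<kappa> \<le> P n" for \<kappa> n
    using that s_pos by unfold_locales auto
  have w_eq: "intersection_params.w s \<kappa> (P n) = weight s \<kappa> (P n)" if "s \<le> \<kappa>" "\<kappa> \<le> P n" for \<kappa> n
    using intersection_params.w_def[OF params[OF that]] by (simp add: weight_def)
  have A_eq: "real n * weight s (K n) (P n) = ln (real n) + (real k - 1) * ln (ln (real n)) + \<alpha> n" if "1 \<le> n" for n
    using alpha_def[OF that] that by (simp add: weight_def)
  have lnln: "eventually (\<lambda>n. 0 \<le> (real k - 1) * ln (ln (real n))) sequentially"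
  proof -
    have "eventually (\<lambda>n. 0 \<le> ln (ln (real n))) sequentially" by real_asymp
    thus ?thesis by eventually_elim (use k_pos in simp)
  qed
  have lnln_o: "(\<lambda>n. (real k - 1) * ln (ln (real n)) / ln (real n)) \<longlonglongrightarrow> 0" by real_asymp
  have order: "eventually (\<lambda>n. pV n \<le> pE n \<and> pE n \<le> pD n) sequentially"
    using eventually_ge_at_top[of "2 * k + 2"]
  proof eventually_elim
    case (elim n)
    have "k_vertex_connected k {..<n} (sadj s f) \<Longrightarrow> k_edge_connected k {..<n} (sadj s f)" for f
      using elim k_pos by (intro k_vertex_connected_imp_k_edge_connected) (auto simp: sadj_def Int_commute)
    moreover have "k_edge_connected k {..<n} (sadj s f) \<Longrightarrow> min_degree_ge k {..<n} (sadj s f)" for f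
      using elim by (intro k_edge_connected_imp_min_degree_ge) auto
    ultimately show ?case unfolding pV_def pE_def pD_def
      by (intro conjI measure_pmf.finite_measure_mono) auto
  qed
  have squeeze: "pE \<longlonglongrightarrow> L" if "pV \<longlonglongrightarrow> L" "pD \<longlonglongrightarrow> L" for L
    by (rule tendsto_sandwich[OF _ _ that]) (use order in \<open>auto elim: eventually_mono\<close>)
  show ?thesis
  proof (intro conjI[OF _ conjI] allI impI)
    fix l :: real assume \<alpha>: "\<alpha> \<longlonglongrightarrow> l"
    define A where "A = (\<lambda>n. real n * weight s (K n) (P n))"
    have inv_ln: "(\<lambda>n. inverse (ln (real n))) \<longlonglongrightarrow> 0" by real_asymp
    have "(\<lambda>n. 1 + (real k - 1) * ln (ln (real n)) / ln (real n) + \<alpha> n * inverse (ln (real n))) \<longlonglongrightarrow> 1 + 0 + l * 0"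
      by (intro tendsto_add tendsto_mult tendsto_const lnln_o \<alpha> inv_ln)
    moreover have "eventually (\<lambda>n. 1 + (real k - 1) * ln (ln (real n)) / ln (real n) + \<alpha> n * inverse (ln (real n)) = A n / ln (real n)) sequentially"
      using eventually_gt_at_top[of 1]
    proof eventually_elim
      case (elim n)
      hence "ln (real n) \<noteq> 0" by simp
      thus ?case using A_eq[of n] elim by (simp add: A_def field_simps)
    qed
    ultimately have ratio: "(\<lambda>n. A n / ln (real n)) \<longlonglongrightarrow> 1" by (simp add: tendsto_cong)
    have lower: "eventually (\<lambda>n. y * ln (real n) \<le> A n) sequentially" if "y < 1" for y
      using order_tendstoD(1)[OF ratio that] eventually_gt_at_top[of 1]
      by eventually_elim (simp add: field_simps)
    have upper: "eventually (\<lambda>n. A n \<le> 2 * ln (real n)) sequentially"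
    proof -
      have "eventually (\<lambda>n. A n / ln (real n) < 2) sequentially" by (rule order_tendstoD(2)[OF ratio]) simp
      thus ?thesis using eventually_gt_at_top[of 1] by eventually_elim (simp add: field_simps)
    qed
    \<comment> \<open>\<open>A / ln n\<close> tends to 1, so any constants on either side of 1 would
      serve.\<close>
    interpret reg: regime s K P c "1/2" 2
      by unfold_locales (use KP c(1) P_ge lower[of "1/2"] upper s_pos w_eq in \<open>auto simp: A_def\<close>)
    have aA: "reg.a n = A n" for n using KP[of n] w_eq[of "K n" n] by (simp add: reg.a_def A_def)
    interpret reg: connectivity_regime s K P c "1/2" 2 k
      by unfold_locales (use k_pos lower in \<open>auto simp: aA\<close>)
    have "(\<lambda>n. (A n / ln (real n)) ^ (k - 1) / fact (k - 1) * exp (- \<alpha> n)) \<longlonglongrightarrow> 1 ^ (k - 1) / fact (k - 1) * exp (- l)"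
      by (intro tendsto_mult tendsto_divide tendsto_power ratio tendsto_const tendsto_exp tendsto_minus \<alpha>) auto
    moreover have "eventually (\<lambda>n. (A n / ln (real n)) ^ (k - 1) / fact (k - 1) * exp (- \<alpha> n) = real n * reg.b k n) sequentially"
      using eventually_gt_at_top[of 1]
    proof eventually_elim
      case (elim n)
      show ?case using reg.n_mult_b_eq[OF elim k_pos] A_eq[of n] elim by (simp add: aA A_def)
    qed
    ultimately have "(\<lambda>n. real n * reg.b k n) \<longlonglongrightarrow> exp (- l) / fact (k - 1)" by (simp add: tendsto_cong)
    from reg.pD_tendsto[OF k_pos this]
    have D: "reg.pD k \<longlonglongrightarrow> exp (- exp (- l) / fact (k - 1))" by simp
    have "pD \<longlonglongrightarrow> exp (- exp (- l) / fact (k - 1))" using D unfolding pD_def reg.pD_def[abs_def] .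
    moreover have "pV \<longlonglongrightarrow> exp (- exp (- l) / fact (k - 1))"
      using reg.pV_tendsto[OF D] unfolding pV_def reg.pV_def[abs_def] .
    ultimately show "pV \<longlonglongrightarrow> exp (- exp (- l) / fact (k - 1))" "pE \<longlonglongrightarrow> exp (- exp (- l) / fact (k - 1))"
      "pD \<longlonglongrightarrow> exp (- exp (- l) / fact (k - 1))"
      using squeeze by blast+
  next
    assume \<alpha>: "filterlim \<alpha> at_bot sequentially"
    \<comment> \<open>Chosen so that overshooting the threshold \<open>\<theta> * ln n\<close> by
      the factor \<open>4 ^ s\<close> still leaves \<open>A\<close> at most
      \<open>ln n / 2\<close>.\<close>
    define \<theta> where "\<theta> = 1 / (2 * 4 ^ s :: real)"
    have \<theta>: "0 < \<theta>" "\<theta> * 4 ^ s = 1 / 2" by (auto simp: \<theta>_def)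
    define A where "A = (\<lambda>\<kappa> n. real n * weight s \<kappa> (P n))"
    define S where "S = (\<lambda>n \<kappa>. K n \<le> \<kappa> \<and> \<theta> * ln (real n) \<le> A \<kappa> n)"
    \<comment> \<open>Too few items per vertex are raised to the least number that reaches the scale
      \<open>ln n\<close>. The second alternative of the test covers those \<open>n\<close> for
      which even all \<open>P n\<close> items do not suffice; it keeps
      \<open>\<kappa> n <= P n\<close> valid for every \<open>n\<close>.\<close>
    define \<kappa> where "\<kappa> = (\<lambda>n. if \<theta> * ln (real n) \<le> A (K n) n \<or> \<not> \<theta> * ln (real n) \<le> A (P n) n then K n else (LEAST \<kappa>. S n \<kappa>))"
    have \<kappa>_Least: "S n (LEAST \<kappa>. S n \<kappa>)" "(LEAST \<kappa>. S n \<kappa>) \<le> P n" if "\<theta> * ln (real n) \<le> A (P n) n" for n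
    proof -
      have "S n (P n)" using KP[of n] that by (simp add: S_def)
      thus "S n (LEAST \<kappa>. S n \<kappa>)" "(LEAST \<kappa>. S n \<kappa>) \<le> P n" by (rule LeastI, rule Least_le)
    qed
    have \<kappa>: "K n \<le> \<kappa> n" "\<kappa> n \<le> P n" for n
      using KP[of n] \<kappa>_Least[of n] by (auto simp: \<kappa>_def S_def)
    have \<kappa>s: "s \<le> \<kappa> n" for n using \<kappa>(1)[of n] KP[of n] by linarith
    \<comment> \<open>With all \<open>P n\<close> items the weight is \<open>P ^ s / fact s\<close>,
      at least \<open>1 / fact s\<close>, so \<open>A\<close> grows linearly and the exceptional
      \<open>n\<close> are finitely many.\<close>
    have AP: "eventually (\<lambda>n. \<theta> * ln (real n) \<le> A (P n) n) sequentially"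
    proof -
      have "eventually (\<lambda>n. \<theta> * ln (real n) \<le> real n * (1 / fact s)) sequentially"
        using \<theta>(1) by real_asymp
      thus ?thesis
      proof eventually_elim
        case (elim n)
        have "real (P n) ^ (2 * s) / real (P n) ^ s = real (P n) ^ s" using KP[of n] by (simp add: mult_2 power_add)
        moreover have "1 \<le> real (P n) ^ s" using KP[of n] by (intro one_le_power) simp
        ultimately have "1 / fact s * 1 \<le> weight s (P n) (P n)" unfolding weight_def by (intro mult_left_mono) auto
        hence "real n * (1 / fact s * 1) \<le> A (P n) n" unfolding A_def by (intro mult_left_mono) auto
        thus ?case using elim by simp
      qed
    qed
    have lower: "eventually (\<lambda>n. \<theta> * ln (real n) \<le> A (\<kappa> n) n) sequentially"
      using AP by eventually_elim (use \<kappa>_Least(1) in \<open>auto simp: \<kappa>_def S_def\<close>)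
    have split: "eventually (\<lambda>n. \<kappa> n = K n \<or> A (\<kappa> n) n \<le> 1 / 2 * ln (real n)) sequentially"
      using AP
    proof eventually_elim
      case (elim n)
      show ?case
      proof (cases "\<kappa> n = K n")
        case False
        hence L: "\<kappa> n = (LEAST \<kappa>. S n \<kappa>)" by (auto simp: \<kappa>_def split: if_splits)
        hence gt: "K n < \<kappa> n" using \<kappa>(1)[of n] False by simp
        hence "\<not> S n (\<kappa> n - 1)" unfolding L using not_less_Least[of "(LEAST \<kappa>. S n \<kappa>) - 1" "S n"] by auto
        hence less: "A (\<kappa> n - 1) n < \<theta> * ln (real n)" using gt by (auto simp: S_def)
        have "weight s (\<kappa> n) (P n) \<le> 4 ^ s * weight s (\<kappa> n - 1) (P n)"
          by (rule weight_double) (use gt KP[of n] in linarith)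
        hence "A (\<kappa> n) n \<le> 4 ^ s * A (\<kappa> n - 1) n" unfolding A_def
          using mult_left_mono[of "weight s (\<kappa> n) (P n)" "4 ^ s * weight s (\<kappa> n - 1) (P n)" "real n"] by (simp add: mult_ac)
        also have "\<dots> \<le> 4 ^ s * (\<theta> * ln (real n))" using less by (intro mult_left_mono) auto
        also have "\<dots> = (\<theta> * 4 ^ s) * ln (real n)" by simp
        finally show ?thesis unfolding \<theta>(2) by simp
      qed simp
    qed
    define \<alpha>' where "\<alpha>' = (\<lambda>n. A (\<kappa> n) n - ln (real n) - (real k - 1) * ln (ln (real n)))"
    \<comment> \<open>Where \<open>K\<close> was raised, \<open>A <= ln n / 2\<close> keeps the new
      deviation below \<open>- ln n / 2\<close>; elsewhere the deviation is the old one. Hence it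
      still tends to minus infinity.\<close>
    have \<alpha>'_le: "eventually (\<lambda>n. \<alpha>' n \<le> max (\<alpha> n) (- (1 / 2 * ln (real n)))) sequentially"
      using split lnln eventually_gt_at_top[of 1]
    proof eventually_elim
      case (elim n)
      from elim(1) show ?case
      proof
        assume "\<kappa> n = K n"
        thus ?thesis using A_eq[of n] elim by (simp add: \<alpha>'_def A_def)
      next
        assume "A (\<kappa> n) n \<le> 1 / 2 * ln (real n)"
        thus ?thesis using elim unfolding \<alpha>'_def by linarith
      qed
    qed
    have "filterlim (\<lambda>n. max (\<alpha> n) (- (1 / 2 * ln (real n)))) at_bot sequentially"
    proof -
      have "filterlim (\<lambda>n. - (1 / 2 * ln (real n))) at_bot sequentially" by real_asymp
      thus ?thesis using \<alpha> unfolding filterlim_at_bot by (auto intro: eventually_conj)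
    qed
    hence \<alpha>': "filterlim \<alpha>' at_bot sequentially" by (rule filterlim_at_bot_mono) (rule \<alpha>'_le)
    have upper: "eventually (\<lambda>n. A (\<kappa> n) n \<le> 2 * ln (real n)) sequentially"
    proof -
      have "eventually (\<lambda>n. \<alpha>' n \<le> 0) sequentially" using \<alpha>' by (simp add: filterlim_at_bot)
      moreover have "eventually (\<lambda>n. (real k - 1) * ln (ln (real n)) / ln (real n) < 1) sequentially"
        by (rule order_tendstoD[OF lnln_o]) simp
      ultimately show ?thesis using eventually_gt_at_top[of 1]
      proof eventually_elim
        case (elim n)
        have "(real k - 1) * ln (ln (real n)) \<le> ln (real n)" using elim by (simp add: divide_less_eq)
        thus ?case using elim(1) unfolding \<alpha>'_def by linarith
      qed
    qed
    interpret reg: regime s \<kappa> P c \<theta> 2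
      by unfold_locales (use \<kappa> \<kappa>s c(1) P_ge lower upper s_pos w_eq \<theta>(1) in \<open>auto simp: A_def\<close>)
    have aA: "reg.a n = A (\<kappa> n) n" for n using \<kappa>(2)[of n] \<kappa>s[of n] w_eq[of "\<kappa> n" n] by (simp add: reg.a_def A_def)
    have "filterlim (\<lambda>n. \<theta> ^ (k - 1) / fact (k - 1) * exp (- \<alpha>' n)) at_top sequentially"
    proof (rule filterlim_tendsto_pos_mult_at_top[OF tendsto_const])
      show "0 < \<theta> ^ (k - 1) / fact (k - 1)" using \<theta> by simp
      have "filterlim (\<lambda>n. - \<alpha>' n) at_top sequentially" using \<alpha>' by (simp add: filterlim_uminus_at_bot)
      thus "filterlim (\<lambda>n. exp (- \<alpha>' n)) at_top sequentially" by (rule filterlim_compose[OF exp_at_top])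
    qed
    hence "filterlim (\<lambda>n. real n * reg.b k n) at_top sequentially"
    proof (rule filterlim_at_top_mono)
      show "eventually (\<lambda>n. \<theta> ^ (k - 1) / fact (k - 1) * exp (- \<alpha>' n) \<le> real n * reg.b k n) sequentially"
        using lower eventually_gt_at_top[of 1]
      proof eventually_elim
        case (elim n)
        have "\<theta> \<le> A (\<kappa> n) n / ln (real n)" using elim by (simp add: le_divide_eq)
        hence "\<theta> ^ (k - 1) \<le> (A (\<kappa> n) n / ln (real n)) ^ (k - 1)" using \<theta> by (intro power_mono) auto
        thus ?case unfolding reg.n_mult_b_eq[OF elim(2) k_pos] aA \<alpha>'_def
          by (intro mult_right_mono divide_right_mono) auto
      qed
    qed
    from reg.pD_tendsto_0[OF k_pos this] have D: "reg.pD k \<longlonglongrightarrow> 0" .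
    \<comment> \<open>More items per vertex only add edges, so the limit 0 passes down to the
      original graph.\<close>
    have D_le: "pD n \<le> reg.pD k n" for n
      unfolding pD_def reg.pD_def
    proof (rule prob_rand_sets_mono_K)
      show "K n \<le> \<kappa> n" "\<kappa> n \<le> P n" by (rule \<kappa>)+
      fix f g assume fg: "\<And>i. i < n \<Longrightarrow> f i \<subseteq> g i \<and> finite (g i)" and "min_degree_ge k {..<n} (sadj s f)"
      thus "min_degree_ge k {..<n} (sadj s g)"
        by (elim min_degree_ge_mono) (auto intro: sadj_mono[OF fg])
    qed
    have "pD \<longlonglongrightarrow> 0"
      by (rule tendsto_0_if_eventually_le[OF _ D]) (use D_le in \<open>auto simp: pD_def\<close>)
    moreover have "pV \<longlonglongrightarrow> 0"
    proof (rule tendsto_0_if_eventually_le)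
      show "eventually (\<lambda>n. pV n \<le> pD n) sequentially" using order by eventually_elim linarith
    qed (use \<open>pD \<longlonglongrightarrow> 0\<close> in \<open>auto simp: pV_def\<close>)
    ultimately show "pV \<longlonglongrightarrow> 0" "pE \<longlonglongrightarrow> 0" "pD \<longlonglongrightarrow> 0" using squeeze by blast+
  next
    assume \<alpha>: "filterlim \<alpha> at_top sequentially"
    define A where "A = (\<lambda>\<kappa> n. real n * weight s \<kappa> (P n))"
    \<comment> \<open>Now \<open>K\<close> is lowered when \<open>A\<close> exceeds
      \<open>2 * ln n\<close>, to the least admissible value that keeps
      \<open>A >= 2 * ln n\<close>. Any constant above 1 would keep the deviation growing, and
      \<open>s <= \<kappa>\<close> preserves the standing assumption on the number of items.\<close>
    define S where "S = (\<lambda>n \<kappa>. s \<le> \<kappa> \<and> 2 * ln (real n) \<le> A \<kappa> n)"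
    define \<kappa> where "\<kappa> = (\<lambda>n. if A (K n) n \<le> 2 * ln (real n) then K n else (LEAST \<kappa>. S n \<kappa>))"
    have \<kappa>_Least: "S n (LEAST \<kappa>. S n \<kappa>)" "(LEAST \<kappa>. S n \<kappa>) \<le> K n" if "\<not> A (K n) n \<le> 2 * ln (real n)" for n
    proof -
      have "S n (K n)" using KP[of n] that by (simp add: S_def)
      thus "S n (LEAST \<kappa>. S n \<kappa>)" "(LEAST \<kappa>. S n \<kappa>) \<le> K n" by (rule LeastI, rule Least_le)
    qed
    have \<kappa>: "s \<le> \<kappa> n" "\<kappa> n \<le> K n" for n
      using KP[of n] \<kappa>_Least[of n] by (auto simp: \<kappa>_def S_def)
    have \<kappa>P: "\<kappa> n \<le> P n" for n using \<kappa>(2)[of n] KP[of n] by linarith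
    have split: "\<kappa> n = K n \<or> 2 * ln (real n) \<le> A (\<kappa> n) n" for n
      using \<kappa>_Least(1)[of n] by (auto simp: \<kappa>_def S_def)
    define C0 where "C0 = (2 * 4 ^ s :: real)"
    have C0: "2 \<le> C0" by (simp add: C0_def)
    have upper: "eventually (\<lambda>n. A (\<kappa> n) n \<le> C0 * ln (real n)) sequentially"
    proof -
      have "eventually (\<lambda>n. real s ^ (2 * s) / c \<le> ln (real n)) sequentially" by real_asymp
      with P_ge eventually_gt_at_top[of 1] show ?thesis
      proof eventually_elim
        case (elim n)
        have ln0: "0 < ln (real n)" using elim by simp
        have two: "2 * ln (real n) \<le> C0 * ln (real n)" using C0 ln0 by (intro mult_right_mono) auto
        show ?case
        proof (cases "A (K n) n \<le> 2 * ln (real n)")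
          case True
          thus ?thesis using two by (simp add: \<kappa>_def)
        next
          case False
          hence L: "\<kappa> n = (LEAST \<kappa>. S n \<kappa>)" by (simp add: \<kappa>_def)
          show ?thesis
          proof (cases "\<kappa> n = s")
            \<comment> \<open>At \<open>\<kappa> = s\<close> there is no smaller admissible value to
              compare with. But then \<open>P >= c * n\<close> bounds \<open>A\<close> by the
              constant \<open>s ^ (2 * s) / c\<close>.\<close>
            case True
            have "c * real n \<le> real (P n) ^ 1" using elim by simp
            also have "\<dots> \<le> real (P n) ^ s" using KP[of n] s_pos by (intro power_increasing) auto
            finally have Ps: "c * real n \<le> real (P n) ^ s" .
            have "A (\<kappa> n) n = 1 / fact s * (real n * (real s ^ (2 * s) / real (P n) ^ s))"
              by (simp add: A_def weight_def True)
            also have "\<dots> \<le> 1 * (real n * (real s ^ (2 * s) / (c * real n)))"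
              using Ps c(1) elim KP[of n] by (intro mult_mono mult_left_mono divide_left_mono mult_pos_pos) (auto simp: fact_ge_1)
            also have "\<dots> = real s ^ (2 * s) / c" using elim by simp
            finally show ?thesis using elim(3) two ln0 by linarith
          next
            case False
            hence gt: "s < \<kappa> n" using \<kappa>(1)[of n] by simp
            hence "\<not> S n (\<kappa> n - 1)" unfolding L using not_less_Least[of "(LEAST \<kappa>. S n \<kappa>) - 1" "S n"] by auto
            hence less: "A (\<kappa> n - 1) n < 2 * ln (real n)" using gt by (auto simp: S_def)
            have "weight s (\<kappa> n) (P n) \<le> 4 ^ s * weight s (\<kappa> n - 1) (P n)"
              by (rule weight_double) (use gt s_pos in linarith)
            hence "A (\<kappa> n) n \<le> 4 ^ s * A (\<kappa> n - 1) n" unfolding A_def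
              using mult_left_mono[of "weight s (\<kappa> n) (P n)" "4 ^ s * weight s (\<kappa> n - 1) (P n)" "real n"] by (simp add: mult_ac)
            also have "\<dots> \<le> 4 ^ s * (2 * ln (real n))" using less by (intro mult_left_mono) auto
            finally show ?thesis by (simp add: C0_def)
          qed
        qed
      qed
    qed
    define \<alpha>' where "\<alpha>' = (\<lambda>n. A (\<kappa> n) n - ln (real n) - (real k - 1) * ln (ln (real n)))"
    \<comment> \<open>Where \<open>K\<close> was lowered, \<open>A >= 2 * ln n\<close> leaves a
      deviation of at least \<open>ln n - (k - 1) * ln (ln n)\<close>, which tends to
      infinity.\<close>
    have \<alpha>'_ge: "eventually (\<lambda>n. min (\<alpha> n) (ln (real n) - (real k - 1) * ln (ln (real n))) \<le> \<alpha>' n) sequentially"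
      using eventually_gt_at_top[of 1]
    proof eventually_elim
      case (elim n)
      from split[of n] show ?case
      proof
        assume "\<kappa> n = K n"
        thus ?thesis using A_eq[of n] elim by (simp add: \<alpha>'_def A_def)
      qed (simp add: \<alpha>'_def)
    qed
    have "filterlim (\<lambda>n. min (\<alpha> n) (ln (real n) - (real k - 1) * ln (ln (real n)))) at_top sequentially"
    proof -
      have "filterlim (\<lambda>n. ln (real n) - (real k - 1) * ln (ln (real n))) at_top sequentially" by real_asymp
      thus ?thesis using \<alpha> unfolding filterlim_at_top by (auto intro: eventually_conj)
    qed
    hence \<alpha>': "filterlim \<alpha>' at_top sequentially" by (rule filterlim_at_top_mono) (rule \<alpha>'_ge)
    have lower: "eventually (\<lambda>n. 1 * ln (real n) \<le> A (\<kappa> n) n) sequentially"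
    proof -
      have "eventually (\<lambda>n. 0 \<le> \<alpha>' n) sequentially" using \<alpha>' by (simp add: filterlim_at_top)
      thus ?thesis using lnln by eventually_elim (simp add: \<alpha>'_def)
    qed
    interpret reg: regime s \<kappa> P c 1 C0
      by unfold_locales (use \<kappa> \<kappa>P c(1) P_ge lower upper s_pos w_eq in \<open>auto simp: A_def\<close>)
    have aA: "reg.a n = A (\<kappa> n) n" for n using \<kappa>P[of n] \<kappa>(1)[of n] w_eq[of "\<kappa> n" n] by (simp add: reg.a_def A_def)
    interpret reg: connectivity_regime s \<kappa> P c 1 C0 k
    proof (unfold_locales)
      show "1 \<le> k" by (rule k_pos)
      fix \<eta> :: real assume "0 < \<eta>"
      show "eventually (\<lambda>n. (1 - \<eta>) * ln (real n) \<le> reg.a n) sequentially"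
        using lower eventually_gt_at_top[of 1]
      proof eventually_elim
        case (elim n)
        have "(1 - \<eta>) * ln (real n) \<le> 1 * ln (real n)" using \<open>0 < \<eta>\<close> elim by (intro mult_right_mono) auto
        thus ?case using elim(1) unfolding aA by linarith
      qed
    qed
    have "(\<lambda>n. exp (- \<alpha>' n)) \<longlonglongrightarrow> 0"
      by (rule filterlim_compose[OF exp_at_bot]) (use \<alpha>' in \<open>simp add: filterlim_uminus_at_top\<close>)
    hence "(\<lambda>n. C0 ^ (k - 1) / fact (k - 1) * exp (- \<alpha>' n)) \<longlonglongrightarrow> C0 ^ (k - 1) / fact (k - 1) * 0"
      by (intro tendsto_mult tendsto_const)
    hence lim: "(\<lambda>n. C0 ^ (k - 1) / fact (k - 1) * exp (- \<alpha>' n)) \<longlonglongrightarrow> 0" by simp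
    have "(\<lambda>n. real n * reg.b k n) \<longlonglongrightarrow> 0"
    proof (rule tendsto_0_if_eventually_le[OF _ lim])
      show "eventually (\<lambda>n. real n * reg.b k n \<le> C0 ^ (k - 1) / fact (k - 1) * exp (- \<alpha>' n)) sequentially"
        using upper eventually_gt_at_top[of 1]
      proof eventually_elim
        case (elim n)
        have "A (\<kappa> n) n / ln (real n) \<le> C0" using elim by (simp add: divide_le_eq)
        moreover have "0 \<le> A (\<kappa> n) n / ln (real n)" using elim weight_nonneg by (simp add: A_def)
        ultimately have "(A (\<kappa> n) n / ln (real n)) ^ (k - 1) \<le> C0 ^ (k - 1)" by (intro power_mono)
        thus ?case unfolding reg.n_mult_b_eq[OF elim(2) k_pos] aA \<alpha>'_def
          by (intro mult_right_mono divide_right_mono) auto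
      qed
    qed (use reg.b_nonneg in simp)
    from reg.pD_tendsto[OF k_pos this] have "reg.pD k \<longlonglongrightarrow> 1" by simp
    hence V: "reg.pV \<longlonglongrightarrow> 1" by (rule reg.pV_tendsto)
    \<comment> \<open>The sparser coupled graph is already \<open>k\<close>-vertex-connected with
      high probability, and this property is monotone.\<close>
    have V_le: "reg.pV n \<le> pV n" for n
      unfolding pV_def reg.pV_def
    proof (rule prob_rand_sets_mono_K)
      show "\<kappa> n \<le> K n" by (rule \<kappa>)
      show "K n \<le> P n" using KP[of n] by simp
      fix f g assume fg: "\<And>i. i < n \<Longrightarrow> f i \<subseteq> g i \<and> finite (g i)" and "k_vertex_connected k {..<n} (sadj s f)"
      thus "k_vertex_connected k {..<n} (sadj s g)"
        by (elim k_vertex_connected_mono) (auto intro: sadj_mono[OF fg])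
    qed
    have pV1: "pV \<longlonglongrightarrow> 1"
      by (rule tendsto_sandwich[OF _ _ V tendsto_const]) (use V_le in \<open>auto simp: pV_def\<close>)
    have pD1: "pD \<longlonglongrightarrow> 1"
    proof (rule tendsto_sandwich[OF _ _ pV1 tendsto_const])
      show "eventually (\<lambda>n. pV n \<le> pD n) sequentially" using order by eventually_elim linarith
    qed (auto simp: pD_def)
    show "pV \<longlonglongrightarrow> 1" "pE \<longlonglongrightarrow> 1" "pD \<longlonglongrightarrow> 1" using pV1 pD1 squeeze by blast+
  qed
qed

end
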